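(* Let $\Gamma\subset\mathrm{Aut}(\mathbb B^n)$ be a torsion-free lattice, and let $\Sigma=\mathbb B^n/\Gamma$ be the corresponding complex hyperbolic space form of finite volume. Let $\Omega$ be the quotient of $\mathbb B^n\times\mathbb B^n$ by the diagonal action of $\Gamma$. Then $A^2_{-1}(\Omega)\cong\mathbb C$, and $\Omega$ has no non-constant bounded holomorphic function.
   Context: $\mathbb B^n$ is the unit ball in $\mathbb C^n$. The diagonal action is $(z,w)\mapsto(\gamma z,\gamma w)$, $\gamma\in\Gamma$. Let $K_{\mathbb B^n}(z,w)=(1-z\cdot\bar w)^{-(n+1)}$. $\Omega$ carries the Kähler form $$\omega_\Omega=\frac{\sqrt{-1}}{n+1}\partial\bar\partial\log K_{\mathbb B^n}(z,z)+\frac{\sqrt{-1}}{n+1}\partial\bar\partial\log K_{\mathbb B^n}(w,w),$$ with volume form $dV_{\omega_\Omega}=\frac1{(2n)!}\omega_\Omega^{2n}$. For $z\in\mathbb B^n$ let $$T_z(w)=\frac{z-P_z(w)-s_zQ_z(w)}{1-w\cdot\bar z},$$ where $|z|^2=z\cdot\bar z$, $s_z=\sqrt{1-|z|^2}$, $P_z$ is the orthogonal projection of $\mathbb C^n$ onto the span $[z]$ of $z$, and $Q_z$ the orthogonal projection onto $[z]^\perp$. Put $\delta=1-|T_zw|^2$, which descends to $\Omega$. For a holomorphic function $f$ on $\Omega$ and $\alpha>-1$ set $$\|f\|_\alpha^2=\frac{\Gamma(n+\alpha+1)}{n!\,\Gamma(\alpha+1)}\int_\Omega|f|^2\,\delta^{\alpha+n+1}\,dV_{\omega_\Omega}$$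 (here $\Gamma(\cdot)$ is the Gamma function). The Hardy space is $A^2_{-1}(\Omega)=\{f\in\mathcal O(\Omega):\|f\|_{-1}^2:=\lim_{\alpha\searrow-1}\|f\|_\alpha^2<\infty\}$. *)

theory Defs
  imports "HOL-Analysis.Analysis" "HOL-Algebra.Bij" "HOL-Algebra.Group_Action"
begin

section \<open>Hermitian geometry of the ball\<close>

abbreviation unit_ball :: "(complex^'n) set"  (\<open>\<bbbB>\<close>)
  where "\<bbbB> \<equiv> ball 0 1"

definition cdot :: "complex^'n \<Rightarrow> complex^'n \<Rightarrow> complex"
  where "cdot z w = (\<Sum>i\<in>UNIV. z $ i * cnj (w $ i))"

definition orth_compl :: "(complex^'n) set \<Rightarrow> (complex^'n) set"
  where "orth_compl V = {u. \<forall>v\<in>V. cdot u v = 0}"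

definition orth_proj :: "(complex^'n) set \<Rightarrow> complex^'n \<Rightarrow> complex^'n"
  where "orth_proj V w = (THE p. p \<in> V \<and> w - p \<in> orth_compl V)"

definition T :: "complex^'n \<Rightarrow> complex^'n \<Rightarrow> complex^'n"
  where "T z w =
    (let P = orth_proj (vec.span {z}); Q = orth_proj (orth_compl (vec.span {z})) in
     (1 / (1 - cdot w z)) *s (z - P w - sqrt (1 - (norm z)\<^sup>2) *\<^sub>R Q w))"

definition bergman_kernel :: "complex^'n \<Rightarrow> complex^'n \<Rightarrow> complex"
  where "bergman_kernel z w = 1 / (1 - cdot z w) ^ (CARD('n) + 1)"

text \<open>Holomorphy in several variables: the real Frechet derivative exists and is complex linear.\<close>

definition holo_map_on :: "(complex^'n \<Rightarrow> complex^'m) \<Rightarrow> (complex^'n) set \<Rightarrow> bool"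
  where "holo_map_on f S \<longleftrightarrow>
    (\<forall>z\<in>S. \<exists>D. (f has_derivative D) (at z) \<and> (\<forall>c v. D (c *s v) = c *s D v))"

definition holo_fun_on ::
    "((complex^'n) \<times> (complex^'m) \<Rightarrow> complex) \<Rightarrow> ((complex^'n) \<times> (complex^'m)) set \<Rightarrow> bool"
  where "holo_fun_on F S \<longleftrightarrow>
    (\<forall>p\<in>S. \<exists>D. (F has_derivative D) (at p) \<and>
       (\<forall>c u v. D (c *s u, c *s v) = c * D (u, v)))"


section \<open>Kaehler forms given by a potential, and their volume\<close>

text \<open>
  A family \<open>e\<close> encodes complex linear coordinates indexed by \<open>'m\<close>: \<open>e j c\<close> is the vector whose
  \<open>j\<close>-th coordinate is \<open>c\<close> and whose other coordinates vanish.  The operators below are the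
  Wirtinger derivatives with respect to the \<open>j\<close>-th coordinate and its conjugate.
\<close>

definition del :: "('m \<Rightarrow> complex \<Rightarrow> 'a) \<Rightarrow> 'm \<Rightarrow> ('a::real_normed_vector \<Rightarrow> complex) \<Rightarrow> 'a \<Rightarrow> complex"
  where "del e j g p =
    (frechet_derivative g (at p) (e j 1) - \<i> * frechet_derivative g (at p) (e j \<i>)) / 2"

definition delbar :: "('m \<Rightarrow> complex \<Rightarrow> 'a) \<Rightarrow> 'm \<Rightarrow> ('a::real_normed_vector \<Rightarrow> complex) \<Rightarrow> 'a \<Rightarrow> complex"
  where "delbar e j g p =
    (frechet_derivative g (at p) (e j 1) + \<i> * frechet_derivative g (at p) (e j \<i>)) / 2"

text \<open>
  The coefficients \<open>g\<^sub>j\<^sub>k\<close> of the form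
  \<open>\<omega> = \<i> \<partial>\<partial>bar \<phi> = \<i> (\<Sum>j k. g\<^sub>j\<^sub>k dz\<^sub>j \<and> d(cnj z\<^sub>k))\<close>.
\<close>

definition kaehler_coeff ::
    "('m \<Rightarrow> complex \<Rightarrow> 'a) \<Rightarrow> ('a::real_normed_vector \<Rightarrow> real) \<Rightarrow> 'a \<Rightarrow> complex^'m^'m"
  where "kaehler_coeff e \<phi> p = (\<chi> j k. del e j (delbar e k (\<lambda>q. complex_of_real (\<phi> q))) p)"

text \<open>
  The measure of the volume form \<open>\<omega>\<^sup>m / m!\<close>, \<open>m = CARD('m)\<close>.  In coordinates
  \<open>\<omega>\<^sup>m / m! = det (g\<^sub>j\<^sub>k) \<Prod>\<^sub>j (\<i> dz\<^sub>j \<and> d(cnj z\<^sub>j))\<close>, and \<open>\<i> dz \<and> d(cnj z) = 2 dx \<and> dy\<close>, whence the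
  factor \<open>2\<^sup>m\<close> relative to Lebesgue measure.
\<close>

definition kaehler_volume ::
    "('m::finite \<Rightarrow> complex \<Rightarrow> 'a) \<Rightarrow> ('a::euclidean_space \<Rightarrow> real) \<Rightarrow> 'a set \<Rightarrow> 'a measure"
  where "kaehler_volume e \<phi> S =
    density (restrict_space lborel S)
      (\<lambda>p. ennreal (2 ^ CARD('m) * Re (det (kaehler_coeff e \<phi> p))))"

definition bergman_potential :: "complex^'n \<Rightarrow> real"
  where "bergman_potential z = ln (Re (bergman_kernel z z)) / (real CARD('n) + 1)"

definition pair_coord :: "'n + 'n \<Rightarrow> complex \<Rightarrow> (complex^'n) \<times> (complex^'n)"
  where "pair_coord j c = (case j of Inl i \<Rightarrow> (axis i c, 0) | Inr i \<Rightarrow> (0, axis i c))"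

definition ball_volume_form :: "(complex^'n) measure"
  where "ball_volume_form = kaehler_volume axis bergman_potential \<bbbB>"

definition biball_volume_form :: "((complex^'n) \<times> (complex^'n)) measure"
  where "biball_volume_form =
    kaehler_volume pair_coord (\<lambda>(z, w). bergman_potential z + bergman_potential w) (\<bbbB> \<times> \<bbbB>)"


section \<open>Lattices in the automorphism group of the ball\<close>

text \<open>Elements of \<open>Bij \<bbbB>\<close> are extensional, so that automorphisms are determined on the ball.\<close>

definition Aut_ball :: "(complex^'n \<Rightarrow> complex^'n) monoid"
  where "Aut_ball = (BijGroup \<bbbB>)
    \<lparr>carrier := {f \<in> Bij \<bbbB>. holo_map_on f \<bbbB> \<and> holo_map_on (inv_into \<bbbB> f) \<bbbB>}\<rparr>"

text \<open>The compact-open topology, which is the Lie group topology of the automorphism group.\<close>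

definition Aut_topology :: "(complex^'n \<Rightarrow> complex^'n) topology"
  where "Aut_topology = topology_generated_by
    {{f \<in> carrier Aut_ball. f ` K \<subseteq> U} | K U. compact K \<and> K \<subseteq> \<bbbB> \<and> open U}"

abbreviation restricted_group :: "(complex^'n \<Rightarrow> complex^'n) set \<Rightarrow> (complex^'n \<Rightarrow> complex^'n) monoid"
  where "restricted_group \<Gamma> \<equiv> Aut_ball\<lparr>carrier := \<Gamma>\<rparr>"

text \<open>
  The measure induced by an invariant measure \<open>M\<close> on the quotient by the action \<open>\<phi>\<close> of a group \<open>G\<close>,
  normalised such that the quotient map preserves the measure of every measurable set on which
  it is injective.  Hence the measure of \<open>A\<close> is the mass of a measurable set of representatives
  for \<open>A\<close>, i.e. of a largest set injecting into \<open>A\<close>.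
\<close>

definition quotient_measure ::
    "('g, 'r) monoid_scheme \<Rightarrow> ('g \<Rightarrow> 'a \<Rightarrow> 'a) \<Rightarrow> 'a measure \<Rightarrow> 'a set measure"
  where "quotient_measure G \<phi> M = measure_of (orbits G (space M) \<phi>)
    {A. A \<subseteq> orbits G (space M) \<phi> \<and> {p \<in> space M. orbit G \<phi> p \<in> A} \<in> sets M}
    (\<lambda>A. SUP E \<in> {E \<in> sets M. inj_on (orbit G \<phi>) E \<and> orbit G \<phi> ` E \<subseteq> A}. emeasure M E)"

definition Sigma_volume :: "(complex^'n \<Rightarrow> complex^'n) set \<Rightarrow> (complex^'n) set measure"
  where "Sigma_volume \<Gamma> = quotient_measure (restricted_group \<Gamma>) (\<lambda>\<gamma>. \<gamma>) ball_volume_form"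

text \<open>A lattice is a discrete subgroup of finite covolume.\<close>

definition lattice_in_Aut_ball :: "(complex^'n \<Rightarrow> complex^'n) set \<Rightarrow> bool"
  where "lattice_in_Aut_ball \<Gamma> \<longleftrightarrow>
    subgroup \<Gamma> Aut_ball \<and>
    subtopology Aut_topology \<Gamma> = discrete_topology \<Gamma> \<and>
    emeasure (Sigma_volume \<Gamma>) (space (Sigma_volume \<Gamma>)) < \<infinity>"

definition torsion_free :: "(complex^'n \<Rightarrow> complex^'n) set \<Rightarrow> bool"
  where "torsion_free \<Gamma> \<longleftrightarrow>
    (\<forall>\<gamma>\<in>\<Gamma>. \<forall>k::nat. 0 < k \<and> \<gamma> [^]\<^bsub>Aut_ball\<^esub> k = \<one>\<^bsub>Aut_ball\<^esub> \<longrightarrow> \<gamma> = \<one>\<^bsub>Aut_ball\<^esub>)"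


section \<open>The quotient of the product of two balls by the diagonal action\<close>

definition diagonal_action ::
    "(complex^'n \<Rightarrow> complex^'n) \<Rightarrow> (complex^'n) \<times> (complex^'n) \<Rightarrow> (complex^'n) \<times> (complex^'n)"
  where "diagonal_action \<gamma> = (\<lambda>(z, w). (\<gamma> z, \<gamma> w))"

definition Omega_proj ::
    "(complex^'n \<Rightarrow> complex^'n) set \<Rightarrow> (complex^'n) \<times> (complex^'n) \<Rightarrow> ((complex^'n) \<times> (complex^'n)) set"
  where "Omega_proj \<Gamma> = orbit (restricted_group \<Gamma>) diagonal_action"

definition Omega :: "(complex^'n \<Rightarrow> complex^'n) set \<Rightarrow> ((complex^'n) \<times> (complex^'n)) set set"
  where "Omega \<Gamma> = orbits (restricted_group \<Gamma>) (\<bbbB> \<times> \<bbbB>) diagonal_action"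

definition Omega_volume ::
    "(complex^'n \<Rightarrow> complex^'n) set \<Rightarrow> ((complex^'n) \<times> (complex^'n)) set measure"
  where "Omega_volume \<Gamma> =
    quotient_measure (restricted_group \<Gamma>) diagonal_action biball_volume_form"

text \<open>
  The complex structure of \<open>Omega \<Gamma>\<close> is the one making the quotient map a local biholomorphism, so
  a function on \<open>Omega \<Gamma>\<close> is holomorphic iff its pullback is.
\<close>

definition holo_on_Omega ::
    "(complex^'n \<Rightarrow> complex^'n) set \<Rightarrow> (((complex^'n) \<times> (complex^'n)) set \<Rightarrow> complex) \<Rightarrow> bool"
  where "holo_on_Omega \<Gamma> f \<longleftrightarrow> holo_fun_on (\<lambda>p. f (Omega_proj \<Gamma> p)) (\<bbbB> \<times> \<bbbB>)"

text \<open>The function \<open>1 - |T\<^sub>z w|\<^sup>2\<close> is constant on orbits.\<close>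

definition delta :: "((complex^'n) \<times> (complex^'n)) set \<Rightarrow> real"
  where "delta x = the_elem ((\<lambda>(z, w). 1 - (norm (T z w))\<^sup>2) ` x)"

definition bergman_norm_sq ::
    "(complex^'n \<Rightarrow> complex^'n) set \<Rightarrow> real \<Rightarrow> (((complex^'n) \<times> (complex^'n)) set \<Rightarrow> complex) \<Rightarrow> ennreal"
  where "bergman_norm_sq \<Gamma> \<alpha> f =
    ennreal (Gamma (real CARD('n) + \<alpha> + 1) / (fact CARD('n) * Gamma (\<alpha> + 1))) *
    (\<integral>\<^sup>+x. ennreal ((norm (f x))\<^sup>2 * delta x powr (\<alpha> + real CARD('n) + 1)) \<partial>Omega_volume \<Gamma>)"

text \<open>Functions on \<open>Omega \<Gamma>\<close> are represented by extensional ones.\<close>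

definition hardy_space ::
    "(complex^'n \<Rightarrow> complex^'n) set \<Rightarrow> (((complex^'n) \<times> (complex^'n)) set \<Rightarrow> complex) set"
  where "hardy_space \<Gamma> = {f \<in> extensional (Omega \<Gamma>). holo_on_Omega \<Gamma> f \<and>
    (\<exists>L<\<infinity>. ((\<lambda>\<alpha>. bergman_norm_sq \<Gamma> \<alpha> f) \<longlongrightarrow> L) (at_right (-1)))}"

definition hardy_norm ::
    "(complex^'n \<Rightarrow> complex^'n) set \<Rightarrow> (((complex^'n) \<times> (complex^'n)) set \<Rightarrow> complex) \<Rightarrow> real"
  where "hardy_norm \<Gamma> f = sqrt (enn2real (Lim (at_right (-1)) (\<lambda>\<alpha>. bergman_norm_sq \<Gamma> \<alpha> f)))"

end

theory Submission
  imports Defs "HOL-Complex_Analysis.Complex_Analysis"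
begin

text \<open>A holomorphic function on \<open>Omega \<Gamma>\<close> is a holomorphic function \<open>F\<close> on \<open>\<bbbB> \<times> \<bbbB>\<close> that is invariant under the
  diagonal action.  Write \<open>V\<close> for the invariant volume of the ball, \<open>\<delta>(z, w) = 1 - |T\<^sub>z w|\<^sup>2\<close>, and
  \<open>K\<^sub>\<alpha>(z, w)\<close> for the constant in \<open>bergman_norm_sq\<close> times \<open>\<delta>(z, w)\<close> to the power \<open>\<alpha> + n + 1\<close>.

  Growth.  Let \<open>D\<close> be a Borel fundamental domain of \<open>\<Gamma>\<close> in the ball.  Then \<open>D \<times> \<bbbB>\<close> is one for the
  diagonal action, and the norm of \<open>F\<close> is \<open>N\<^sub>\<alpha> = \<integral>\<^sub>D \<integral> K\<^sub>\<alpha>(z, w) |F(z, w)|\<^sup>2 dV(w) dV(z)\<close>.  The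
  substitution \<open>w = T\<^sub>z t\<close> makes the kernel radial in \<open>t\<close>, so only the spherical means of
  \<open>|F(z, T\<^sub>z t)|\<^sup>2\<close> matter; they increase with the radius, and so does their integral \<open>G(r)\<close> over
  \<open>z \<in> D\<close>.  The radial kernels have one and the same mass \<open>\<kappa>\<close>, which moves to the sphere as \<open>\<alpha>\<close>
  decreases to \<open>-1\<close>.  Hence \<open>N\<^sub>\<alpha>\<close> tends to \<open>\<kappa> S\<close> with \<open>S = sup G\<close> (lemma \<open>weighted_norm_tendsto\<close>): the
  Hardy space consists of the \<open>F\<close> with \<open>S < \<infinity>\<close>.  Bounded functions belong to it, because \<open>D\<close> has finite
  volume.

  Rigidity.  Suppose \<open>S < \<infinity>\<close> and consider
  \<open>I\<^sub>\<alpha> = \<integral>\<^sub>D \<integral> \<integral> K\<^sub>0(z, z') K\<^sub>\<alpha>(z, w) |F(z', w)|\<^sup>2 dV(w) dV(z') dV(z)\<close>.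
  Integration over \<open>z'\<close> first, with the mean value property of the holomorphic function \<open>F(\<cdot>, w)\<close>, gives
  \<open>I\<^sub>\<alpha> = \<kappa> N\<^sub>\<alpha> + X\<^sub>\<alpha>\<close>, where \<open>X\<^sub>\<alpha>\<close> is the nonnegative contribution of the increments
  \<open>F(T\<^sub>z s, w) - F(z, w)\<close> (lemma \<open>double_integral_eq\<close>).  On the other hand unfolding over \<open>\<Gamma>\<close> lets \<open>z'\<close>
  instead of \<open>z\<close> range over \<open>D\<close>; integration over \<open>z\<close> then replaces the two kernels by their convolution,
  a function of \<open>\<delta>(z', w)\<close> of mass \<open>\<kappa>\<^sup>2\<close>, so that \<open>I\<^sub>\<alpha> \<le> \<kappa>\<^sup>2 S\<close> (lemma \<open>double_integral_upper\<close>).  In the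
  limit \<open>\<alpha> \<rightarrow> -1\<close> both estimates have the main term \<open>\<kappa>\<^sup>2 S\<close>.  As this is finite, \<open>X\<^sub>\<alpha>\<close> tends to \<open>0\<close>, and
  since its limit is a supremum, all increments vanish: \<open>F(z, w)\<close> depends on \<open>w\<close> only
  (lemma \<open>finite_growth_imp_const_fst\<close>).  Its value at \<open>(z, w)\<close> is then a \<open>\<Gamma>\<close>-invariant function \<open>g(w)\<close>
  with \<open>\<integral>\<^sub>D |g|\<^sup>2 dV = G(0) < \<infinity>\<close>, so the same argument applies to \<open>(z, w) \<mapsto> g(z)\<close>, and \<open>F\<close> is constant.

  Groups.  Automorphisms preserve \<open>\<delta>\<close> by the Schwarz-Pick lemma, and hence \<open>V\<close>.  Therefore a discrete
  group acts properly discontinuously (lemma \<open>finite_bounded_orbit\<close>, by the theorem of Arzela and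
  Ascoli), a torsion-free one acts freely, and a Borel fundamental domain can be assembled from
  countably many wandering open sets.  Integrals over the quotients are integrals over the fundamental
  domains (lemma \<open>nn_integral_quotient_measure\<close>).\<close>

section \<open>The Hermitian product and the involutions of the ball\<close>

lemma cdot_add_left: "cdot (x + y) z = cdot x z + cdot y z"
  by (simp add: cdot_def sum.distrib algebra_simps)

lemma cdot_diff_left: "cdot (x - y) z = cdot x z - cdot y z"
  by (simp add: cdot_def sum_subtractf algebra_simps)

lemma cdot_scale_left: "cdot (c *s x) z = c * cdot x z"
  by (simp add: cdot_def sum_distrib_left algebra_simps)

lemma cdot_cnj: "cnj (cdot x y) = cdot y x"
  by (simp add: cdot_def algebra_simps)

lemma cdot_diff_right: "cdot z (x - y) = cdot z x - cdot z y"
  by (simp add: cdot_def sum_subtractf algebra_simps)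

lemma cdot_scale_right: "cdot z (c *s x) = cnj c * cdot z x"
  by (simp add: cdot_def sum_distrib_left algebra_simps)

lemma cdot_zero [simp]: "cdot 0 z = 0" "cdot z 0 = 0"
  by (simp_all add: cdot_def)

lemma cdot_self: "cdot x x = of_real ((norm x)\<^sup>2)"
  by (simp add: cdot_def norm_vec_def L2_set_def complex_norm_square sum_nonneg del: of_real_power)

lemma scaleR_vec_complex: "r *\<^sub>R (x :: complex^'n) = of_real r *s x"
  by (simp add: vec_eq_iff scaleR_conv_of_real[symmetric])

lemma norm_vector_smult: "norm (c *s (x :: complex^'n)) = norm c * norm x"
  unfolding norm_vec_def L2_set_def
  by (simp add: norm_mult power_mult_distrib sum_distrib_left[symmetric] real_sqrt_mult)

lemma inner_eq_Re_cdot: "inner x y = Re (cdot x y)"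
  by (simp add: inner_vec_def cdot_def inner_complex_def)

lemma norm_cdot_le: "norm (cdot x y) \<le> norm x * norm y"
proof (cases "cdot x y = 0")
  case False
  \<comment> \<open>rotate \<open>x\<close> by a phase to make the Hermitian product real, hence a real inner product\<close>
  define c where "c = cnj (cdot x y) / norm (cdot x y)"
  have "norm c = 1" using False by (simp add: c_def norm_divide)
  have "c * cdot x y = norm (cdot x y)"
    using False by (simp add: c_def complex_norm_square[symmetric] power2_eq_square mult.commute)
  then have "norm (cdot x y) = inner (c *s x) y"
    by (simp add: inner_eq_Re_cdot cdot_scale_left)
  also have "\<dots> \<le> norm (c *s x) * norm y" by (rule norm_cauchy_schwarz)
  finally show ?thesis using \<open>norm c = 1\<close> by (simp add: norm_vector_smult)
qed simp

lemma norm_cdot_less_one: "norm x < 1 \<Longrightarrow> norm y < 1 \<Longrightarrow> norm (cdot x y) < 1"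
  by (smt (verit) mult_less_cancel_right2 norm_cdot_le norm_ge_zero mult_left_le_one_le mult_right_le_one_le)

lemma one_minus_cdot_nonzero: "norm x < 1 \<Longrightarrow> norm y < 1 \<Longrightarrow> 1 - cdot x y \<noteq> 0"
  using norm_cdot_less_one[of x y] by auto

lemma orth_proj_eqI:
  assumes "p \<in> V" "w - p \<in> orth_compl V" and diff: "\<And>x y. x \<in> V \<Longrightarrow> y \<in> V \<Longrightarrow> x - y \<in> V"
  shows "orth_proj V w = p"
  unfolding orth_proj_def
proof (rule the_equality)
  fix q assume q: "q \<in> V \<and> w - q \<in> orth_compl V"
  have d: "p - q \<in> V" using q assms by blast
  have "cdot (w - q) (p - q) = 0" "cdot (w - p) (p - q) = 0"
    using q assms d by (auto simp: orth_compl_def)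
  then have "cdot (p - q) (p - q) = 0" by (simp add: cdot_diff_left)
  then show "q = p" by (simp add: cdot_self)
qed (use assms in auto)

definition sfun :: "complex^'n \<Rightarrow> real" where "sfun z = sqrt (1 - (norm z)\<^sup>2)"

text \<open>The projections onto \<open>[z]\<close> and its complement are inserted explicitly.  The form
  \<open>(1 - s) / |z|\<^sup>2 = 1 / (1 + s)\<close> of the resulting coefficient removes the singularity at \<open>z = 0\<close>, so
  that one rational expression serves for all \<open>z\<close> in the ball.\<close>

lemma T_eq:
  assumes "norm z < 1"
  shows "T z w = (1 / (1 - cdot w z)) *s ((1 - cdot w z / (1 + of_real (sfun z))) *s z - of_real (sfun z) *s w)"
proof -
  let ?V = "vec.span {z}"
  define P where "P = (cdot w z / (norm z)\<^sup>2) *s z"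
  have sp: "?V = range (\<lambda>k. k *s z)" by (rule vec.span_singleton)
  have PV: "P \<in> ?V" by (auto simp: sp P_def)
  have Pz: "cdot P z = cdot w z"
    by (cases "z = 0") (simp_all add: P_def cdot_scale_left cdot_self)
  have oV: "w - P \<in> orth_compl ?V"
    by (auto simp: orth_compl_def sp cdot_diff_left cdot_scale_right Pz)
  have P: "orth_proj ?V w = P"
    by (rule orth_proj_eqI) (auto simp: PV oV vec.span_diff)
  have Q: "orth_proj (orth_compl ?V) w = w - P"
  proof (rule orth_proj_eqI)
    have "cdot P v = 0" if "v \<in> orth_compl ?V" for v
    proof -
      have "cdot v P = 0" using that PV by (auto simp: orth_compl_def)
      then show ?thesis by (metis cdot_cnj complex_cnj_zero)
    qed
    then show "w - (w - P) \<in> orth_compl (orth_compl ?V)" by (auto simp: orth_compl_def)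
  qed (use oV in \<open>auto simp: orth_compl_def cdot_diff_left\<close>)
  have s: "0 < sfun z" "(sfun z)\<^sup>2 = 1 - (norm z)\<^sup>2"
    using assms by (simp_all add: sfun_def power_less_one_iff abs_square_less_1 abs_square_le_1 order_less_imp_le)
  have "P - of_real (sfun z) *s P = (cdot w z / (1 + of_real (sfun z))) *s z"
  proof (cases "z = 0")
    case False
    have "(1 - sfun z) * (1 + sfun z) = (norm z)\<^sup>2" using s by (simp add: algebra_simps power2_eq_square)
    then have "(1 - sfun z) / (norm z)\<^sup>2 = 1 / (1 + sfun z)"
      using False s by (simp add: field_simps)
    then have "(1 - of_real (sfun z)) / (of_real ((norm z)\<^sup>2)) = 1 / (1 + complex_of_real (sfun z))"
      by (metis of_real_1 of_real_add of_real_diff of_real_divide)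
    then have *: "cdot w z * ((1 - of_real (sfun z)) / (of_real ((norm z)\<^sup>2))) = cdot w z / (1 + of_real (sfun z))"
      by simp
    have "P - of_real (sfun z) *s P = (cdot w z * ((1 - of_real (sfun z)) / (of_real ((norm z)\<^sup>2)))) *s z"
      by (simp add: P_def vec_eq_iff algebra_simps diff_divide_distrib)
    then show ?thesis unfolding * by simp
  qed (simp add: P_def)
  then have "z - P - of_real (sfun z) *s (w - P) = (1 - cdot w z / (1 + of_real (sfun z))) *s z - of_real (sfun z) *s w"
    by (simp add: vec_eq_iff algebra_simps)
  then show ?thesis
    unfolding T_def Let_def P Q scaleR_vec_complex sfun_def[symmetric] by (simp only:)
qed

lemma sfun_pos: "norm z < 1 \<Longrightarrow> 0 < sfun z"
  by (simp add: sfun_def abs_square_less_1)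

lemma sfun_sq: "norm z < 1 \<Longrightarrow> (sfun z)\<^sup>2 = 1 - (norm z)\<^sup>2"
  by (simp add: sfun_def abs_square_le_1 order_less_imp_le)

text \<open>The identity behind the geometry of the involutions: the case \<open>z = w\<close> shows that they preserve
  the ball, and the case \<open>w = 0\<close> that they are involutive.\<close>

lemma one_minus_cdot_T:
  assumes a: "norm a < 1" and z: "norm z < 1" and w: "norm w < 1"
  shows "1 - cdot (T a z) (T a w) =
    of_real (1 - (norm a)\<^sup>2) * (1 - cdot z w) / ((1 - cdot z a) * (1 - cdot a w))"
proof -
  define s x y where "s = complex_of_real (sfun a)" and "x = cdot z a" and "y = cdot a w"
  have y: "cnj (cdot w a) = y" by (simp add: y_def cdot_cnj)
  have cs: "cnj s = s" by (simp add: s_def)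
  have aa: "cdot a a = 1 - s\<^sup>2" using sfun_sq[OF a] by (simp add: cdot_self s_def flip: of_real_power)
  have s1: "1 + s \<noteq> 0" using sfun_pos[OF a]
    by (metis add_pos_pos of_real_1 of_real_add of_real_eq_0_iff order_less_irrefl s_def zero_less_one)
  have nz: "1 - x \<noteq> 0" "1 - y \<noteq> 0" using one_minus_cdot_nonzero[OF z a] one_minus_cdot_nonzero[OF a w]
    by (simp_all add: x_def y_def)
  have "cdot ((1 - x / (1 + s)) *s a - s *s z) ((1 - cdot w a / (1 + s)) *s a - s *s w)
     = (1 - x/(1+s)) * (1 - y/(1+s)) * (1 - s\<^sup>2) - s * (1 - x/(1+s)) * y - s * (1 - y/(1+s)) * x + s\<^sup>2 * cdot z w"
  proof -
    have "cdot (u *s a - s *s z) (v *s a - s *s w)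
        = u * cnj v * (1 - s\<^sup>2) - s * u * y - s * cnj v * x + s\<^sup>2 * cdot z w" for u v
      unfolding cdot_diff_left cdot_diff_right cdot_scale_left cdot_scale_right cs aa
         y_def[symmetric] x_def[symmetric] by (simp add: algebra_simps power2_eq_square)
    from this[of "1 - x / (1 + s)" "1 - cdot w a / (1 + s)"] show ?thesis by (simp add: y cs mult.assoc)
  qed
  also have "\<dots> = (1 - x) * (1 - y) - s\<^sup>2 * (1 - cdot z w)"
  proof -
    define u where "u = 1 / (1 + s)"
    have u: "u * (1 + s) = 1" using s1 by (simp add: u_def)
    have *: "x/(1+s) = x * u" "y/(1+s) = y * u" by (simp_all add: u_def)
    have "1 - s\<^sup>2 = (1 - s) * (1 + s)" by (simp add: algebra_simps power2_eq_square)
    show ?thesis unfolding * using u by algebra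
  qed
  finally have N: "cdot ((1 - x / (1 + s)) *s a - s *s z) ((1 - cdot w a / (1 + s)) *s a - s *s w)
     = (1 - x) * (1 - y) - s\<^sup>2 * (1 - cdot z w)" .
  have "cdot (T a z) (T a w) = ((1 - x) * (1 - y) - s\<^sup>2 * (1 - cdot z w)) / ((1 - x) * (1 - y))"
    unfolding T_eq[OF a] s_def[symmetric] x_def[symmetric] cdot_scale_left cdot_scale_right N
    by (simp add: y)
  moreover have "of_real (1 - (norm a)\<^sup>2) = s\<^sup>2" using sfun_sq[OF a] by (simp add: s_def flip: of_real_power)
  ultimately show ?thesis
    unfolding x_def[symmetric] y_def[symmetric] using nz by (simp only:) (simp add: divide_simps)
qed

lemma one_minus_norm_T:
  assumes a: "norm a < 1" and z: "norm z < 1"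
  shows "1 - (norm (T a z))\<^sup>2 = (1 - (norm a)\<^sup>2) * (1 - (norm z)\<^sup>2) / (norm (1 - cdot z a))\<^sup>2"
proof -
  have "complex_of_real (1 - (norm (T a z))\<^sup>2) = 1 - cdot (T a z) (T a z)"
    by (simp add: cdot_self)
  also have "\<dots> = of_real (1 - (norm a)\<^sup>2) * of_real (1 - (norm z)\<^sup>2) / ((1 - cdot z a) * cnj (1 - cdot z a))"
    unfolding one_minus_cdot_T[OF a z z] by (simp add: cdot_self cdot_cnj)
  also have "\<dots> = of_real ((1 - (norm a)\<^sup>2) * (1 - (norm z)\<^sup>2) / (norm (1 - cdot z a))\<^sup>2)"
    by (simp add: complex_norm_square del: of_real_power)
  finally show ?thesis using of_real_eq_iff by blast
qed

lemma norm_T_less_one: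
  assumes a: "norm a < 1" and z: "norm z < 1"
  shows "norm (T a z) < 1"
proof -
  have "0 < (1 - (norm a)\<^sup>2) * (1 - (norm z)\<^sup>2) / (norm (1 - cdot z a))\<^sup>2"
    using one_minus_cdot_nonzero[OF z a] a z
    by (intro divide_pos_pos mult_pos_pos) (auto simp: abs_square_less_1)
  then have "(norm (T a z))\<^sup>2 < 1" using one_minus_norm_T[OF a z] by simp
  then show ?thesis by (simp add: abs_square_less_1)
qed

lemma T_zero [simp]: "norm a < 1 \<Longrightarrow> T a 0 = a"
  by (simp add: T_eq)

lemma T_self [simp]: assumes a: "norm a < 1" shows "T a a = 0"
proof -
  have "1 - (norm (T a a))\<^sup>2 = 1"
    using one_minus_norm_T[OF a a] a abs_square_less_1[of "norm a"]
    by (simp add: cdot_self power2_eq_square norm_mult flip: of_real_mult of_real_diff)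
     (smt (verit) cdot_self norm_of_real of_real_1 of_real_diff one_minus_cdot_nonzero power2_eq_square divide_self_if mult_eq_0_iff of_real_0)
  then show ?thesis by simp
qed

lemma T_T [simp]: assumes a: "norm a < 1" and w: "norm w < 1" shows "T a (T a w) = w"
proof -
  define s x where "s = complex_of_real (sfun a)" and "x = cdot w a"
  have s0: "s \<noteq> 0" "1 + s \<noteq> 0" using sfun_pos[OF a]
    by (simp add: s_def) (metis add_pos_pos of_real_1 of_real_add of_real_eq_0_iff order_less_irrefl s_def zero_less_one sfun_pos[OF a])
  have nz: "1 - x \<noteq> 0" using one_minus_cdot_nonzero[OF w a] by (simp add: x_def)
  have s2: "of_real (1 - (norm a)\<^sup>2) = s\<^sup>2" using sfun_sq[OF a] by (simp add: s_def flip: of_real_power)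
  have "1 - cdot (T a w) (T a 0) = s\<^sup>2 / (1 - x)"
    using one_minus_cdot_T[OF a w, of 0] unfolding s2 by (simp add: x_def)
  then have c: "1 - cdot (T a w) a = s\<^sup>2 / (1 - x)" using a by simp
  then have c': "cdot (T a w) a = 1 - s\<^sup>2 / (1 - x)" by (simp add: algebra_simps)
  have Tw: "T a w = (1 / (1 - x)) *s ((1 - x / (1 + s)) *s a - s *s w)"
    unfolding T_eq[OF a] s_def[symmetric] x_def[symmetric] ..
  have "T a (T a w) = ((1 - x) / s\<^sup>2) *s ((1 - (1 - s\<^sup>2 / (1 - x)) / (1 + s)) *s a
      - s *s ((1 / (1 - x)) *s ((1 - x / (1 + s)) *s a - s *s w)))"
    unfolding T_eq[OF a, of "T a w"] s_def[symmetric] c c' by (simp add: Tw)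
  also have "\<dots> = w"
  proof -
    have e: "(1 - (1 - s\<^sup>2 / (1 - x)) / (1 + s)) - s * (1 / (1 - x)) * (1 - x / (1 + s)) = 0"
      using nz s0 by (simp add: divide_simps) (simp add: algebra_simps power2_eq_square)
    have "(1 - (1 - s\<^sup>2 / (1 - x)) / (1 + s)) *s a - s *s ((1 / (1 - x)) *s ((1 - x / (1 + s)) *s a - s *s w))
      = ((1 - (1 - s\<^sup>2 / (1 - x)) / (1 + s)) - s * (1 / (1 - x)) * (1 - x / (1 + s))) *s a + (s\<^sup>2 / (1 - x)) *s w"
      by (simp add: vec_eq_iff algebra_simps power2_eq_square)
    then have *: "(1 - (1 - s\<^sup>2 / (1 - x)) / (1 + s)) *s a - s *s ((1 / (1 - x)) *s ((1 - x / (1 + s)) *s a - s *s w))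
      = (s\<^sup>2 / (1 - x)) *s w" unfolding e by simp
    show ?thesis unfolding * using nz s0 by simp
  qed
  finally show ?thesis .
qed

lemma T_maps_ball: "a \<in> \<bbbB> \<Longrightarrow> T a ` \<bbbB> = \<bbbB>"
  by (auto simp: norm_T_less_one image_iff) (metis T_T norm_T_less_one mem_ball_0)

section \<open>Holomorphic maps and automorphisms of the ball\<close>

text \<open>Scalar functions need their own notion because the predicate for maps takes values in
  \<open>complex^'m\<close>.\<close>

definition cholo_on :: "(complex^'n \<Rightarrow> complex) \<Rightarrow> (complex^'n) set \<Rightarrow> bool"
  where "cholo_on g S \<longleftrightarrow> (\<forall>z\<in>S. \<exists>D. (g has_derivative D) (at z) \<and> (\<forall>c v. D (c *s v) = c * D v))"

lemma bounded_bilinear_vector_smult: "bounded_bilinear ((*s) :: complex \<Rightarrow> complex^'n \<Rightarrow> _)"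
proof
  show "\<exists>K. \<forall>a b. norm (a *s (b :: complex^'n)) \<le> norm a * norm b * K"
    by (intro exI[of _ 1]) (simp add: norm_vector_smult)
  show "(r *\<^sub>R a) *s b = r *\<^sub>R (a *s b)" for r a and b :: "complex^'n"
    by (simp add: vec_eq_iff)
  show "a *s (r *\<^sub>R b) = r *\<^sub>R (a *s b)" for r a and b :: "complex^'n"
    by (simp add: vec_eq_iff)
qed (simp_all add: vec_eq_iff algebra_simps)

lemmas has_derivative_vector_smult [derivative_intros] =
  bounded_bilinear.FDERIV[OF bounded_bilinear_vector_smult]
lemmas continuous_on_vector_smult [continuous_intros] =
  bounded_bilinear.continuous_on[OF bounded_bilinear_vector_smult]

lemma bounded_linear_cdot_left: "bounded_linear (\<lambda>w. cdot w a)"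
  by (rule bounded_linear_intro[where K="norm a"])
    (simp_all add: cdot_add_left scaleR_vec_complex cdot_scale_left scaleR_conv_of_real norm_cdot_le)

lemma continuous_on_cdot [continuous_intros]:
  "continuous_on S f \<Longrightarrow> continuous_on S g \<Longrightarrow> continuous_on S (\<lambda>x. cdot (f x) (g x))"
  unfolding cdot_def by (intro continuous_intros)

lemma T_has_derivative:
  assumes a: "norm a < 1" and w: "norm w < 1"
  shows "(T a has_derivative (\<lambda>h. (1 / (1 - cdot w a)) *s (- ((cdot h a / (1 + of_real (sfun a))) *s a) - of_real (sfun a) *s h)
     + (cdot h a / (1 - cdot w a)\<^sup>2) *s ((1 - cdot w a / (1 + of_real (sfun a))) *s a - of_real (sfun a) *s w))) (at w)"
proof -
  define s where "s = complex_of_real (sfun a)"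
  have nz: "1 - cdot w a \<noteq> 0" using one_minus_cdot_nonzero[OF w a] .
  have s1: "1 + s \<noteq> 0" using sfun_pos[OF a]
    by (metis add_pos_pos of_real_1 of_real_add of_real_eq_0_iff order_less_irrefl s_def zero_less_one)
  have "((\<lambda>x. 1 / (1 - x)) has_field_derivative 1 / (1 - cdot w a)\<^sup>2) (at (cdot w a))"
    using nz by (auto intro!: derivative_eq_intros simp: power2_eq_square)
  from has_derivative_compose[OF bounded_linear_imp_has_derivative[OF bounded_linear_cdot_left[of a], of "at w"]
      this[unfolded has_field_derivative_def]]
  have 1: "((\<lambda>w. 1 / (1 - cdot w a)) has_derivative (\<lambda>h. cdot h a / (1 - cdot w a)\<^sup>2)) (at w)"
    by (simp add: o_def)
  have L: "bounded_linear (\<lambda>h. - ((cdot h a / (1 + s)) *s a) - s *s h)"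
    by (intro bounded_linear_sub bounded_linear_minus
      bounded_linear_compose[OF bounded_bilinear.bounded_linear_left[OF bounded_bilinear_vector_smult]]
      bounded_linear_divide[THEN bounded_linear_compose] bounded_linear_cdot_left
      bounded_bilinear.bounded_linear_right[OF bounded_bilinear_vector_smult])
  have "(\<lambda>w. (1 - cdot w a / (1 + s)) *s a - s *s w) = (\<lambda>w. a + (- ((cdot w a / (1 + s)) *s a) - s *s w))"
    by (simp add: fun_eq_iff vec_eq_iff algebra_simps)
  then have 2: "((\<lambda>w. (1 - cdot w a / (1 + s)) *s a - s *s w) has_derivative
     (\<lambda>h. - ((cdot h a / (1 + s)) *s a) - s *s h)) (at w)"
    using has_derivative_add[OF has_derivative_const[of a] bounded_linear_imp_has_derivative[OF L], of "at w"]
    by simp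
  have "(T a has_derivative (\<lambda>h. (1 / (1 - cdot w a)) *s (- ((cdot h a / (1 + s)) *s a) - s *s h)
     + (cdot h a / (1 - cdot w a)\<^sup>2) *s ((1 - cdot w a / (1 + s)) *s a - s *s w))) (at w)"
    using has_derivative_vector_smult[OF 1 2]
    unfolding T_eq[OF a, abs_def] s_def .
  then show ?thesis unfolding s_def .
qed

lemma T_has_derivative_zero:
  assumes a: "norm a < 1"
  shows "(T a has_derivative (\<lambda>h. - (sfun a *\<^sub>R (h - (cdot h a / (1 + of_real (sfun a))) *s a)))) (at 0)"
proof -
  define s where "s = complex_of_real (sfun a)"
  have s1: "1 + s \<noteq> 0" using sfun_pos[OF a]
    by (metis add_pos_pos of_real_1 of_real_add of_real_eq_0_iff order_less_irrefl s_def zero_less_one)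
  have "(\<lambda>h. (1 / (1 - cdot 0 a)) *s (- ((cdot h a / (1 + s)) *s a) - s *s h)
     + (cdot h a / (1 - cdot 0 a)\<^sup>2) *s ((1 - cdot 0 a / (1 + s)) *s a - s *s 0))
     = (\<lambda>h. - (sfun a *\<^sub>R (h - (cdot h a / (1 + s)) *s a)))"
  proof
    fix h
    have "x - x / (1 + s) = s * x / (1 + s)" for x :: complex using s1 by (simp add: field_simps)
    then show "(1 / (1 - cdot 0 a)) *s (- ((cdot h a / (1 + s)) *s a) - s *s h)
     + (cdot h a / (1 - cdot 0 a)\<^sup>2) *s ((1 - cdot 0 a / (1 + s)) *s a - s *s 0)
     = - (sfun a *\<^sub>R (h - (cdot h a / (1 + s)) *s a))"
      using s1 by (simp add: scaleR_vec_complex s_def[symmetric] vec_eq_iff field_simps)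
  qed
  then show ?thesis using T_has_derivative[OF a, of 0] unfolding s_def by simp
qed

lemma holo_map_on_T: assumes "a \<in> \<bbbB>" shows "holo_map_on (T a) \<bbbB>"
  unfolding holo_map_on_def
proof
  fix w :: "complex^'a" assume "w \<in> \<bbbB>"
  with assms have *: "norm a < 1" "norm w < 1" by auto
  show "\<exists>D. (T a has_derivative D) (at w) \<and> (\<forall>c v. D (c *s v) = c *s D v)"
    by (intro exI conjI, rule T_has_derivative[OF *])
      (simp add: cdot_scale_left vec_eq_iff algebra_simps)
qed

lemma holo_map_on_compose:
  assumes "holo_map_on f S" "holo_map_on g R" "f ` S \<subseteq> R"
  shows "holo_map_on (\<lambda>z. g (f z)) S"
  unfolding holo_map_on_def
proof
  fix z assume z: "z \<in> S"
  obtain D where D: "(f has_derivative D) (at z)" "\<forall>c v. D (c *s v) = c *s D v"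
    using assms z unfolding holo_map_on_def by blast
  obtain E where E: "(g has_derivative E) (at (f z))" "\<forall>c v. E (c *s v) = c *s E v"
    using assms z unfolding holo_map_on_def by blast
  show "\<exists>D. ((\<lambda>z. g (f z)) has_derivative D) (at z) \<and> (\<forall>c v. D (c *s v) = c *s D v)"
    using has_derivative_compose[OF D(1) E(1)] D(2) E(2) by auto
qed

lemma cholo_on_compose:
  assumes "holo_map_on f S" "cholo_on g R" "f ` S \<subseteq> R"
  shows "cholo_on (\<lambda>z. g (f z)) S"
  unfolding cholo_on_def
proof
  fix z assume z: "z \<in> S"
  obtain D where D: "(f has_derivative D) (at z)" "\<forall>c v. D (c *s v) = c *s D v"
    using assms z unfolding holo_map_on_def by blast
  obtain E where E: "(g has_derivative E) (at (f z))" "\<forall>c v. E (c *s v) = c * E v"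
    using assms z unfolding cholo_on_def by blast
  show "\<exists>D. ((\<lambda>z. g (f z)) has_derivative D) (at z) \<and> (\<forall>c v. D (c *s v) = c * D v)"
    using has_derivative_compose[OF D(1) E(1)] D(2) E(2) by auto
qed

lemma cholo_on_cdot: "cholo_on (\<lambda>z. cdot z u) S"
  unfolding cholo_on_def
  by (auto intro!: exI[of _ "\<lambda>h. cdot h u"] bounded_linear_imp_has_derivative bounded_linear_cdot_left
      simp: cdot_scale_left)

lemma cholo_on_imp_continuous_on: "cholo_on g S \<Longrightarrow> continuous_on S g"
  unfolding cholo_on_def
  by (meson continuous_at_imp_continuous_on has_derivative_continuous)

lemma holo_map_on_imp_continuous_on: "holo_map_on g S \<Longrightarrow> continuous_on S g"
  unfolding holo_map_on_def
  by (meson continuous_at_imp_continuous_on has_derivative_continuous)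

lemma cholo_on_slice:
  assumes g: "cholo_on g \<bbbB>" and e: "norm e \<le> 1"
  shows "(\<lambda>t. g (t *s e)) holomorphic_on ball 0 1"
proof (rule holomorphic_onI)
  fix t :: complex assume "t \<in> ball 0 1"
  then have "t *s e \<in> \<bbbB>" using e
    by (simp add: norm_vector_smult) (smt (verit) mult_left_le norm_ge_zero)
  then obtain D where D: "(g has_derivative D) (at (t *s e))" "\<forall>c v. D (c *s v) = c * D v"
    using g unfolding cholo_on_def by blast
  have "((\<lambda>t. t *s e) has_derivative (\<lambda>h. h *s e)) (at t)"
    by (rule bounded_linear_imp_has_derivative[OF bounded_bilinear.bounded_linear_left[OF bounded_bilinear_vector_smult]])
  from has_derivative_compose[OF this D(1)]
  have "((\<lambda>t. g (t *s e)) has_derivative (\<lambda>h. h * D e)) (at t)" by (simp add: D(2))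
  moreover have "(\<lambda>h. h * D e) = (*) (D e)" by (simp add: fun_eq_iff mult.commute)
  ultimately have "((\<lambda>t. g (t *s e)) has_field_derivative D e) (at t)"
    by (simp add: has_field_derivative_def)
  then show "(\<lambda>t. g (t *s e)) field_differentiable at t within ball 0 1"
    using field_differentiable_at_within field_differentiable_def by blast
qed

text \<open>Restricted to the complex line through \<open>z\<close>, and composed with the projection onto the direction of
  \<open>f z\<close>, the map becomes a function of the disc into itself that fixes \<open>0\<close>.\<close>

lemma Schwarz_ball:
  assumes f: "holo_map_on f \<bbbB>" "f ` \<bbbB> \<subseteq> \<bbbB>" "f 0 = 0" and z: "z \<in> \<bbbB>"
  shows "norm (f z) \<le> norm z"
proof (cases "z = 0 \<or> f z = 0")
  case False
  define e where "e = of_real (1 / norm z) *s z"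
  define u where "u = of_real (1 / norm (f z)) *s f z"
  have e: "norm e = 1" and u: "norm u = 1" using False by (simp_all add: e_def u_def norm_vector_smult norm_divide)
  have "of_real (norm z) *s e = z" using False by (simp add: e_def)
  define g where "g = (\<lambda>t. cdot (f (t *s e)) u)"
  have hol: "g holomorphic_on ball 0 1"
    unfolding g_def using cholo_on_slice[OF cholo_on_compose[OF f(1) cholo_on_cdot[of u UNIV]], of e] e by simp
  have bd: "norm (g t) < 1" if "norm t < 1" for t
  proof -
    have "t *s e \<in> \<bbbB>" using that e by (simp add: norm_vector_smult)
    then have "f (t *s e) \<in> \<bbbB>" using f(2) by blast
    then have "norm (f (t *s e)) < 1" by simp
    then show ?thesis unfolding g_def using norm_cdot_le[of "f (t *s e)" u] u by simp
  qed
  have "norm (g (of_real (norm z))) \<le> norm (of_real (norm z) :: complex)"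
    using z by (intro Schwarz_Lemma(1)[OF hol _ bd]) (auto simp: g_def f(3))
  moreover have "norm (g (of_real (norm z))) = norm (f z)"
    using False unfolding g_def \<open>of_real (norm z) *s e = z\<close>
    by (simp add: u_def cdot_scale_right cdot_self norm_mult norm_divide norm_power power2_eq_square)
  ultimately show ?thesis by simp
qed (use f(3) in auto)

text \<open>Conjugation with the involutions at \<open>z\<close> and \<open>f z\<close> moves both points to the origin.\<close>

lemma Schwarz_Pick_ball:
  assumes f: "holo_map_on f \<bbbB>" "f ` \<bbbB> \<subseteq> \<bbbB>" and z: "z \<in> \<bbbB>" and w: "w \<in> \<bbbB>"
  shows "norm (T (f z) (f w)) \<le> norm (T z w)"
proof -
  have fz: "f z \<in> \<bbbB>" using f z by blast
  have 1: "holo_map_on (\<lambda>t. f (T z t)) \<bbbB>"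
    using T_maps_ball[OF z] by (intro holo_map_on_compose[OF holo_map_on_T[OF z] f(1)]) blast
  have 2: "holo_map_on (\<lambda>t. T (f z) (f (T z t))) \<bbbB>"
    using T_maps_ball[OF z] f by (intro holo_map_on_compose[OF 1 holo_map_on_T[OF fz]]) blast
  have "norm (T (f z) (f (T z (T z w)))) \<le> norm (T z w)"
  proof (rule Schwarz_ball[OF 2])
    show "(\<lambda>t. T (f z) (f (T z t))) ` \<bbbB> \<subseteq> \<bbbB>"
      using f fz T_maps_ball[OF z] T_maps_ball[OF fz] by blast
  qed (use z w fz in \<open>auto simp: norm_T_less_one\<close>)
  then show ?thesis using z w by simp
qed

text \<open>The elements of \<open>Aut_ball\<close> without the requirement of being extensional: the involutions and the
  unitary maps are used as plain functions.\<close>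

definition ball_auto :: "(complex^'n \<Rightarrow> complex^'n) \<Rightarrow> bool"
  where "ball_auto g \<longleftrightarrow> holo_map_on g \<bbbB> \<and> bij_betw g \<bbbB> \<bbbB> \<and> holo_map_on (inv_into \<bbbB> g) \<bbbB>"

lemma ball_autoI:
  assumes g: "holo_map_on g \<bbbB>" "g ` \<bbbB> \<subseteq> \<bbbB>" and h: "holo_map_on h \<bbbB>" "h ` \<bbbB> \<subseteq> \<bbbB>"
    and hg: "\<And>z. z \<in> \<bbbB> \<Longrightarrow> h (g z) = z" and gh: "\<And>z. z \<in> \<bbbB> \<Longrightarrow> g (h z) = z"
  shows "ball_auto g"
proof -
  have bij: "bij_betw g \<bbbB> \<bbbB>"
    by (rule bij_betw_byWitness[where f'=h]) (use assms in auto)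
  have "inv_into \<bbbB> g z = h z" if "z \<in> \<bbbB>" for z
    by (rule inv_into_f_eq) (use bij h gh that in \<open>unfold bij_betw_def, blast+\<close>)
  moreover have "(inv_into \<bbbB> g has_derivative D) (at z)" if "z \<in> \<bbbB>" "(h has_derivative D) (at z)" for z D
    by (rule has_derivative_transform_within_open[OF that(2) open_ball that(1)]) (use calculation in auto)
  then have "holo_map_on (inv_into \<bbbB> g) \<bbbB>" using h(1) unfolding holo_map_on_def by meson
  then show ?thesis using g bij unfolding ball_auto_def by blast
qed

lemma ball_auto_T: assumes "a \<in> \<bbbB>" shows "ball_auto (T a)"
  using T_maps_ball[OF assms] assms
  by (intro ball_autoI[of _ "T a", OF holo_map_on_T[OF assms] _ holo_map_on_T[OF assms]]) simp_all

lemma ball_auto_in [simp]: "ball_auto g \<Longrightarrow> z \<in> \<bbbB> \<Longrightarrow> g z \<in> \<bbbB>"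
  unfolding ball_auto_def bij_betw_def by blast

lemma ball_auto_inv: assumes "ball_auto g" shows "ball_auto (inv_into \<bbbB> g)"
proof -
  have g: "holo_map_on g \<bbbB>" "holo_map_on (inv_into \<bbbB> g) \<bbbB>" and b: "bij_betw g \<bbbB> \<bbbB>"
    using assms unfolding ball_auto_def by blast+
  show ?thesis
    by (rule ball_autoI[OF g(2) _ g(1)])
      (use b in \<open>simp_all only: bij_betw_imp_surj_on[OF b] bij_betw_imp_surj_on[OF bij_betw_inv_into[OF b]]
        bij_betw_inv_into_left[OF b] bij_betw_inv_into_right[OF b] order_refl\<close>)
qed

lemma ball_auto_inv_left: "ball_auto g \<Longrightarrow> z \<in> \<bbbB> \<Longrightarrow> inv_into \<bbbB> g (g z) = z"
  unfolding ball_auto_def by (blast intro: bij_betw_inv_into_left)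

lemma ball_auto_inv_right: "ball_auto g \<Longrightarrow> z \<in> \<bbbB> \<Longrightarrow> g (inv_into \<bbbB> g z) = z"
  unfolding ball_auto_def by (blast intro: bij_betw_inv_into_right)

lemma ball_auto_image: "ball_auto g \<Longrightarrow> g ` \<bbbB> = \<bbbB>"
  by (simp only: ball_auto_def bij_betw_def)

lemma ball_auto_Schwarz_Pick:
  assumes g: "ball_auto g" and z: "z \<in> \<bbbB>" and w: "w \<in> \<bbbB>"
  shows "norm (T (g z) (g w)) \<le> norm (T z w)"
  by (rule Schwarz_Pick_ball[OF _ _ z w])
    (use g in \<open>simp_all only: ball_auto_image order_refl\<close>, simp only: ball_auto_def)

text \<open>The Schwarz-Pick inequality for the map and for its inverse.\<close>

lemma ball_auto_norm_T:
  assumes g: "ball_auto g" and z: "z \<in> \<bbbB>" and w: "w \<in> \<bbbB>"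
  shows "norm (T (g z) (g w)) = norm (T z w)"
proof (rule antisym)
  show "norm (T (g z) (g w)) \<le> norm (T z w)"
    by (rule ball_auto_Schwarz_Pick[OF g z w])
  show "norm (T z w) \<le> norm (T (g z) (g w))"
    using ball_auto_Schwarz_Pick[OF ball_auto_inv[OF g] ball_auto_in[OF g z] ball_auto_in[OF g w]]
    by (simp only: ball_auto_inv_left[OF g] z w)
qed

lemma ball_auto_T_fixes_norm:
  assumes g: "ball_auto g" and z: "z \<in> \<bbbB>" and w: "w \<in> \<bbbB>"
  shows "norm (T (g z) (g (T z w))) = norm w"
  using ball_auto_norm_T[OF g z, of "T z w"] z w by (simp add: norm_T_less_one)

section \<open>Jacobians of maps between Euclidean spaces\<close>

text \<open>Determinants belong to square matrices, and the change of variables formula to \<open>real^'n\<close> with a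
  well-ordered index type.  The basis of an arbitrary Euclidean space is therefore indexed by a type
  that copies an initial segment of the natural numbers.\<close>

typedef (overloaded) ('a::euclidean_space) basis_index = "{..<DIM('a)}"
  by (auto intro!: exI[of _ 0])

instantiation basis_index :: (euclidean_space) wellorder
begin
definition less_eq_basis_index :: "'a basis_index \<Rightarrow> 'a basis_index \<Rightarrow> bool"
  where "less_eq_basis_index x y \<longleftrightarrow> Rep_basis_index x \<le> Rep_basis_index y"
definition less_basis_index :: "'a basis_index \<Rightarrow> 'a basis_index \<Rightarrow> bool"
  where "less_basis_index x y \<longleftrightarrow> Rep_basis_index x < Rep_basis_index y"
instance
proof
  fix P :: "'a basis_index \<Rightarrow> bool" and x :: "'a basis_index"
  assume step: "\<And>x. (\<And>y. y < x \<Longrightarrow> P y) \<Longrightarrow> P x"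
  show "P x"
    by (induction "Rep_basis_index x" arbitrary: x rule: less_induct) (rule step, simp add: less_basis_index_def)
qed (auto simp: less_eq_basis_index_def less_basis_index_def Rep_basis_index_inject)
end

instance basis_index :: (euclidean_space) finite
proof
  show "finite (UNIV :: 'a basis_index set)"
    unfolding type_definition.univ[OF type_definition_basis_index] by simp
qed

lemma CARD_basis_index: "CARD('a::euclidean_space basis_index) = DIM('a)"
  unfolding type_definition.card[OF type_definition_basis_index] by simp

definition basis_of :: "'a::euclidean_space basis_index \<Rightarrow> 'a"
  where "basis_of = (SOME f. bij_betw f UNIV Basis)"

lemma bij_basis_of: "bij_betw (basis_of :: 'a::euclidean_space basis_index \<Rightarrow> 'a) UNIV Basis"
proof -
  have "\<exists>f. bij_betw f (UNIV :: 'a basis_index set) (Basis :: 'a set)"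
    by (rule finite_same_card_bij) (simp_all add: CARD_basis_index)
  then show ?thesis unfolding basis_of_def by (rule someI_ex)
qed

definition to_cart :: "'a::euclidean_space \<Rightarrow> real^('a basis_index)"
  where "to_cart x = (\<chi> k. inner x (basis_of k))"

definition of_cart :: "real^('a basis_index) \<Rightarrow> 'a::euclidean_space"
  where "of_cart v = (\<Sum>k\<in>UNIV. v $ k *\<^sub>R basis_of k)"

lemma sum_Basis_basis_of: "(\<Sum>k\<in>UNIV. f (basis_of k)) = (\<Sum>b\<in>Basis. f b)"
  by (rule sum.reindex_bij_betw[OF bij_basis_of])

lemma of_to_cart [simp]: "of_cart (to_cart x) = x"
  unfolding of_cart_def to_cart_def
  by (simp add: sum_Basis_basis_of[of "\<lambda>b. inner x b *\<^sub>R b"] euclidean_representation)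

lemma basis_of_in [simp]: "basis_of k \<in> Basis"
  using bij_basis_of by (auto simp: bij_betw_def)

lemma inner_basis_of: "inner (basis_of i) (basis_of j) = (if i = j then 1 else 0)"
  using bij_basis_of by (auto simp: inner_Basis bij_betw_def inj_on_def)

lemma to_of_cart [simp]: "to_cart (of_cart v) = v"
  by (simp add: to_cart_def of_cart_def inner_sum_left inner_basis_of vec_eq_iff sum.delta
      if_distrib[of "\<lambda>x. _ * x"] cong: if_cong)

lemma linear_to_cart: "linear to_cart"
  by (rule linearI) (simp_all add: to_cart_def vec_eq_iff inner_add_left)

lemma linear_of_cart: "linear of_cart"
  by (rule linearI) (simp_all add: of_cart_def algebra_simps sum.distrib scaleR_sum_right)

lemma inner_to_cart: "inner (to_cart x) (to_cart y) = inner x y"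
  by (simp add: inner_vec_def to_cart_def sum_Basis_basis_of[of "\<lambda>b. inner x b * inner y b"]
      euclidean_inner[of x y])

lemma norm_to_cart [simp]: "norm (to_cart x) = norm x"
  by (simp add: norm_eq_sqrt_inner inner_to_cart)

lemma norm_of_cart [simp]: "norm (of_cart x) = norm x"
  by (metis norm_to_cart to_of_cart)

lemma borel_measurable_of_cart [measurable]: "of_cart \<in> borel_measurable borel"
  by (intro borel_measurable_continuous_onI linear_continuous_on linear_conv_bounded_linear[THEN iffD1] linear_of_cart)

text \<open>The coordinate map sends boxes to boxes with the same side lengths.\<close>

lemma distr_of_cart: "distr lborel borel (of_cart :: _ \<Rightarrow> 'a::euclidean_space) = lborel"
proof (rule lborel_eqI[symmetric])
  fix l u :: 'a assume le: "\<And>b. b \<in> Basis \<Longrightarrow> l \<bullet> b \<le> u \<bullet> b"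
  have "of_cart -` box l u = box (to_cart l) (to_cart u)"
  proof -
    have "inner (of_cart v) (basis_of k) = v $ k" for v and k :: "'a basis_index"
      using arg_cong[OF to_of_cart[of v], of "\<lambda>x. x $ k"] by (simp add: to_cart_def del: to_of_cart)
    then have "of_cart v \<in> box l u \<longleftrightarrow> (\<forall>k. l \<bullet> basis_of k < v $ k \<and> v $ k < u \<bullet> basis_of k)" for v
      using bij_basis_of[where 'a='a] unfolding box_def bij_betw_def by (auto simp: image_iff) (metis UNIV_I imageI image_iff)+
    then show ?thesis by (auto simp: mem_box_cart to_cart_def)
  qed
  then have "emeasure (distr lborel borel of_cart) (box l u) = emeasure lborel (box (to_cart l) (to_cart u))"
    by (simp add: emeasure_distr)
  also have "\<dots> = (\<Prod>b\<in>Basis. (to_cart u - to_cart l) \<bullet> b)"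
    by (rule emeasure_lborel_box) (auto simp: Basis_vec_def inner_axis to_cart_def intro!: le)
  also have "(\<Prod>b\<in>Basis. (to_cart u - to_cart l) \<bullet> b) = (\<Prod>k\<in>(UNIV::'a basis_index set). (u - l) \<bullet> basis_of k)"
  proof -
    have "(\<Prod>b\<in>Basis. (to_cart u - to_cart l) \<bullet> b) = (\<Prod>k\<in>(UNIV::'a basis_index set). (to_cart u - to_cart l) \<bullet> axis k 1)"
      by (rule prod.reindex_cong[where l="\<lambda>k. axis k 1"]) (auto simp: inj_on_def axis_eq_axis Basis_vec_def)
    then show ?thesis by (simp add: inner_axis to_cart_def inner_diff_left)
  qed
  also have "(\<Prod>k\<in>(UNIV::'a basis_index set). (u - l) \<bullet> basis_of k) = (\<Prod>b\<in>Basis. (u - l) \<bullet> b)"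
    by (rule prod.reindex_bij_betw[OF bij_basis_of])
  finally show "emeasure (distr lborel borel of_cart) (box l u) = (\<Prod>b\<in>Basis. (u - l) \<bullet> b)" .
qed simp

text \<open>The absolute value makes the choice of the order of the basis irrelevant.\<close>

definition abs_jac :: "('a::euclidean_space \<Rightarrow> 'a) \<Rightarrow> real"
  where "abs_jac L = \<bar>det (matrix (\<lambda>v. to_cart (L (of_cart v))))\<bar>"

lemma linear_conj_cart: "linear L \<Longrightarrow> linear (\<lambda>v. to_cart (L (of_cart v)))"
  using linear_compose[OF linear_compose[OF linear_of_cart] linear_to_cart] by (simp add: o_def)

lemma abs_jac_compose:
  assumes "linear L" "linear M"
  shows "abs_jac (\<lambda>x. L (M x)) = abs_jac L * abs_jac M"
proof -
  have "matrix (\<lambda>v. to_cart (L (M (of_cart v)))) =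
      matrix (\<lambda>v. to_cart (L (of_cart v))) ** matrix (\<lambda>v. to_cart (M (of_cart v)))"
    using matrix_compose[OF linear_conj_cart[OF assms(2)] linear_conj_cart[OF assms(1)]] by (simp add: o_def)
  then show ?thesis by (simp add: abs_jac_def det_mul abs_mult)
qed

lemma abs_jac_isometry:
  assumes "linear L" "\<And>x. norm (L x) = norm x"
  shows "abs_jac L = 1"
proof -
  have "orthogonal_transformation (\<lambda>v. to_cart (L (of_cart v)))"
    by (simp add: orthogonal_transformation linear_conj_cart assms)
  then show ?thesis
    using det_orthogonal_matrix[of "matrix (\<lambda>v. to_cart (L (of_cart v)))"]
    by (auto simp: abs_jac_def orthogonal_transformation_matrix)
qed

lemma abs_jac_id: "abs_jac (\<lambda>x. x) = 1"
  by (rule abs_jac_isometry) (auto intro: linear_id[unfolded id_def])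

lemma abs_jac_scale: "abs_jac (\<lambda>x::'a::euclidean_space. c *\<^sub>R x) = \<bar>c\<bar> ^ DIM('a)"
proof -
  have "matrix (\<lambda>v::real^'a basis_index. to_cart (c *\<^sub>R of_cart v)) = (\<chi> i j. if i = j then c else 0)"
    by (simp add: linear_scale[OF linear_to_cart] matrix_def axis_def vec_eq_iff)
  then show ?thesis
    by (simp add: abs_jac_def det_diagonal CARD_basis_index abs_prod flip: power_abs)
qed

lemma sum_delta_mult:
  fixes f :: "'n::finite \<Rightarrow> 'a::semiring_1"
  shows "(\<Sum>k\<in>UNIV. (if i = k then 1 else 0) * f k) = f i" "(\<Sum>k\<in>UNIV. (if k = i then 1 else 0) * f k) = f i"
    "(\<Sum>k\<in>UNIV. f k * (if i = k then 1 else 0)) = f i" "(\<Sum>k\<in>UNIV. f k * (if k = i then 1 else 0)) = f i"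
  by (simp_all add: if_distrib[of "\<lambda>x. x * _"] if_distrib[of "\<lambda>x. _ * x"] sum.delta sum.delta' cong: if_cong)

text \<open>Let \<open>M = 1 + u v\<^sup>T\<close> and let \<open>S\<close> be the identity matrix with its \<open>k\<close>-th column replaced by \<open>u\<close>, where
  \<open>u\<^sub>k \<noteq> 0\<close>.  Then \<open>M S = S R\<^sup>T\<close> with a matrix \<open>R\<^sup>T\<close> that differs from the identity only in its \<open>k\<close>-th row,
  so all determinants other than that of \<open>M\<close> are instances of Cramer's rule.\<close>

lemma det_rank_one_update:
  fixes u v :: "'a::field^'n"
  shows "det (\<chi> i j. (if i = j then 1 else 0) + u $ i * v $ j) = 1 + (\<Sum>i\<in>UNIV. u $ i * v $ i)"
proof (cases "u = 0")
  case True
  have "(\<chi> i j. if i = j then 1 else 0) = (mat 1 :: 'a^'n^'n)" by (simp add: mat_def)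
  then show ?thesis using True by simp
next
  case False
  then obtain k where k: "u $ k \<noteq> 0" by (auto simp: vec_eq_iff)
  define S :: "'a^'n^'n" where "S = (\<chi> i j. if j = k then (mat 1 *v u) $ i else mat 1 $ i $ j)"
  define M where "M = (\<chi> i j. (if i = j then 1 else 0) + u $ i * v $ j)"
  define w where "w = (\<chi> j. \<Sum>i\<in>UNIV. v $ i * S $ i $ j)"
  define R :: "'a^'n^'n" where "R = (\<chi> i j. if j = k then (mat 1 *v (axis k 1 + w)) $ i else mat 1 $ i $ j)"
  have dS: "det S = u $ k" unfolding S_def cramer_lemma by simp
  have dR: "det (transpose R) = 1 + w $ k" unfolding R_def det_transpose cramer_lemma by (simp add: axis_def)
  have "(M ** S) $ i $ j = (S ** transpose R) $ i $ j" for i j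
  proof -
    have "(M ** S) $ i $ j = S $ i $ j + u $ i * w $ j"
      by (simp add: matrix_matrix_mult_def M_def w_def distrib_right sum.distrib sum_distrib_left mult.assoc sum_delta_mult)
    moreover have "transpose R $ l $ j = (if l = j then 1 else 0) + (if l = k then w $ j else 0)" for l
      by (simp add: transpose_def R_def) (auto simp: mat_def axis_def)
    then have "(S ** transpose R) $ i $ j = S $ i $ j + S $ i $ k * w $ j"
      using sum_delta_mult(4)[of "\<lambda>l. S $ i $ l * w $ j" k]
      by (simp add: matrix_matrix_mult_def distrib_left sum.distrib sum_delta_mult mult.commute mult.left_commute
          if_distrib[of "\<lambda>x. _ * x"] sum.delta cong: if_cong)
    moreover have "S $ i $ k = u $ i" by (simp add: S_def)
    ultimately show ?thesis by simp
  qed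
  then have "det M * det S = det S * det (transpose R)"
    by (metis det_mul vec_eq_iff)
  then have "det M = 1 + w $ k" using k by (simp add: dS dR[unfolded det_transpose])
  also have "w $ k = (\<Sum>i\<in>UNIV. u $ i * v $ i)" by (simp add: w_def S_def mult.commute)
  finally show ?thesis by (simp add: M_def)
qed

lemma abs_jac_rank_one: "abs_jac (\<lambda>x. x + (x \<bullet> v) *\<^sub>R u) = \<bar>1 + u \<bullet> v\<bar>"
proof -
  have "inner (of_cart x) v = inner x (to_cart v)" for x
    using inner_to_cart[of "of_cart x" v] by simp
  then have "(\<lambda>x. to_cart (of_cart x + (of_cart x \<bullet> v) *\<^sub>R u)) = (\<lambda>x. x + (x \<bullet> to_cart v) *\<^sub>R to_cart u)"
    by (simp add: linear_add[OF linear_to_cart] linear_scale[OF linear_to_cart] fun_eq_iff)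
  then have "matrix (\<lambda>x. to_cart (of_cart x + (of_cart x \<bullet> v) *\<^sub>R u))
     = (\<chi> i j. (if i = j then 1 else 0) + to_cart u $ i * to_cart v $ j)"
    by (simp add: matrix_def vec_eq_iff inner_axis' mult.commute) (simp add: axis_def)
  then show ?thesis
    using inner_to_cart[of u v] by (simp add: abs_jac_def det_rank_one_update inner_vec_def)
qed

text \<open>Change of variables for sets of finite measure, carried over from \<open>real^'n\<close> with the coordinate
  map, which preserves Lebesgue measure.\<close>

lemma emeasure_differentiable_image:
  fixes g :: "'a::euclidean_space \<Rightarrow> 'a"
  assumes S: "S \<in> sets borel" and gS: "g ` S \<in> sets borel" and fin: "emeasure lborel (g ` S) < \<infinity>"
    and der: "\<And>x. x \<in> S \<Longrightarrow> (g has_derivative g' x) (at x)" and inj: "inj_on g S"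
    and J: "\<And>x. x \<in> S \<Longrightarrow> abs_jac (g' x) = J x"
    and J_meas: "(\<lambda>x. ennreal (J x) * indicator S x) \<in> borel_measurable borel"
  shows "emeasure lborel (g ` S) = (\<integral>\<^sup>+x. ennreal (J x) * indicator S x \<partial>lborel)"
proof -
  define S' where "S' = to_cart ` S"
  define h where "h = (\<lambda>v. to_cart (g (of_cart v)))"
  define h' where "h' = (\<lambda>v w. to_cart (g' (of_cart v) (of_cart w)))"
  have pre: "to_cart ` A = of_cart -` A" for A :: "'a set" by (auto simp: image_iff) (metis to_of_cart)
  have S': "S' \<in> sets borel" unfolding S'_def pre using measurable_sets_borel[OF borel_measurable_of_cart S] .
  have hS': "h ` S' = to_cart ` (g ` S)" by (simp add: h_def S'_def image_image)
  have em: "emeasure lborel (to_cart ` A) = emeasure lborel A" if "A \<in> sets borel" for A :: "'a set"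
    using arg_cong[OF distr_of_cart, of "\<lambda>M. emeasure M A"] that by (simp add: pre emeasure_distr)
  have hS'b: "h ` S' \<in> sets borel" unfolding hS' pre using measurable_sets_borel[OF borel_measurable_of_cart gS] .
  have "h ` S' \<in> lmeasurable"
    using em[OF gS] fin hS'b by (intro fmeasurableI) (auto simp: hS')
  have bl: "bounded_linear (to_cart :: 'a \<Rightarrow> _)" "bounded_linear (of_cart :: _ \<Rightarrow> 'a)"
    using linear_to_cart linear_of_cart linear_conv_bounded_linear by blast+
  have dh: "(h has_derivative h' v) (at v within S')" if v: "v \<in> S'" for v
  proof -
    have "(g has_derivative g' (of_cart v)) (at (of_cart v))" using v by (auto simp: S'_def intro: der)
    from has_derivative_compose[OF bounded_linear_imp_has_derivative[OF bl(2)] this]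
    have "((\<lambda>v. g (of_cart v)) has_derivative (\<lambda>w. g' (of_cart v) (of_cart w))) (at v within S')" .
    from bounded_linear.has_derivative[OF bl(1) this] show ?thesis unfolding h_def h'_def .
  qed
  have inj': "inj_on h S'"
    using inj by (auto simp: inj_on_def h_def S'_def) (metis of_to_cart)
  have "((\<lambda>v. \<bar>det (matrix (h' v))\<bar>) has_integral measure lebesgue (h ` S')) S'"
    using has_measure_differentiable_image[OF _ dh inj'] S' \<open>h ` S' \<in> lmeasurable\<close> by auto
  from nn_integral_has_integral_lebesgue[OF _ this]
  have "(\<integral>\<^sup>+v. ennreal (indicator S' v * \<bar>det (matrix (h' v))\<bar>) \<partial>lborel) = measure lebesgue (h ` S')"
    by simp
  also have "\<dots> = emeasure lborel (g ` S)"
  proof -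
    have "emeasure lborel (h ` S') = emeasure lborel (g ` S)" using em[OF gS] by (simp add: hS')
    moreover have "emeasure lborel (h ` S') = measure lebesgue (h ` S')"
      using em[OF gS] fin hS'b by (simp add: measure_completion measure_def ennreal_enn2real hS')
    ultimately show ?thesis by simp
  qed
  finally have "emeasure lborel (g ` S) = (\<integral>\<^sup>+v. ennreal (indicator S' v * \<bar>det (matrix (h' v))\<bar>) \<partial>lborel)"
    by simp
  also have "\<dots> = (\<integral>\<^sup>+v. ennreal (J (of_cart v)) * indicator S (of_cart v) \<partial>lborel)"
    by (rule nn_integral_cong) (auto simp: S'_def pre indicator_def h'_def abs_jac_def J[symmetric])
  also have "\<dots> = (\<integral>\<^sup>+x. ennreal (J x) * indicator S x \<partial>distr lborel borel of_cart)"
    using J_meas by (subst nn_integral_distr) simp_all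
  finally show ?thesis unfolding distr_of_cart .
qed

section \<open>The invariant volume of the ball\<close>

lemma ball_auto_norm_less [simp]: "ball_auto g \<Longrightarrow> norm z < 1 \<Longrightarrow> norm (g z) < 1"
  using ball_auto_in[of g z] by simp

text \<open>The derivative of \<open>T a\<close> at the origin.\<close>

definition T_deriv0 :: "complex^'n \<Rightarrow> complex^'n \<Rightarrow> complex^'n"
  where "T_deriv0 a h = - (sfun a *\<^sub>R (h - (cdot h a / (1 + of_real (sfun a))) *s a))"

text \<open>The derivative multiplies the complex direction of \<open>a\<close> by \<open>s\<^sup>2\<close> and the orthogonal complement by \<open>s\<close>, up
  to sign, where \<open>s\<^sup>2 = 1 - |a|\<^sup>2\<close>.  Over the reals this is a product of \<open>2 n + 2\<close> factors \<open>s\<close>: a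
  homothety followed by two rank one updates, one for \<open>a\<close> and one for \<open>\<i> a\<close>.\<close>

lemma abs_jac_T_deriv0:
  fixes a :: "complex^'n"
  assumes a: "norm a < 1"
  shows "abs_jac (T_deriv0 a) = (1 - (norm a)\<^sup>2) ^ (CARD('n) + 1)"
proof -
  define s where "s = sfun a"
  define k where "k = - (1 / (1 + s))"
  define b where "b = \<i> *s a"
  define R where "R = (\<lambda>(u :: complex^'n) x. x + (x \<bullet> u) *\<^sub>R (k *\<^sub>R u))"
  have s: "0 < s" "s\<^sup>2 = 1 - (norm a)\<^sup>2" using sfun_pos[OF a] sfun_sq[OF a] by (simp_all add: s_def)
  have lin: "linear (R u)" for u
    by (rule linearI) (simp_all add: R_def algebra_simps inner_add_left)
  have ab: "a \<bullet> b = 0" by (simp add: inner_eq_Re_cdot b_def cdot_scale_right cdot_self)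
  have nb: "norm b = norm a" by (simp add: b_def norm_vector_smult)
  have "1 + k * (norm a)\<^sup>2 = s"
  proof -
    have "(norm a)\<^sup>2 = (1 - s) * (1 + s)" using s by (simp add: algebra_simps power2_eq_square)
    then show ?thesis using s by (simp add: k_def)
  qed
  then have jR: "abs_jac (R u) = s" if "norm u = norm a" for u
    using abs_jac_rank_one[of u "k *\<^sub>R u"] s that
    by (simp add: R_def dot_square_norm)
  have "T_deriv0 a h = (- s) *\<^sub>R R a (R b h)" for h
  proof -
    have "R a (R b h) = h + (k * (h \<bullet> b)) *\<^sub>R b + (k * (h \<bullet> a)) *\<^sub>R a"
      using ab by (simp add: R_def inner_add_left inner_commute[of b a] mult.commute)
    also have "\<dots> = h - (cdot h a / (1 + of_real s)) *s a"
    proof -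
      have "h \<bullet> b = Im (cdot h a)" by (simp add: inner_eq_Re_cdot b_def cdot_scale_right)
      then have "(k * (h \<bullet> b)) *\<^sub>R b + (k * (h \<bullet> a)) *\<^sub>R a
         = (of_real k * (\<i> * of_real (Im (cdot h a)) + of_real (Re (cdot h a)))) *s a"
        by (simp add: b_def inner_eq_Re_cdot scaleR_vec_complex vec_eq_iff algebra_simps)
      also have "\<i> * of_real (Im (cdot h a)) + of_real (Re (cdot h a)) = cdot h a"
        by (metis add.commute complex_eq)
      finally show ?thesis by (simp add: k_def add.assoc)
    qed
    finally show ?thesis by (simp add: T_deriv0_def s_def)
  qed
  then have "T_deriv0 a = (\<lambda>h. (- s) *\<^sub>R R a (R b h))" by (rule ext)
  then have "abs_jac (T_deriv0 a) = abs_jac (\<lambda>h. (- s) *\<^sub>R R a (R b h))" by (rule arg_cong)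
  also have "\<dots> = \<bar>- s\<bar> ^ DIM(complex^'n) * (s * s)"
  proof -
    have "linear (\<lambda>x :: complex^'n. (- s) *\<^sub>R x)" by (rule linearI) (simp_all add: algebra_simps)
    moreover have "linear (\<lambda>h. R a (R b h))" using linear_compose[OF lin[of b] lin[of a]] by (simp only: o_def)
    ultimately have "abs_jac (\<lambda>h. (- s) *\<^sub>R R a (R b h)) = abs_jac (\<lambda>x :: complex^'n. (- s) *\<^sub>R x) * abs_jac (\<lambda>h. R a (R b h))"
      by (rule abs_jac_compose)
    also have "abs_jac (\<lambda>h. R a (R b h)) = s * s"
      unfolding abs_jac_compose[OF lin[of a] lin[of b]] by (simp only: jR nb)
    finally show ?thesis by (simp only: abs_jac_scale)
  qed
  also have "\<dots> = (s\<^sup>2) ^ (CARD('n) + 1)"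
    using s by (simp add: power_mult[symmetric] power_add[symmetric] power2_eq_square mult.commute)
       (simp add: power_mult mult_2_right power_add power_mult_distrib[symmetric])
  finally show ?thesis by (simp add: s)
qed

lemma T_has_derivative0: "norm a < 1 \<Longrightarrow> (T a has_derivative T_deriv0 a) (at 0)"
  using T_has_derivative_zero[of a] by (simp add: T_deriv0_def[abs_def])

text \<open>Along a ray the difference quotients have constant norm.\<close>

lemma derivative_norm_preserving:
  fixes f :: "'a::real_normed_vector \<Rightarrow> 'b::real_normed_vector"
  assumes D: "(f has_derivative D) (at 0)" and f0: "f 0 = 0" and r: "0 < r"
    and nf: "\<And>x. norm x < r \<Longrightarrow> norm (f x) = norm x"
  shows "norm (D v) = norm v"
proof (cases "v = 0")
  case True
  then show ?thesis using has_derivative_linear[OF D] by (simp add: linear_0)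
next
  case False
  have "\<bar>norm v - norm (D v)\<bar> \<le> e * norm v" if "e > 0" for e
  proof -
    from D that have "\<exists>d>0. \<forall>y. norm (y - 0) < d \<longrightarrow> norm (f y - f 0 - D (y - 0)) \<le> e * norm (y - 0)"
      unfolding has_derivative_at_alt by blast
    then obtain d where d: "d > 0" "\<And>y. norm y < d \<Longrightarrow> norm (f y - D y) \<le> e * norm y"
      unfolding f0 diff_zero by blast
    define t where "t = min d r / (2 * norm v)"
    have t: "t > 0" using d(1) r False by (simp add: t_def)
    have nt: "norm (t *\<^sub>R v) < d" "norm (t *\<^sub>R v) < r"
      using d(1) r False by (auto simp: t_def min_def)
    have "D (t *\<^sub>R v) = t *\<^sub>R D v" using has_derivative_linear[OF D] by (simp add: linear_scale)
    then have "\<bar>norm (t *\<^sub>R v) - norm (t *\<^sub>R D v)\<bar> \<le> e * norm (t *\<^sub>R v)"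
      using order_trans[OF norm_triangle_ineq3 d(2)[OF nt(1)]] by (simp only: nf[OF nt(2)])
    moreover have "norm (t *\<^sub>R v) - norm (t *\<^sub>R D v) = t * (norm v - norm (D v))"
      using t by (simp add: right_diff_distrib)
    ultimately have "t * \<bar>norm v - norm (D v)\<bar> \<le> t * (e * norm v)"
      using t by (simp add: abs_mult mult.left_commute)
    then show ?thesis using t by (rule mult_left_le_imp_le)
  qed
  note * = this
  have "\<bar>norm v - norm (D v)\<bar> \<le> 0 + e" if "e > 0" for e
    using *[of "e / norm v"] that False by simp
  then have "\<bar>norm v - norm (D v)\<bar> \<le> 0" by (rule field_le_epsilon)
  then show ?thesis by simp
qed

text \<open>With \<open>b = g z\<close> the map \<open>T\<^sub>b \<circ> g \<circ> T\<^sub>z\<close> fixes the origin and preserves the norm, so its derivative there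
  is an isometry.  The Jacobian of \<open>g\<close> at \<open>z\<close> is therefore the quotient of those of \<open>T\<^sub>b\<close> and \<open>T\<^sub>z\<close> at
  the origin.\<close>

lemma ball_auto_jacobian:
  fixes g :: "complex^'n \<Rightarrow> complex^'n"
  assumes g: "ball_auto g" and z: "z \<in> \<bbbB>" and D: "(g has_derivative D) (at z)"
  shows "abs_jac D = ((1 - (norm (g z))\<^sup>2) / (1 - (norm z)\<^sup>2)) ^ (CARD('n) + 1)"
proof -
  define b where "b = g z"
  have b: "b \<in> \<bbbB>" using g z by (simp add: b_def)
  then have nb: "norm b < 1" and nz: "norm z < 1" using z by simp_all
  obtain B where B: "(T b has_derivative B) (at b)"
    using holo_map_on_T[OF b] b unfolding holo_map_on_def by blast
  have lin: "linear B" "linear D" "linear (T_deriv0 z)" "linear (T_deriv0 b)"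
    using has_derivative_linear B D T_has_derivative0 nb nz by blast+
  have "((\<lambda>t. g (T z t)) has_derivative (\<lambda>h. D (T_deriv0 z h))) (at 0)"
    by (rule has_derivative_compose[OF T_has_derivative0[OF nz]]) (use nz D in simp)
  then have "((\<lambda>t. T b (g (T z t))) has_derivative (\<lambda>h. B (D (T_deriv0 z h)))) (at 0)"
    by (rule has_derivative_compose) (use nz B in \<open>simp add: b_def\<close>)
  then have "norm (B (D (T_deriv0 z h))) = norm h" for h
  proof (rule derivative_norm_preserving)
    show "T b (g (T z 0)) = 0" using nz nb by (simp add: b_def)
    show "norm (T b (g (T z x))) = norm x" if "norm x < 1" for x
      unfolding b_def by (rule ball_auto_T_fixes_norm[OF g z]) (use that in simp)
  qed simp
  moreover have lin2: "linear (\<lambda>h. D (T_deriv0 z h))" using linear_compose[OF lin(3,2)] by (simp add: o_def)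
  ultimately have "abs_jac (\<lambda>h. B (D (T_deriv0 z h))) = 1"
    using linear_compose[OF lin2 lin(1)] by (intro abs_jac_isometry) (simp_all add: o_def)
  then have 1: "abs_jac B * (abs_jac D * abs_jac (T_deriv0 z)) = 1"
    by (simp add: abs_jac_compose[OF lin(1) lin2] abs_jac_compose[OF lin(2,3)])
  have "((\<lambda>t. T b (T b t)) has_derivative (\<lambda>h. B (T_deriv0 b h))) (at 0)"
    by (rule has_derivative_compose[OF T_has_derivative0[OF nb]]) (use nb B in simp)
  then have "((\<lambda>t. t) has_derivative (\<lambda>h. B (T_deriv0 b h))) (at 0)"
    by (rule has_derivative_transform_within_open[OF _ open_ball[of 0 1]]) (use nb in auto)
  then have "(\<lambda>h. B (T_deriv0 b h)) = (\<lambda>h. h)"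
    using has_derivative_unique has_derivative_ident by blast
  then have 2: "abs_jac B * abs_jac (T_deriv0 b) = 1"
    using abs_jac_compose[OF lin(1,4)] by (simp add: abs_jac_id)
  have "abs_jac B * abs_jac (T_deriv0 b) = abs_jac B * (abs_jac D * abs_jac (T_deriv0 z))" using 1 2 by simp
  then have "abs_jac (T_deriv0 b) = abs_jac D * abs_jac (T_deriv0 z)" using 2 by (metis mult_cancel_left mult_zero_left zero_neq_one)
  moreover have "(1 - (norm z)\<^sup>2) > 0" using nz by (simp add: abs_square_less_1)
  ultimately show ?thesis
    unfolding abs_jac_T_deriv0[OF nb] abs_jac_T_deriv0[OF nz] by (simp add: b_def power_divide field_simps)
qed

definition hyp_volume :: "(complex^'n) measure"
  where "hyp_volume = density (restrict_space lborel \<bbbB>)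
    (\<lambda>z. ennreal (2 ^ CARD('n) / (1 - (norm z)\<^sup>2) ^ (CARD('n) + 1)))"

lemma space_hyp_volume [simp]: "space hyp_volume = \<bbbB>"
  by (simp add: hyp_volume_def space_restrict_space)

lemma sets_hyp_volume: "sets hyp_volume = sets (restrict_space borel \<bbbB>)"
  by (simp add: hyp_volume_def) (rule sets_restrict_space_cong, simp)

lemma in_sets_hyp_volume: "A \<in> sets hyp_volume \<longleftrightarrow> A \<in> sets borel \<and> A \<subseteq> \<bbbB>"
  by (subst sets_hyp_volume, subst sets_restrict_space_iff) auto

lemma measurable_hyp_volume_cong: "measurable hyp_volume N = measurable (restrict_space borel \<bbbB>) N"
  by (rule measurable_cong_sets[OF sets_hyp_volume refl])

lemma ball_auto_measurable_borel:
  assumes "ball_auto g" shows "g \<in> measurable (restrict_space borel \<bbbB>) (restrict_space borel \<bbbB>)"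
proof (rule measurable_restrict_space2)
  show "g \<in> space (restrict_space borel \<bbbB>) \<rightarrow> \<bbbB>" using assms by (auto simp: space_restrict_space)
  show "g \<in> borel_measurable (restrict_space borel \<bbbB>)"
    by (rule borel_measurable_continuous_on_restrict, rule holo_map_on_imp_continuous_on)
      (use assms in \<open>simp add: ball_auto_def\<close>)
qed

lemma ball_auto_measurable: "ball_auto g \<Longrightarrow> g \<in> measurable hyp_volume hyp_volume"
  using ball_auto_measurable_borel[of g]
  by (simp cong: measurable_cong_sets add: measurable_cong_sets[OF sets_hyp_volume sets_hyp_volume])

text \<open>The Jacobian of an automorphism is the density at the point divided by the density at the image.\<close>

lemma hyp_volume_invariant:
  fixes g :: "complex^'n \<Rightarrow> complex^'n"
  assumes g: "ball_auto g"
  shows "distr hyp_volume hyp_volume g = hyp_volume"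
proof -
  let ?L = "restrict_space lborel \<bbbB> :: (complex^'n) measure"
  define J where "J = (\<lambda>z. ((1 - (norm (g z))\<^sup>2) / (1 - (norm z)\<^sup>2)) ^ (CARD('n) + 1))"
  define h where "h = (\<lambda>z :: complex^'n. 2 ^ CARD('n) / (1 - (norm z)\<^sup>2) ^ (CARD('n) + 1))"
  have setsL: "sets ?L = sets (restrict_space borel \<bbbB>)" by (rule sets_restrict_space_cong) simp
  have spL: "space ?L = \<bbbB>" by (simp add: space_restrict_space)
  have gL[measurable]: "g \<in> measurable ?L ?L"
    using ball_auto_measurable_borel[OF g] by (simp add: measurable_cong_sets[OF setsL setsL])
  have gb[measurable]: "g \<in> borel_measurable ?L"
    using gL measurable_restrict_space2_iff[of g ?L lborel] by (simp add: measurable_lborel2)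
  have idL[measurable]: "(\<lambda>x. x) \<in> borel_measurable ?L"
    by (rule measurable_restrict_space1) simp
  have JL[measurable]: "J \<in> borel_measurable ?L" unfolding J_def by measurable
  have hL[measurable]: "h \<in> borel_measurable ?L" unfolding h_def by measurable
  have pos: "1 - (norm z)\<^sup>2 > 0" if "z \<in> \<bbbB>" for z :: "complex^'n"
    using that by (simp add: abs_square_less_1)
  have hJ: "ennreal (J z) * ennreal (h (g z)) = ennreal (h z)" if z: "z \<in> \<bbbB>" for z
    using pos[OF z] pos[OF ball_auto_in[OF g z]]
    by (simp add: J_def h_def ennreal_mult[symmetric] field_simps power_divide del: power_Suc)
  have inL: "A \<in> sets ?L \<longleftrightarrow> A \<in> sets borel \<and> A \<subseteq> \<bbbB>" for A
    by (subst sets_restrict_space_iff) auto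
  define N where "N = density ?L (\<lambda>z. ennreal (J z))"
  have N: "distr N ?L g = ?L"
  proof (rule measure_eqI)
    fix E assume "E \<in> sets (distr N ?L g)"
    then have E: "E \<in> sets ?L" by simp
    define S where "S = g -` E \<inter> \<bbbB>"
    have S: "S \<in> sets ?L" using measurable_sets[OF gL E] by (simp add: S_def spL)
    have gS: "g ` S = E"
    proof
      show "E \<subseteq> g ` S"
      proof
        fix x assume x: "x \<in> E"
        then have "x \<in> g ` \<bbbB>" using E unfolding inL ball_auto_image[OF g] by blast
        then obtain y where "y \<in> \<bbbB>" "x = g y" by blast
        then show "x \<in> g ` S" using x unfolding S_def by blast
      qed
    qed (auto simp: S_def)
    have "emeasure lborel (\<bbbB> :: (complex^'n) set) < \<infinity>" by (rule emeasure_lborel_ball_finite)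
    then have fin: "emeasure lborel E < \<infinity>"
      using E emeasure_mono[of E \<bbbB> lborel] unfolding inL by (simp add: order_le_less_trans)
    have der: "\<exists>D. \<forall>x\<in>S. (g has_derivative D x) (at x)"
      using g unfolding ball_auto_def holo_map_on_def S_def by (intro bchoice) blast
    then obtain D where D: "\<And>x. x \<in> S \<Longrightarrow> (g has_derivative D x) (at x)" by blast
    have "emeasure lborel (g ` S) = (\<integral>\<^sup>+x. ennreal (J x) * indicator S x \<partial>lborel)"
    proof (rule emeasure_differentiable_image)
      show "inj_on g S" using g unfolding ball_auto_def bij_betw_def S_def by (meson inf_le2 inj_on_subset)
      show "abs_jac (D x) = J x" if "x \<in> S" for x
        unfolding J_def by (rule ball_auto_jacobian[OF g _ D[OF that]]) (use that in \<open>simp add: S_def\<close>)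
      have "(\<lambda>x. ennreal (J x) * indicator S x) \<in> borel_measurable ?L" using S by measurable
      then have "(\<lambda>x. ennreal (J x) * indicator S x * indicator \<bbbB> x) \<in> borel_measurable lborel"
        by (subst (asm) borel_measurable_restrict_space_iff_ennreal) auto
      moreover have "ennreal (J x) * indicator S x * indicator \<bbbB> x = ennreal (J x) * indicator S x" for x
        by (auto simp: S_def indicator_def)
      ultimately show "(\<lambda>x. ennreal (J x) * indicator S x) \<in> borel_measurable borel" by simp
    qed (use D S E fin in \<open>auto simp: gS inL\<close>)
    also have "\<dots> = emeasure N S"
    proof -
      have "emeasure N S = (\<integral>\<^sup>+x. ennreal (J x) * indicator S x \<partial>?L)"
        unfolding N_def by (rule emeasure_density) (use S in measurable)
      also have "\<dots> = (\<integral>\<^sup>+x. ennreal (J x) * indicator S x * indicator \<bbbB> x \<partial>lborel)"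
        by (rule nn_integral_restrict_space) simp
      also have "\<dots> = (\<integral>\<^sup>+x. ennreal (J x) * indicator S x \<partial>lborel)"
        by (rule nn_integral_cong) (auto simp: S_def indicator_def)
      finally show ?thesis by simp
    qed
    finally have "emeasure N S = emeasure lborel E" by (simp add: gS)
    moreover have "emeasure (distr N ?L g) E = emeasure N S"
      by (subst emeasure_distr) (use E gL in \<open>simp_all add: N_def S_def spL\<close>)
    moreover have "emeasure ?L E = emeasure lborel E"
      using E unfolding inL by (intro emeasure_restrict_space) auto
    ultimately show "emeasure (distr N ?L g) E = emeasure ?L E" by simp
  qed simp
  have "hyp_volume = density N (\<lambda>z. ennreal (h (g z)))"
  proof -
    have "density N (\<lambda>z. ennreal (h (g z))) = density ?L (\<lambda>z. ennreal (J z) * ennreal (h (g z)))"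
      unfolding N_def by (rule density_density_eq) measurable
    also have "\<dots> = density ?L (\<lambda>z. ennreal (h z))"
    proof (rule density_cong)
      show "AE x in ?L. ennreal (J x) * ennreal (h (g x)) = ennreal (h x)"
        using hJ by (intro AE_I2) (simp add: spL)
    qed measurable
    finally show ?thesis by (simp add: hyp_volume_def h_def)
  qed
  then have "distr hyp_volume ?L g = distr (density N (\<lambda>z. ennreal (h (g z)))) ?L g" by simp
  also have "\<dots> = density (distr N ?L g) (\<lambda>z. ennreal (h z))"
    by (rule density_distr[symmetric]) (simp_all add: N_def)
  also have "\<dots> = hyp_volume" unfolding N by (simp add: hyp_volume_def h_def)
  finally have "distr hyp_volume ?L g = hyp_volume" .
  moreover have "distr hyp_volume hyp_volume g = distr hyp_volume ?L g"
    by (rule distr_cong) (simp_all add: hyp_volume_def)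
  ultimately show ?thesis by simp
qed

lemma nn_integral_hyp_invariant:
  assumes g: "ball_auto g" and u: "u \<in> borel_measurable hyp_volume"
  shows "(\<integral>\<^sup>+w. u (g w) \<partial>hyp_volume) = (\<integral>\<^sup>+w. u w \<partial>hyp_volume)"
  using nn_integral_distr[OF ball_auto_measurable[OF g], of u] u by (simp add: hyp_volume_invariant[OF g])

section \<open>Volumes of the Kaehler forms\<close>

lemma one_minus_norm_sq_pos: "norm (z :: 'a::real_normed_vector) < 1 \<Longrightarrow> 0 < 1 - (norm z)\<^sup>2"
  by (simp add: abs_square_less_1)

lemma bergman_potential_eq:
  fixes z :: "complex^'n"
  assumes z: "norm z < 1"
  shows "bergman_potential z = - ln (1 - (norm z)\<^sup>2)"
proof -
  define N where "N = real CARD('n) + 1"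
  have N: "N > 0" by (simp add: N_def)
  have p: "0 < 1 - (norm z)\<^sup>2" using z by (rule one_minus_norm_sq_pos)
  have "bergman_kernel z z = of_real (1 / (1 - (norm z)\<^sup>2) ^ (CARD('n) + 1))"
    by (simp add: bergman_kernel_def cdot_self)
  then have "bergman_potential z = ln (1 / (1 - (norm z)\<^sup>2) ^ (CARD('n) + 1)) / N"
    by (simp add: bergman_potential_def N_def)
  also have "ln (1 / (1 - (norm z)\<^sup>2) ^ (CARD('n) + 1)) = - N * ln (1 - (norm z)\<^sup>2)"
    using p by (simp add: ln_div ln_realpow N_def algebra_simps del: power_Suc)
  finally show ?thesis using N by simp
qed

lemma potential_has_derivative:
  fixes q :: "'a::real_inner"
  assumes "norm q < 1"
  shows "((\<lambda>q. - ln (1 - (norm q)\<^sup>2)) has_derivative (\<lambda>h. 2 * (q \<bullet> h) / (1 - (norm q)\<^sup>2))) (at q)"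
proof -
  have p: "0 < 1 - (norm q)\<^sup>2" using assms by (rule one_minus_norm_sq_pos)
  have d: "((\<lambda>x. - ln (1 - x)) has_real_derivative 1 / (1 - x)) (at x)" if "0 < 1 - x" for x :: real
    using that by (auto intro!: derivative_eq_intros)
  have "((\<lambda>q. - ln (1 - (norm q)\<^sup>2)) has_derivative (\<lambda>h. (2 *\<^sub>R (q \<bullet> h)) * (1 / (1 - (norm q)\<^sup>2)))) (at q)"
    by (rule DERIV_compose_FDERIV[OF d[OF p] has_derivative_sqnorm_at])
  then show ?thesis by simp
qed

lemma frechet_derivativeI: "(f has_derivative D) (at x) \<Longrightarrow> frechet_derivative f (at x) = D"
  by (rule frechet_derivative_at[symmetric])

lemma inner_axis_complex:
  fixes q :: "complex^'n"
  shows "q \<bullet> axis k 1 = Re (q $ k)" "q \<bullet> axis k \<i> = Im (q $ k)"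
  by (simp_all add: inner_axis inner_complex_def)

lemma component_has_derivative:
  fixes q :: "complex^'n"
  assumes "norm q < 1"
  shows "((\<lambda>q. q $ k / of_real (1 - (norm q)\<^sup>2)) has_derivative
    (\<lambda>h. h $ k / of_real (1 - (norm q)\<^sup>2) + q $ k * of_real (2 * (q \<bullet> h)) / of_real (1 - (norm q)\<^sup>2) ^ 2)) (at q)"
proof -
  have p: "0 < 1 - (norm q)\<^sup>2" using assms by (rule one_minus_norm_sq_pos)
  have d: "((\<lambda>x. 1 / (1 - x)) has_real_derivative 1 / (1 - x)\<^sup>2) (at x)" if "0 < 1 - x" for x :: real
    using that by (auto intro!: derivative_eq_intros simp: power2_eq_square)
  have 1: "((\<lambda>q. 1 / (1 - (norm q)\<^sup>2)) has_derivative (\<lambda>h. (2 *\<^sub>R (q \<bullet> h)) * (1 / (1 - (norm q)\<^sup>2)\<^sup>2))) (at q)"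
    by (rule DERIV_compose_FDERIV[OF d[OF p] has_derivative_sqnorm_at])
  have 2: "((\<lambda>q :: complex^'n. q $ k) has_derivative (\<lambda>h. h $ k)) (at q)"
    by (rule bounded_linear_imp_has_derivative[OF bounded_linear_vec_nth])
  have "((\<lambda>q. q $ k * complex_of_real (1 / (1 - (norm q)\<^sup>2))) has_derivative
      (\<lambda>h. q $ k * of_real ((2 *\<^sub>R (q \<bullet> h)) * (1 / (1 - (norm q)\<^sup>2)\<^sup>2)) + h $ k * of_real (1 / (1 - (norm q)\<^sup>2)))) (at q)"
    by (rule has_derivative_mult[OF 2 bounded_linear.has_derivative[OF bounded_linear_of_real 1]])
  moreover have "(\<lambda>q. q $ k * complex_of_real (1 / (1 - (norm q)\<^sup>2))) = (\<lambda>q. q $ k / of_real (1 - (norm q)\<^sup>2))"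
    by (simp add: fun_eq_iff)
  moreover have "(\<lambda>h. q $ k * of_real ((2 *\<^sub>R (q \<bullet> h)) * (1 / (1 - (norm q)\<^sup>2)\<^sup>2)) + h $ k * of_real (1 / (1 - (norm q)\<^sup>2)))
     = (\<lambda>h. h $ k / of_real (1 - (norm q)\<^sup>2) + q $ k * of_real (2 * (q \<bullet> h)) / of_real (1 - (norm q)\<^sup>2) ^ 2)"
    by (simp add: fun_eq_iff)
  ultimately show ?thesis by simp
qed

text \<open>With \<open>m = 1 - |z|\<^sup>2\<close> the matrix of the Kaehler form is \<open>1/m\<close> times a rank one update of the identity; this
  is the determinant of the update.\<close>

lemma one_plus_norm_frac:
  fixes z :: "complex^'n"
  assumes "norm z < 1"
  shows "1 + (\<Sum>i\<in>UNIV. cnj (z $ i) * (z $ i / of_real (1 - (norm z)\<^sup>2))) = of_real (1 / (1 - (norm z)\<^sup>2))"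
proof -
  have p: "0 < 1 - (norm z)\<^sup>2" using assms by (rule one_minus_norm_sq_pos)
  have "(\<Sum>i\<in>UNIV. cnj (z $ i) * (z $ i / of_real (1 - (norm z)\<^sup>2))) = cdot z z / of_real (1 - (norm z)\<^sup>2)"
    by (simp add: cdot_def sum_divide_distrib mult.commute)
  also have "\<dots> = of_real ((norm z)\<^sup>2 / (1 - (norm z)\<^sup>2))" unfolding cdot_self by simp
  finally have "1 + (\<Sum>i\<in>UNIV. cnj (z $ i) * (z $ i / of_real (1 - (norm z)\<^sup>2))) = of_real (1 + (norm z)\<^sup>2 / (1 - (norm z)\<^sup>2))"
    by (simp del: of_real_divide)
  also have "1 + (norm z)\<^sup>2 / (1 - (norm z)\<^sup>2) = 1 / (1 - (norm z)\<^sup>2)" using p by (simp add: field_simps)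
  finally show ?thesis .
qed

text \<open>Evaluation of \<open>delbar\<close> on a real potential whose derivative is \<open>2 (q \<bullet> h) / r\<close>.\<close>

lemma Wirtinger_of_real_parts:
  "(complex_of_real (2 * x / r) + \<i> * complex_of_real (2 * y / r)) / 2 = Complex x y / of_real r"
  by (cases "r = 0") (simp_all add: complex_eq_iff Re_divide_of_real Im_divide_of_real)

lemma kaehler_coeff_ball:
  fixes z :: "complex^'n"
  assumes z: "norm z < 1"
  shows "kaehler_coeff axis bergman_potential z $ j $ k =
    (if j = k then 1 else 0) / of_real (1 - (norm z)\<^sup>2) + cnj (z $ j) * z $ k / of_real (1 - (norm z)\<^sup>2) ^ 2"
proof -
  have db: "delbar axis k (\<lambda>q. complex_of_real (bergman_potential q)) q = q $ k / of_real (1 - (norm q)\<^sup>2)"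
    if q: "norm q < 1" for q :: "complex^'n"
  proof -
    have "((\<lambda>q. complex_of_real (- ln (1 - (norm q)\<^sup>2))) has_derivative (\<lambda>h. of_real (2 * (q \<bullet> h) / (1 - (norm q)\<^sup>2)))) (at q)"
      by (rule bounded_linear.has_derivative[OF bounded_linear_of_real potential_has_derivative[OF q]])
    then have "((\<lambda>q. complex_of_real (bergman_potential q)) has_derivative (\<lambda>h. of_real (2 * (q \<bullet> h) / (1 - (norm q)\<^sup>2)))) (at q)"
      by (rule has_derivative_transform_within_open[OF _ open_ball[of 0 1]]) (use q in \<open>auto simp: bergman_potential_eq\<close>)
    note D = frechet_derivativeI[OF this]
    show ?thesis unfolding delbar_def D inner_axis_complex Wirtinger_of_real_parts by simp
  qed
  have "(delbar axis k (\<lambda>q. complex_of_real (bergman_potential q)) has_derivative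
     (\<lambda>h. h $ k / of_real (1 - (norm z)\<^sup>2) + z $ k * of_real (2 * (z \<bullet> h)) / of_real (1 - (norm z)\<^sup>2) ^ 2)) (at z)"
    by (rule has_derivative_transform_within_open[OF component_has_derivative[OF z] open_ball[of 0 1]]) (use z in \<open>auto simp: db\<close>)
  note D = frechet_derivativeI[OF this]
  define m where "m = complex_of_real (1 - (norm z)\<^sup>2)"
  have c: "cnj (z $ j) = of_real (Re (z $ j)) - \<i> * of_real (Im (z $ j))" by (simp add: complex_eq_iff)
  have "kaehler_coeff axis bergman_potential z $ j $ k =
    ((axis j 1 $ k :: complex) - \<i> * axis j \<i> $ k) / (2 * m) + cnj (z $ j) * z $ k / m ^ 2"
    unfolding kaehler_coeff_def del_def vec_lambda_beta D inner_axis_complex m_def[symmetric] c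
    by (simp add: add_divide_distrib diff_divide_distrib algebra_simps)
  also have "(axis j 1 $ k :: complex) - \<i> * axis j \<i> $ k = (if j = k then 2 else 0)"
    by (auto simp: axis_def)
  finally show ?thesis unfolding m_def[symmetric] by simp
qed

lemma det_kaehler_coeff_ball:
  fixes z :: "complex^'n"
  assumes z: "norm z < 1"
  shows "det (kaehler_coeff axis bergman_potential z) = of_real (1 / (1 - (norm z)\<^sup>2) ^ (CARD('n) + 1))"
proof -
  define m where "m = complex_of_real (1 - (norm z)\<^sup>2)"
  have m: "m \<noteq> 0" using one_minus_norm_sq_pos[OF z] by (simp only: m_def of_real_eq_0_iff)
  define A :: "complex^'n^'n" where "A = (\<chi> j k. (if j = k then 1 else 0) + (\<chi> i. cnj (z $ i)) $ j * (\<chi> k. z $ k / m) $ k)"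
  have "kaehler_coeff axis bergman_potential z = (\<chi> j. (1 / m) *s (A $ j))"
    unfolding vec_eq_iff kaehler_coeff_ball[OF z] A_def m_def[symmetric] vec_lambda_beta vector_smult_component
    using m by (simp add: distrib_left power2_eq_square)
  then have "det (kaehler_coeff axis bergman_potential z) = (1 / m) ^ CARD('n) * det A"
    using det_rows_mul[of "\<lambda>_. 1 / m" "\<lambda>j. A $ j"] by simp
  also have "det A = 1 / m"
    unfolding A_def det_rank_one_update using one_plus_norm_frac[OF z] by (simp add: m_def)
  finally show ?thesis by (simp add: m_def power_divide)
qed

lemma density_cong_space:
  assumes "\<And>x. x \<in> space M \<Longrightarrow> f x = g x" shows "density M f = density M g"
  unfolding density_def
  by (intro arg_cong[where f="measure_of _ _"] ext nn_integral_cong) (simp add: assms)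

lemma ball_volume_form_eq: "ball_volume_form = hyp_volume"
  unfolding ball_volume_form_def kaehler_volume_def hyp_volume_def
  by (rule density_cong_space) (simp add: space_restrict_space det_kaehler_coeff_ball)

text \<open>The coordinates of a pair, and for each coordinate the value \<open>1 - |\<cdot>|\<^sup>2\<close> of the factor it belongs to.
  With them the coefficient matrix of the product metric has the same shape as that of one ball, and
  vanishes between different factors.\<close>

definition block_coord :: "(complex^'n) \<times> (complex^'n) \<Rightarrow> 'n + 'n \<Rightarrow> complex"
  where "block_coord p j = (case j of Inl i \<Rightarrow> fst p $ i | Inr i \<Rightarrow> snd p $ i)"

definition block_mass :: "(complex^'n) \<times> (complex^'n) \<Rightarrow> 'n + 'n \<Rightarrow> complex"
  where "block_mass p j = of_real (case j of Inl i \<Rightarrow> 1 - (norm (fst p))\<^sup>2 | Inr i \<Rightarrow> 1 - (norm (snd p))\<^sup>2)"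

lemma kaehler_coeff_biball:
  fixes p :: "(complex^'n) \<times> (complex^'n)"
  assumes p: "p \<in> \<bbbB> \<times> \<bbbB>"
  shows "kaehler_coeff pair_coord (\<lambda>(z, w). bergman_potential z + bergman_potential w) p $ j $ k =
    (if j = k then 1 else 0) / block_mass p j +
    (if isl j = isl k then cnj (block_coord p j) * block_coord p k / (block_mass p j) ^ 2 else 0)"
proof -
  let ?g = "\<lambda>q. complex_of_real ((\<lambda>(z, w). bergman_potential z + bergman_potential w) q)"
  have opn: "open (\<bbbB> \<times> \<bbbB> :: ((complex^'n) \<times> (complex^'n)) set)" by (intro open_Times open_ball)
  have db: "delbar pair_coord k ?g q = block_coord q k / block_mass q k"
    if q: "q \<in> \<bbbB> \<times> \<bbbB>" for q :: "(complex^'n) \<times> (complex^'n)"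
  proof -
    have n: "norm (fst q) < 1" "norm (snd q) < 1" using q by auto
    have "((\<lambda>q :: (complex^'n) \<times> (complex^'n). - ln (1 - (norm (fst q))\<^sup>2) + - ln (1 - (norm (snd q))\<^sup>2)) has_derivative
        (\<lambda>h. 2 * (fst q \<bullet> fst h) / (1 - (norm (fst q))\<^sup>2) + 2 * (snd q \<bullet> snd h) / (1 - (norm (snd q))\<^sup>2))) (at q)"
      by (intro has_derivative_add has_derivative_compose[of fst fst q UNIV, OF _ potential_has_derivative[OF n(1)]]
         has_derivative_compose[of snd snd q UNIV, OF _ potential_has_derivative[OF n(2)]]
         bounded_linear_imp_has_derivative bounded_linear_fst bounded_linear_snd)
    from bounded_linear.has_derivative[OF bounded_linear_of_real this]
    have "(?g has_derivative (\<lambda>h. of_real (2 * (fst q \<bullet> fst h) / (1 - (norm (fst q))\<^sup>2) + 2 * (snd q \<bullet> snd h) / (1 - (norm (snd q))\<^sup>2)))) (at q)"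
      by (rule has_derivative_transform_within_open[OF _ opn q]) (auto simp: bergman_potential_eq)
    note D = frechet_derivativeI[OF this]
    show ?thesis
    proof (cases k)
      case (Inl k')
      show ?thesis unfolding delbar_def D Inl pair_coord_def sum.case fst_conv snd_conv inner_axis_complex inner_zero_right
          mult_zero_right div_0 add_0_right Wirtinger_of_real_parts block_coord_def block_mass_def by simp
    next
      case (Inr k')
      show ?thesis unfolding delbar_def D Inr pair_coord_def sum.case fst_conv snd_conv inner_axis_complex inner_zero_right
          mult_zero_right div_0 add_0_left Wirtinger_of_real_parts block_coord_def block_mass_def by simp
    qed
  qed
  have n: "norm (fst p) < 1" "norm (snd p) < 1" using p by auto
  define m1 m2 where "m1 = complex_of_real (1 - (norm (fst p))\<^sup>2)" and "m2 = complex_of_real (1 - (norm (snd p))\<^sup>2)"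
  have c: "cnj z = of_real (Re z) - \<i> * of_real (Im z)" for z by (simp add: complex_eq_iff)
  have bm: "block_mass p (Inl i) = m1" "block_mass p (Inr i) = m2" for i
    by (simp_all only: block_mass_def sum.case m1_def m2_def)
  show ?thesis
  proof (cases k)
    case (Inl k')
    have eq: "delbar pair_coord k ?g q = fst q $ k' / of_real (1 - (norm (fst q))\<^sup>2)"
      if "q \<in> \<bbbB> \<times> \<bbbB>" for q :: "(complex^'n) \<times> (complex^'n)"
      unfolding db[OF that] by (simp add: block_coord_def block_mass_def Inl)
    have "((\<lambda>q. fst q $ k' / of_real (1 - (norm (fst q))\<^sup>2)) has_derivative
       (\<lambda>h. fst h $ k' / m1 + fst p $ k' * of_real (2 * (fst p \<bullet> fst h)) / m1 ^ 2)) (at p)"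
      unfolding m1_def
      by (rule has_derivative_compose[of fst fst p UNIV, OF _ component_has_derivative[OF n(1)]])
        (intro bounded_linear_imp_has_derivative bounded_linear_fst)
    then have "(delbar pair_coord k ?g has_derivative
       (\<lambda>h. fst h $ k' / m1 + fst p $ k' * of_real (2 * (fst p \<bullet> fst h)) / m1 ^ 2)) (at p)"
      by (rule has_derivative_transform_within_open[OF _ opn p]) (simp only: eq)
    note D = frechet_derivativeI[OF this]
    show ?thesis
      unfolding kaehler_coeff_def del_def vec_lambda_beta D
    proof (cases j)
      case (Inl j')
      show "((fst (pair_coord j 1) $ k' / m1 + fst p $ k' * of_real (2 * (fst p \<bullet> fst (pair_coord j 1))) / m1 ^ 2)
        - \<i> * (fst (pair_coord j \<i>) $ k' / m1 + fst p $ k' * of_real (2 * (fst p \<bullet> fst (pair_coord j \<i>))) / m1 ^ 2)) / 2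
        = (if j = k then 1 else 0) / block_mass p j + (if isl j = isl k then cnj (block_coord p j) * block_coord p k / (block_mass p j) ^ 2 else 0)"
        unfolding Inl \<open>k = Inl k'\<close> pair_coord_def sum.case fst_conv snd_conv inner_axis_complex block_coord_def bm c
        by (cases "j' = k'") (simp_all add: axis_def add_divide_distrib diff_divide_distrib algebra_simps)
    qed (simp add: pair_coord_def \<open>k = Inl k'\<close>)
  next
    case (Inr k')
    have eq: "delbar pair_coord k ?g q = snd q $ k' / of_real (1 - (norm (snd q))\<^sup>2)"
      if "q \<in> \<bbbB> \<times> \<bbbB>" for q :: "(complex^'n) \<times> (complex^'n)"
      unfolding db[OF that] by (simp add: block_coord_def block_mass_def Inr)
    have "((\<lambda>q. snd q $ k' / of_real (1 - (norm (snd q))\<^sup>2)) has_derivative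
       (\<lambda>h. snd h $ k' / m2 + snd p $ k' * of_real (2 * (snd p \<bullet> snd h)) / m2 ^ 2)) (at p)"
      unfolding m2_def
      by (rule has_derivative_compose[of snd snd p UNIV, OF _ component_has_derivative[OF n(2)]])
        (intro bounded_linear_imp_has_derivative bounded_linear_snd)
    then have "(delbar pair_coord k ?g has_derivative
       (\<lambda>h. snd h $ k' / m2 + snd p $ k' * of_real (2 * (snd p \<bullet> snd h)) / m2 ^ 2)) (at p)"
      by (rule has_derivative_transform_within_open[OF _ opn p]) (simp only: eq)
    note D = frechet_derivativeI[OF this]
    show ?thesis
      unfolding kaehler_coeff_def del_def vec_lambda_beta D
    proof (cases j)
      case (Inr j')
      show "((snd (pair_coord j 1) $ k' / m2 + snd p $ k' * of_real (2 * (snd p \<bullet> snd (pair_coord j 1))) / m2 ^ 2)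
        - \<i> * (snd (pair_coord j \<i>) $ k' / m2 + snd p $ k' * of_real (2 * (snd p \<bullet> snd (pair_coord j \<i>))) / m2 ^ 2)) / 2
        = (if j = k then 1 else 0) / block_mass p j + (if isl j = isl k then cnj (block_coord p j) * block_coord p k / (block_mass p j) ^ 2 else 0)"
        unfolding Inr \<open>k = Inr k'\<close> pair_coord_def sum.case fst_conv snd_conv inner_axis_complex block_coord_def bm c
        by (cases "j' = k'") (simp_all add: axis_def add_divide_distrib diff_divide_distrib algebra_simps)
    qed (simp add: pair_coord_def \<open>k = Inr k'\<close>)
  qed
qed

lemma sum_UNIV_sum: "(\<Sum>j\<in>(UNIV :: ('a::finite + 'b::finite) set). f j) = (\<Sum>i\<in>UNIV. f (Inl i)) + (\<Sum>i\<in>UNIV. f (Inr i))"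
  by (subst UNIV_sum, subst sum.union_disjoint) (auto simp: sum.reindex)

lemma prod_UNIV_sum: "(\<Prod>j\<in>(UNIV :: ('a::finite + 'b::finite) set). f j) = (\<Prod>i\<in>UNIV. f (Inl i)) * (\<Prod>i\<in>UNIV. f (Inr i))"
  by (subst UNIV_sum, subst prod.union_disjoint) (auto simp: prod.reindex)

text \<open>The matrix is block diagonal.  To stay with one index type, it is written, up to factors of the rows,
  as the product of two rank one updates of the identity, one for each block.\<close>

lemma det_kaehler_coeff_biball:
  fixes p :: "(complex^'n) \<times> (complex^'n)"
  assumes p: "p \<in> \<bbbB> \<times> \<bbbB>"
  shows "det (kaehler_coeff pair_coord (\<lambda>(z, w). bergman_potential z + bergman_potential w) p) =
    of_real (1 / (1 - (norm (fst p))\<^sup>2) ^ (CARD('n) + 1) * (1 / (1 - (norm (snd p))\<^sup>2) ^ (CARD('n) + 1)))"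
proof -
  have n: "norm (fst p) < 1" "norm (snd p) < 1" using p by auto
  define m1 m2 where "m1 = complex_of_real (1 - (norm (fst p))\<^sup>2)" and "m2 = complex_of_real (1 - (norm (snd p))\<^sup>2)"
  have m: "m1 \<noteq> 0" "m2 \<noteq> 0" using one_minus_norm_sq_pos[OF n(1)] one_minus_norm_sq_pos[OF n(2)]
    by (simp_all only: m1_def m2_def of_real_eq_0_iff)
  define u1 v1 u2 v2 :: "complex^('n+'n)" where
    "u1 = (\<chi> j. if isl j then cnj (block_coord p j) else 0)" and
    "v1 = (\<chi> j. if isl j then block_coord p j / m1 else 0)" and
    "u2 = (\<chi> j. if isl j then 0 else cnj (block_coord p j))" and
    "v2 = (\<chi> j. if isl j then 0 else block_coord p j / m2)"
  define A1 A2 :: "complex^('n+'n)^('n+'n)" where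
    "A1 = (\<chi> i j. (if i = j then 1 else 0) + u1 $ i * v1 $ j)" and
    "A2 = (\<chi> i j. (if i = j then 1 else 0) + u2 $ i * v2 $ j)"
  have bm: "block_mass p (Inl i) = m1" "block_mass p (Inr i) = m2" for i
    by (simp_all only: block_mass_def sum.case m1_def m2_def)
  have z: "v1 $ l * u2 $ l = 0" for l by (simp add: v1_def u2_def)
  have A12: "(A1 ** A2) $ i $ j = (if i = j then 1 else 0) + u1 $ i * v1 $ j + u2 $ i * v2 $ j" for i j
  proof -
    have "(\<Sum>l\<in>UNIV. u1 $ i * v1 $ l * (u2 $ l * v2 $ j)) = 0"
    proof (intro sum.neutral ballI)
      fix l
      have "u1 $ i * v1 $ l * (u2 $ l * v2 $ j) = u1 $ i * (v1 $ l * u2 $ l) * v2 $ j" by (simp only: mult.assoc)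
      then show "u1 $ i * v1 $ l * (u2 $ l * v2 $ j) = 0" unfolding z by simp
    qed
    then show ?thesis
      using sum_delta_mult(4)[of "\<lambda>k. u1 $ i * v1 $ k" j]
      by (simp add: matrix_matrix_mult_def A1_def A2_def distrib_left distrib_right sum.distrib sum_delta_mult mult.assoc)
  qed
  have "kaehler_coeff pair_coord (\<lambda>(z, w). bergman_potential z + bergman_potential w) p
      = (\<chi> j. (1 / block_mass p j) *s ((A1 ** A2) $ j))"
    unfolding vec_eq_iff
  proof (intro allI)
    fix j k
    show "kaehler_coeff pair_coord (\<lambda>(z, w). bergman_potential z + bergman_potential w) p $ j $ k
      = (\<chi> j. (1 / block_mass p j) *s ((A1 ** A2) $ j)) $ j $ k"
      unfolding kaehler_coeff_biball[OF p] vec_lambda_beta vector_smult_component A12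
      by (cases j; cases k) (simp_all add: u1_def u2_def v1_def v2_def bm distrib_left power2_eq_square)
  qed
  then have "det (kaehler_coeff pair_coord (\<lambda>(z, w). bergman_potential z + bergman_potential w) p)
      = (\<Prod>j\<in>UNIV. 1 / block_mass p j) * (det A1 * det A2)"
    using det_rows_mul[of "\<lambda>j. 1 / block_mass p j" "\<lambda>j. (A1 ** A2) $ j"] by (simp add: det_mul)
  also have "det A1 = 1 / m1"
    unfolding A1_def det_rank_one_update sum_UNIV_sum
    using one_plus_norm_frac[OF n(1)] by (simp add: u1_def v1_def block_coord_def m1_def)
  also have "det A2 = 1 / m2"
    unfolding A2_def det_rank_one_update sum_UNIV_sum
    using one_plus_norm_frac[OF n(2)] by (simp add: u2_def v2_def block_coord_def m2_def)
  also have "(\<Prod>j\<in>UNIV. 1 / block_mass p j) = (1 / m1) ^ CARD('n) * (1 / m2) ^ CARD('n)"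
    by (simp add: prod_UNIV_sum block_mass_def m1_def m2_def power_divide)
  finally show ?thesis by (simp add: m1_def m2_def power_divide)
qed

lemma hyp_incl_measurable: "(\<lambda>x. x) \<in> measurable hyp_volume borel"
  unfolding measurable_hyp_volume_cong by (rule measurable_restrict_space1) simp

lemma sets_hyp_prod:
  "sets (hyp_volume \<Otimes>\<^sub>M hyp_volume) = sets (restrict_space borel (\<bbbB> \<times> \<bbbB> :: ((complex^'n) \<times> (complex^'n)) set))"
proof
  have BB: "(\<bbbB> \<times> \<bbbB> :: ((complex^'n) \<times> (complex^'n)) set) \<in> sets borel" by (intro borel_open open_Times open_ball)
  have in_iff: "X \<in> sets (restrict_space borel (\<bbbB> \<times> \<bbbB>)) \<longleftrightarrow> X \<in> sets borel \<and> X \<subseteq> \<bbbB> \<times> \<bbbB>" for X :: "((complex^'n) \<times> (complex^'n)) set"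
    by (subst sets_restrict_space_iff) (use BB in auto)
  have "{a \<times> b |a b. a \<in> sets hyp_volume \<and> b \<in> sets hyp_volume} \<subseteq> sets (restrict_space borel (\<bbbB> \<times> \<bbbB> :: ((complex^'n) \<times> (complex^'n)) set))"
  proof safe
    fix a b :: "(complex^'n) set" assume "a \<in> sets hyp_volume" "b \<in> sets hyp_volume"
    then have ab: "a \<in> sets borel" "a \<subseteq> \<bbbB>" "b \<in> sets borel" "b \<subseteq> \<bbbB>" by (simp_all add: in_sets_hyp_volume)
    then have "a \<times> b \<in> sets (borel \<Otimes>\<^sub>M borel)" by simp
    from this[unfolded borel_prod] show "a \<times> b \<in> sets (restrict_space borel (\<bbbB> \<times> \<bbbB>))"
      unfolding in_iff using ab by blast
  qed
  then show "sets (hyp_volume \<Otimes>\<^sub>M hyp_volume) \<subseteq> sets (restrict_space borel (\<bbbB> \<times> \<bbbB> :: ((complex^'n) \<times> (complex^'n)) set))"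
    unfolding sets_pair_measure using sets.sigma_sets_subset[of _ "restrict_space borel (\<bbbB> \<times> \<bbbB>)"]
    by (simp add: space_restrict_space)
  show "sets (restrict_space borel (\<bbbB> \<times> \<bbbB> :: ((complex^'n) \<times> (complex^'n)) set)) \<subseteq> sets (hyp_volume \<Otimes>\<^sub>M hyp_volume)"
  proof
    fix X :: "((complex^'n) \<times> (complex^'n)) set" assume "X \<in> sets (restrict_space borel (\<bbbB> \<times> \<bbbB>))"
    then have X: "X \<in> sets (borel \<Otimes>\<^sub>M borel)" "X \<subseteq> \<bbbB> \<times> \<bbbB>" unfolding in_iff borel_prod by auto
    have "(\<lambda>x. (fst x, snd x)) \<in> measurable (hyp_volume \<Otimes>\<^sub>M hyp_volume) (borel \<Otimes>\<^sub>M borel :: ((complex^'n) \<times> (complex^'n)) measure)"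
      by (intro measurable_Pair measurable_compose[OF measurable_fst hyp_incl_measurable] measurable_compose[OF measurable_snd hyp_incl_measurable])
    from measurable_sets[OF this X(1)]
    have "X \<inter> (\<bbbB> \<times> \<bbbB>) \<in> sets (hyp_volume \<Otimes>\<^sub>M hyp_volume)"
      by (simp add: space_pair_measure vimage_def Int_def)
    then show "X \<in> sets (hyp_volume \<Otimes>\<^sub>M hyp_volume)" using X(2) by (simp add: Int_absorb2)
  qed
qed

lemma sigma_finite_hyp_volume: "sigma_finite_measure hyp_volume"
proof -
  have "finite_measure (restrict_space lborel (\<bbbB> :: (complex^'n) set))"
    by (rule finite_measureI) (use emeasure_lborel_ball_finite[of "0 :: complex^'n" 1] in \<open>simp add: emeasure_restrict_space space_restrict_space\<close>)
  then interpret finite_measure "restrict_space lborel (\<bbbB> :: (complex^'n) set)" .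
  show ?thesis unfolding hyp_volume_def
    by (subst sigma_finite_iff_density_finite) (auto intro: measurable_restrict_space1)
qed

lemma emeasure_hyp_volume:
  fixes A :: "(complex^'n) set"
  assumes "A \<in> sets hyp_volume"
  shows "emeasure hyp_volume A = (\<integral>\<^sup>+z. ennreal (2 ^ CARD('n) / (1 - (norm z)\<^sup>2) ^ (CARD('n) + 1)) * indicator A z \<partial>lborel)"
proof -
  have A: "A \<in> sets (restrict_space lborel \<bbbB>)" using assms unfolding hyp_volume_def by simp
  have "emeasure hyp_volume A = (\<integral>\<^sup>+z. ennreal (2 ^ CARD('n) / (1 - (norm z)\<^sup>2) ^ (CARD('n) + 1)) * indicator A z \<partial>restrict_space lborel \<bbbB>)"
    unfolding hyp_volume_def by (rule emeasure_density) (use A in \<open>auto intro: measurable_restrict_space1\<close>)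
  also have "\<dots> = (\<integral>\<^sup>+z. ennreal (2 ^ CARD('n) / (1 - (norm z)\<^sup>2) ^ (CARD('n) + 1)) * indicator A z * indicator \<bbbB> z \<partial>lborel)"
    by (rule nn_integral_restrict_space) simp
  also have "\<dots> = (\<integral>\<^sup>+z. ennreal (2 ^ CARD('n) / (1 - (norm z)\<^sup>2) ^ (CARD('n) + 1)) * indicator A z \<partial>lborel)"
    using assms by (intro nn_integral_cong) (auto simp: in_sets_hyp_volume indicator_def)
  finally show ?thesis .
qed

text \<open>The determinant of a block diagonal matrix is a product, so the density is the product of the two
  densities.\<close>

lemma biball_volume_form_eq: "(biball_volume_form :: ((complex^'n) \<times> (complex^'n)) measure) = hyp_volume \<Otimes>\<^sub>M hyp_volume"
proof (rule pair_measure_eqI[symmetric, OF sigma_finite_hyp_volume sigma_finite_hyp_volume])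
  let ?h = "\<lambda>z :: complex^'n. ennreal (2 ^ CARD('n) / (1 - (norm z)\<^sup>2) ^ (CARD('n) + 1))"
  let ?BB = "\<bbbB> \<times> \<bbbB> :: ((complex^'n) \<times> (complex^'n)) set"
  have BB: "?BB \<in> sets borel" by (intro borel_open open_Times open_ball)
  have sm: "sets (biball_volume_form :: ((complex^'n) \<times> (complex^'n)) measure) = sets (restrict_space borel ?BB)"
    unfolding biball_volume_form_def kaehler_volume_def by simp (rule sets_restrict_space_cong, simp)
  then show sets: "sets (hyp_volume \<Otimes>\<^sub>M hyp_volume) = sets (biball_volume_form :: ((complex^'n) \<times> (complex^'n)) measure)"
    by (simp add: sets_hyp_prod)
  fix A B :: "(complex^'n) set" assume AB: "A \<in> sets hyp_volume" "B \<in> sets hyp_volume"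
  then have bAB: "A \<in> sets borel" "A \<subseteq> \<bbbB>" "B \<in> sets borel" "B \<subseteq> \<bbbB>" by (simp_all add: in_sets_hyp_volume)
  have [measurable]: "A \<in> sets lborel" "B \<in> sets lborel" using bAB by auto
  have eq: "biball_volume_form = density (restrict_space lborel ?BB) (\<lambda>p. ?h (fst p) * ?h (snd p))"
    unfolding biball_volume_form_def kaehler_volume_def
  proof (rule density_cong_space)
    fix p assume "p \<in> space (restrict_space lborel ?BB)"
    then have p: "p \<in> ?BB" by (simp add: space_restrict_space)
    then have "0 \<le> 1 - (norm (fst p))\<^sup>2" "0 \<le> 1 - (norm (snd p))\<^sup>2" by (auto simp: abs_square_le_1 less_imp_le)
    then show "ennreal (2 ^ CARD('n + 'n) * Re (det (kaehler_coeff pair_coord (\<lambda>(z, w). bergman_potential z + bergman_potential w) p))) = ?h (fst p) * ?h (snd p)"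
      unfolding det_kaehler_coeff_biball[OF p] by (simp add: ennreal_mult[symmetric] power_add del: power_Suc)
  qed
  have m: "(\<lambda>p. ?h (fst p) * ?h (snd p)) \<in> borel_measurable (lborel :: ((complex^'n) \<times> (complex^'n)) measure)"
    unfolding lborel_prod[symmetric] by measurable
  have "A \<times> B \<in> sets (hyp_volume \<Otimes>\<^sub>M hyp_volume)" using AB by simp
  then have ABr: "A \<times> B \<in> sets (restrict_space lborel ?BB)" unfolding sets eq by simp
  have "emeasure biball_volume_form (A \<times> B) = (\<integral>\<^sup>+p. ?h (fst p) * ?h (snd p) * indicator (A \<times> B) p \<partial>restrict_space lborel ?BB)"
    unfolding eq by (rule emeasure_density) (use ABr m in \<open>auto intro: measurable_restrict_space1\<close>)
  also have "\<dots> = (\<integral>\<^sup>+p. ?h (fst p) * ?h (snd p) * indicator (A \<times> B) p * indicator ?BB p \<partial>lborel)"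
    by (rule nn_integral_restrict_space) (use BB in simp)
  also have "\<dots> = (\<integral>\<^sup>+p. (?h (fst p) * indicator A (fst p)) * (?h (snd p) * indicator B (snd p)) \<partial>(lborel \<Otimes>\<^sub>M lborel))"
    unfolding lborel_prod using bAB by (intro nn_integral_cong) (auto simp: indicator_def)
  also have "\<dots> = (\<integral>\<^sup>+x. \<integral>\<^sup>+y. (?h x * indicator A x) * (?h y * indicator B y) \<partial>lborel \<partial>lborel)"
    by (subst lborel.nn_integral_fst[symmetric]) simp_all
  also have "\<dots> = emeasure hyp_volume A * emeasure hyp_volume B"
    unfolding emeasure_hyp_volume[OF AB(1)] emeasure_hyp_volume[OF AB(2)]
    by (simp add: nn_integral_cmult nn_integral_multc)
  finally show "emeasure hyp_volume A * emeasure hyp_volume B = emeasure biball_volume_form (A \<times> B)" by simp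
qed

section \<open>Circle averages of holomorphic functions\<close>

definition unit_exp :: "real \<Rightarrow> complex" where "unit_exp x = exp (2 * of_real pi * \<i> * of_real x)"

lemma norm_unit_exp [simp]: "norm (unit_exp x) = 1"
  by (simp add: unit_exp_def norm_exp_eq_Re)

lemma continuous_on_unit_exp [continuous_intros]: "continuous_on S f \<Longrightarrow> continuous_on S (\<lambda>x. unit_exp (f x))"
  unfolding unit_exp_def by (intro continuous_intros)

lemma unit_exp_add: "unit_exp (x + y) = unit_exp x * unit_exp y"
  by (simp add: unit_exp_def exp_add[symmetric] algebra_simps)

lemma unit_exp_one_add: "unit_exp (x + 1) = unit_exp x"
  by (simp add: unit_exp_add) (simp add: unit_exp_def)

lemma circle_in_ball: "norm s < 1 \<Longrightarrow> s * unit_exp x \<in> ball 0 1"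
  by (simp add: norm_mult)

lemma continuous_on_circle:
  fixes g :: "complex \<Rightarrow> 'b::topological_space"
  assumes g: "continuous_on (ball 0 1) g" and s: "norm s < 1"
  shows "continuous_on S (\<lambda>x. g (s * unit_exp x))"
  using circle_in_ball[OF s]
  by (intro continuous_on_compose2[OF g] continuous_intros) (auto simp: norm_mult)

lemma circle_mean_value:
  assumes g: "g holomorphic_on ball 0 1" and r: "0 \<le> r" "r < 1"
  shows "((\<lambda>x. g (of_real r * unit_exp x)) has_integral g 0) {0..1}"
proof (cases "r = 0")
  case True
  then show ?thesis using has_integral_const_real[of "g 0" 0 1] by simp
next
  case False
  then have r0: "r > 0" using r by simp
  have cont: "continuous_on (cball 0 r) g"
    using r holomorphic_on_imp_continuous_on[OF g] by (auto elim: continuous_on_subset)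
  have hol: "g holomorphic_on ball 0 r" using r by (intro holomorphic_on_subset[OF g]) auto
  have "((\<lambda>u. g u / (u - 0)) has_contour_integral (2 * of_real pi * \<i> * g 0)) (circlepath 0 r)"
    by (rule Cauchy_integral_circlepath[OF cont hol]) (use r0 in simp)
  then have "((\<lambda>x. g (circlepath 0 r x) / circlepath 0 r x * vector_derivative (circlepath 0 r) (at x within {0..1}))
      has_integral (2 * of_real pi * \<i> * g 0)) {0..1}"
    by (simp add: has_contour_integral_def)
  moreover have "g (circlepath 0 r x) / circlepath 0 r x * vector_derivative (circlepath 0 r) (at x within {0..1})
      = (2 * of_real pi * \<i>) * g (of_real r * unit_exp x)" if "x \<in> {0..1}" for x
    using that r0 vector_derivative_circlepath01[of x 0 r] by (simp only: atLeastAtMost_iff simp_thms) (simp add: circlepath unit_exp_def)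
  ultimately have "((\<lambda>x. (2 * of_real pi * \<i>) * g (of_real r * unit_exp x)) has_integral (2 * of_real pi * \<i> * g 0)) {0..1}"
    by (rule has_integral_eq[rotated])
  from has_integral_mult_right[OF this, of "1 / (2 * of_real pi * \<i>)"] show ?thesis by simp
qed

text \<open>The base point \<open>s\<close> is complex although the average depends on \<open>|s|\<close> only: the maximum principle is
  applied on a circle of base points.\<close>

definition circle_avg :: "(complex \<Rightarrow> complex) \<Rightarrow> complex \<Rightarrow> real"
  where "circle_avg g s = integral {0..1} (\<lambda>x. (cmod (g (s * unit_exp x)))\<^sup>2)"

lemma circle_avg_rotate:
  assumes g: "continuous_on (ball 0 1) g" and s: "norm s < 1" and t: "0 \<le> t" "t \<le> 1"
  shows "circle_avg g (s * unit_exp t) = circle_avg g s"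
proof -
  define h where "h = (\<lambda>x. (cmod (g (s * unit_exp x)))\<^sup>2)"
  have ch: "continuous_on S h" for S
    unfolding h_def by (intro continuous_intros continuous_on_circle[OF g s])
  have int: "h integrable_on {a..b}" for a b by (rule integrable_continuous_real[OF ch])
  have "circle_avg g (s * unit_exp t) = integral {0..1} (h \<circ> (+) t)"
    by (simp add: circle_avg_def h_def o_def unit_exp_add mult.assoc)
  also have "\<dots> = integral {0 + t..1 + t} h" by (rule integral_shift_Icc_real)
  also have "\<dots> = integral {t..1} h + integral {1..1 + t} h"
    using t by (simp add: Henstock_Kurzweil_Integration.integral_combine int)
  also have "integral {1..1 + t} h = integral {0..t} h"
    using integral_shift_Icc_real[of 0 t h 1]
    by (simp add: o_def h_def add.commute[of 1] unit_exp_one_add)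
  also have "integral {t..1} h + integral {0..t} h = integral {0..1} h"
    using t Henstock_Kurzweil_Integration.integral_combine[of 0 t 1 h] int by simp
  finally show ?thesis by (simp add: circle_avg_def h_def)
qed

lemma exists_unit_exp: assumes "norm s = r" "r \<ge> 0" obtains t where "0 \<le> t" "t \<le> 1" "s = of_real r * unit_exp t"
proof -
  define t where "t = Arg2pi s / (2 * pi)"
  have "0 \<le> t" "t \<le> 1" using Arg2pi_ge_0[of s] Arg2pi_lt_2pi[of s] by (simp_all add: t_def field_simps)
  moreover have "s = of_real r * unit_exp t"
    using Arg2pi_eq[of s] assms by (simp add: t_def unit_exp_def mult_ac)
  ultimately show ?thesis using that by blast
qed

text \<open>Hardy's convexity theorem in its weakest form.  The function \<open>s \<mapsto> \<integral> g(s e) cnj (g(r e))\<close>, with \<open>e\<close>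
  running over the unit circle, is holomorphic and takes the value \<open>circle_avg g r\<close> at \<open>r\<close>.  On the
  circle of radius \<open>r'\<close> it is bounded by the arithmetic mean of the two averages, and the maximum
  principle concludes.\<close>

lemma circle_avg_mono:
  assumes g: "g holomorphic_on ball 0 1" and r: "0 \<le> r" "r \<le> r'" "r' < 1"
  shows "circle_avg g (of_real r) \<le> circle_avg g (of_real r')"
proof (cases "r = r'")
  case False
  then have r': "r < r'" "0 < r'" using r by auto
  have cg: "continuous_on (ball 0 1) g" using g by (rule holomorphic_on_imp_continuous_on)
  have cdg: "continuous_on (ball 0 1) (deriv g)"
    using g by (intro holomorphic_on_imp_continuous_on holomorphic_deriv) auto
  have nr: "norm (complex_of_real r) < 1" "norm (complex_of_real r') < 1" using r by auto
  define P where "P = (\<lambda>s. integral (cbox 0 1) (\<lambda>x. g (s * unit_exp x) * cnj (g (of_real r * unit_exp x))))"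
  have sqint: "(\<lambda>x. (cmod (g (s * unit_exp x)))\<^sup>2) integrable_on {0..1}" if "norm s < 1" for s
    by (intro integrable_continuous_real continuous_intros continuous_on_circle[OF cg that])
  have hP: "P holomorphic_on ball 0 1"
    unfolding P_def
  proof (rule leibniz_rule_holomorphic)
    fix s :: complex and t :: real assume s: "s \<in> ball 0 1"
    have "(g has_field_derivative deriv g (s * unit_exp t)) (at (s * unit_exp t))"
      using g circle_in_ball[of s t] s by (intro holomorphic_derivI[of g "ball 0 1"]) auto
    then have "((\<lambda>s. g (s * unit_exp t)) has_field_derivative deriv g (s * unit_exp t) * unit_exp t) (at s)"
      by (rule DERIV_chain2) (auto intro!: derivative_eq_intros)
    then have "((\<lambda>s. g (s * unit_exp t) * cnj (g (of_real r * unit_exp t))) has_field_derivative deriv g (s * unit_exp t) * unit_exp t * cnj (g (of_real r * unit_exp t))) (at s)"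
      by (rule DERIV_cmult_right)
    then show "((\<lambda>s. g (s * unit_exp t) * cnj (g (of_real r * unit_exp t))) has_field_derivative deriv g (s * unit_exp t) * unit_exp t * cnj (g (of_real r * unit_exp t))) (at s within ball 0 1)"
      by (rule has_field_derivative_at_within)
  next
    fix s :: complex assume "s \<in> ball 0 1"
    then have s: "norm s < 1" by simp
    show "(\<lambda>x. g (s * unit_exp x) * cnj (g (of_real r * unit_exp x))) integrable_on cbox 0 1"
      by (intro integrable_continuous continuous_intros continuous_on_circle[OF cg s] continuous_on_circle[OF cg nr(1)])
  next
    have "continuous_on (ball 0 1 \<times> cbox (0::real) 1) (\<lambda>p. deriv g (fst p * unit_exp (snd p)))"
      by (rule continuous_on_compose2[OF cdg]) (auto intro!: continuous_intros simp: norm_mult)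
    moreover have "continuous_on (ball (0::complex) 1 \<times> cbox (0::real) 1) (\<lambda>p. g (of_real r * unit_exp (snd p)))"
      by (rule continuous_on_compose2[OF cg]) (use r in \<open>auto intro!: continuous_intros simp: norm_mult\<close>)
    ultimately show "continuous_on (ball 0 1 \<times> cbox 0 1) (\<lambda>(s, t). deriv g (s * unit_exp t) * unit_exp t * cnj (g (of_real r * unit_exp t)))"
      unfolding case_prod_beta by (intro continuous_intros)
  qed (simp add: convex_ball)
  \<comment> \<open>\<open>P\<close> is the inner product of \<open>g(s \<cdot>)\<close> with \<open>g(r \<cdot>)\<close> on the unit circle; the bound on \<open>|s| = r'\<close> is the inequality of the means\<close>
  have "norm (P (of_real r)) \<le> (circle_avg g (of_real r') + circle_avg g (of_real r)) / 2"
  proof (rule maximum_modulus_frontier[where f=P and S="ball (0::complex) r'" and \<xi>="of_real r"])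
    show "P holomorphic_on interior (ball 0 r')" using r by (intro holomorphic_on_subset[OF hP]) auto
    show "continuous_on (closure (ball 0 r')) P"
      using r r' by (intro continuous_on_subset[OF holomorphic_on_imp_continuous_on[OF hP]]) auto
    show "complex_of_real r \<in> ball 0 r'" using r r' by simp
    fix s :: complex assume "s \<in> frontier (ball 0 r')"
    then have s: "norm s = r'" using r' by simp
    then have s1: "norm s < 1" using r by simp
    obtain t where t: "0 \<le> t" "t \<le> 1" "s = of_real r' * unit_exp t" using exists_unit_exp[OF s] r' by auto
    have "norm (P s) \<le> integral (cbox 0 1) (\<lambda>x. ((cmod (g (s * unit_exp x)))\<^sup>2 + (cmod (g (of_real r * unit_exp x)))\<^sup>2) / 2)"
      unfolding P_def
    proof (rule integral_norm_bound_integral)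
      show "(\<lambda>x. g (s * unit_exp x) * cnj (g (of_real r * unit_exp x))) integrable_on cbox 0 1"
        by (intro integrable_continuous continuous_intros continuous_on_circle[OF cg s1] continuous_on_circle[OF cg nr(1)])
      show "(\<lambda>x. ((cmod (g (s * unit_exp x)))\<^sup>2 + (cmod (g (of_real r * unit_exp x)))\<^sup>2) / 2) integrable_on cbox 0 1"
        by (intro integrable_continuous continuous_intros continuous_on_circle[OF cg s1] continuous_on_circle[OF cg nr(1)]) simp
      fix x :: real
      have "2 * (a * b) \<le> a\<^sup>2 + b\<^sup>2" for a b :: real using sum_squares_bound[of a b] by simp
      from this[of "cmod (g (s * unit_exp x))" "cmod (g (of_real r * unit_exp x))"]
      show "norm (g (s * unit_exp x) * cnj (g (of_real r * unit_exp x))) \<le> ((cmod (g (s * unit_exp x)))\<^sup>2 + (cmod (g (of_real r * unit_exp x)))\<^sup>2) / 2"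
        by (simp add: norm_mult)
    qed
    also have "\<dots> = (circle_avg g s + circle_avg g (of_real r)) / 2"
      using integral_add[OF sqint[OF s1] sqint[OF nr(1)]] by (simp add: circle_avg_def)
    also have "circle_avg g s = circle_avg g (of_real r')"
      unfolding t(3) by (rule circle_avg_rotate[OF cg nr(2) t(1,2)])
    finally show "norm (P s) \<le> (circle_avg g (of_real r') + circle_avg g (of_real r)) / 2" .
  qed simp
  moreover have "P (of_real r) = of_real (circle_avg g (of_real r))"
  proof -
    have "P (of_real r) = integral {0..1} (\<lambda>x. of_real ((cmod (g (of_real r * unit_exp x)))\<^sup>2))"
      unfolding P_def by (simp add: complex_norm_square del: of_real_power)
    then show ?thesis
      using integral_linear[OF sqint[OF nr(1)] bounded_linear_of_real] by (simp add: circle_avg_def o_def)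
  qed
  moreover have "circle_avg g (of_real r) \<ge> 0"
    unfolding circle_avg_def by (rule integral_nonneg[OF sqint[OF nr(1)]]) simp
  ultimately show ?thesis by simp
qed simp

text \<open>Expansion of the square; the mixed term vanishes by the mean value property of \<open>g\<close>.\<close>

lemma circle_avg_variance:
  assumes g: "g holomorphic_on ball 0 1" and r: "0 \<le> r" "r < 1"
  shows "circle_avg g (of_real r) = (cmod (g 0))\<^sup>2 + circle_avg (\<lambda>s. g s - g 0) (of_real r)"
proof -
  have cg: "continuous_on (ball 0 1) g" using g by (rule holomorphic_on_imp_continuous_on)
  have nr: "norm (complex_of_real r) < 1" using r by auto
  let ?h = "\<lambda>x. g (of_real r * unit_exp x) - g 0"
  have "(?h has_integral 0) {0..1}"
    using has_integral_diff[OF circle_mean_value[OF g r] has_integral_const_real[of "g 0" 0 1]] by simp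
  then have "((\<lambda>x. 2 * Re (?h x * cnj (g 0))) has_integral 0) {0..1}"
    using has_integral_mult_right[OF has_integral_Re[OF has_integral_mult_left[of ?h 0 "{0..1}" "cnj (g 0)"]], of 2] by simp
  moreover have "((\<lambda>x. (cmod (?h x))\<^sup>2) has_integral circle_avg (\<lambda>s. g s - g 0) (of_real r)) {0..1}"
    unfolding circle_avg_def
    by (intro integrable_integral integrable_continuous_real continuous_intros continuous_on_circle[OF cg nr])
  moreover have "((\<lambda>x::real. (cmod (g 0))\<^sup>2) has_integral (cmod (g 0))\<^sup>2) {0..1}"
    using has_integral_const_real[of "(cmod (g 0))\<^sup>2" 0 1] by simp
  ultimately have "((\<lambda>x. 2 * Re (?h x * cnj (g 0)) + ((cmod (?h x))\<^sup>2 + (cmod (g 0))\<^sup>2)) has_integral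
     (0 + (circle_avg (\<lambda>s. g s - g 0) (of_real r) + (cmod (g 0))\<^sup>2))) {0..1}"
    by (intro has_integral_add)
  moreover have "2 * Re ((a - b) * cnj b) + ((cmod (a - b))\<^sup>2 + (cmod b)\<^sup>2) = (cmod a)\<^sup>2" for a b
    unfolding cmod_power2 by (simp add: algebra_simps power2_eq_square)
  ultimately show ?thesis unfolding circle_avg_def by (simp add: integral_unique)
qed

lemma nn_circle_avg:
  assumes g: "g holomorphic_on ball 0 1" and r: "0 \<le> r" "r < 1"
  shows "(\<integral>\<^sup>+x\<in>{0..1}. ennreal ((cmod (g (of_real r * unit_exp x)))\<^sup>2) \<partial>lborel) = ennreal (circle_avg g (of_real r))"
proof -
  have cg: "continuous_on (ball 0 1) g" using g by (rule holomorphic_on_imp_continuous_on)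
  have nr: "norm (complex_of_real r) < 1" using r by auto
  have "((\<lambda>x. (cmod (g (of_real r * unit_exp x)))\<^sup>2) has_integral circle_avg g (of_real r)) {0..1}"
    unfolding circle_avg_def
    by (intro integrable_integral integrable_continuous_real continuous_intros continuous_on_circle[OF cg nr])
  from nn_integral_has_integral_lebesgue[OF _ this]
  have "(\<integral>\<^sup>+x. ennreal (indicator {0..1} x * (cmod (g (of_real r * unit_exp x)))\<^sup>2) \<partial>lborel) = ennreal (circle_avg g (of_real r))"
    by simp
  moreover have "ennreal (indicator {0..1} x * (cmod (g (of_real r * unit_exp x)))\<^sup>2)
     = ennreal ((cmod (g (of_real r * unit_exp x)))\<^sup>2) * indicator {0..1} x" for x
    by (simp add: indicator_def)
  ultimately show ?thesis by simp
qed

section \<open>Spherical means in the ball\<close>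

lemma ball_in_sets_borel [measurable]: "ball c r \<in> sets (borel :: 'a::metric_space measure)"
  by simp

lemma nn_integral_lborel_scale:
  fixes f :: "'a::euclidean_space \<Rightarrow> ennreal"
  assumes f: "f \<in> borel_measurable borel" and c: "c \<noteq> 0"
  shows "(\<integral>\<^sup>+x. f x \<partial>lborel) = ennreal (\<bar>c\<bar> ^ DIM('a)) * (\<integral>\<^sup>+x. f (c *\<^sub>R x) \<partial>lborel)"
proof -
  have "(\<integral>\<^sup>+x. f x \<partial>lborel) = (\<integral>\<^sup>+x. f x \<partial>density (distr lborel borel (\<lambda>x. 0 + c *\<^sub>R x)) (\<lambda>_. ennreal (\<bar>c\<bar> ^ DIM('a))))"
    by (subst lborel_affine[OF c, of 0]) (simp add: ennreal_power)
  also have "\<dots> = ennreal (\<bar>c\<bar> ^ DIM('a)) * (\<integral>\<^sup>+x. f (c *\<^sub>R x) \<partial>lborel)"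
    using f by (simp add: nn_integral_density nn_integral_distr nn_integral_cmult)
  finally show ?thesis .
qed

lemma lborel_Fubini:
  fixes f :: "'a::euclidean_space \<times> 'b::euclidean_space \<Rightarrow> ennreal"
  assumes "f \<in> borel_measurable (lborel \<Otimes>\<^sub>M lborel)"
  shows "(\<integral>\<^sup>+x. \<integral>\<^sup>+y. f (x, y) \<partial>lborel \<partial>lborel) = (\<integral>\<^sup>+y. \<integral>\<^sup>+x. f (x, y) \<partial>lborel \<partial>lborel)"
  using lborel_pair.Fubini[OF assms] by simp

lemma nn_integral_lborel_cong_nonzero:
  fixes f g :: "'a::euclidean_space \<Rightarrow> ennreal"
  assumes "\<And>x. x \<noteq> 0 \<Longrightarrow> f x = g x"
  shows "(\<integral>\<^sup>+x. f x \<partial>lborel) = (\<integral>\<^sup>+x. g x \<partial>lborel)"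
proof (rule nn_integral_cong_AE)
  show "AE x in lborel. f x = g x"
    using AE_lborel_singleton[of "0::'a"] by eventually_elim (rule assms)
qed

text \<open>Polar coordinates without a measure on the sphere: the direction of a uniformly distributed
  vector of the ball is used as the random direction.  Three substitutions \<open>v \<mapsto> c v\<close> and two
  applications of Tonelli's theorem show that both sides agree up to a factor independent of
  \<open>\<phi>\<close> and \<open>u\<close>, which is then found from \<open>u = 1\<close>.\<close>

lemma radial_averaging:
  fixes u :: "'a::euclidean_space \<Rightarrow> ennreal" and \<phi> :: "real \<Rightarrow> ennreal"
  assumes [measurable]: "u \<in> borel_measurable borel" "\<phi> \<in> borel_measurable borel"
  shows "(\<integral>\<^sup>+t. \<phi> (norm t) * (\<integral>\<^sup>+v. indicator (ball 0 1) v * u ((norm t / norm v) *\<^sub>R v) \<partial>lborel) \<partial>(lborel :: 'a measure))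
    = emeasure lborel (ball 0 1 :: 'a set) * (\<integral>\<^sup>+t. \<phi> (norm t) * u t \<partial>lborel)"
proof -
  define q :: "'a \<Rightarrow> ennreal" where "q = (\<lambda>t. ennreal ((1 / norm t) ^ DIM('a)))"
  have [measurable]: "q \<in> borel_measurable borel" unfolding q_def by measurable
  define C where "C = (\<integral>\<^sup>+t. q t * q t * indicator {t. 1 < norm t} t \<partial>lborel)"
  have main: "(\<integral>\<^sup>+t. \<phi> (norm t) * (\<integral>\<^sup>+v. indicator (ball 0 1) v * u ((norm t / norm v) *\<^sub>R v) \<partial>lborel) \<partial>(lborel :: 'a measure))
    = C * (\<integral>\<^sup>+t. \<phi> (norm t) * u t \<partial>lborel)"
    if [measurable]: "u \<in> borel_measurable borel" "\<phi> \<in> borel_measurable borel"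
    for u :: "'a \<Rightarrow> ennreal" and \<phi> :: "real \<Rightarrow> ennreal"
  proof -
    define G where "G = (\<lambda>(t, v). \<phi> (norm t) * q t * indicator {p. norm (snd p) < norm (fst p)} (t, v) * u ((norm t / norm v) *\<^sub>R v))"
    have [measurable]: "{p :: 'a \<times> 'a. norm (snd p) < norm (fst p)} \<in> sets (borel \<Otimes>\<^sub>M borel)"
      unfolding borel_prod by (intro borel_open open_Collect_less continuous_intros)
    have [measurable]: "G \<in> borel_measurable (lborel \<Otimes>\<^sub>M lborel)" unfolding G_def by measurable
    define K where "K = (\<lambda>(v, t). \<phi> (norm (norm t *\<^sub>R v)) * q t * indicator {t. 1 < norm t} t * u (norm t *\<^sub>R v))"
    have [measurable]: "K \<in> borel_measurable (lborel \<Otimes>\<^sub>M lborel)" unfolding K_def by measurable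
    have 1: "\<phi> (norm t) * (\<integral>\<^sup>+v. indicator (ball 0 1) v * u ((norm t / norm v) *\<^sub>R v) \<partial>lborel) = (\<integral>\<^sup>+v. G (t, v) \<partial>lborel)"
      if t: "t \<noteq> 0" for t
    proof -
      have "(\<integral>\<^sup>+v. indicator (ball 0 1) v * u ((norm t / norm v) *\<^sub>R v) \<partial>lborel)
        = q t * (\<integral>\<^sup>+v. indicator (ball 0 1) ((1 / norm t) *\<^sub>R v) * u ((norm t / norm ((1 / norm t) *\<^sub>R v)) *\<^sub>R ((1 / norm t) *\<^sub>R v)) \<partial>lborel)"
        unfolding q_def using t by (subst nn_integral_lborel_scale[of _ "1 / norm t"]) auto
      also have "(\<integral>\<^sup>+v. indicator (ball 0 1) ((1 / norm t) *\<^sub>R v) * u ((norm t / norm ((1 / norm t) *\<^sub>R v)) *\<^sub>R ((1 / norm t) *\<^sub>R v)) \<partial>lborel)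
        = (\<integral>\<^sup>+v. indicator {p. norm (snd p) < norm (fst p)} (t, v) * u ((norm t / norm v) *\<^sub>R v) \<partial>lborel)"
        using t by (intro nn_integral_cong) (simp add: indicator_def field_simps)
      finally show ?thesis unfolding G_def by (simp add: nn_integral_cmult mult.assoc)
    qed
    have 2: "(\<integral>\<^sup>+t. G (t, v) \<partial>lborel) = (\<integral>\<^sup>+t. K (v, t) \<partial>lborel)" if v: "v \<noteq> 0" for v
    proof -
      have "(\<integral>\<^sup>+t. G (t, v) \<partial>lborel) = ennreal (norm v ^ DIM('a)) * (\<integral>\<^sup>+t. G (norm v *\<^sub>R t, v) \<partial>lborel)"
        using v by (subst nn_integral_lborel_scale[of _ "norm v"]) auto
      also have "\<dots> = (\<integral>\<^sup>+t. ennreal (norm v ^ DIM('a)) * G (norm v *\<^sub>R t, v) \<partial>lborel)"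
        by (rule nn_integral_cmult[symmetric]) measurable
      also have "\<dots> = (\<integral>\<^sup>+t. K (v, t) \<partial>lborel)"
      proof (rule nn_integral_cong)
        fix t :: 'a
        have e1: "ennreal (norm v ^ DIM('a)) * q (norm v *\<^sub>R t) = q t"
          using v unfolding q_def by (simp add: ennreal_mult'[symmetric] power_divide power_mult_distrib)
        have e2: "(indicator {p. norm (snd p) < norm (fst p)} (norm v *\<^sub>R t, v) :: ennreal) = indicator {t. 1 < norm t} t"
          using v by (simp add: indicator_def)
        have e3: "(norm (norm v *\<^sub>R t) / norm v) *\<^sub>R v = norm t *\<^sub>R v" using v by simp
        have e4: "norm (norm v *\<^sub>R t) = norm (norm t *\<^sub>R v)" by simp
        show "ennreal (norm v ^ DIM('a)) * G (norm v *\<^sub>R t, v) = K (v, t)"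
          unfolding G_def K_def case_prod_conv e2 e3 unfolding e4 e1[symmetric] by (simp only: mult_ac)
      qed
      finally show ?thesis .
    qed
    have 3: "(\<integral>\<^sup>+v. K (v, t) \<partial>lborel) = q t * q t * indicator {t. 1 < norm t} t * (\<integral>\<^sup>+v. \<phi> (norm v) * u v \<partial>lborel)" for t
    proof (cases "1 < norm t")
      case True
      then have t0: "t \<noteq> 0" by auto
      let ?X = "\<integral>\<^sup>+v. \<phi> (norm (norm t *\<^sub>R v)) * u (norm t *\<^sub>R v) \<partial>lborel"
      have "K (v, t) = q t * (\<phi> (norm (norm t *\<^sub>R v)) * u (norm t *\<^sub>R v))" for v
        using True by (simp add: K_def mult_ac)
      then have k1: "(\<integral>\<^sup>+v. K (v, t) \<partial>lborel) = q t * ?X"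
        by (simp only:) (rule nn_integral_cmult, measurable)
      have k2: "(\<integral>\<^sup>+v. \<phi> (norm v) * u v \<partial>lborel) = ennreal (norm t ^ DIM('a)) * ?X"
        using t0 by (subst nn_integral_lborel_scale[of _ "norm t"]) simp_all
      have k3: "q t * ennreal (norm t ^ DIM('a)) = 1"
        using t0 unfolding q_def by (simp add: ennreal_mult'[symmetric] power_divide)
      have "q t * q t * (ennreal (norm t ^ DIM('a)) * ?X) = (q t * ennreal (norm t ^ DIM('a))) * (q t * ?X)"
        by (simp only: mult_ac)
      then show ?thesis using True unfolding k1 k2 k3 by (simp only: indicator_simps mem_Collect_eq mult_1_left mult_1_right)
    qed (simp add: K_def)
    have "(\<integral>\<^sup>+t. \<phi> (norm t) * (\<integral>\<^sup>+v. indicator (ball 0 1) v * u ((norm t / norm v) *\<^sub>R v) \<partial>lborel) \<partial>(lborel :: 'a measure))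
       = (\<integral>\<^sup>+t. \<integral>\<^sup>+v. G (t, v) \<partial>lborel \<partial>lborel)"
      by (rule nn_integral_lborel_cong_nonzero) (rule 1)
    also have "\<dots> = (\<integral>\<^sup>+v. \<integral>\<^sup>+t. G (t, v) \<partial>lborel \<partial>lborel)" by (rule lborel_Fubini) measurable
    also have "\<dots> = (\<integral>\<^sup>+v. \<integral>\<^sup>+t. K (v, t) \<partial>lborel \<partial>lborel)"
      by (rule nn_integral_lborel_cong_nonzero) (rule 2)
    also have "\<dots> = (\<integral>\<^sup>+t. \<integral>\<^sup>+v. K (v, t) \<partial>lborel \<partial>lborel)" by (rule lborel_Fubini) measurable
    also have "\<dots> = C * (\<integral>\<^sup>+t. \<phi> (norm t) * u t \<partial>lborel)"
      unfolding 3 C_def by (rule nn_integral_multc) measurable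
    finally show ?thesis .
  qed
  define V where "V = emeasure lborel (ball 0 1 :: 'a set)"
  have V: "V \<noteq> 0" "V \<noteq> \<infinity>"
    using emeasure_lborel_ball_finite[of "0::'a" 1] unit_ball_vol_pos[of "real DIM('a)"]
    by (auto simp: V_def emeasure_ball simp del: unit_ball_vol_pos)
  have one: "indicator {..<1} (norm t) = (indicator (ball 0 1) t :: ennreal)" for t :: 'a by (simp add: indicator_def)
  have "C * V = V * V"
    using main[of "\<lambda>_. 1" "indicator {..<1}"] unfolding one by (simp add: V_def nn_integral_multc)
  then have "C * V / V = V * V / V" by (rule arg_cong[where f="\<lambda>x. x / V"])
  moreover have "V \<noteq> top_class.top" using V(2) by simp
  ultimately have "C = V" using V(1) mult_divide_eq_ennreal[of V] by metis
  then show ?thesis using main[of u \<phi>] by (simp add: V_def)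
qed

lemma nn_integral_hyp:
  fixes f :: "complex^'n \<Rightarrow> ennreal"
  assumes f: "f \<in> borel_measurable borel"
  shows "(\<integral>\<^sup>+z. f z \<partial>hyp_volume) =
    (\<integral>\<^sup>+z. ennreal (2 ^ CARD('n) / (1 - (norm z)\<^sup>2) ^ (CARD('n) + 1)) * indicator \<bbbB> z * f z \<partial>lborel)"
proof -
  have "(\<integral>\<^sup>+z. f z \<partial>hyp_volume) = (\<integral>\<^sup>+z. ennreal (2 ^ CARD('n) / (1 - (norm z)\<^sup>2) ^ (CARD('n) + 1)) * f z \<partial>restrict_space lborel \<bbbB>)"
    unfolding hyp_volume_def
    by (rule nn_integral_density) (use f in \<open>auto intro: measurable_restrict_space1\<close>)
  also have "\<dots> = (\<integral>\<^sup>+z. ennreal (2 ^ CARD('n) / (1 - (norm z)\<^sup>2) ^ (CARD('n) + 1)) * f z * indicator \<bbbB> z \<partial>lborel)"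
    by (rule nn_integral_restrict_space) simp
  finally show ?thesis by (simp add: mult_ac)
qed

lemma nn_integral_ball_as_hyp:
  fixes f :: "complex^'n \<Rightarrow> ennreal"
  assumes [measurable]: "f \<in> borel_measurable borel"
  shows "(\<integral>\<^sup>+z. indicator \<bbbB> z * f z \<partial>lborel) = (\<integral>\<^sup>+z. ennreal ((1 - (norm z)\<^sup>2) ^ (CARD('n) + 1) / 2 ^ CARD('n)) * f z \<partial>hyp_volume)"
proof -
  have "(\<integral>\<^sup>+z. ennreal ((1 - (norm z)\<^sup>2) ^ (CARD('n) + 1) / 2 ^ CARD('n)) * f z \<partial>hyp_volume)
    = (\<integral>\<^sup>+z. ennreal (2 ^ CARD('n) / (1 - (norm z)\<^sup>2) ^ (CARD('n) + 1)) * indicator \<bbbB> z *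
       (ennreal ((1 - (norm z)\<^sup>2) ^ (CARD('n) + 1) / 2 ^ CARD('n)) * f z) \<partial>lborel)"
    by (rule nn_integral_hyp) measurable
  also have "\<dots> = (\<integral>\<^sup>+z. indicator \<bbbB> z * f z \<partial>lborel)"
  proof (rule nn_integral_cong)
    fix z :: "complex^'n"
    show "ennreal (2 ^ CARD('n) / (1 - (norm z)\<^sup>2) ^ (CARD('n) + 1)) * indicator \<bbbB> z *
       (ennreal ((1 - (norm z)\<^sup>2) ^ (CARD('n) + 1) / 2 ^ CARD('n)) * f z) = indicator \<bbbB> z * f z"
    proof (cases "z \<in> \<bbbB>")
      case True
      then have p: "0 < 1 - (norm z)\<^sup>2" by (intro one_minus_norm_sq_pos) simp
      then have "ennreal (2 ^ CARD('n) / (1 - (norm z)\<^sup>2) ^ (CARD('n) + 1)) * ennreal ((1 - (norm z)\<^sup>2) ^ (CARD('n) + 1) / 2 ^ CARD('n)) = 1"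
        by (simp add: ennreal_mult[symmetric] del: power_Suc)
      then show ?thesis using True by (simp add: mult.assoc[symmetric])
    qed simp
  qed
  finally show ?thesis by simp
qed

lemma ball_auto_unitary:
  fixes U :: "complex^'n \<Rightarrow> complex^'n"
  assumes "linear U" "\<And>c v. U (c *s v) = c *s U v" "\<And>v. norm (U v) = norm v"
    and "linear W" "\<And>c v. W (c *s v) = c *s W v" "\<And>v. W (U v) = v" "\<And>v. U (W v) = v"
  shows "ball_auto U"
proof (rule ball_autoI[of _ W])
  have h: "holo_map_on L \<bbbB>" if "linear L" "\<And>c v. L (c *s v) = c *s L v" for L :: "complex^'n \<Rightarrow> complex^'n"
    unfolding holo_map_on_def using that linear_conv_bounded_linear bounded_linear_imp_has_derivative by blast
  show "holo_map_on U \<bbbB>" "holo_map_on W \<bbbB>" using h assms by blast+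
  have "norm (W v) = norm v" for v using assms(3)[of "W v"] by (simp add: assms(7))
  then show "U ` \<bbbB> \<subseteq> \<bbbB>" "W ` \<bbbB> \<subseteq> \<bbbB>" by (auto simp: assms(3))
qed (simp_all add: assms)

lemma ball_auto_phase: assumes "norm c = 1" shows "ball_auto ((*s) c)"
proof (rule ball_auto_unitary[where W="(*s) (1 / c)"])
  have "linear ((*s) k :: complex^'a \<Rightarrow> _)" for k :: complex
    by (rule linearI) (simp_all add: vec_eq_iff algebra_simps)
  then show "linear ((*s) c :: complex^'a \<Rightarrow> _)" "linear ((*s) (1 / c) :: complex^'a \<Rightarrow> _)" by blast+
  have "c \<noteq> 0" using assms by auto
  then show "(1 / c) *s (c *s v) = v" "c *s ((1 / c) *s v) = v" for v :: "complex^'a" by simp_all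
  show "c *s (k *s v) = k *s (c *s v)" "(1 / c) *s (k *s v) = k *s ((1 / c) *s v)" for k and v :: "complex^'a"
    by (simp_all add: vec_eq_iff)
  show "norm (c *s v) = norm v" for v :: "complex^'a" by (simp add: norm_vector_smult assms)
qed

lemma nn_integral_ball_phase:
  fixes f :: "complex^'n \<Rightarrow> ennreal"
  assumes f: "f \<in> borel_measurable borel" and c: "norm c = 1"
  shows "(\<integral>\<^sup>+z. indicator \<bbbB> z * f (c *s z) \<partial>lborel) = (\<integral>\<^sup>+z. indicator \<bbbB> z * f z \<partial>lborel)"
proof -
  have m: "((*s) c :: complex^'n \<Rightarrow> _) \<in> borel_measurable borel"
    by (intro borel_measurable_continuous_onI continuous_intros)
  have [measurable]: "f \<in> borel_measurable hyp_volume" "f \<in> borel_measurable borel"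
    using f measurable_compose[OF hyp_incl_measurable f] by simp_all
  have "(\<integral>\<^sup>+z. indicator \<bbbB> z * f (c *s z) \<partial>lborel) = (\<integral>\<^sup>+z. ennreal ((1 - (norm z)\<^sup>2) ^ (CARD('n) + 1) / 2 ^ CARD('n)) * f (c *s z) \<partial>hyp_volume)"
    by (rule nn_integral_ball_as_hyp) (rule measurable_compose[OF m f])
  also have "\<dots> = (\<integral>\<^sup>+z. ennreal ((1 - (norm (c *s z))\<^sup>2) ^ (CARD('n) + 1) / 2 ^ CARD('n)) * f (c *s z) \<partial>hyp_volume)"
    by (simp add: norm_vector_smult c)
  also have "\<dots> = (\<integral>\<^sup>+z. ennreal ((1 - (norm z)\<^sup>2) ^ (CARD('n) + 1) / 2 ^ CARD('n)) * f z \<partial>hyp_volume)"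
  proof (rule nn_integral_hyp_invariant[OF ball_auto_phase[OF c], of "\<lambda>z. ennreal ((1 - (norm z)\<^sup>2) ^ (CARD('n) + 1) / 2 ^ CARD('n)) * f z"])
    have "(\<lambda>z :: complex^'n. ennreal ((1 - (norm z)\<^sup>2) ^ (CARD('n) + 1) / 2 ^ CARD('n))) \<in> borel_measurable borel" by measurable
    from measurable_compose[OF hyp_incl_measurable this]
    show "(\<lambda>z. ennreal ((1 - (norm z)\<^sup>2) ^ (CARD('n) + 1) / 2 ^ CARD('n)) * f z) \<in> borel_measurable hyp_volume" by measurable
  qed
  also have "\<dots> = (\<integral>\<^sup>+z. indicator \<bbbB> z * f z \<partial>lborel)"
    by (rule nn_integral_ball_as_hyp[symmetric]) measurable
  finally show ?thesis .
qed

definition ball_vol :: "'n::finite itself \<Rightarrow> ennreal" where "ball_vol _ = emeasure lborel (\<bbbB> :: (complex^'n) set)"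

lemma ball_vol_nz: "ball_vol TYPE('n::finite) \<noteq> 0" "ball_vol TYPE('n) \<noteq> \<infinity>" "ball_vol TYPE('n) \<noteq> top_class.top"
proof -
  have "emeasure lborel (\<bbbB> :: (complex^'n) set) = ennreal (unit_ball_vol (real DIM(complex^'n)))"
    by (simp only: emeasure_ball[OF zero_le_one] power_one mult_1_right)
  moreover have "unit_ball_vol (real DIM(complex^'n)) > 0" by (rule unit_ball_vol_pos) simp
  ultimately show "ball_vol TYPE('n::finite) \<noteq> 0" "ball_vol TYPE('n) \<noteq> \<infinity>" "ball_vol TYPE('n) \<noteq> top_class.top"
    unfolding ball_vol_def by (simp_all only: ennreal_eq_0_iff infinity_ennreal_def ennreal_neq_top not_le not_False_eq_True)
qed

text \<open>The mean over the sphere of radius \<open>r\<close>, with the direction \<open>v / |v|\<close> of a uniformly distributed vector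
  of the ball in place of surface measure.\<close>

definition sphere_mean :: "(complex^'n \<Rightarrow> ennreal) \<Rightarrow> real \<Rightarrow> ennreal"
  where "sphere_mean u r = (\<integral>\<^sup>+v. indicator \<bbbB> v * u ((r / norm v) *\<^sub>R v) \<partial>lborel) / ball_vol TYPE('n)"

lemma sphere_mean_measurable [measurable]:
  assumes [measurable]: "u \<in> borel_measurable borel"
  shows "sphere_mean u \<in> borel_measurable borel"
proof -
  have "(\<lambda>r. \<integral>\<^sup>+v. indicator \<bbbB> v * u ((r / norm v) *\<^sub>R v) \<partial>lborel) \<in> borel_measurable borel"
    by measurable
  then show ?thesis unfolding sphere_mean_def by measurable
qed

lemma nn_integral_hyp_radial:
  fixes u :: "complex^'n \<Rightarrow> ennreal"
  assumes [measurable]: "u \<in> borel_measurable borel" "\<phi> \<in> borel_measurable borel"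
  shows "(\<integral>\<^sup>+t. \<phi> (norm t) * u t \<partial>hyp_volume) = (\<integral>\<^sup>+t. \<phi> (norm t) * sphere_mean u (norm t) \<partial>(hyp_volume :: (complex^'n) measure))"
proof -
  define \<psi> :: "real \<Rightarrow> ennreal" where "\<psi> r = ennreal (2 ^ CARD('n) / (1 - r\<^sup>2) ^ (CARD('n) + 1)) * indicator {..<1} r * \<phi> r" for r
  have [measurable]: "\<psi> \<in> borel_measurable borel" unfolding \<psi>_def by measurable
  have ps: "ennreal (2 ^ CARD('n) / (1 - (norm t)\<^sup>2) ^ (CARD('n) + 1)) * indicator \<bbbB> t * (\<phi> (norm t) * x) = \<psi> (norm t) * x" for t :: "complex^'n" and x
    by (simp add: \<psi>_def mult_ac indicator_def)
  have h: "(\<integral>\<^sup>+t. \<phi> (norm t) * w t \<partial>hyp_volume) = (\<integral>\<^sup>+t. \<psi> (norm t) * w t \<partial>lborel)"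
    if [measurable]: "w \<in> borel_measurable borel" for w :: "complex^'n \<Rightarrow> ennreal"
    unfolding ps[symmetric] by (rule nn_integral_hyp) measurable
  have sm: "(\<lambda>t :: complex^'n. sphere_mean u (norm t)) \<in> borel_measurable borel" by measurable
  have "(\<integral>\<^sup>+t. \<psi> (norm t) * (\<integral>\<^sup>+v. indicator \<bbbB> v * u ((norm t / norm v) *\<^sub>R v) \<partial>lborel) \<partial>(lborel :: (complex^'n) measure))
     = ball_vol TYPE('n) * (\<integral>\<^sup>+t. \<psi> (norm t) * u t \<partial>lborel)"
    unfolding ball_vol_def by (rule radial_averaging) measurable
  then have "(\<integral>\<^sup>+t. \<psi> (norm t) * (\<integral>\<^sup>+v. indicator \<bbbB> v * u ((norm t / norm v) *\<^sub>R v) \<partial>lborel) \<partial>(lborel :: (complex^'n) measure)) / ball_vol TYPE('n)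
     = ball_vol TYPE('n) * (\<integral>\<^sup>+t. \<psi> (norm t) * u t \<partial>lborel) / ball_vol TYPE('n)" by (rule arg_cong[where f="\<lambda>x. x / ball_vol TYPE('n)"])
  also have "\<dots> = (\<integral>\<^sup>+t. \<psi> (norm t) * u t \<partial>lborel)"
    unfolding mult.commute[of "ball_vol TYPE('n)"] by (rule mult_divide_eq_ennreal[OF ball_vol_nz(1) ball_vol_nz(3)])
  finally have "(\<integral>\<^sup>+t. \<psi> (norm t) * u t \<partial>lborel) =
     (\<integral>\<^sup>+t. \<psi> (norm t) * (\<integral>\<^sup>+v. indicator \<bbbB> v * u ((norm t / norm v) *\<^sub>R v) \<partial>lborel) \<partial>(lborel :: (complex^'n) measure)) / ball_vol TYPE('n)" by (rule sym)
  also have "(\<integral>\<^sup>+t. \<psi> (norm t) * (\<integral>\<^sup>+v. indicator \<bbbB> v * u ((norm t / norm v) *\<^sub>R v) \<partial>lborel) \<partial>(lborel :: (complex^'n) measure)) / ball_vol TYPE('n) = (\<integral>\<^sup>+t. \<psi> (norm t) * (\<integral>\<^sup>+v. indicator \<bbbB> v * u ((norm t / norm v) *\<^sub>R v) \<partial>lborel) / ball_vol TYPE('n) \<partial>(lborel :: (complex^'n) measure))"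
    by (rule nn_integral_divide[symmetric]) measurable
  also have "\<dots> = (\<integral>\<^sup>+t. \<psi> (norm t) * sphere_mean u (norm t) \<partial>(lborel :: (complex^'n) measure))"
    unfolding sphere_mean_def by (simp only: ennreal_times_divide)
  finally show ?thesis unfolding h[OF assms(1)] h[OF sm] .
qed

lemma borel_measurable_unit_exp [measurable]: "unit_exp \<in> borel_measurable borel"
  by (rule borel_measurable_continuous_onI[OF continuous_on_unit_exp[OF continuous_on_id]])

lemma borel_measurable_vector_smult [measurable (raw)]:
  fixes b :: "_ \<Rightarrow> complex^'n"
  assumes "a \<in> borel_measurable M" "b \<in> borel_measurable M"
  shows "(\<lambda>x. a x *s b x) \<in> borel_measurable M"
proof -
  have "(\<lambda>p :: complex \<times> (complex^'n). fst p *s snd p) \<in> borel_measurable borel"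
    by (intro borel_measurable_continuous_onI continuous_intros)
  then have "(\<lambda>p :: complex \<times> (complex^'n). fst p *s snd p) \<in> borel_measurable (borel \<Otimes>\<^sub>M borel)"
    by (simp add: borel_prod)
  from measurable_compose[OF measurable_Pair[OF assms] this] show ?thesis by simp
qed

lemma circle_integral_measurable:
  fixes u :: "complex^'n \<Rightarrow> ennreal"
  assumes [measurable]: "u \<in> borel_measurable borel"
  shows "(\<lambda>v. \<integral>\<^sup>+x\<in>{0..1}. u ((of_real r * unit_exp x) *s ((1 / norm v) *\<^sub>R v)) \<partial>lborel) \<in> borel_measurable borel"
proof -
  show ?thesis by measurable
qed

text \<open>The sphere is invariant under phases.  Averaging over them expresses a spherical mean by circle
  averages on complex lines through the origin.\<close>

lemma sphere_mean_circle:
  fixes u :: "complex^'n \<Rightarrow> ennreal"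
  assumes [measurable]: "u \<in> borel_measurable borel"
  shows "sphere_mean u r = (\<integral>\<^sup>+v. indicator \<bbbB> v * (\<integral>\<^sup>+x\<in>{0..1}. u ((of_real r * unit_exp x) *s ((1 / norm v) *\<^sub>R v)) \<partial>lborel) \<partial>lborel) / ball_vol TYPE('n)"
proof -
  note sm = borel_measurable_vector_smult
  define I where "I = (\<integral>\<^sup>+v. indicator \<bbbB> v * u ((r / norm v) *\<^sub>R v) \<partial>lborel)"
  have I: "I = (\<integral>\<^sup>+v. indicator \<bbbB> v * u ((of_real r * unit_exp x) *s ((1 / norm v) *\<^sub>R v)) \<partial>lborel)" for x
  proof -
    have "I = (\<integral>\<^sup>+v. indicator \<bbbB> v * u ((r / norm (unit_exp x *s v)) *\<^sub>R (unit_exp x *s v)) \<partial>lborel)"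
      unfolding I_def by (rule nn_integral_ball_phase[of "\<lambda>v. u ((r / norm v) *\<^sub>R v)" "unit_exp x", symmetric]) simp_all
    moreover have "(r / norm (unit_exp x *s v)) *\<^sub>R (unit_exp x *s v) = (of_real r * unit_exp x) *s ((1 / norm v) *\<^sub>R v)" for v :: "complex^'n"
      by (simp add: norm_vector_smult scaleR_vec_complex mult_ac)
    ultimately show ?thesis by (simp only:)
  qed
  have "I = (\<integral>\<^sup>+x. indicator {0..1} x * I \<partial>(lborel :: real measure))" by (simp add: nn_integral_multc)
  also have "\<dots> = (\<integral>\<^sup>+x. \<integral>\<^sup>+v. indicator {0..1} x * (indicator \<bbbB> v * u ((of_real r * unit_exp x) *s ((1 / norm v) *\<^sub>R v))) \<partial>lborel \<partial>lborel)"
  proof (rule nn_integral_cong)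
    fix x :: real
    show "indicator {0..1} x * I = (\<integral>\<^sup>+v. indicator {0..1} x * (indicator \<bbbB> v * u ((of_real r * unit_exp x) *s ((1 / norm v) *\<^sub>R v))) \<partial>lborel)"
      by (subst I[of x], rule nn_integral_cmult[symmetric]) measurable
  qed
  also have "\<dots> = (\<integral>\<^sup>+v. \<integral>\<^sup>+x. indicator {0..1} x * (indicator \<bbbB> v * u ((of_real r * unit_exp x) *s ((1 / norm v) *\<^sub>R v))) \<partial>lborel \<partial>lborel)"
    using lborel_Fubini[of "\<lambda>(x, v). indicator {0..1} x * (indicator \<bbbB> v * u ((of_real r * unit_exp x) *s ((1 / norm v) *\<^sub>R v)))"]
    by simp
  also have "\<dots> = (\<integral>\<^sup>+v. indicator \<bbbB> v * (\<integral>\<^sup>+x\<in>{0..1}. u ((of_real r * unit_exp x) *s ((1 / norm v) *\<^sub>R v)) \<partial>lborel) \<partial>lborel)"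
    by (intro nn_integral_cong, subst nn_integral_cmult[symmetric]) (measurable, simp add: mult_ac)
  finally show ?thesis unfolding sphere_mean_def I_def by simp
qed

text \<open>The value \<open>0\<close> outside the ball makes the function Borel measurable on the whole space.\<close>

definition ball_sq :: "(complex^'n \<Rightarrow> complex) \<Rightarrow> complex^'n \<Rightarrow> ennreal"
  where "ball_sq f t = indicator \<bbbB> t * ennreal ((cmod (f t))\<^sup>2)"

lemma borel_measurable_ball_sq [measurable]:
  assumes "continuous_on \<bbbB> f" shows "ball_sq f \<in> borel_measurable borel"
proof -
  have "(\<lambda>t. indicator \<bbbB> t *\<^sub>R (cmod (f t))\<^sup>2) \<in> borel_measurable borel"
    by (rule borel_measurable_continuous_on_indicator) (auto intro!: continuous_intros assms)
  then have "(\<lambda>t. ennreal (indicator \<bbbB> t *\<^sub>R (cmod (f t))\<^sup>2)) \<in> borel_measurable borel" by measurable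
  moreover have "ennreal (indicator \<bbbB> t *\<^sub>R (cmod (f t))\<^sup>2) = ball_sq f t" for t
    by (simp add: ball_sq_def indicator_def)
  ultimately show ?thesis by (simp only:)
qed

lemma circle_integral_ball_sq:
  fixes f :: "complex^'n \<Rightarrow> complex"
  assumes f: "cholo_on f \<bbbB>" and r: "0 \<le> r" "r < 1"
  shows "(\<integral>\<^sup>+x\<in>{0..1}. ball_sq f ((of_real r * unit_exp x) *s ((1 / norm v) *\<^sub>R v)) \<partial>lborel)
     = ennreal (circle_avg (\<lambda>s. f (s *s ((1 / norm v) *\<^sub>R v))) (of_real r))"
proof -
  define e where "e = (1 / norm v) *\<^sub>R v"
  have e: "norm e \<le> 1" by (simp add: e_def)
  have "norm ((of_real r * unit_exp x) *s e) < 1" for x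
    using e r by (simp add: norm_vector_smult norm_mult) (smt (verit) mult_left_le norm_ge_zero)
  then have "ball_sq f ((of_real r * unit_exp x) *s e) = ennreal ((cmod (f ((of_real r * unit_exp x) *s e)))\<^sup>2)" for x
    by (simp add: ball_sq_def)
  then show ?thesis
    using nn_circle_avg[OF cholo_on_slice[OF f e] r] by (simp add: e_def[symmetric])
qed

lemma sphere_mean_ball_sq:
  fixes f :: "complex^'n \<Rightarrow> complex"
  assumes f: "cholo_on f \<bbbB>" and r: "0 \<le> r" "r < 1"
  shows "sphere_mean (ball_sq f) r =
    (\<integral>\<^sup>+v. indicator \<bbbB> v * ennreal (circle_avg (\<lambda>s. f (s *s ((1 / norm v) *\<^sub>R v))) (of_real r)) \<partial>lborel) / ball_vol TYPE('n)"
  unfolding sphere_mean_circle[OF borel_measurable_ball_sq[OF cholo_on_imp_continuous_on[OF f]]] circle_integral_ball_sq[OF f r] ..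

lemma sphere_mean_mono:
  assumes f: "cholo_on f \<bbbB>" and r: "0 \<le> r" "r \<le> r'" "r' < 1"
  shows "sphere_mean (ball_sq f) r \<le> sphere_mean (ball_sq f) r'"
proof -
  have "circle_avg (\<lambda>s. f (s *s ((1 / norm v) *\<^sub>R v))) (of_real r) \<le> circle_avg (\<lambda>s. f (s *s ((1 / norm v) *\<^sub>R v))) (of_real r')" for v
    by (rule circle_avg_mono[OF cholo_on_slice[OF f] r]) simp
  then show ?thesis
    unfolding sphere_mean_ball_sq[OF f r(1) order_le_less_trans[OF r(2,3)]] sphere_mean_ball_sq[OF f order_trans[OF r(1,2)] r(3)]
    by (intro divide_right_mono_ennreal nn_integral_mono mult_left_mono ennreal_leI) auto
qed

lemma cholo_on_diff_const: "cholo_on f S \<Longrightarrow> cholo_on (\<lambda>t. f t - c) S"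
  unfolding cholo_on_def
proof
  fix z assume "\<forall>z\<in>S. \<exists>D. (f has_derivative D) (at z) \<and> (\<forall>a v. D (a *s v) = a * D v)" "z \<in> S"
  then obtain D where D: "(f has_derivative D) (at z)" "\<forall>a v. D (a *s v) = a * D v" by blast
  from has_derivative_diff[OF D(1) has_derivative_const[of c]]
  have "((\<lambda>t. f t - c) has_derivative D) (at z)" by simp
  then show "\<exists>D. ((\<lambda>t. f t - c) has_derivative D) (at z) \<and> (\<forall>a v. D (a *s v) = a * D v)"
    using D(2) by blast
qed

lemma sphere_mean_variance:
  fixes f :: "complex^'n \<Rightarrow> complex"
  assumes f: "cholo_on f \<bbbB>" and r: "0 \<le> r" "r < 1"
  shows "sphere_mean (ball_sq f) r = ennreal ((cmod (f 0))\<^sup>2) + sphere_mean (ball_sq (\<lambda>t. f t - f 0)) r"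
proof -
  let ?A = "\<lambda>v. ennreal (circle_avg (\<lambda>s. f (s *s ((1 / norm v) *\<^sub>R v)) - f 0) (of_real r))"
  have var: "circle_avg (\<lambda>s. f (s *s ((1 / norm v) *\<^sub>R v))) (of_real r) = (cmod (f 0))\<^sup>2 + circle_avg (\<lambda>s. f (s *s ((1 / norm v) *\<^sub>R v)) - f 0) (of_real r)" for v
    using circle_avg_variance[OF cholo_on_slice[OF f, of "(1 / norm v) *\<^sub>R v"] r] by simp
  have nn: "circle_avg g s \<ge> 0" for g s
    unfolding circle_avg_def by (cases "(\<lambda>x. (cmod (g (s * unit_exp x)))\<^sup>2) integrable_on {0..1}") (simp_all add: integral_nonneg not_integrable_integral)
  have "(\<integral>\<^sup>+v. indicator \<bbbB> v * ennreal (circle_avg (\<lambda>s. f (s *s ((1 / norm v) *\<^sub>R v))) (of_real r)) \<partial>lborel)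
     = (\<integral>\<^sup>+v. indicator \<bbbB> v * ennreal ((cmod (f 0))\<^sup>2) + indicator \<bbbB> v * ?A v \<partial>lborel)"
    unfolding var by (simp add: ennreal_plus nn distrib_left)
  also have "\<dots> = ball_vol TYPE('n) * ennreal ((cmod (f 0))\<^sup>2) + (\<integral>\<^sup>+v. indicator \<bbbB> v * ?A v \<partial>lborel)"
  proof -
    have g: "cholo_on (\<lambda>t. f t - f 0) \<bbbB>" by (rule cholo_on_diff_const[OF f])
    have "?A = (\<lambda>v. \<integral>\<^sup>+x\<in>{0..1}. ball_sq (\<lambda>t. f t - f 0) ((of_real r * unit_exp x) *s ((1 / norm v) *\<^sub>R v)) \<partial>lborel)"
      by (simp only: circle_integral_ball_sq[OF g r])
    then have [measurable]: "?A \<in> borel_measurable borel"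
      using circle_integral_measurable[OF borel_measurable_ball_sq[OF cholo_on_imp_continuous_on[OF g]]] by simp
    show ?thesis unfolding ball_vol_def by (subst nn_integral_add) (simp_all add: nn_integral_multc)
  qed
  finally show ?thesis
    unfolding sphere_mean_ball_sq[OF f r] sphere_mean_ball_sq[OF cholo_on_diff_const[OF f] r]
    by (simp only: add_divide_distrib_ennreal mult.commute[of "ball_vol TYPE('n)"] mult_divide_eq_ennreal[OF ball_vol_nz(1) ball_vol_nz(3)])
qed

section \<open>Radial kernels and their concentration on the sphere\<close>

text \<open>The invariant volume as a measure on all Borel sets, so that measurability need not be tracked
  relative to the ball.\<close>

definition hyp_borel :: "(complex^'n) measure"
  where "hyp_borel = density lborel
    (\<lambda>z. ennreal (2 ^ CARD('n) / (1 - (norm z)\<^sup>2) ^ (CARD('n) + 1)) * indicator \<bbbB> z)"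

lemma sets_hyp_borel [measurable_cong, simp]: "sets hyp_borel = sets borel"
  by (simp add: hyp_borel_def)

lemma space_hyp_borel [simp]: "space hyp_borel = UNIV"
  by (simp add: hyp_borel_def)

lemma AE_hyp_borel: "AE z in hyp_borel. z \<in> \<bbbB>"
  unfolding hyp_borel_def by (subst AE_density) (auto simp: indicator_def)

lemma hyp_borel_cong:
  assumes "\<And>z. z \<in> \<bbbB> \<Longrightarrow> f z = g z"
  shows "(\<integral>\<^sup>+z. f z \<partial>hyp_borel) = (\<integral>\<^sup>+z. g z \<partial>hyp_borel)"
proof (rule nn_integral_cong_AE)
  show "AE z in hyp_borel. f z = g z" using AE_hyp_borel by eventually_elim (rule assms)
qed

lemma hyp_borel_mono:
  assumes "\<And>z. z \<in> \<bbbB> \<Longrightarrow> f z \<le> g z"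
  shows "(\<integral>\<^sup>+z. f z \<partial>hyp_borel) \<le> (\<integral>\<^sup>+z. g z \<partial>hyp_borel)"
proof (rule nn_integral_mono_AE)
  show "AE z in hyp_borel. f z \<le> g z" using AE_hyp_borel by eventually_elim (rule assms)
qed

lemma nn_integral_hyp_borel_borel:
  fixes f :: "complex^'n \<Rightarrow> ennreal"
  assumes f: "f \<in> borel_measurable borel"
  shows "(\<integral>\<^sup>+z. f z \<partial>hyp_borel) = (\<integral>\<^sup>+z. f z \<partial>hyp_volume)"
  unfolding nn_integral_hyp[OF f] hyp_borel_def
  by (rule nn_integral_density) (use f in measurable)

lemma nn_integral_hyp_borel:
  fixes f :: "complex^'n \<Rightarrow> ennreal"
  assumes f: "f \<in> borel_measurable hyp_volume"
  shows "(\<integral>\<^sup>+z. f z \<partial>hyp_borel) = (\<integral>\<^sup>+z. f z \<partial>hyp_volume)"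
proof -
  have "f \<in> borel_measurable (restrict_space borel \<bbbB>)" using f by (simp only: measurable_hyp_volume_cong)
  then have m: "(\<lambda>x. f x * indicator \<bbbB> x) \<in> borel_measurable borel"
    by (subst (asm) borel_measurable_restrict_space_iff_ennreal) simp_all
  have "(\<integral>\<^sup>+z. f z \<partial>hyp_borel) = (\<integral>\<^sup>+z. f z * indicator \<bbbB> z \<partial>hyp_borel)"
    by (rule hyp_borel_cong) (simp add: indicator_def)
  also have "\<dots> = (\<integral>\<^sup>+z. f z * indicator \<bbbB> z \<partial>hyp_volume)" by (rule nn_integral_hyp_borel_borel[OF m])
  also have "\<dots> = (\<integral>\<^sup>+z. f z \<partial>hyp_volume)" by (rule nn_integral_cong) simp
  finally show ?thesis .
qed

lemma measurable_hyp_volume_of_borel: "f \<in> measurable borel N \<Longrightarrow> f \<in> measurable hyp_volume N"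
  by (rule measurable_compose[OF hyp_incl_measurable])

lemma hyp_borel_invariant:
  fixes u :: "complex^'n \<Rightarrow> ennreal"
  assumes g: "ball_auto g" and u: "u \<in> borel_measurable borel"
  shows "(\<integral>\<^sup>+w. u (g w) \<partial>hyp_borel) = (\<integral>\<^sup>+w. u w \<partial>hyp_borel)"
proof -
  have u': "u \<in> borel_measurable hyp_volume" by (rule measurable_hyp_volume_of_borel[OF u])
  have "(\<integral>\<^sup>+w. u (g w) \<partial>hyp_borel) = (\<integral>\<^sup>+w. u (g w) \<partial>hyp_volume)"
    by (rule nn_integral_hyp_borel) (rule measurable_compose[OF ball_auto_measurable[OF g] u'])
  also have "\<dots> = (\<integral>\<^sup>+w. u w \<partial>hyp_volume)" by (rule nn_integral_hyp_invariant[OF g u'])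
  finally show ?thesis by (simp add: nn_integral_hyp_borel_borel[OF u])
qed

lemma hyp_borel_radial:
  fixes u :: "complex^'n \<Rightarrow> ennreal"
  assumes [measurable]: "u \<in> borel_measurable borel" "\<phi> \<in> borel_measurable borel"
  shows "(\<integral>\<^sup>+t. \<phi> (norm t) * u t \<partial>hyp_borel) = (\<integral>\<^sup>+t. \<phi> (norm t) * sphere_mean u (norm t) \<partial>(hyp_borel :: (complex^'n) measure))"
proof -
  have 1: "(\<lambda>t. \<phi> (norm t) * u t) \<in> borel_measurable borel" by measurable
  have 2: "(\<lambda>t :: complex^'n. \<phi> (norm t) * sphere_mean u (norm t)) \<in> borel_measurable borel" by measurable
  show ?thesis
    unfolding nn_integral_hyp_borel_borel[OF 1] nn_integral_hyp_borel_borel[OF 2]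
    by (rule nn_integral_hyp_radial[OF assms])
qed

lemma sigma_finite_hyp_borel: "sigma_finite_measure (hyp_borel :: (complex^'n) measure)"
  unfolding hyp_borel_def
  by (subst sigma_finite_measure.sigma_finite_iff_density_finite[OF sigma_finite_lborel]) (measurable, auto simp: indicator_def)

lemma hyp_borel_Fubini:
  fixes f :: "(complex^'n) \<times> (complex^'n) \<Rightarrow> ennreal"
  assumes "f \<in> borel_measurable (borel \<Otimes>\<^sub>M borel)"
  shows "(\<integral>\<^sup>+x. \<integral>\<^sup>+y. f (x, y) \<partial>hyp_borel \<partial>hyp_borel) = (\<integral>\<^sup>+y. \<integral>\<^sup>+x. f (x, y) \<partial>hyp_borel \<partial>hyp_borel)"
proof -
  interpret a: sigma_finite_measure "hyp_borel :: (complex^'n) measure" by (rule sigma_finite_hyp_borel)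
  interpret pair_sigma_finite "hyp_borel :: (complex^'n) measure" "hyp_borel :: (complex^'n) measure" ..
  have "f \<in> borel_measurable (hyp_borel \<Otimes>\<^sub>M hyp_borel)" using assms by measurable
  from Fubini[OF this] show ?thesis by simp
qed

lemma hyp_borel_integral_measurable:
  fixes f :: "'a \<Rightarrow> complex^'n \<Rightarrow> ennreal"
  assumes "case_prod f \<in> borel_measurable (M \<Otimes>\<^sub>M borel)"
  shows "(\<lambda>x. \<integral>\<^sup>+y. f x y \<partial>hyp_borel) \<in> borel_measurable M"
proof -
  interpret sigma_finite_measure "hyp_borel :: (complex^'n) measure" by (rule sigma_finite_hyp_borel)
  have "case_prod f \<in> borel_measurable (M \<Otimes>\<^sub>M hyp_borel)" using assms by measurable
  then show ?thesis by (rule borel_measurable_nn_integral)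
qed

definition kern_const :: "nat \<Rightarrow> real \<Rightarrow> real"
  where "kern_const N \<alpha> = Gamma (real N + \<alpha> + 1) / (fact N * Gamma (\<alpha> + 1))"

text \<open>The kernel of the Bergman norm as a function of \<open>\<delta>\<close>.\<close>

definition kern :: "nat \<Rightarrow> real \<Rightarrow> real \<Rightarrow> ennreal"
  where "kern N \<alpha> x = ennreal (kern_const N \<alpha>) * ennreal (x powr (\<alpha> + real N + 1))"

lemma kern_measurable [measurable]: "kern N \<alpha> \<in> borel_measurable borel"
  unfolding kern_def[abs_def] by measurable

text \<open>The mass of every radial kernel with \<open>\<alpha> > -1\<close>, see lemma \<open>kern_total_mass\<close>.\<close>

definition kern_mass :: "'n::finite itself \<Rightarrow> ennreal"
  where "kern_mass _ = 2 ^ CARD('n) * ball_vol TYPE('n)"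

lemma kern_mass_nz: "kern_mass TYPE('n::finite) \<noteq> 0" "kern_mass TYPE('n) \<noteq> top_class.top"
  using ball_vol_nz[where 'n='n] by (auto simp: kern_mass_def ennreal_mult_eq_top_iff power_eq_top_ennreal)

lemma kern_const_nonneg: "\<alpha> > -1 \<Longrightarrow> 0 \<le> kern_const N \<alpha>"
  unfolding kern_const_def
  by (intro divide_nonneg_nonneg mult_nonneg_nonneg order_less_imp_le[OF Gamma_real_pos]) auto

text \<open>The normalising constant is the inverse of a Beta integral; this is what makes the mass of the kernel
  independent of \<open>\<alpha>\<close>.\<close>

lemma kern_const_Beta:
  assumes "\<alpha> > -1" "N > 0"
  shows "kern_const N \<alpha> * (real N * Beta (real N) (\<alpha> + 1)) = 1"
proof -
  have 1: "Gamma (\<alpha> + 1) > 0" "Gamma (real N + \<alpha> + 1) > 0" using assms by (auto intro!: Gamma_real_pos)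
  have "Gamma (real N + 1) = real N * Gamma (real N)"
    using assms by (intro Gamma_plus1) auto
  then have "real N * Gamma (real N) = fact N" using Gamma_fact[of N, where 'a=real] by (simp add: add.commute)
  then have "real N * Beta (real N) (\<alpha> + 1) = fact N * Gamma (\<alpha> + 1) / Gamma (real N + \<alpha> + 1)"
    by (simp add: Beta_def add.assoc)
  then show ?thesis using 1 by (simp add: kern_const_def)
qed

text \<open>The Gamma function has a pole at \<open>0\<close>.\<close>

lemma kern_const_tendsto:
  assumes "N > 0" shows "((\<lambda>\<alpha>. kern_const N \<alpha>) \<longlongrightarrow> 0) (at_right (-1))"
proof -
  have eq: "kern_const N \<alpha> = Gamma (real N + \<alpha> + 1) * rGamma (\<alpha> + 1) / fact N" for \<alpha>
    by (simp add: kern_const_def rGamma_inverse_Gamma field_simps)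
  have "real N + (-1) + 1 \<notin> \<int>\<^sub>\<le>\<^sub>0" using assms by (auto dest: nonpos_Ints_nonpos)
  then have "isCont (\<lambda>\<alpha>. Gamma (real N + \<alpha> + 1) * rGamma (\<alpha> + 1) / fact N) (-1)"
    by (intro continuous_intros) auto
  from Lim_at_imp_Lim_at_within[OF this[unfolded isCont_def]]
  have "((\<lambda>\<alpha>. Gamma (real N + \<alpha> + 1) * rGamma (\<alpha> + 1) / fact N) \<longlongrightarrow> 0) (at_right (-1))" by simp
  then show ?thesis by (simp add: eq)
qed

lemma emeasure_norm_sq_greater:
  fixes x :: real
  assumes "0 \<le> x" "x < 1"
  shows "emeasure lborel {t \<in> \<bbbB> :: (complex^'n) set. x < (norm t)\<^sup>2} = ball_vol TYPE('n) * ennreal (1 - x ^ CARD('n))"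
proof -
  have D: "DIM(complex^'n) = 2 * CARD('n)" by simp
  have sx: "0 \<le> sqrt x" "sqrt x < 1" using assms by auto
  have iff: "x < (norm t)\<^sup>2 \<longleftrightarrow> \<not> norm t \<le> sqrt x" for t :: "complex^'n"
    using assms by (metis abs_norm_cancel not_le real_le_rsqrt real_sqrt_abs real_sqrt_le_iff sqrt_le_D)
  have "{t \<in> \<bbbB> :: (complex^'n) set. x < (norm t)\<^sup>2} = \<bbbB> - cball 0 (sqrt x)"
    by (auto simp: iff)
  also have "emeasure lborel (\<bbbB> - cball 0 (sqrt x) :: (complex^'n) set) = emeasure lborel (\<bbbB> :: (complex^'n) set) - emeasure lborel (cball 0 (sqrt x) :: (complex^'n) set)"
  proof (rule emeasure_Diff)
    show "emeasure lborel (cball 0 (sqrt x) :: (complex^'n) set) \<noteq> \<infinity>" using sx by (simp add: emeasure_cball)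
    show "cball 0 (sqrt x) \<subseteq> (\<bbbB> :: (complex^'n) set)"
    proof
      fix t :: "complex^'n" assume "t \<in> cball 0 (sqrt x)"
      then have "norm t \<le> sqrt x" by simp
      also note sx(2)
      finally show "t \<in> \<bbbB>" by simp
    qed
  qed auto
  also have "emeasure lborel (cball 0 (sqrt x) :: (complex^'n) set) = ennreal (unit_ball_vol (real DIM(complex^'n)) * x ^ CARD('n))"
  proof -
    have "sqrt x ^ DIM(complex^'n) = x ^ CARD('n)" unfolding D power_mult using assms by simp
    then show ?thesis unfolding emeasure_cball[OF sx(1)] by simp
  qed
  also have "emeasure lborel (\<bbbB> :: (complex^'n) set) = ennreal (unit_ball_vol (real DIM(complex^'n)))"
    by (simp only: emeasure_ball[OF zero_le_one] power_one mult_1_right)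
  also have "ennreal (unit_ball_vol (real DIM(complex^'n))) - ennreal (unit_ball_vol (real DIM(complex^'n)) * x ^ CARD('n))
     = ennreal (unit_ball_vol (real DIM(complex^'n)) * (1 - x ^ CARD('n)))"
    using assms by (subst ennreal_minus) (auto simp: algebra_simps)
  also have "\<dots> = ball_vol TYPE('n) * ennreal (1 - x ^ CARD('n))"
    using assms unfolding ball_vol_def emeasure_ball[OF zero_le_one]
    by (subst ennreal_mult) (auto simp: power_le_one)
  finally show ?thesis .
qed

text \<open>The distribution of \<open>|t|\<^sup>2\<close> has the density \<open>n x\<^sup>n\<^sup>-\<^sup>1\<close> on the unit interval, because balls of radius
  \<open>x\<close> have volume proportional to the \<open>2 n\<close>-th power of \<open>x\<close>.\<close>

lemma nn_integral_norm_sq: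
  assumes [measurable]: "\<phi> \<in> borel_measurable borel"
  shows "(\<integral>\<^sup>+t. indicator \<bbbB> t * \<phi> ((norm t)\<^sup>2) \<partial>(lborel :: (complex^'n) measure)) =
    ball_vol TYPE('n) * (\<integral>\<^sup>+x. ennreal (real CARD('n) * x ^ (CARD('n) - 1)) * indicator {0..1} x * \<phi> x \<partial>lborel)"
proof -
  define M where "M = distr (density lborel (indicator (\<bbbB> :: (complex^'n) set))) borel (\<lambda>t. (norm t)\<^sup>2)"
  define w where "w = (\<lambda>x::real. ball_vol TYPE('n) * (ennreal (real CARD('n) * x ^ (CARD('n) - 1)) * indicator {0..1} x))"
  have [measurable]: "w \<in> borel_measurable borel" unfolding w_def by measurable
  define N where "N = density lborel w"
  have eM: "emeasure M {x<..} = emeasure lborel {t \<in> \<bbbB> :: (complex^'n) set. x < (norm t)\<^sup>2}" for x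
  proof -
    have "emeasure M {x<..} = (\<integral>\<^sup>+t. indicator \<bbbB> t * indicator {t. x < (norm t)\<^sup>2} t \<partial>(lborel :: (complex^'n) measure))"
      unfolding M_def by (subst emeasure_distr, simp_all, subst emeasure_density) (auto simp: vimage_def)
    also have "\<dots> = (\<integral>\<^sup>+t. indicator {t \<in> \<bbbB>. x < (norm t)\<^sup>2} t \<partial>(lborel :: (complex^'n) measure))"
      by (rule nn_integral_cong) (auto simp: indicator_def)
    finally show ?thesis by simp
  qed
  have eN: "emeasure N {x<..} = ball_vol TYPE('n) * (\<integral>\<^sup>+y. ennreal (real CARD('n) * y ^ (CARD('n) - 1)) * indicator ({0..1} \<inter> {x<..}) y \<partial>lborel)" for x
    unfolding N_def w_def
    by (subst emeasure_density, measurable, subst nn_integral_cmult[symmetric], measurable)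
      (auto intro!: nn_integral_cong simp: indicator_def)
  have I: "(\<integral>\<^sup>+y. ennreal (real CARD('n) * y ^ (CARD('n) - 1)) * indicator {x..1} y \<partial>lborel) = ennreal (1 - x ^ CARD('n))" if "0 \<le> x" "x \<le> 1" for x :: real
  proof -
    have "((\<lambda>y. real CARD('n) * y ^ (CARD('n) - 1)) has_integral (1 ^ CARD('n) - x ^ CARD('n))) {x..1}"
      using that by (intro fundamental_theorem_of_calculus)
        (auto intro!: derivative_eq_intros simp: has_real_derivative_iff_has_vector_derivative[symmetric])
    from nn_integral_has_integral_lebesgue[OF _ this] that
    have "(\<integral>\<^sup>+y. ennreal (indicator {x..1} y * (real CARD('n) * y ^ (CARD('n) - 1))) \<partial>lborel) = ennreal (1 - x ^ CARD('n))" by simp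
    moreover have "ennreal (indicator {x..1} y * (real CARD('n) * y ^ (CARD('n) - 1))) = ennreal (real CARD('n) * y ^ (CARD('n) - 1)) * indicator {x..1} y" for y
      by (simp add: indicator_def)
    ultimately show ?thesis by simp
  qed
  have MN: "emeasure M {x<..} = emeasure N {x<..}" for x
  proof -
    consider "x < 0" | "0 \<le> x" "x < 1" | "1 \<le> x" by linarith
    then show ?thesis
    proof cases
      case 1
      then have "{t \<in> \<bbbB> :: (complex^'n) set. x < (norm t)\<^sup>2} = \<bbbB>" by (auto intro: less_le_trans)
      moreover have "{0..1} \<inter> {x<..} = {0..1}" using 1 by auto
      ultimately show ?thesis unfolding eM eN using I[of 0] by (simp add: ball_vol_def power_0_left)
    next
      case 2
      have "(\<integral>\<^sup>+y. ennreal (real CARD('n) * y ^ (CARD('n) - 1)) * indicator ({0..1} \<inter> {x<..}) y \<partial>lborel)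
        = (\<integral>\<^sup>+y. ennreal (real CARD('n) * y ^ (CARD('n) - 1)) * indicator {x..1} y \<partial>lborel)"
      proof (rule nn_integral_cong_AE)
        show "AE y in lborel. ennreal (real CARD('n) * y ^ (CARD('n) - 1)) * indicator ({0..1} \<inter> {x<..}) y = ennreal (real CARD('n) * y ^ (CARD('n) - 1)) * indicator {x..1} y"
          using AE_lborel_singleton[of x] by eventually_elim (use 2 in \<open>auto simp: indicator_def\<close>)
      qed
      then show ?thesis unfolding eM eN using emeasure_norm_sq_greater[OF 2, where 'n='n] I[of x] 2 by simp
    next
      case 3
      have "\<not> x < (norm t)\<^sup>2" if "t \<in> \<bbbB>" for t :: "complex^'n"
        using one_minus_norm_sq_pos[of t] that 3 by simp
      then have "{t \<in> \<bbbB> :: (complex^'n) set. x < (norm t)\<^sup>2} = {}" by blast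
      then have "emeasure lborel {t \<in> \<bbbB> :: (complex^'n) set. x < (norm t)\<^sup>2} = 0" by (simp only: emeasure_empty)
      moreover have "{0..1} \<inter> {x<..} = {}" using 3 by auto
      ultimately show ?thesis unfolding eM eN by simp
    qed
  qed
  have "M = N"
  proof (rule measure_eqI_lessThan)
    fix x show "emeasure M {x<..} < \<infinity>"
      unfolding eM
      by (rule order_le_less_trans[OF emeasure_mono[of _ "\<bbbB>"] emeasure_lborel_ball_finite]) auto
  qed (simp_all add: M_def N_def MN[unfolded M_def N_def])
  have "(\<integral>\<^sup>+t. indicator \<bbbB> t * \<phi> ((norm t)\<^sup>2) \<partial>(lborel :: (complex^'n) measure)) = (\<integral>\<^sup>+x. \<phi> x \<partial>M)"
    unfolding M_def by (simp add: nn_integral_distr nn_integral_density)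
  also have "\<dots> = (\<integral>\<^sup>+x. w x * \<phi> x \<partial>lborel)" unfolding \<open>M = N\<close> N_def by (simp add: nn_integral_density)
  also have "\<dots> = (\<integral>\<^sup>+x. ball_vol TYPE('n) * (ennreal (real CARD('n) * x ^ (CARD('n) - 1)) * indicator {0..1} x * \<phi> x) \<partial>lborel)"
    unfolding w_def by (simp only: mult.assoc)
  also have "\<dots> = ball_vol TYPE('n) * (\<integral>\<^sup>+x. ennreal (real CARD('n) * x ^ (CARD('n) - 1)) * indicator {0..1} x * \<phi> x \<partial>lborel)"
    by (rule nn_integral_cmult) measurable
  finally show ?thesis .
qed

text \<open>In the variable \<open>x = |t|\<^sup>2\<close> the integral is a Beta integral.\<close>

lemma kern_total_mass:
  assumes "\<alpha> > -1"
  shows "(\<integral>\<^sup>+t. kern CARD('n) \<alpha> (1 - (norm t)\<^sup>2) \<partial>(hyp_borel :: (complex^'n) measure)) = kern_mass TYPE('n)"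
proof -
  define c where "c = kern_const CARD('n) \<alpha>"
  have c: "c \<ge> 0" using kern_const_nonneg[OF assms] by (simp add: c_def)
  have "(\<integral>\<^sup>+t. kern CARD('n) \<alpha> (1 - (norm t)\<^sup>2) \<partial>(hyp_borel :: (complex^'n) measure))
    = (\<integral>\<^sup>+t. ennreal (2 ^ CARD('n) / (1 - (norm t)\<^sup>2) ^ (CARD('n) + 1)) * indicator \<bbbB> t * kern CARD('n) \<alpha> (1 - (norm t)\<^sup>2) \<partial>(lborel :: (complex^'n) measure))"
    unfolding hyp_borel_def by (rule nn_integral_density) measurable
  also have "\<dots> = (\<integral>\<^sup>+t. (2 ^ CARD('n) * ennreal c) * (indicator \<bbbB> t * ennreal ((1 - (norm t)\<^sup>2) powr \<alpha>)) \<partial>(lborel :: (complex^'n) measure))"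
  proof (rule nn_integral_cong)
    fix t :: "complex^'n"
    show "ennreal (2 ^ CARD('n) / (1 - (norm t)\<^sup>2) ^ (CARD('n) + 1)) * indicator \<bbbB> t * kern CARD('n) \<alpha> (1 - (norm t)\<^sup>2)
      = (2 ^ CARD('n) * ennreal c) * (indicator \<bbbB> t * ennreal ((1 - (norm t)\<^sup>2) powr \<alpha>))"
    proof (cases "t \<in> \<bbbB>")
      case True
      define m where "m = 1 - (norm t)\<^sup>2"
      have m: "m > 0" using True one_minus_norm_sq_pos[of t] by (simp add: m_def)
      have "m powr (\<alpha> + real CARD('n) + 1) = m powr \<alpha> * m ^ (CARD('n) + 1)"
        using m powr_realpow[OF m, of "CARD('n) + 1"] by (simp add: powr_add add.assoc mult.commute del: power_Suc)
      then have "2 ^ CARD('n) / m ^ (CARD('n) + 1) * (c * m powr (\<alpha> + real CARD('n) + 1)) = 2 ^ CARD('n) * c * m powr \<alpha>"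
        using m by simp
      then have "ennreal (2 ^ CARD('n) / m ^ (CARD('n) + 1)) * (ennreal c * ennreal (m powr (\<alpha> + real CARD('n) + 1))) = ennreal (2 ^ CARD('n) * c * m powr \<alpha>)"
        using m c by (simp add: ennreal_mult[symmetric] del: power_Suc)
      also have "\<dots> = 2 ^ CARD('n) * ennreal c * ennreal (m powr \<alpha>)"
        using c by (simp add: ennreal_mult ennreal_power[symmetric])
      finally show ?thesis using True by (simp add: kern_def m_def[symmetric] c_def[symmetric])
    qed simp
  qed
  also have "\<dots> = 2 ^ CARD('n) * ennreal c * (\<integral>\<^sup>+t. indicator \<bbbB> t * ennreal ((1 - (norm t)\<^sup>2) powr \<alpha>) \<partial>(lborel :: (complex^'n) measure))"
    by (rule nn_integral_cmult) measurable
  also have "(\<integral>\<^sup>+t. indicator \<bbbB> t * ennreal ((1 - (norm t)\<^sup>2) powr \<alpha>) \<partial>(lborel :: (complex^'n) measure))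
    = ball_vol TYPE('n) * (\<integral>\<^sup>+x. ennreal (real CARD('n) * x ^ (CARD('n) - 1)) * indicator {0..1} x * ennreal ((1 - x) powr \<alpha>) \<partial>lborel)"
    by (rule nn_integral_norm_sq[of "\<lambda>x. ennreal ((1 - x) powr \<alpha>)"]) measurable
  also have "(\<integral>\<^sup>+x. ennreal (real CARD('n) * x ^ (CARD('n) - 1)) * indicator {0..1} x * ennreal ((1 - x) powr \<alpha>) \<partial>lborel)
    = ennreal (real CARD('n) * Beta (real CARD('n)) (\<alpha> + 1))"
  proof -
    have "((\<lambda>x. real CARD('n) * (x powr (real CARD('n) - 1) * (1 - x) powr (\<alpha> + 1 - 1))) has_integral real CARD('n) * Beta (real CARD('n)) (\<alpha> + 1)) {0..1}"
      using assms by (intro has_integral_mult_right has_integral_Beta_real) auto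
    from nn_integral_has_integral_lebesgue[OF _ this]
    have "(\<integral>\<^sup>+x. ennreal (indicator {0..1} x * (real CARD('n) * (x powr (real CARD('n) - 1) * (1 - x) powr \<alpha>))) \<partial>lborel) = ennreal (real CARD('n) * Beta (real CARD('n)) (\<alpha> + 1))"
      by simp
    moreover have "(\<integral>\<^sup>+x. ennreal (real CARD('n) * x ^ (CARD('n) - 1)) * indicator {0..1} x * ennreal ((1 - x) powr \<alpha>) \<partial>lborel)
      = (\<integral>\<^sup>+x. ennreal (indicator {0..1} x * (real CARD('n) * (x powr (real CARD('n) - 1) * (1 - x) powr \<alpha>))) \<partial>lborel)"
    proof (rule nn_integral_lborel_cong_nonzero)
      fix x :: real assume "x \<noteq> 0"
      show "ennreal (real CARD('n) * x ^ (CARD('n) - 1)) * indicator {0..1} x * ennreal ((1 - x) powr \<alpha>)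
        = ennreal (indicator {0..1} x * (real CARD('n) * (x powr (real CARD('n) - 1) * (1 - x) powr \<alpha>)))"
      proof (cases "x \<in> {0..1}")
        case True
        then have x: "x > 0" using \<open>x \<noteq> 0\<close> by simp
        have "x powr (real CARD('n) - 1) = x ^ (CARD('n) - 1)"
          using powr_realpow[OF x, of "CARD('n) - 1"] by (simp add: of_nat_diff)
        then show ?thesis using True x by (simp add: ennreal_mult[symmetric] mult.assoc)
      qed simp
    qed
    ultimately show ?thesis by simp
  qed
  also have "2 ^ CARD('n) * ennreal c * (ball_vol TYPE('n) * ennreal (real CARD('n) * Beta (real CARD('n)) (\<alpha> + 1)))
    = kern_mass TYPE('n) * (ennreal c * ennreal (real CARD('n) * Beta (real CARD('n)) (\<alpha> + 1)))"
    unfolding kern_mass_def by (simp only: mult_ac)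
  also have "ennreal c * ennreal (real CARD('n) * Beta (real CARD('n)) (\<alpha> + 1)) = 1"
    unfolding c_def ennreal_mult'[OF kern_const_nonneg[OF assms], symmetric] using kern_const_Beta[OF assms, of "CARD('n)"] by simp
  finally show ?thesis by simp
qed

lemma kern_bound:
  assumes "\<alpha> > -1" "0 \<le> x" "x \<le> 1"
  shows "kern N \<alpha> x \<le> ennreal (kern_const N \<alpha>)"
proof -
  have "x powr (\<alpha> + real N + 1) \<le> 1"
    using assms powr_mono2[of "\<alpha> + real N + 1" x 1] by simp
  then have "ennreal (x powr (\<alpha> + real N + 1)) \<le> 1" by simp
  then show ?thesis unfolding kern_def using mult_left_mono[of "ennreal (x powr (\<alpha> + real N + 1))" 1] by simp
qed

lemma hyp_small_ball_finite:
  assumes "r < 1"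
  shows "(\<integral>\<^sup>+t. indicator {..<r} (norm t) \<partial>(hyp_borel :: (complex^'n) measure)) < \<infinity>"
proof -
  define b where "b = 2 ^ CARD('n) / (1 - r\<^sup>2) ^ (CARD('n) + 1)"
  have "(\<integral>\<^sup>+t. indicator {..<r} (norm t) \<partial>(hyp_borel :: (complex^'n) measure))
    = (\<integral>\<^sup>+t. ennreal (2 ^ CARD('n) / (1 - (norm t)\<^sup>2) ^ (CARD('n) + 1)) * indicator \<bbbB> t * indicator {..<r} (norm t) \<partial>(lborel :: (complex^'n) measure))"
    unfolding hyp_borel_def by (rule nn_integral_density) measurable
  also have "\<dots> \<le> (\<integral>\<^sup>+t. ennreal b * indicator \<bbbB> t \<partial>(lborel :: (complex^'n) measure))"
  proof (rule nn_integral_mono)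
    fix t :: "complex^'n"
    show "ennreal (2 ^ CARD('n) / (1 - (norm t)\<^sup>2) ^ (CARD('n) + 1)) * indicator \<bbbB> t * indicator {..<r} (norm t) \<le> ennreal b * indicator \<bbbB> t"
    proof (cases "norm t < r")
      case True
      then have "0 \<le> r" using norm_ge_zero[of t] by linarith
      then have r: "0 < 1 - r\<^sup>2" using assms by (simp add: abs_square_less_1)
      have "(norm t)\<^sup>2 \<le> r\<^sup>2" using True by (intro power_mono) auto
      then have "2 ^ CARD('n) / (1 - (norm t)\<^sup>2) ^ (CARD('n) + 1) \<le> b"
        unfolding b_def using r by (intro divide_left_mono mult_pos_pos zero_less_power power_mono) auto
      then show ?thesis by (auto simp: indicator_def intro: ennreal_leI)
    qed simp
  qed
  also have "\<dots> = ennreal b * ball_vol TYPE('n)"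
    unfolding ball_vol_def by (rule nn_integral_cmult_indicator) simp
  also have "\<dots> < \<infinity>" using ball_vol_nz[where 'n='n] by (simp add: ennreal_mult_less_top less_top)
  finally show ?thesis .
qed

text \<open>On a smaller ball the power of \<open>\<delta>\<close> is at most \<open>1\<close> and the volume is finite, while the constant tends
  to \<open>0\<close>.\<close>

lemma kern_mass_concentrates:
  assumes "r < 1"
  shows "((\<lambda>\<alpha>. \<integral>\<^sup>+t. indicator {..<r} (norm t) * kern CARD('n) \<alpha> (1 - (norm t)\<^sup>2) \<partial>(hyp_borel :: (complex^'n) measure)) \<longlongrightarrow> 0) (at_right (-1))"
proof -
  define B where "B = (\<integral>\<^sup>+t. indicator {..<r} (norm t) \<partial>(hyp_borel :: (complex^'n) measure))"
  have B: "B \<noteq> \<infinity>" using hyp_small_ball_finite[OF assms, where 'n='n] by (simp add: B_def)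
  have up: "(\<integral>\<^sup>+t. indicator {..<r} (norm t) * kern CARD('n) \<alpha> (1 - (norm t)\<^sup>2) \<partial>(hyp_borel :: (complex^'n) measure)) \<le> ennreal (kern_const CARD('n) \<alpha>) * B"
    if "\<alpha> > -1" for \<alpha>
  proof -
    have "(\<integral>\<^sup>+t. indicator {..<r} (norm t) * kern CARD('n) \<alpha> (1 - (norm t)\<^sup>2) \<partial>(hyp_borel :: (complex^'n) measure))
      \<le> (\<integral>\<^sup>+t. ennreal (kern_const CARD('n) \<alpha>) * indicator {..<r} (norm t) \<partial>(hyp_borel :: (complex^'n) measure))"
    proof (rule hyp_borel_mono)
      fix t :: "complex^'n" assume "t \<in> \<bbbB>"
      then have "0 \<le> 1 - (norm t)\<^sup>2" "1 - (norm t)\<^sup>2 \<le> 1" using one_minus_norm_sq_pos[of t] by auto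
      from kern_bound[OF that this]
      show "indicator {..<r} (norm t) * kern CARD('n) \<alpha> (1 - (norm t)\<^sup>2) \<le> ennreal (kern_const CARD('n) \<alpha>) * indicator {..<r} (norm t)"
        by (simp add: indicator_def)
    qed
    also have "\<dots> = ennreal (kern_const CARD('n) \<alpha>) * B"
      unfolding B_def by (rule nn_integral_cmult) measurable
    finally show ?thesis .
  qed
  have "((\<lambda>\<alpha>. ennreal (kern_const CARD('n) \<alpha>) * B) \<longlongrightarrow> ennreal 0 * B) (at_right (-1))"
    using B by (intro tendsto_mult_ennreal tendsto_ennrealI kern_const_tendsto tendsto_const) auto
  then have "((\<lambda>\<alpha>. ennreal (kern_const CARD('n) \<alpha>) * B) \<longlongrightarrow> 0) (at_right (-1))" by simp
  then have lim: "((\<lambda>\<alpha>. ennreal (kern_const CARD('n) \<alpha>) * B) \<longlongrightarrow> 0) (at_right (-1))" .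
  show ?thesis
  proof (rule tendsto_sandwich[OF _ _ tendsto_const lim])
    show "eventually (\<lambda>\<alpha>. (\<integral>\<^sup>+t. indicator {..<r} (norm t) * kern CARD('n) \<alpha> (1 - (norm t)\<^sup>2) \<partial>(hyp_borel :: (complex^'n) measure)) \<le> ennreal (kern_const CARD('n) \<alpha>) * B) (at_right (-1))"
      by (rule eventually_mono[OF eventually_at_right_less]) (rule up)
  qed simp
qed

lemma radial_integral_le_Sup:
  assumes [measurable]: "\<phi> \<in> borel_measurable borel" and G: "\<And>r. 0 \<le> r \<Longrightarrow> r < 1 \<Longrightarrow> G r \<le> S"
  shows "(\<integral>\<^sup>+t. \<phi> (norm t) * G (norm t) \<partial>(hyp_borel :: (complex^'n) measure)) \<le> (\<integral>\<^sup>+t. \<phi> (norm t) \<partial>(hyp_borel :: (complex^'n) measure)) * S"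
proof -
  have "(\<integral>\<^sup>+t. \<phi> (norm t) * G (norm t) \<partial>(hyp_borel :: (complex^'n) measure)) \<le> (\<integral>\<^sup>+t. \<phi> (norm t) * S \<partial>(hyp_borel :: (complex^'n) measure))"
    by (rule hyp_borel_mono) (auto intro!: mult_left_mono G)
  also have "\<dots> = (\<integral>\<^sup>+t. \<phi> (norm t) \<partial>(hyp_borel :: (complex^'n) measure)) * S"
    by (rule nn_integral_multc) measurable
  finally show ?thesis .
qed

text \<open>As \<open>\<alpha>\<close> decreases to \<open>-1\<close> the kernels push all their mass to the boundary, so the integral of an
  increasing function tends to its supremum.\<close>

lemma kern_integral_tendsto:
  assumes mono: "\<And>r r'. 0 \<le> r \<Longrightarrow> r \<le> r' \<Longrightarrow> r' < 1 \<Longrightarrow> G r \<le> (G r' :: ennreal)"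
  shows "((\<lambda>\<alpha>. \<integral>\<^sup>+t. kern CARD('n) \<alpha> (1 - (norm t)\<^sup>2) * G (norm t) \<partial>(hyp_borel :: (complex^'n) measure)) \<longlongrightarrow> kern_mass TYPE('n) * (SUP r\<in>{0..<1}. G r)) (at_right (-1))"
proof (rule order_tendstoI)
  let ?I = "\<lambda>\<alpha>. \<integral>\<^sup>+t. kern CARD('n) \<alpha> (1 - (norm t)\<^sup>2) * G (norm t) \<partial>(hyp_borel :: (complex^'n) measure)"
  have ev: "eventually (\<lambda>\<alpha>. \<alpha> > -1) (at_right (-1 :: real))" by (simp add: eventually_at_right_less)
  {
    fix y assume y: "kern_mass TYPE('n) * (SUP r\<in>{0..<1}. G r) < y"
    show "eventually (\<lambda>\<alpha>. ?I \<alpha> < y) (at_right (-1))"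
      using ev
    proof eventually_elim
      case (elim \<alpha>)
      have "?I \<alpha> \<le> (\<integral>\<^sup>+t. kern CARD('n) \<alpha> (1 - (norm t)\<^sup>2) \<partial>(hyp_borel :: (complex^'n) measure)) * (SUP r\<in>{0..<1}. G r)"
        by (rule radial_integral_le_Sup[of "\<lambda>r. kern CARD('n) \<alpha> (1 - r\<^sup>2)"]) (measurable, auto intro!: SUP_upper)
      then show ?case using y unfolding kern_total_mass[OF elim] by simp
    qed
  next
    fix y assume y: "y < kern_mass TYPE('n) * (SUP r\<in>{0..<1}. G r)"
    have "kern_mass TYPE('n) * (SUP r\<in>{0..<1}. G r) = (SUP r\<in>{0..<1}. kern_mass TYPE('n) * G r)"
      by (rule SUP_mult_left_ennreal)
    with y obtain r where r: "0 \<le> r" "r < 1" "y < kern_mass TYPE('n) * G r"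
      by (auto simp: less_SUP_iff)
    let ?e = "\<lambda>\<alpha>. \<integral>\<^sup>+t. indicator {..<r} (norm t) * kern CARD('n) \<alpha> (1 - (norm t)\<^sup>2) \<partial>(hyp_borel :: (complex^'n) measure)"
    have "((\<lambda>\<alpha>. (kern_mass TYPE('n) - ?e \<alpha>) * G r) \<longlongrightarrow> (kern_mass TYPE('n) - 0) * G r) (at_right (-1))"
      using kern_mass_nz[where 'n='n]
      by (intro tendsto_mult_ennreal tendsto_diff_ennreal_general tendsto_const kern_mass_concentrates r) auto
    then have "eventually (\<lambda>\<alpha>. y < (kern_mass TYPE('n) - ?e \<alpha>) * G r) (at_right (-1))"
      using r(3) by (intro order_tendstoD(1)) auto
    then show "eventually (\<lambda>\<alpha>. y < ?I \<alpha>) (at_right (-1))"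
      using ev
    proof eventually_elim
      case (elim \<alpha>)
      let ?o = "\<integral>\<^sup>+t. indicator {r..} (norm t) * kern CARD('n) \<alpha> (1 - (norm t)\<^sup>2) \<partial>(hyp_borel :: (complex^'n) measure)"
      have "kern_mass TYPE('n) = (\<integral>\<^sup>+t. indicator {..<r} (norm t) * kern CARD('n) \<alpha> (1 - (norm t)\<^sup>2) + indicator {r..} (norm t) * kern CARD('n) \<alpha> (1 - (norm t)\<^sup>2) \<partial>(hyp_borel :: (complex^'n) measure))"
        unfolding kern_total_mass[OF elim(2), where 'n='n, symmetric]
        by (rule nn_integral_cong) (auto simp: indicator_def)
      also have "\<dots> = ?e \<alpha> + ?o" by (rule nn_integral_add) measurable
      finally have m: "kern_mass TYPE('n) = ?e \<alpha> + ?o" .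
      then have "?e \<alpha> \<noteq> top_class.top" using kern_mass_nz(2)[where 'n='n] by auto
      then have "kern_mass TYPE('n) - ?e \<alpha> = ?o" unfolding m by (simp add: ennreal_add_diff_cancel_left)
      then have "y < ?o * G r" using elim(1) by simp
      also have "?o * G r = (\<integral>\<^sup>+t. indicator {r..} (norm t) * kern CARD('n) \<alpha> (1 - (norm t)\<^sup>2) * G r \<partial>(hyp_borel :: (complex^'n) measure))"
        by (rule nn_integral_multc[symmetric]) measurable
      also have "\<dots> \<le> ?I \<alpha>"
      proof (rule hyp_borel_mono)
        fix t :: "complex^'n" assume "t \<in> \<bbbB>"
        then show "indicator {r..} (norm t) * kern CARD('n) \<alpha> (1 - (norm t)\<^sup>2) * G r \<le> kern CARD('n) \<alpha> (1 - (norm t)\<^sup>2) * G (norm t)"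
          using mono[OF r(1), of "norm t"] by (auto simp: indicator_def intro: mult_left_mono)
      qed
      finally show ?case .
    qed
  }
qed

section \<open>Kernels of two points and the growth of spherical means\<close>

text \<open>A rational expression in both arguments that agrees with \<open>T\<close> on the ball: unlike \<open>T\<close> itself, which is
  defined by projections, it is visibly jointly Borel measurable.\<close>

definition T_formula :: "complex^'n \<Rightarrow> complex^'n \<Rightarrow> complex^'n"
  where "T_formula z w = (1 / (1 - cdot w z)) *s ((1 - cdot w z / (1 + of_real (sfun z))) *s z - of_real (sfun z) *s w)"

lemma T_eq_T_formula: "norm z < 1 \<Longrightarrow> T z w = T_formula z w"
  by (simp only: T_eq T_formula_def)

lemma borel_measurable_cdot [measurable (raw)]:
  fixes a b :: "_ \<Rightarrow> complex^'n"
  assumes "a \<in> borel_measurable M" "b \<in> borel_measurable M"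
  shows "(\<lambda>x. cdot (a x) (b x)) \<in> borel_measurable M"
proof -
  have "(\<lambda>p :: (complex^'n) \<times> (complex^'n). cdot (fst p) (snd p)) \<in> borel_measurable borel"
    by (intro borel_measurable_continuous_onI continuous_intros)
  then have "(\<lambda>p :: (complex^'n) \<times> (complex^'n). cdot (fst p) (snd p)) \<in> borel_measurable (borel \<Otimes>\<^sub>M borel)"
    by (simp only: borel_prod)
  from measurable_compose[OF measurable_Pair[OF assms] this] show ?thesis by simp
qed

lemma borel_measurable_sfun [measurable]: "sfun \<in> borel_measurable borel"
  unfolding sfun_def[abs_def] by measurable

lemma borel_measurable_T_formula [measurable (raw)]:
  assumes [measurable]: "a \<in> borel_measurable M" "b \<in> borel_measurable M"
  shows "(\<lambda>x. T_formula (a x) (b x)) \<in> borel_measurable M"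
  unfolding T_formula_def by measurable

text \<open>The function \<open>1 - |T\<^sub>z w|\<^sup>2\<close> of two points of the ball, by an expression that is measurable and
  symmetric.\<close>

definition dl :: "complex^'n \<Rightarrow> complex^'n \<Rightarrow> real"
  where "dl z w = (1 - (norm z)\<^sup>2) * (1 - (norm w)\<^sup>2) / (norm (1 - cdot w z))\<^sup>2"

lemma borel_measurable_dl [measurable (raw)]:
  assumes [measurable]: "a \<in> borel_measurable M" "b \<in> borel_measurable M"
  shows "(\<lambda>x. dl (a x) (b x)) \<in> borel_measurable M"
  unfolding dl_def by measurable

lemma dl_T: "z \<in> \<bbbB> \<Longrightarrow> w \<in> \<bbbB> \<Longrightarrow> dl z w = 1 - (norm (T z w))\<^sup>2"
  by (simp add: dl_def one_minus_norm_T)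

lemma dl_invariant: "ball_auto g \<Longrightarrow> z \<in> \<bbbB> \<Longrightarrow> w \<in> \<bbbB> \<Longrightarrow> dl (g z) (g w) = dl z w"
  by (simp only: dl_T ball_auto_in ball_auto_norm_T)

lemma dl_commute: "dl z w = dl w z"
proof -
  have "norm (1 - cdot w z) = norm (cnj (1 - cdot w z))" by (rule complex_mod_cnj[symmetric])
  then show ?thesis by (simp add: dl_def cdot_cnj mult.commute)
qed

lemma dl_zero_left [simp]: "dl 0 t = 1 - (norm t)\<^sup>2"
  by (simp add: dl_def)

lemma T_in_ball [simp]: "z \<in> \<bbbB> \<Longrightarrow> t \<in> \<bbbB> \<Longrightarrow> T z t \<in> \<bbbB>"
  by (simp add: norm_T_less_one)

lemma dl_T_right: "z \<in> \<bbbB> \<Longrightarrow> t \<in> \<bbbB> \<Longrightarrow> dl z (T z t) = 1 - (norm t)\<^sup>2"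
  by (subst dl_T) (simp_all add: norm_T_less_one)

lemma dl_pos: assumes "z \<in> \<bbbB>" "w \<in> \<bbbB>" shows "0 < dl z w"
  using one_minus_norm_sq_pos[of "T z w"] T_in_ball[OF assms] by (simp only: dl_T[OF assms] mem_ball_0)

lemma kern_dl_pos: "\<alpha> > -1 \<Longrightarrow> z \<in> \<bbbB> \<Longrightarrow> w \<in> \<bbbB> \<Longrightarrow> kern N \<alpha> (dl z w) > 0"
proof -
  assume a: "\<alpha> > -1" and zw: "z \<in> \<bbbB>" "w \<in> \<bbbB>"
  have "kern_const N \<alpha> > 0" unfolding kern_const_def
    using a by (intro divide_pos_pos mult_pos_pos Gamma_real_pos) auto
  then show ?thesis using dl_pos[OF zw] unfolding kern_def by (simp add: ennreal_zero_less_mult_iff)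
qed

text \<open>A reflection in the complex hyperplane orthogonal to \<open>a - c b\<close>, with the phase \<open>c\<close> chosen so that
  \<open>\<langle>a, c b\<rangle>\<close> is real, maps \<open>a\<close> to \<open>c b\<close>.\<close>

lemma unitary_transitive:
  fixes a b :: "complex^'n"
  assumes ab: "norm a = norm b"
  obtains U where "ball_auto U" "U 0 = 0" "U a = b"
proof -
  define c where "c = (if cdot a b = 0 then 1 else cdot a b / norm (cdot a b))"
  have c: "norm c = 1" by (simp add: c_def norm_divide)
  have re: "cdot a (c *s b) = of_real (norm (cdot a b))"
    by (simp add: cdot_scale_right c_def complex_norm_square[symmetric] power2_eq_square mult.commute)
  define b' where "b' = c *s b"
  have nb': "norm b' = norm a" by (simp add: b'_def norm_vector_smult c ab)
  define v where "v = a - b'"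
  define k where "k = 2 / complex_of_real ((norm v)\<^sup>2)"
  define R where "R x = x - (k * cdot x v) *s v" for x
  have kr: "cnj k = k" by (simp add: k_def)
  have kv: "k * k * of_real ((norm v)\<^sup>2) = 2 * k"
    by (cases "v = 0") (simp_all add: k_def field_simps power2_eq_square)
  have sc: "R (d *s x) = d *s R x" for d x
    by (simp add: R_def cdot_scale_left vec_eq_iff algebra_simps)
  have lin: "linear R"
    by (rule linearI) (simp_all add: R_def cdot_add_left scaleR_vec_complex cdot_scale_left vec_eq_iff algebra_simps)
  have RR: "R (R x) = x" for x
  proof -
    have e: "cdot (R x) v = cdot x v - k * cdot x v * of_real ((norm v)\<^sup>2)"
      by (simp add: R_def cdot_diff_left cdot_scale_left cdot_self)
    have "k * cdot (R x) v = k * cdot x v - (k * k * of_real ((norm v)\<^sup>2)) * cdot x v"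
      unfolding e by (simp add: algebra_simps)
    also have "\<dots> = - (k * cdot x v)" unfolding kv by simp
    finally have "R (R x) = R x - (- (k * cdot x v)) *s v" unfolding R_def[of "R x"] by simp
    then show ?thesis by (simp add: R_def vec_eq_iff)
  qed
  have nR: "norm (R x) = norm x" for x
  proof -
    have "cdot (R x) (R x) = cdot x x - k * cdot x v * cdot v x - k * cdot v x * cdot x v + (k * k * of_real ((norm v)\<^sup>2)) * (cdot x v * cdot v x)"
      unfolding R_def cdot_diff_left cdot_diff_right cdot_scale_left cdot_scale_right cdot_self[of v]
      by (simp add: kr cdot_cnj algebra_simps)
    also have "\<dots> = cdot x x" unfolding kv by (simp add: algebra_simps)
    finally have "complex_of_real ((norm (R x))\<^sup>2) = complex_of_real ((norm x)\<^sup>2)" by (simp only: cdot_self)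
    then have "(norm (R x))\<^sup>2 = (norm x)\<^sup>2" using of_real_eq_iff by blast
    then show ?thesis by simp
  qed
  have "R a = b'"
  proof (cases "v = 0")
    case False
    have "cdot b' a = cdot a b'" using re by (metis b'_def cdot_cnj complex_cnj_complex_of_real)
    then have "cdot v v = 2 * cdot a v"
      unfolding v_def cdot_diff_left cdot_diff_right cdot_self[of a] cdot_self[of b'] nb' by simp
    then have "2 * cdot a v = of_real ((norm v)\<^sup>2)" unfolding cdot_self by simp
    then have "k * cdot a v = 1" using False by (simp add: k_def)
    then show ?thesis by (simp add: R_def v_def)
  qed (simp add: R_def v_def)
  have "ball_auto R" by (rule ball_auto_unitary[where W=R]) (simp_all add: lin sc nR RR)
  have c': "norm (1 / c) = 1" using c by (simp add: norm_divide)
  have "ball_auto (\<lambda>x. (1 / c) *s R x)"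
  proof (rule ball_auto_unitary[where W="\<lambda>x. R (c *s x)"])
    have l: "linear ((*s) d :: complex^'n \<Rightarrow> _)" for d :: complex
      by (rule linearI) (simp_all add: vec_eq_iff algebra_simps)
    show "linear (\<lambda>x. (1 / c) *s R x)" using linear_compose[OF lin l] by (simp add: o_def)
    show "linear (\<lambda>x. R (c *s x))" using linear_compose[OF l lin] by (simp add: o_def)
    have c0: "c \<noteq> 0" using c by auto
    show "R (c *s ((1 / c) *s R x)) = x" "(1 / c) *s R (R (c *s x)) = x" for x using c0 by (simp_all add: RR)
    show "norm ((1 / c) *s R x) = norm x" for x using c' by (simp add: norm_vector_smult nR)
    show "(1 / c) *s R (d *s x) = d *s ((1 / c) *s R x)" "R (c *s (d *s x)) = d *s R (c *s x)" for d x
      by (simp_all add: sc vec_eq_iff)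
  qed
  moreover have "(1 / c) *s R 0 = 0" by (simp add: R_def)
  moreover have "(1 / c) *s R a = b" using c unfolding \<open>R a = b'\<close> b'_def by auto
  ultimately show ?thesis by (rule that)
qed

text \<open>The invariant volume is preserved by \<open>T\<^sub>z\<close>, which carries \<open>\<delta>(z, \<cdot>)\<close> to a function of the norm.\<close>

lemma radial_substitution:
  fixes u :: "complex^'n \<Rightarrow> ennreal"
  assumes z: "z \<in> \<bbbB>" and [measurable]: "u \<in> borel_measurable borel" "k \<in> borel_measurable borel"
  shows "(\<integral>\<^sup>+w. k (dl z w) * u w \<partial>hyp_borel) = (\<integral>\<^sup>+t. k (1 - (norm t)\<^sup>2) * u (T z t) \<partial>hyp_borel)"
proof -
  have "(\<integral>\<^sup>+w. k (dl z w) * u w \<partial>hyp_borel) = (\<integral>\<^sup>+t. k (dl z (T z t)) * u (T z t) \<partial>hyp_borel)"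
    by (rule hyp_borel_invariant[OF ball_auto_T[OF z], of "\<lambda>w. k (dl z w) * u w", symmetric]) measurable
  also have "\<dots> = (\<integral>\<^sup>+t. k (1 - (norm t)\<^sup>2) * u (T z t) \<partial>hyp_borel)"
    by (rule hyp_borel_cong) (simp only: dl_T_right[OF z])
  finally show ?thesis .
qed

lemma kern_dl_mass:
  assumes z: "z \<in> \<bbbB>" and a: "\<alpha> > -1"
  shows "(\<integral>\<^sup>+w. kern CARD('n) \<alpha> (dl z w) \<partial>(hyp_borel :: (complex^'n) measure)) = kern_mass TYPE('n)"
  using radial_substitution[OF z, of "\<lambda>_. 1" "kern CARD('n) \<alpha>"] kern_total_mass[OF a, where 'n='n] by simp

text \<open>The function \<open>|f(z, T\<^sub>z t)|\<^sup>2\<close> of \<open>t\<close>, whose mean over the sphere of radius \<open>r\<close> about the origin is the mean of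
  \<open>|f(z, \<cdot>)|\<^sup>2\<close> over an invariant sphere about \<open>z\<close>.\<close>

definition pullback_sq :: "((complex^'n) \<times> (complex^'n) \<Rightarrow> complex) \<Rightarrow> complex^'n \<Rightarrow> complex^'n \<Rightarrow> ennreal"
  where "pullback_sq f z t = indicator \<bbbB> t * ennreal ((cmod (f (z, T_formula z t)))\<^sup>2)"

text \<open>If \<open>f\<close> is holomorphic in the second variable this increases with \<open>r\<close>, and its supremum is, up to the
  factor \<open>\<kappa>\<close>, the limit of the Bergman norms.\<close>

definition mean_growth :: "(complex^'n) set \<Rightarrow> ((complex^'n) \<times> (complex^'n) \<Rightarrow> complex) \<Rightarrow> real \<Rightarrow> ennreal"
  where "mean_growth D f r = (\<integral>\<^sup>+z. indicator D z * sphere_mean (pullback_sq f z) r \<partial>hyp_borel)"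

lemma pullback_sq_measurable [measurable (raw)]:
  assumes [measurable]: "f \<in> borel_measurable (borel \<Otimes>\<^sub>M borel)" "a \<in> borel_measurable M" "b \<in> borel_measurable M"
  shows "(\<lambda>x. pullback_sq f (a x) (b x)) \<in> borel_measurable M"
  unfolding pullback_sq_def by measurable

lemma sphere_mean_measurable2:
  fixes u :: "'a \<Rightarrow> complex^'n \<Rightarrow> ennreal"
  assumes [measurable]: "case_prod u \<in> borel_measurable (M \<Otimes>\<^sub>M borel)" "r \<in> borel_measurable M"
  shows "(\<lambda>x. sphere_mean (u x) (r x)) \<in> borel_measurable M"
  unfolding sphere_mean_def by measurable

lemma pullback_sq_eq: "z \<in> \<bbbB> \<Longrightarrow> pullback_sq f z = ball_sq (\<lambda>t. f (z, T z t))"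
  by (simp add: fun_eq_iff pullback_sq_def ball_sq_def T_eq_T_formula)

lemma cholo_on_slice_T:
  assumes "z \<in> \<bbbB>" "cholo_on (\<lambda>w. f (z, w)) \<bbbB>"
  shows "cholo_on (\<lambda>t. f (z, T z t)) \<bbbB>"
  using T_maps_ball[OF assms(1)] by (intro cholo_on_compose[OF holo_map_on_T[OF assms(1)] assms(2)]) blast

lemma mean_growth_mono:
  assumes D: "D \<subseteq> \<bbbB>" and f: "\<And>z. z \<in> D \<Longrightarrow> cholo_on (\<lambda>w. f (z, w)) \<bbbB>"
    and r: "0 \<le> r" "r \<le> r'" "r' < 1"
  shows "mean_growth D f r \<le> mean_growth D f r'"
  unfolding mean_growth_def
proof (rule nn_integral_mono)
  fix z
  show "indicator D z * sphere_mean (pullback_sq f z) r \<le> indicator D z * sphere_mean (pullback_sq f z) r'"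
  proof (cases "z \<in> D")
    case True
    then have z: "z \<in> \<bbbB>" using D by blast
    show ?thesis unfolding pullback_sq_eq[OF z]
      by (intro mult_left_mono sphere_mean_mono[OF cholo_on_slice_T[OF z f[OF True]] r]) simp
  qed simp
qed

lemma mean_growth_radial:
  fixes f :: "(complex^'n) \<times> (complex^'n) \<Rightarrow> complex"
  assumes D: "D \<subseteq> \<bbbB>" and [measurable]: "D \<in> sets borel" "f \<in> borel_measurable (borel \<Otimes>\<^sub>M borel)" "k \<in> borel_measurable borel"
  shows "(\<integral>\<^sup>+z. indicator D z * (\<integral>\<^sup>+w. k (dl z w) * ennreal ((cmod (f (z, w)))\<^sup>2) \<partial>hyp_borel) \<partial>hyp_borel)
    = (\<integral>\<^sup>+t. k (1 - (norm t)\<^sup>2) * mean_growth D f (norm t) \<partial>(hyp_borel :: (complex^'n) measure))"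
proof -
  have [measurable]: "(\<lambda>p. sphere_mean (pullback_sq f (fst p)) (norm (snd p))) \<in> borel_measurable (borel \<Otimes>\<^sub>M (borel :: (complex^'n) measure))"
    by (rule sphere_mean_measurable2) measurable
  have "(\<integral>\<^sup>+z. indicator D z * (\<integral>\<^sup>+w. k (dl z w) * ennreal ((cmod (f (z, w)))\<^sup>2) \<partial>hyp_borel) \<partial>hyp_borel)
    = (\<integral>\<^sup>+z. \<integral>\<^sup>+t. indicator D z * (k (1 - (norm t)\<^sup>2) * sphere_mean (pullback_sq f z) (norm t)) \<partial>(hyp_borel :: (complex^'n) measure) \<partial>hyp_borel)"
  proof (rule nn_integral_cong)
    fix z :: "complex^'n"
    show "indicator D z * (\<integral>\<^sup>+w. k (dl z w) * ennreal ((cmod (f (z, w)))\<^sup>2) \<partial>hyp_borel)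
      = (\<integral>\<^sup>+t. indicator D z * (k (1 - (norm t)\<^sup>2) * sphere_mean (pullback_sq f z) (norm t)) \<partial>(hyp_borel :: (complex^'n) measure))"
    proof (cases "z \<in> D")
      case True
      then have z: "z \<in> \<bbbB>" using D by blast
      have "(\<integral>\<^sup>+w. k (dl z w) * ennreal ((cmod (f (z, w)))\<^sup>2) \<partial>hyp_borel) = (\<integral>\<^sup>+t. k (1 - (norm t)\<^sup>2) * ennreal ((cmod (f (z, T z t)))\<^sup>2) \<partial>hyp_borel)"
        by (rule radial_substitution[OF z]) measurable
      also have "\<dots> = (\<integral>\<^sup>+t. k (1 - (norm t)\<^sup>2) * pullback_sq f z t \<partial>hyp_borel)"
        by (rule hyp_borel_cong) (use z in \<open>simp add: pullback_sq_def T_eq_T_formula\<close>)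
      also have "\<dots> = (\<integral>\<^sup>+t. k (1 - (norm t)\<^sup>2) * sphere_mean (pullback_sq f z) (norm t) \<partial>(hyp_borel :: (complex^'n) measure))"
        by (rule hyp_borel_radial[of "pullback_sq f z" "\<lambda>r. k (1 - r\<^sup>2)"]) measurable
      finally show ?thesis using True by simp
    qed simp
  qed
  also have "\<dots> = (\<integral>\<^sup>+t. \<integral>\<^sup>+z. indicator D z * (k (1 - (norm t)\<^sup>2) * sphere_mean (pullback_sq f z) (norm t)) \<partial>hyp_borel \<partial>(hyp_borel :: (complex^'n) measure))"
    using hyp_borel_Fubini[of "\<lambda>p. indicator D (fst p) * (k (1 - (norm (snd p))\<^sup>2) * sphere_mean (pullback_sq f (fst p)) (norm (snd p)))"]
    by simp
  also have "\<dots> = (\<integral>\<^sup>+t. k (1 - (norm t)\<^sup>2) * mean_growth D f (norm t) \<partial>(hyp_borel :: (complex^'n) measure))"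
    unfolding mean_growth_def
  proof (rule nn_integral_cong)
    fix t :: "complex^'n"
    have [measurable]: "(\<lambda>z. sphere_mean (pullback_sq f z) (norm t)) \<in> borel_measurable borel"
      by (rule sphere_mean_measurable2) measurable
    have "(\<integral>\<^sup>+z. indicator D z * (k (1 - (norm t)\<^sup>2) * sphere_mean (pullback_sq f z) (norm t)) \<partial>hyp_borel)
      = (\<integral>\<^sup>+z. k (1 - (norm t)\<^sup>2) * (indicator D z * sphere_mean (pullback_sq f z) (norm t)) \<partial>hyp_borel)"
      by (simp only: mult.left_commute)
    also have "\<dots> = k (1 - (norm t)\<^sup>2) * (\<integral>\<^sup>+z. indicator D z * sphere_mean (pullback_sq f z) (norm t) \<partial>hyp_borel)"
      by (rule nn_integral_cmult) measurable
    finally show "(\<integral>\<^sup>+z. indicator D z * (k (1 - (norm t)\<^sup>2) * sphere_mean (pullback_sq f z) (norm t)) \<partial>hyp_borel)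
      = k (1 - (norm t)\<^sup>2) * (\<integral>\<^sup>+z. indicator D z * sphere_mean (pullback_sq f z) (norm t) \<partial>hyp_borel)" .
  qed
  finally show ?thesis .
qed

section \<open>Unfolding over a group with a fundamental domain\<close>

text \<open>A countable group of automorphisms with a Borel fundamental domain \<open>D\<close>.  The inversion \<open>\<iota>\<close> enters as a
  bijection of the index set of the sums that result from unfolding.\<close>

locale ball_quotient =
  fixes \<Gamma> :: "(complex^'n \<Rightarrow> complex^'n) set" and \<iota> :: "(complex^'n \<Rightarrow> complex^'n) \<Rightarrow> complex^'n \<Rightarrow> complex^'n"
    and D :: "(complex^'n) set"
  assumes countable_\<Gamma>: "countable \<Gamma>"
    and auto_\<Gamma>: "\<gamma> \<in> \<Gamma> \<Longrightarrow> ball_auto \<gamma>"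
    and borel_\<Gamma>: "\<gamma> \<in> \<Gamma> \<Longrightarrow> \<gamma> \<in> borel_measurable borel"
    and bij_\<iota>: "bij_betw \<iota> \<Gamma> \<Gamma>"
    and \<iota>_left: "\<gamma> \<in> \<Gamma> \<Longrightarrow> z \<in> \<bbbB> \<Longrightarrow> \<iota> \<gamma> (\<gamma> z) = z"
    and \<iota>_right: "\<gamma> \<in> \<Gamma> \<Longrightarrow> z \<in> \<bbbB> \<Longrightarrow> \<gamma> (\<iota> \<gamma> z) = z"
    and borel_D: "D \<in> sets borel"
    and D_ball: "D \<subseteq> \<bbbB>"
    and fundamental: "z \<in> \<bbbB> \<Longrightarrow> \<exists>!\<gamma>. \<gamma> \<in> \<Gamma> \<and> z \<in> \<gamma> ` D"
begin

lemma \<iota>_in: "\<gamma> \<in> \<Gamma> \<Longrightarrow> \<iota> \<gamma> \<in> \<Gamma>"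
  using bij_\<iota> by (auto simp: bij_betw_def)

lemma translate_D:
  assumes "\<gamma> \<in> \<Gamma>" "z \<in> \<bbbB>" shows "z \<in> \<gamma> ` D \<longleftrightarrow> \<iota> \<gamma> z \<in> D"
  using assms D_ball \<iota>_left[OF assms(1)] \<iota>_right[OF assms] by (metis image_iff subsetD)

lemma Tonelli_\<Gamma>:
  fixes f :: "(complex^'n \<Rightarrow> complex^'n) \<Rightarrow> complex^'n \<Rightarrow> ennreal"
  assumes "\<And>\<gamma>. \<gamma> \<in> \<Gamma> \<Longrightarrow> f \<gamma> \<in> borel_measurable borel"
  shows "(\<integral>\<^sup>+z. \<integral>\<^sup>+\<gamma>. f \<gamma> z \<partial>count_space \<Gamma> \<partial>hyp_borel) = (\<integral>\<^sup>+\<gamma>. \<integral>\<^sup>+z. f \<gamma> z \<partial>hyp_borel \<partial>count_space \<Gamma>)"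
proof -
  interpret a: sigma_finite_measure "hyp_borel :: (complex^'n) measure" by (rule sigma_finite_hyp_borel)
  interpret b: sigma_finite_measure "count_space \<Gamma>" by (rule sigma_finite_measure_count_space_countable[OF countable_\<Gamma>])
  interpret pair_sigma_finite "count_space \<Gamma>" "hyp_borel :: (complex^'n) measure" ..
  have "(\<lambda>p. f (fst p) (snd p)) \<in> borel_measurable (count_space \<Gamma> \<Otimes>\<^sub>M hyp_borel)"
    by (rule measurable_pair_measure_countable1[OF countable_\<Gamma>]) (use assms in simp)
  from Fubini[OF this] show ?thesis by simp
qed

text \<open>The ball is the disjoint union of the translates of \<open>D\<close>.\<close>

lemma unfold_integral:
  assumes [measurable]: "h \<in> borel_measurable borel"
  shows "(\<integral>\<^sup>+z. h z \<partial>hyp_borel) = (\<integral>\<^sup>+\<gamma>. \<integral>\<^sup>+z. indicator D z * h (\<gamma> z) \<partial>hyp_borel \<partial>count_space \<Gamma>)"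
proof -
  note [measurable] = borel_D borel_\<Gamma>
  define f where "f \<gamma> z = indicator \<bbbB> z * (indicator D (\<iota> \<gamma> z) * h z)" for \<gamma> and z :: "complex^'n"
  have fm: "f \<gamma> \<in> borel_measurable borel" if "\<gamma> \<in> \<Gamma>" for \<gamma>
    using borel_\<Gamma>[OF \<iota>_in[OF that], measurable] unfolding f_def by measurable
  have "(\<integral>\<^sup>+z. h z \<partial>hyp_borel) = (\<integral>\<^sup>+z. \<integral>\<^sup>+\<gamma>. f \<gamma> z \<partial>count_space \<Gamma> \<partial>hyp_borel)"
  proof (rule hyp_borel_cong)
    fix z :: "complex^'n" assume z: "z \<in> \<bbbB>"
    obtain \<gamma>0 where g0: "\<gamma>0 \<in> \<Gamma>" "\<And>\<gamma>. \<gamma> \<in> \<Gamma> \<Longrightarrow> z \<in> \<gamma> ` D \<longleftrightarrow> \<gamma> = \<gamma>0"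
      using fundamental[OF z] by auto
    have "(\<integral>\<^sup>+\<gamma>. f \<gamma> z \<partial>count_space \<Gamma>) = (\<integral>\<^sup>+\<gamma>. h z * indicator {\<gamma>0} \<gamma> \<partial>count_space \<Gamma>)"
      by (rule nn_integral_cong) (use z g0 translate_D[OF _ z] in \<open>auto simp: f_def indicator_def\<close>)
    also have "\<dots> = h z" using g0(1) by (simp add: nn_integral_cmult_indicator)
    finally show "h z = (\<integral>\<^sup>+\<gamma>. f \<gamma> z \<partial>count_space \<Gamma>)" by simp
  qed
  also have "\<dots> = (\<integral>\<^sup>+\<gamma>. \<integral>\<^sup>+z. f \<gamma> z \<partial>hyp_borel \<partial>count_space \<Gamma>)" by (rule Tonelli_\<Gamma>[OF fm])
  also have "\<dots> = (\<integral>\<^sup>+\<gamma>. \<integral>\<^sup>+z. indicator D z * h (\<gamma> z) \<partial>hyp_borel \<partial>count_space \<Gamma>)"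
  proof (rule nn_integral_cong)
    fix \<gamma> assume "\<gamma> \<in> space (count_space \<Gamma>)"
    then have g: "\<gamma> \<in> \<Gamma>" by simp
    have "(\<integral>\<^sup>+z. f \<gamma> z \<partial>hyp_borel) = (\<integral>\<^sup>+z. f \<gamma> (\<gamma> z) \<partial>hyp_borel)"
      by (rule hyp_borel_invariant[OF auto_\<Gamma>[OF g] fm[OF g], symmetric])
    also have "\<dots> = (\<integral>\<^sup>+z. indicator D z * h (\<gamma> z) \<partial>hyp_borel)"
    proof (rule hyp_borel_cong)
      fix z :: "complex^'n" assume z: "z \<in> \<bbbB>"
      show "f \<gamma> (\<gamma> z) = indicator D z * h (\<gamma> z)"
        unfolding f_def \<iota>_left[OF g z] using ball_auto_in[OF auto_\<Gamma>[OF g] z] by simp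
    qed
    finally show "(\<integral>\<^sup>+z. f \<gamma> z \<partial>hyp_borel) = (\<integral>\<^sup>+z. indicator D z * h (\<gamma> z) \<partial>hyp_borel)" .
  qed
  finally show ?thesis .
qed

text \<open>Unfolding turns both sides into sums over the group of integrals over \<open>D \<times> D\<close>; the invariance of \<open>H\<close>
  identifies the term of \<open>\<gamma>\<close> on one side with that of its inverse on the other.\<close>

lemma swap_integral:
  assumes [measurable]: "H \<in> borel_measurable (borel \<Otimes>\<^sub>M borel)"
    and inv: "\<And>\<gamma> z w. \<gamma> \<in> \<Gamma> \<Longrightarrow> z \<in> \<bbbB> \<Longrightarrow> w \<in> \<bbbB> \<Longrightarrow> H (\<gamma> z, \<gamma> w) = H (z, w)"
  shows "(\<integral>\<^sup>+z. indicator D z * (\<integral>\<^sup>+w. H (z, w) \<partial>hyp_borel) \<partial>hyp_borel)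
    = (\<integral>\<^sup>+w. indicator D w * (\<integral>\<^sup>+z. H (z, w) \<partial>hyp_borel) \<partial>hyp_borel)"
proof -
  note [measurable] = borel_D
  define A where "A \<gamma> = (\<integral>\<^sup>+z. \<integral>\<^sup>+w. indicator D z * (indicator D w * H (z, \<gamma> w)) \<partial>hyp_borel \<partial>hyp_borel)" for \<gamma>
  define B where "B \<gamma> = (\<integral>\<^sup>+w. \<integral>\<^sup>+z. indicator D w * (indicator D z * H (\<gamma> z, w)) \<partial>hyp_borel \<partial>hyp_borel)" for \<gamma>
  have L: "(\<integral>\<^sup>+z. indicator D z * (\<integral>\<^sup>+w. H (z, w) \<partial>hyp_borel) \<partial>hyp_borel) = (\<integral>\<^sup>+\<gamma>. A \<gamma> \<partial>count_space \<Gamma>)"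
  proof -
    have "(\<integral>\<^sup>+z. indicator D z * (\<integral>\<^sup>+w. H (z, w) \<partial>hyp_borel) \<partial>hyp_borel)
      = (\<integral>\<^sup>+z. \<integral>\<^sup>+\<gamma>. indicator D z * (\<integral>\<^sup>+w. indicator D w * H (z, \<gamma> w) \<partial>hyp_borel) \<partial>count_space \<Gamma> \<partial>hyp_borel)"
      by (rule nn_integral_cong, subst unfold_integral) (measurable, subst nn_integral_cmult, auto)
    also have "\<dots> = (\<integral>\<^sup>+\<gamma>. \<integral>\<^sup>+z. indicator D z * (\<integral>\<^sup>+w. indicator D w * H (z, \<gamma> w) \<partial>hyp_borel) \<partial>hyp_borel \<partial>count_space \<Gamma>)"
    proof (rule Tonelli_\<Gamma>)
      fix \<gamma> assume "\<gamma> \<in> \<Gamma>"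
      note [measurable] = borel_\<Gamma>[OF this]
      have "(\<lambda>z. \<integral>\<^sup>+w. indicator D w * H (z, \<gamma> w) \<partial>hyp_borel) \<in> borel_measurable borel"
        by (rule hyp_borel_integral_measurable) measurable
      then show "(\<lambda>z. indicator D z * (\<integral>\<^sup>+w. indicator D w * H (z, \<gamma> w) \<partial>hyp_borel)) \<in> borel_measurable borel" by measurable
    qed
    also have "\<dots> = (\<integral>\<^sup>+\<gamma>. A \<gamma> \<partial>count_space \<Gamma>)"
      unfolding A_def
    proof (intro nn_integral_cong nn_integral_cmult[symmetric])
      fix \<gamma> z assume "\<gamma> \<in> space (count_space \<Gamma>)"
      then have [measurable]: "\<gamma> \<in> borel_measurable borel" by (simp add: borel_\<Gamma>)
      show "(\<lambda>w. indicator D w * H (z, \<gamma> w)) \<in> borel_measurable hyp_borel" by measurable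
    qed
    finally show ?thesis .
  qed
  have R: "(\<integral>\<^sup>+w. indicator D w * (\<integral>\<^sup>+z. H (z, w) \<partial>hyp_borel) \<partial>hyp_borel) = (\<integral>\<^sup>+\<gamma>. B \<gamma> \<partial>count_space \<Gamma>)"
  proof -
    have "(\<integral>\<^sup>+w. indicator D w * (\<integral>\<^sup>+z. H (z, w) \<partial>hyp_borel) \<partial>hyp_borel)
      = (\<integral>\<^sup>+w. \<integral>\<^sup>+\<gamma>. indicator D w * (\<integral>\<^sup>+z. indicator D z * H (\<gamma> z, w) \<partial>hyp_borel) \<partial>count_space \<Gamma> \<partial>hyp_borel)"
      by (rule nn_integral_cong, subst unfold_integral) (measurable, subst nn_integral_cmult, auto)
    also have "\<dots> = (\<integral>\<^sup>+\<gamma>. \<integral>\<^sup>+w. indicator D w * (\<integral>\<^sup>+z. indicator D z * H (\<gamma> z, w) \<partial>hyp_borel) \<partial>hyp_borel \<partial>count_space \<Gamma>)"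
    proof (rule Tonelli_\<Gamma>)
      fix \<gamma> assume "\<gamma> \<in> \<Gamma>"
      note [measurable] = borel_\<Gamma>[OF this]
      have "(\<lambda>w. \<integral>\<^sup>+z. indicator D z * H (\<gamma> z, w) \<partial>hyp_borel) \<in> borel_measurable borel"
        by (rule hyp_borel_integral_measurable) measurable
      then show "(\<lambda>w. indicator D w * (\<integral>\<^sup>+z. indicator D z * H (\<gamma> z, w) \<partial>hyp_borel)) \<in> borel_measurable borel" by measurable
    qed
    also have "\<dots> = (\<integral>\<^sup>+\<gamma>. B \<gamma> \<partial>count_space \<Gamma>)"
      unfolding B_def
    proof (intro nn_integral_cong nn_integral_cmult[symmetric])
      fix \<gamma> w assume "\<gamma> \<in> space (count_space \<Gamma>)"
      then have [measurable]: "\<gamma> \<in> borel_measurable borel" by (simp add: borel_\<Gamma>)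
      show "(\<lambda>z. indicator D z * H (\<gamma> z, w)) \<in> borel_measurable hyp_borel" by measurable
    qed
    finally show ?thesis .
  qed
  have AB: "B \<gamma> = A (\<iota> \<gamma>)" if g: "\<gamma> \<in> \<Gamma>" for \<gamma>
  proof -
    note [measurable] = borel_\<Gamma>[OF g]
    have "A (\<iota> \<gamma>) = (\<integral>\<^sup>+z. \<integral>\<^sup>+w. indicator D w * (indicator D z * H (\<gamma> z, w)) \<partial>hyp_borel \<partial>hyp_borel)"
      unfolding A_def
    proof (intro hyp_borel_cong)
      fix z w :: "complex^'n" assume z: "z \<in> \<bbbB>" and w: "w \<in> \<bbbB>"
      have "H (\<gamma> z, \<gamma> (\<iota> \<gamma> w)) = H (z, \<iota> \<gamma> w)"
        by (rule inv[OF g z ball_auto_in[OF auto_\<Gamma>[OF \<iota>_in[OF g]] w]])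
      then show "indicator D z * (indicator D w * H (z, \<iota> \<gamma> w)) = indicator D w * (indicator D z * H (\<gamma> z, w))"
        by (simp add: \<iota>_right[OF g w] mult_ac)
    qed
    also have "\<dots> = B \<gamma>" unfolding B_def
      using hyp_borel_Fubini[of "\<lambda>p. indicator D (snd p) * (indicator D (fst p) * H (\<gamma> (fst p), snd p))"] by simp
    finally show ?thesis by simp
  qed
  have "(\<integral>\<^sup>+\<gamma>. B \<gamma> \<partial>count_space \<Gamma>) = (\<integral>\<^sup>+\<gamma>. A (\<iota> \<gamma>) \<partial>count_space \<Gamma>)"
    by (rule nn_integral_cong) (simp add: AB)
  also have "\<dots> = (\<integral>\<^sup>+\<gamma>. A \<gamma> \<partial>count_space \<Gamma>)" by (rule nn_integral_bij_count_space[OF bij_\<iota>])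
  finally show ?thesis unfolding L R by simp
qed

end

section \<open>Rigidity of invariant functions of finite growth\<close>

lemma cholo_on_cong:
  assumes S: "open S" and eq: "\<And>z. z \<in> S \<Longrightarrow> f z = g z" and f: "cholo_on f S"
  shows "cholo_on g S"
  unfolding cholo_on_def
proof
  fix z assume z: "z \<in> S"
  then obtain D where D: "(f has_derivative D) (at z)" "\<forall>c v. D (c *s v) = c * D v"
    using f unfolding cholo_on_def by blast
  have "(g has_derivative D) (at z)"
    by (rule has_derivative_transform_within_open[OF D(1) S z eq])
  then show "\<exists>D. (g has_derivative D) (at z) \<and> (\<forall>c v. D (c *s v) = c * D v)" using D(2) by blast
qed

text \<open>The set where \<open>f\<close> does not vanish is open in the ball, and open sets of measure zero are empty.\<close>

lemma AE_hyp_borel_continuous_zero: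
  fixes f :: "complex^'n \<Rightarrow> complex"
  assumes ae: "AE w in hyp_borel. f w = 0" and f: "continuous_on \<bbbB> f" and w: "w \<in> \<bbbB>"
  shows "f w = 0"
proof (rule ccontr)
  assume nz: "f w \<noteq> 0"
  define U where "U = {x \<in> \<bbbB>. f x \<in> - {0}}"
  have "open U" unfolding U_def by (rule continuous_open_preimage[OF f open_ball, of "- {0}", unfolded vimage_def Int_def mem_Collect_eq]) auto
  have wU: "w \<in> U" using w nz by (simp add: U_def)
  have ae': "AE x in hyp_borel. x \<notin> U" using ae by eventually_elim (simp add: U_def)
  have "AE x in lborel. x \<notin> U"
  proof -
    have "AE x in lborel. 0 < ennreal (2 ^ CARD('n) / (1 - (norm x)\<^sup>2) ^ (CARD('n) + 1)) * indicator \<bbbB> x \<longrightarrow> x \<notin> U"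
      using ae' unfolding hyp_borel_def by (subst (asm) AE_density) auto
    then show ?thesis
    proof eventually_elim
      case (elim x)
      show "x \<notin> U"
      proof
        assume xU: "x \<in> U"
        then have xb: "x \<in> \<bbbB>" by (simp add: U_def)
        then have "0 < 1 - (norm x)\<^sup>2" by (intro one_minus_norm_sq_pos) simp
        then have "0 < 2 ^ CARD('n) / (1 - (norm x)\<^sup>2) ^ (CARD('n) + 1)" by (intro divide_pos_pos zero_less_power) auto
        then have "0 < ennreal (2 ^ CARD('n) / (1 - (norm x)\<^sup>2) ^ (CARD('n) + 1)) * indicator \<bbbB> x" using xb by simp
        then show False using elim xU by blast
      qed
    qed
  qed
  then have "emeasure lborel U = 0" using \<open>open U\<close> by (subst (asm) AE_iff_measurable[OF _ refl]) auto
  moreover obtain e where e: "e > 0" "ball w e \<subseteq> U" using \<open>open U\<close> wU open_contains_ball by blast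
  moreover have "emeasure lborel (ball w e) \<le> emeasure lborel U" using e \<open>open U\<close> by (intro emeasure_mono) auto
  moreover have "emeasure lborel (ball w e) > 0"
    using e(1) unit_ball_vol_pos[of "real DIM(complex^'n)"] unfolding emeasure_ball[OF order_less_imp_le[OF e(1)]]
    by (simp del: unit_ball_vol_pos add: zero_less_mult_iff)
  ultimately show False by simp
qed

text \<open>Squared moduli as extended nonnegative numbers, the form in which they enter all integrals.\<close>

definition sqn :: "complex \<Rightarrow> ennreal" where "sqn c = ennreal ((cmod c)\<^sup>2)"

lemma sqn_measurable [measurable]: "sqn \<in> borel_measurable borel"
  unfolding sqn_def[abs_def] by measurable

lemma sqn_eq_0 [simp]: "sqn c = 0 \<longleftrightarrow> c = 0"
  by (simp add: sqn_def)

text \<open>Holomorphy gives \<open>\<integral> |g|\<^sup>2 = |g(0)|\<^sup>2 + \<integral> |g - g(0)|\<^sup>2\<close> on every sphere about the origin; the identity is the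
  superposition of these.\<close>

lemma mean_value_identity:
  fixes g :: "complex^'n \<Rightarrow> complex"
  assumes g: "cholo_on g \<bbbB>" and [measurable]: "k \<in> borel_measurable borel"
  shows "(\<integral>\<^sup>+s. k (1 - (norm s)\<^sup>2) * sqn (g s) \<partial>hyp_borel) =
    (\<integral>\<^sup>+s. k (1 - (norm s)\<^sup>2) \<partial>(hyp_borel :: (complex^'n) measure)) * sqn (g 0) +
    (\<integral>\<^sup>+s. k (1 - (norm s)\<^sup>2) * sqn (g s - g 0) \<partial>hyp_borel)"
proof -
  have g0: "cholo_on (\<lambda>s. g s - g 0) \<bbbB>" by (rule cholo_on_diff_const[OF g])
  note [measurable] = borel_measurable_ball_sq[OF cholo_on_imp_continuous_on[OF g]] borel_measurable_ball_sq[OF cholo_on_imp_continuous_on[OF g0]]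
  have rad: "(\<integral>\<^sup>+s. k (1 - (norm s)\<^sup>2) * sqn (f s) \<partial>hyp_borel) = (\<integral>\<^sup>+s. k (1 - (norm s)\<^sup>2) * sphere_mean (ball_sq f) (norm s) \<partial>(hyp_borel :: (complex^'n) measure))"
    if [measurable]: "ball_sq f \<in> borel_measurable borel" for f :: "complex^'n \<Rightarrow> complex"
  proof -
    have "(\<integral>\<^sup>+s. k (1 - (norm s)\<^sup>2) * sqn (f s) \<partial>hyp_borel) = (\<integral>\<^sup>+s. k (1 - (norm s)\<^sup>2) * ball_sq f s \<partial>hyp_borel)"
      by (rule hyp_borel_cong) (simp add: ball_sq_def sqn_def)
    also have "\<dots> = (\<integral>\<^sup>+s. k (1 - (norm s)\<^sup>2) * sphere_mean (ball_sq f) (norm s) \<partial>(hyp_borel :: (complex^'n) measure))"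
      by (rule hyp_borel_radial[of "ball_sq f" "\<lambda>r. k (1 - r\<^sup>2)"]) measurable
    finally show ?thesis .
  qed
  have [measurable]: "(\<lambda>s :: complex^'n. sphere_mean (ball_sq (\<lambda>s. g s - g 0)) (norm s)) \<in> borel_measurable borel"
    by measurable
  have "(\<integral>\<^sup>+s. k (1 - (norm s)\<^sup>2) * sqn (g s) \<partial>hyp_borel) = (\<integral>\<^sup>+s. k (1 - (norm s)\<^sup>2) * sphere_mean (ball_sq g) (norm s) \<partial>(hyp_borel :: (complex^'n) measure))"
    by (rule rad) measurable
  also have "\<dots> = (\<integral>\<^sup>+s. k (1 - (norm s)\<^sup>2) * sqn (g 0) + k (1 - (norm s)\<^sup>2) * sphere_mean (ball_sq (\<lambda>s. g s - g 0)) (norm s) \<partial>(hyp_borel :: (complex^'n) measure))"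
    by (rule hyp_borel_cong) (simp add: sphere_mean_variance[OF g] sqn_def distrib_left)
  also have "\<dots> = (\<integral>\<^sup>+s. k (1 - (norm s)\<^sup>2) * sqn (g 0) \<partial>(hyp_borel :: (complex^'n) measure)) + (\<integral>\<^sup>+s. k (1 - (norm s)\<^sup>2) * sphere_mean (ball_sq (\<lambda>s. g s - g 0)) (norm s) \<partial>(hyp_borel :: (complex^'n) measure))"
    by (rule nn_integral_add) measurable
  also have "(\<integral>\<^sup>+s. k (1 - (norm s)\<^sup>2) * sqn (g 0) \<partial>(hyp_borel :: (complex^'n) measure)) = (\<integral>\<^sup>+s. k (1 - (norm s)\<^sup>2) \<partial>(hyp_borel :: (complex^'n) measure)) * sqn (g 0)"
    by (rule nn_integral_multc) measurable
  also have "(\<integral>\<^sup>+s. k (1 - (norm s)\<^sup>2) * sphere_mean (ball_sq (\<lambda>s. g s - g 0)) (norm s) \<partial>(hyp_borel :: (complex^'n) measure)) = (\<integral>\<^sup>+s. k (1 - (norm s)\<^sup>2) * sqn (g s - g 0) \<partial>hyp_borel)"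
    by (rule rad[symmetric]) measurable
  finally show ?thesis .
qed

text \<open>The convolution of the kernels with parameters \<open>0\<close> and \<open>\<alpha>\<close>.\<close>

definition kern_conv :: "real \<Rightarrow> complex^'n \<Rightarrow> complex^'n \<Rightarrow> ennreal"
  where "kern_conv \<alpha> z w = (\<integral>\<^sup>+x. kern CARD('n) 0 (dl x z) * kern CARD('n) \<alpha> (dl x w) \<partial>hyp_borel)"

lemma kern_conv_measurable [measurable (raw)]:
  fixes a b :: "'b \<Rightarrow> complex^'n"
  assumes [measurable]: "a \<in> borel_measurable M" "b \<in> borel_measurable M"
  shows "(\<lambda>x. kern_conv \<alpha> (a x) (b x)) \<in> borel_measurable M"
  unfolding kern_conv_def by (rule hyp_borel_integral_measurable) measurable

lemma kern_conv_invariant: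
  fixes z w :: "complex^'n"
  assumes g: "ball_auto g" and z: "z \<in> \<bbbB>" and w: "w \<in> \<bbbB>"
  shows "kern_conv \<alpha> (g z) (g w) = kern_conv \<alpha> z w"
proof -
  have "kern_conv \<alpha> (g z) (g w) = (\<integral>\<^sup>+x. kern CARD('n) 0 (dl (g x) (g z)) * kern CARD('n) \<alpha> (dl (g x) (g w)) \<partial>hyp_borel)"
    unfolding kern_conv_def
    by (rule hyp_borel_invariant[OF g, of "\<lambda>x. kern CARD('n) 0 (dl x (g z)) * kern CARD('n) \<alpha> (dl x (g w))", symmetric]) measurable
  also have "\<dots> = kern_conv \<alpha> z w"
    unfolding kern_conv_def by (rule hyp_borel_cong) (simp only: dl_invariant[OF g _ z] dl_invariant[OF g _ w])
  finally show ?thesis .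
qed

text \<open>The convolution is invariant under automorphisms, and a pair of points can be moved to \<open>0\<close> and a
  prescribed point of the same norm as \<open>T\<^sub>z w\<close>.\<close>

lemma kern_conv_radial:
  fixes e z w :: "complex^'n"
  assumes e: "norm e = 1" and z: "z \<in> \<bbbB>" and w: "w \<in> \<bbbB>"
  shows "kern_conv \<alpha> z w = kern_conv \<alpha> 0 (sqrt (1 - dl z w) *\<^sub>R e)"
proof -
  define t where "t = T z w"
  have t: "t \<in> \<bbbB>" unfolding t_def by (rule T_in_ball[OF z w])
  have s: "sqrt (1 - dl z w) = norm t" unfolding dl_T[OF z w] t_def by simp
  have n: "norm t = norm (norm t *\<^sub>R e)" by (simp add: e)
  obtain U where U: "ball_auto U" "U 0 = 0" "U t = norm t *\<^sub>R e" by (rule unitary_transitive[OF n])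
  have "kern_conv \<alpha> z w = kern_conv \<alpha> (T z z) (T z w)"
    by (rule kern_conv_invariant[OF ball_auto_T[OF z] z w, symmetric])
  also have "\<dots> = kern_conv \<alpha> 0 t" using z by (simp add: t_def)
  also have "\<dots> = kern_conv \<alpha> (U 0) (U t)" by (rule kern_conv_invariant[OF U(1) _ t, symmetric]) simp
  finally show ?thesis unfolding U s .
qed

lemma kern_conv_mass:
  assumes a: "\<alpha> > -1"
  shows "(\<integral>\<^sup>+t. kern_conv \<alpha> 0 t \<partial>(hyp_borel :: (complex^'n) measure)) = kern_mass TYPE('n) * kern_mass TYPE('n)"
proof -
  have "(\<integral>\<^sup>+t. kern_conv \<alpha> 0 t \<partial>(hyp_borel :: (complex^'n) measure)) = (\<integral>\<^sup>+x. \<integral>\<^sup>+t. kern CARD('n) 0 (dl x 0) * kern CARD('n) \<alpha> (dl x t) \<partial>hyp_borel \<partial>(hyp_borel :: (complex^'n) measure))"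
    unfolding kern_conv_def
    using hyp_borel_Fubini[of "\<lambda>p. kern CARD('n) 0 (dl (fst p) 0) * kern CARD('n) \<alpha> (dl (fst p) (snd p :: complex^'n))"] by simp
  also have "\<dots> = (\<integral>\<^sup>+x. kern CARD('n) 0 (dl x 0) * kern_mass TYPE('n) \<partial>(hyp_borel :: (complex^'n) measure))"
    by (rule hyp_borel_cong) (subst nn_integral_cmult, measurable, simp only: kern_dl_mass[OF _ a])
  also have "\<dots> = (\<integral>\<^sup>+x. kern CARD('n) 0 (dl x 0) \<partial>(hyp_borel :: (complex^'n) measure)) * kern_mass TYPE('n)"
    by (rule nn_integral_multc) measurable
  also have "(\<integral>\<^sup>+x. kern CARD('n) 0 (dl x 0) \<partial>(hyp_borel :: (complex^'n) measure)) = kern_mass TYPE('n)"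
    unfolding dl_commute[of _ 0] by (rule kern_dl_mass) simp_all
  finally show ?thesis .
qed

context ball_quotient
begin

definition weighted_norm :: "real \<Rightarrow> ((complex^'n) \<times> (complex^'n) \<Rightarrow> complex) \<Rightarrow> ennreal"
  where "weighted_norm \<alpha> f = (\<integral>\<^sup>+z. indicator D z * (\<integral>\<^sup>+w. kern CARD('n) \<alpha> (dl z w) * sqn (f (z, w)) \<partial>hyp_borel) \<partial>hyp_borel)"

text \<open>The rigidity argument consists in evaluating this integral in two ways, by integrating first over \<open>z'\<close> or
  first over \<open>z\<close>.\<close>

definition double_integral :: "real \<Rightarrow> ((complex^'n) \<times> (complex^'n) \<Rightarrow> complex) \<Rightarrow> ennreal"
  where "double_integral \<alpha> f = (\<integral>\<^sup>+z. indicator D z * (\<integral>\<^sup>+z'. kern CARD('n) 0 (dl z z') *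
     (\<integral>\<^sup>+w. kern CARD('n) \<alpha> (dl z w) * sqn (f (z', w)) \<partial>hyp_borel) \<partial>hyp_borel) \<partial>hyp_borel)"

definition increment :: "((complex^'n) \<times> (complex^'n) \<Rightarrow> complex) \<Rightarrow> complex^'n \<Rightarrow> (complex^'n) \<times> (complex^'n) \<Rightarrow> complex"
  where "increment f s p = f (T_formula (fst p) s, snd p) - f p"

definition increment_growth :: "((complex^'n) \<times> (complex^'n) \<Rightarrow> complex) \<Rightarrow> real \<Rightarrow> ennreal"
  where "increment_growth f r = (\<integral>\<^sup>+s. kern CARD('n) 0 (1 - (norm s)\<^sup>2) * mean_growth D (increment f s) r \<partial>hyp_borel)"

lemma weighted_norm_radial:
  assumes [measurable]: "f \<in> borel_measurable (borel \<Otimes>\<^sub>M borel)"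
  shows "weighted_norm \<alpha> f = (\<integral>\<^sup>+t. kern CARD('n) \<alpha> (1 - (norm t)\<^sup>2) * mean_growth D f (norm t) \<partial>(hyp_borel :: (complex^'n) measure))"
  unfolding weighted_norm_def sqn_def by (rule mean_growth_radial[OF D_ball borel_D]) measurable

text \<open>The integrand with \<open>w\<close> integrated out is an invariant function of \<open>(z, z')\<close>, so the variable that is
  confined to \<open>D\<close> may be changed from \<open>z\<close> to \<open>z'\<close>.  After that the integral over \<open>z\<close> is a convolution of
  kernels, a radial function of mass \<open>\<kappa>\<^sup>2\<close> tested against the spherical means.\<close>

lemma double_integral_upper:
  assumes [measurable]: "f \<in> borel_measurable (borel \<Otimes>\<^sub>M borel)"
    and inv: "\<And>\<gamma> z w. \<gamma> \<in> \<Gamma> \<Longrightarrow> z \<in> \<bbbB> \<Longrightarrow> w \<in> \<bbbB> \<Longrightarrow> f (\<gamma> z, \<gamma> w) = f (z, w)"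
    and a: "\<alpha> > -1"
  shows "double_integral \<alpha> f \<le> kern_mass TYPE('n) * kern_mass TYPE('n) * (SUP r\<in>{0..<1}. mean_growth D f r)"
proof -
  note [measurable] = borel_D
  let ?K0 = "kern CARD('n) 0" and ?Ka = "kern CARD('n) \<alpha>"
  define P where "P z z' = (\<integral>\<^sup>+w. ?Ka (dl z w) * sqn (f (z', w)) \<partial>hyp_borel)" for z z'
  have Pm: "(\<lambda>x. P (a x) (b x)) \<in> borel_measurable M" if [measurable]: "a \<in> borel_measurable M" "b \<in> borel_measurable M" for a b and M :: "'z measure"
    unfolding P_def by (rule hyp_borel_integral_measurable) measurable
  have Pm2[measurable]: "(\<lambda>p. P (fst p) (snd p)) \<in> borel_measurable (borel \<Otimes>\<^sub>M borel)"
    unfolding P_def by (rule hyp_borel_integral_measurable) measurable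
  define e :: "complex^'n" where "e = axis undefined 1"
  have e: "norm e = 1" by (simp add: e_def)
  \<comment> \<open>the convolution as a function of \<open>\<delta>\<close>: the point \<open>sqrt (1 - x) e\<close> has \<open>\<delta> = x\<close> relative to the origin\<close>
  define k where "k x = kern_conv \<alpha> 0 (sqrt (1 - x) *\<^sub>R e)" for x
  have [measurable]: "k \<in> borel_measurable borel" unfolding k_def by measurable
  have kk: "kern_conv \<alpha> z w = k (dl z w)" if "z \<in> \<bbbB>" "w \<in> \<bbbB>" for z w :: "complex^'n"
    unfolding k_def by (rule kern_conv_radial[OF e that])
  have "double_integral \<alpha> f = (\<integral>\<^sup>+z. indicator D z * (\<integral>\<^sup>+z'. (\<lambda>p. ?K0 (dl (fst p) (snd p)) * P (fst p) (snd p)) (z, z') \<partial>hyp_borel) \<partial>hyp_borel)"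
    by (simp add: double_integral_def P_def)
  also have "\<dots> = (\<integral>\<^sup>+z'. indicator D z' * (\<integral>\<^sup>+z. (\<lambda>p. ?K0 (dl (fst p) (snd p)) * P (fst p) (snd p)) (z, z') \<partial>hyp_borel) \<partial>hyp_borel)"
  proof (rule swap_integral)
    fix \<gamma> and z z' :: "complex^'n" assume g: "\<gamma> \<in> \<Gamma>" and z: "z \<in> \<bbbB>" and z': "z' \<in> \<bbbB>"
    note ga = auto_\<Gamma>[OF g]
    have "P (\<gamma> z) (\<gamma> z') = (\<integral>\<^sup>+w. ?Ka (dl (\<gamma> z) (\<gamma> w)) * sqn (f (\<gamma> z', \<gamma> w)) \<partial>hyp_borel)"
      unfolding P_def
      by (rule hyp_borel_invariant[OF ga, of "\<lambda>w. ?Ka (dl (\<gamma> z) w) * sqn (f (\<gamma> z', w))", symmetric]) measurable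
    also have "\<dots> = P z z'"
      unfolding P_def by (rule hyp_borel_cong) (simp only: dl_invariant[OF ga z] inv[OF g z'])
    finally show "(\<lambda>p. ?K0 (dl (fst p) (snd p)) * P (fst p) (snd p)) (\<gamma> z, \<gamma> z') = (\<lambda>p. ?K0 (dl (fst p) (snd p)) * P (fst p) (snd p)) (z, z')"
      by (simp add: dl_invariant[OF ga z z'])
  qed measurable
  also have "\<dots> = (\<integral>\<^sup>+z'. indicator D z' * (\<integral>\<^sup>+w. k (dl z' w) * sqn (f (z', w)) \<partial>hyp_borel) \<partial>hyp_borel)"
  proof (rule hyp_borel_cong)
    fix z' :: "complex^'n" assume z': "z' \<in> \<bbbB>"
    have "(\<integral>\<^sup>+z. ?K0 (dl z z') * P z z' \<partial>hyp_borel) = (\<integral>\<^sup>+z. \<integral>\<^sup>+w. ?K0 (dl z z') * (?Ka (dl z w) * sqn (f (z', w))) \<partial>hyp_borel \<partial>hyp_borel)"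
      unfolding P_def by (intro nn_integral_cong nn_integral_cmult[symmetric]) measurable
    also have "\<dots> = (\<integral>\<^sup>+w. \<integral>\<^sup>+z. ?K0 (dl z z') * (?Ka (dl z w) * sqn (f (z', w))) \<partial>hyp_borel \<partial>hyp_borel)"
      using hyp_borel_Fubini[of "\<lambda>p. ?K0 (dl (fst p) z') * (?Ka (dl (fst p) (snd p)) * sqn (f (z', snd p)))"] by simp
    also have "\<dots> = (\<integral>\<^sup>+w. k (dl z' w) * sqn (f (z', w)) \<partial>hyp_borel)"
    proof (rule hyp_borel_cong)
      fix w :: "complex^'n" assume w: "w \<in> \<bbbB>"
      have "(\<integral>\<^sup>+z. ?K0 (dl z z') * (?Ka (dl z w) * sqn (f (z', w))) \<partial>hyp_borel) = (\<integral>\<^sup>+z. ?K0 (dl z z') * ?Ka (dl z w) * sqn (f (z', w)) \<partial>hyp_borel)"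
        by (simp only: mult.assoc)
      also have "\<dots> = kern_conv \<alpha> z' w * sqn (f (z', w))"
        unfolding kern_conv_def by (rule nn_integral_multc) measurable
      finally show "(\<integral>\<^sup>+z. ?K0 (dl z z') * (?Ka (dl z w) * sqn (f (z', w))) \<partial>hyp_borel) = k (dl z' w) * sqn (f (z', w))"
        by (simp only: kk[OF z' w])
    qed
    finally show "indicator D z' * (\<integral>\<^sup>+z. (\<lambda>p. ?K0 (dl (fst p) (snd p)) * P (fst p) (snd p)) (z, z') \<partial>hyp_borel) = indicator D z' * (\<integral>\<^sup>+w. k (dl z' w) * sqn (f (z', w)) \<partial>hyp_borel)"
      by simp
  qed
  also have "\<dots> = (\<integral>\<^sup>+t. k (1 - (norm t)\<^sup>2) * mean_growth D f (norm t) \<partial>(hyp_borel :: (complex^'n) measure))"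
    unfolding sqn_def by (rule mean_growth_radial[OF D_ball borel_D]) measurable
  also have "\<dots> \<le> (\<integral>\<^sup>+t. k (1 - (norm t)\<^sup>2) \<partial>(hyp_borel :: (complex^'n) measure)) * (SUP r\<in>{0..<1}. mean_growth D f r)"
    by (rule radial_integral_le_Sup[of "\<lambda>r. k (1 - r\<^sup>2)"]) (measurable, auto intro: SUP_upper)
  also have "(\<integral>\<^sup>+t. k (1 - (norm t)\<^sup>2) \<partial>(hyp_borel :: (complex^'n) measure)) = (\<integral>\<^sup>+t. kern_conv \<alpha> 0 t \<partial>(hyp_borel :: (complex^'n) measure))"
    by (rule hyp_borel_cong) (simp add: kk)
  finally show ?thesis unfolding kern_conv_mass[OF a] .
qed

text \<open>For fixed \<open>s\<close> the increment is a function of two points to which the radial form of the weighted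
  norm applies; what remains is the exchange of the integrals over \<open>s\<close> and the other variables.\<close>

lemma increment_integral:
  assumes [measurable]: "f \<in> borel_measurable (borel \<Otimes>\<^sub>M borel)"
  shows "(\<integral>\<^sup>+z. indicator D z * (\<integral>\<^sup>+w. kern CARD('n) \<alpha> (dl z w) *
      (\<integral>\<^sup>+s. kern CARD('n) 0 (1 - (norm s)\<^sup>2) * sqn (increment f s (z, w)) \<partial>hyp_borel) \<partial>hyp_borel) \<partial>hyp_borel)
     = (\<integral>\<^sup>+t. kern CARD('n) \<alpha> (1 - (norm t)\<^sup>2) * increment_growth f (norm t) \<partial>(hyp_borel :: (complex^'n) measure))"
proof -
  note [measurable] = borel_D
  let ?K0 = "kern CARD('n) 0" and ?Ka = "kern CARD('n) \<alpha>"
  define E where "E z w = (\<integral>\<^sup>+s. ?K0 (1 - (norm s)\<^sup>2) * sqn (increment f s (z, w)) \<partial>hyp_borel)" for z w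
  have "(\<integral>\<^sup>+z. indicator D z * (\<integral>\<^sup>+w. ?Ka (dl z w) * E z w \<partial>hyp_borel) \<partial>hyp_borel)
     = (\<integral>\<^sup>+t. ?Ka (1 - (norm t)\<^sup>2) * increment_growth f (norm t) \<partial>(hyp_borel :: (complex^'n) measure))"
  proof -
    define Y where "Y s z = (\<integral>\<^sup>+w. ?Ka (dl z w) * sqn (increment f s (z, w)) \<partial>hyp_borel)" for s z
    have Y2[measurable]: "(\<lambda>p. Y (snd p) (fst p)) \<in> borel_measurable (borel \<Otimes>\<^sub>M borel)"
      unfolding Y_def increment_def by (rule hyp_borel_integral_measurable) measurable
    have Ys[measurable]: "(\<lambda>s. Y s z) \<in> borel_measurable borel" for z
      using measurable_compose[OF measurable_Pair1' Y2, of z] by simp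
    have Yz[measurable]: "Y s \<in> borel_measurable borel" for s
      using measurable_compose[OF measurable_Pair2' Y2, of s] by simp
    have incm: "increment f s \<in> borel_measurable (borel \<Otimes>\<^sub>M borel)" for s
      unfolding increment_def[abs_def] by measurable
    have mg: "(\<lambda>p. mean_growth D (increment f (fst p)) (norm (snd p :: complex^'n))) \<in> borel_measurable (borel \<Otimes>\<^sub>M borel)"
      unfolding mean_growth_def
    proof (rule hyp_borel_integral_measurable)
      have "(\<lambda>q. sphere_mean (pullback_sq (increment f (fst (fst q))) (snd q)) (norm (snd (fst q) :: complex^'n))) \<in> borel_measurable ((borel \<Otimes>\<^sub>M borel) \<Otimes>\<^sub>M borel)"
        by (rule sphere_mean_measurable2) (unfold pullback_sq_def increment_def, measurable)
      then show "(\<lambda>(p, z). indicator D z * sphere_mean (pullback_sq (increment f (fst p)) z) (norm (snd p :: complex^'n))) \<in> borel_measurable ((borel \<Otimes>\<^sub>M borel) \<Otimes>\<^sub>M borel)"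
        unfolding case_prod_beta' by measurable
    qed
    have mgt: "(\<lambda>s. mean_growth D (increment f s) (norm (t :: complex^'n))) \<in> borel_measurable borel" for t
      using measurable_compose[OF measurable_Pair2' mg, of t] by simp
    have mgs: "(\<lambda>t :: complex^'n. mean_growth D (increment f s) (norm t)) \<in> borel_measurable borel" for s
      using measurable_compose[OF measurable_Pair1' mg, of s] by simp
    note [measurable] = mg mgt mgs
    have "(\<integral>\<^sup>+z. indicator D z * (\<integral>\<^sup>+w. ?Ka (dl z w) * E z w \<partial>hyp_borel) \<partial>hyp_borel)
      = (\<integral>\<^sup>+z. \<integral>\<^sup>+s. indicator D z * (?K0 (1 - (norm s)\<^sup>2) * Y s z) \<partial>hyp_borel \<partial>hyp_borel)"
    proof (rule nn_integral_cong)
      fix z :: "complex^'n"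
      have "(\<integral>\<^sup>+w. ?Ka (dl z w) * E z w \<partial>hyp_borel) = (\<integral>\<^sup>+w. \<integral>\<^sup>+s. ?Ka (dl z w) * (?K0 (1 - (norm s)\<^sup>2) * sqn (increment f s (z, w))) \<partial>hyp_borel \<partial>hyp_borel)"
        unfolding E_def increment_def by (intro nn_integral_cong nn_integral_cmult[symmetric]) measurable
      also have "\<dots> = (\<integral>\<^sup>+s. \<integral>\<^sup>+w. ?Ka (dl z w) * (?K0 (1 - (norm s)\<^sup>2) * sqn (increment f s (z, w))) \<partial>hyp_borel \<partial>hyp_borel)"
        using hyp_borel_Fubini[of "\<lambda>p. ?Ka (dl z (fst p)) * (?K0 (1 - (norm (snd p))\<^sup>2) * sqn (increment f (snd p) (z, fst p)))"]
        unfolding increment_def by simp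
      also have "\<dots> = (\<integral>\<^sup>+s. ?K0 (1 - (norm s)\<^sup>2) * Y s z \<partial>hyp_borel)"
      proof (rule nn_integral_cong)
        fix s :: "complex^'n"
        have "(\<integral>\<^sup>+w. ?Ka (dl z w) * (?K0 (1 - (norm s)\<^sup>2) * sqn (increment f s (z, w))) \<partial>hyp_borel)
          = (\<integral>\<^sup>+w. ?K0 (1 - (norm s)\<^sup>2) * (?Ka (dl z w) * sqn (increment f s (z, w))) \<partial>hyp_borel)"
          by (simp only: mult.left_commute)
        also have "\<dots> = ?K0 (1 - (norm s)\<^sup>2) * Y s z"
          unfolding Y_def increment_def fst_conv snd_conv by (rule nn_integral_cmult) measurable
        finally show "(\<integral>\<^sup>+w. ?Ka (dl z w) * (?K0 (1 - (norm s)\<^sup>2) * sqn (increment f s (z, w))) \<partial>hyp_borel)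
          = ?K0 (1 - (norm s)\<^sup>2) * Y s z" .
      qed
      finally show "indicator D z * (\<integral>\<^sup>+w. ?Ka (dl z w) * E z w \<partial>hyp_borel) = (\<integral>\<^sup>+s. indicator D z * (?K0 (1 - (norm s)\<^sup>2) * Y s z) \<partial>hyp_borel)"
        by (simp only:) (rule nn_integral_cmult[symmetric], measurable)
    qed
    also have "\<dots> = (\<integral>\<^sup>+s. \<integral>\<^sup>+z. indicator D z * (?K0 (1 - (norm s)\<^sup>2) * Y s z) \<partial>hyp_borel \<partial>hyp_borel)"
      using hyp_borel_Fubini[of "\<lambda>p. indicator D (fst p) * (?K0 (1 - (norm (snd p))\<^sup>2) * Y (snd p) (fst p))"] by simp
    also have "\<dots> = (\<integral>\<^sup>+s. ?K0 (1 - (norm s)\<^sup>2) * (\<integral>\<^sup>+z. indicator D z * Y s z \<partial>hyp_borel) \<partial>hyp_borel)"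
      unfolding mult.left_commute[of "indicator D _"] by (intro nn_integral_cong nn_integral_cmult) measurable
    also have "\<dots> = (\<integral>\<^sup>+s. ?K0 (1 - (norm s)\<^sup>2) * (\<integral>\<^sup>+t. ?Ka (1 - (norm t)\<^sup>2) * mean_growth D (increment f s) (norm t) \<partial>(hyp_borel :: (complex^'n) measure)) \<partial>hyp_borel)"
      unfolding Y_def sqn_def by (subst mean_growth_radial[OF D_ball borel_D incm]) simp_all
    also have "\<dots> = (\<integral>\<^sup>+s. \<integral>\<^sup>+t. ?K0 (1 - (norm s)\<^sup>2) * (?Ka (1 - (norm t)\<^sup>2) * mean_growth D (increment f s) (norm t)) \<partial>(hyp_borel :: (complex^'n) measure) \<partial>hyp_borel)"
      by (intro nn_integral_cong nn_integral_cmult[symmetric]) measurable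
    also have "\<dots> = (\<integral>\<^sup>+t. \<integral>\<^sup>+s. ?K0 (1 - (norm s)\<^sup>2) * (?Ka (1 - (norm t)\<^sup>2) * mean_growth D (increment f s) (norm t)) \<partial>hyp_borel \<partial>(hyp_borel :: (complex^'n) measure))"
      using hyp_borel_Fubini[of "\<lambda>p. ?K0 (1 - (norm (fst p))\<^sup>2) * (?Ka (1 - (norm (snd p :: complex^'n))\<^sup>2) * mean_growth D (increment f (fst p)) (norm (snd p)))"] by simp
    also have "\<dots> = (\<integral>\<^sup>+t. ?Ka (1 - (norm t)\<^sup>2) * increment_growth f (norm t) \<partial>(hyp_borel :: (complex^'n) measure))"
      unfolding increment_growth_def mult.left_commute[of "?K0 _" "?Ka _"] by (intro nn_integral_cong nn_integral_cmult) measurable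
    finally show ?thesis .
  qed
  then show ?thesis unfolding E_def .
qed

text \<open>The mean value identity in the variable \<open>z'\<close>, written as \<open>z' = T\<^sub>z s\<close>.\<close>

lemma double_integral_eq:
  assumes [measurable]: "f \<in> borel_measurable (borel \<Otimes>\<^sub>M borel)"
    and hol: "\<And>w. w \<in> \<bbbB> \<Longrightarrow> cholo_on (\<lambda>z. f (z, w)) \<bbbB>"
    and a: "\<alpha> > -1"
  shows "double_integral \<alpha> f = kern_mass TYPE('n) * weighted_norm \<alpha> f +
    (\<integral>\<^sup>+t. kern CARD('n) \<alpha> (1 - (norm t)\<^sup>2) * increment_growth f (norm t) \<partial>(hyp_borel :: (complex^'n) measure))"
proof -
  note [measurable] = borel_D
  let ?K0 = "kern CARD('n) 0" and ?Ka = "kern CARD('n) \<alpha>"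
  let ?\<kappa> = "kern_mass TYPE('n)"
  have [measurable]: "(\<lambda>x. increment f (a x) (b x, c x)) \<in> borel_measurable M"
    if [measurable]: "a \<in> borel_measurable M" "b \<in> borel_measurable M" "c \<in> borel_measurable M" for a b c and M :: "'z measure"
    unfolding increment_def fst_conv snd_conv by measurable
  define E where "E z w = (\<integral>\<^sup>+s. ?K0 (1 - (norm s)\<^sup>2) * sqn (increment f s (z, w)) \<partial>hyp_borel)" for z w
  have E2[measurable]: "(\<lambda>p. E (fst p) (snd p)) \<in> borel_measurable (borel \<Otimes>\<^sub>M borel)"
    unfolding E_def increment_def by (rule hyp_borel_integral_measurable) measurable
  have Ez[measurable]: "E z \<in> borel_measurable borel" for z
    using measurable_compose[OF measurable_Pair1' E2, of z] by simp
  have inner: "(\<integral>\<^sup>+z'. ?K0 (dl z z') * (\<integral>\<^sup>+w. ?Ka (dl z w) * sqn (f (z', w)) \<partial>hyp_borel) \<partial>hyp_borel)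
     = ?\<kappa> * (\<integral>\<^sup>+w. ?Ka (dl z w) * sqn (f (z, w)) \<partial>hyp_borel) + (\<integral>\<^sup>+w. ?Ka (dl z w) * E z w \<partial>hyp_borel)"
    if z: "z \<in> \<bbbB>" for z
  proof -
    have mv: "(\<integral>\<^sup>+z'. ?K0 (dl z z') * sqn (f (z', w)) \<partial>hyp_borel) = ?\<kappa> * sqn (f (z, w)) + E z w" if w: "w \<in> \<bbbB>" for w
    proof -
      have "(\<integral>\<^sup>+z'. ?K0 (dl z z') * sqn (f (z', w)) \<partial>hyp_borel) = (\<integral>\<^sup>+s. ?K0 (1 - (norm s)\<^sup>2) * sqn (f (T z s, w)) \<partial>hyp_borel)"
        by (rule radial_substitution[OF z]) measurable
      also have "\<dots> = ?\<kappa> * sqn (f (T z 0, w)) + (\<integral>\<^sup>+s. ?K0 (1 - (norm s)\<^sup>2) * sqn (f (T z s, w) - f (T z 0, w)) \<partial>hyp_borel)"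
      proof (subst mean_value_identity)
        show "cholo_on (\<lambda>s. f (T z s, w)) \<bbbB>"
          using T_maps_ball[OF z] by (intro cholo_on_compose[OF holo_map_on_T[OF z] hol[OF w]]) blast
        show "(\<integral>\<^sup>+s. ?K0 (1 - (norm s)\<^sup>2) \<partial>(hyp_borel :: (complex^'n) measure)) * sqn (f (T z 0, w)) + (\<integral>\<^sup>+s. ?K0 (1 - (norm s)\<^sup>2) * sqn (f (T z s, w) - f (T z 0, w)) \<partial>hyp_borel)
          = ?\<kappa> * sqn (f (T z 0, w)) + (\<integral>\<^sup>+s. ?K0 (1 - (norm s)\<^sup>2) * sqn (f (T z s, w) - f (T z 0, w)) \<partial>hyp_borel)"
          using kern_total_mass[of 0, where 'n='n] by simp
      qed measurable
      also have "\<dots> = ?\<kappa> * sqn (f (z, w)) + E z w"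
        using z by (simp add: E_def increment_def T_eq_T_formula[symmetric])
      finally show ?thesis .
    qed
    have "(\<integral>\<^sup>+z'. ?K0 (dl z z') * (\<integral>\<^sup>+w. ?Ka (dl z w) * sqn (f (z', w)) \<partial>hyp_borel) \<partial>hyp_borel)
      = (\<integral>\<^sup>+z'. \<integral>\<^sup>+w. ?K0 (dl z z') * (?Ka (dl z w) * sqn (f (z', w))) \<partial>hyp_borel \<partial>hyp_borel)"
      by (intro nn_integral_cong nn_integral_cmult[symmetric]) measurable
    also have "\<dots> = (\<integral>\<^sup>+w. \<integral>\<^sup>+z'. ?K0 (dl z z') * (?Ka (dl z w) * sqn (f (z', w))) \<partial>hyp_borel \<partial>hyp_borel)"
      using hyp_borel_Fubini[of "\<lambda>p. ?K0 (dl z (fst p)) * (?Ka (dl z (snd p)) * sqn (f p))"] by simp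
    also have "\<dots> = (\<integral>\<^sup>+w. ?\<kappa> * (?Ka (dl z w) * sqn (f (z, w))) + ?Ka (dl z w) * E z w \<partial>hyp_borel)"
    proof (rule hyp_borel_cong)
      fix w :: "complex^'n" assume w: "w \<in> \<bbbB>"
      have "(\<integral>\<^sup>+z'. ?K0 (dl z z') * (?Ka (dl z w) * sqn (f (z', w))) \<partial>hyp_borel) = (\<integral>\<^sup>+z'. ?Ka (dl z w) * (?K0 (dl z z') * sqn (f (z', w))) \<partial>hyp_borel)"
        by (simp only: mult.left_commute)
      also have "\<dots> = ?Ka (dl z w) * (\<integral>\<^sup>+z'. ?K0 (dl z z') * sqn (f (z', w)) \<partial>hyp_borel)"
        by (rule nn_integral_cmult) measurable
      finally show "(\<integral>\<^sup>+z'. ?K0 (dl z z') * (?Ka (dl z w) * sqn (f (z', w))) \<partial>hyp_borel) = ?\<kappa> * (?Ka (dl z w) * sqn (f (z, w))) + ?Ka (dl z w) * E z w"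
        unfolding mv[OF w] by (simp only: distrib_left mult.left_commute)
    qed
    also have "\<dots> = (\<integral>\<^sup>+w. ?\<kappa> * (?Ka (dl z w) * sqn (f (z, w))) \<partial>hyp_borel) + (\<integral>\<^sup>+w. ?Ka (dl z w) * E z w \<partial>hyp_borel)"
      by (rule nn_integral_add) measurable
    also have "(\<integral>\<^sup>+w. ?\<kappa> * (?Ka (dl z w) * sqn (f (z, w))) \<partial>hyp_borel) = ?\<kappa> * (\<integral>\<^sup>+w. ?Ka (dl z w) * sqn (f (z, w)) \<partial>hyp_borel)"
      by (rule nn_integral_cmult) measurable
    finally show ?thesis .
  qed
  have m1[measurable]: "(\<lambda>z. \<integral>\<^sup>+w. ?Ka (dl z w) * sqn (f (z, w)) \<partial>hyp_borel) \<in> borel_measurable borel"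
    by (rule hyp_borel_integral_measurable) measurable
  have m2[measurable]: "(\<lambda>z. \<integral>\<^sup>+w. ?Ka (dl z w) * E z w \<partial>hyp_borel) \<in> borel_measurable borel"
  proof (rule hyp_borel_integral_measurable)
    have "(\<lambda>p. ?Ka (dl (fst p) (snd p)) * E (fst p) (snd p)) \<in> borel_measurable (borel \<Otimes>\<^sub>M borel)" by measurable
    then show "(\<lambda>(z, w). ?Ka (dl z w) * E z w) \<in> borel_measurable (borel \<Otimes>\<^sub>M borel)" by (simp add: case_prod_beta')
  qed
  have "double_integral \<alpha> f = (\<integral>\<^sup>+z. ?\<kappa> * (indicator D z * (\<integral>\<^sup>+w. ?Ka (dl z w) * sqn (f (z, w)) \<partial>hyp_borel)) + indicator D z * (\<integral>\<^sup>+w. ?Ka (dl z w) * E z w \<partial>hyp_borel) \<partial>hyp_borel)"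
    unfolding double_integral_def
    by (rule hyp_borel_cong) (simp only: inner distrib_left mult.left_commute)
  also have "\<dots> = (\<integral>\<^sup>+z. ?\<kappa> * (indicator D z * (\<integral>\<^sup>+w. ?Ka (dl z w) * sqn (f (z, w)) \<partial>hyp_borel)) \<partial>hyp_borel) + (\<integral>\<^sup>+z. indicator D z * (\<integral>\<^sup>+w. ?Ka (dl z w) * E z w \<partial>hyp_borel) \<partial>hyp_borel)"
    by (rule nn_integral_add) measurable
  also have "(\<integral>\<^sup>+z. ?\<kappa> * (indicator D z * (\<integral>\<^sup>+w. ?Ka (dl z w) * sqn (f (z, w)) \<partial>hyp_borel)) \<partial>hyp_borel) = ?\<kappa> * weighted_norm \<alpha> f"
    unfolding weighted_norm_def by (rule nn_integral_cmult) measurable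
  also have "(\<integral>\<^sup>+z. indicator D z * (\<integral>\<^sup>+w. ?Ka (dl z w) * E z w \<partial>hyp_borel) \<partial>hyp_borel)
     = (\<integral>\<^sup>+t. ?Ka (1 - (norm t)\<^sup>2) * increment_growth f (norm t) \<partial>(hyp_borel :: (complex^'n) measure))"
    unfolding E_def by (rule increment_integral) measurable
  finally show ?thesis .
qed

definition zero_extend :: "((complex^'n) \<times> (complex^'n) \<Rightarrow> complex) \<Rightarrow> (complex^'n) \<times> (complex^'n) \<Rightarrow> complex"
  where "zero_extend F p = (if p \<in> \<bbbB> \<times> \<bbbB> then F p else 0)"

lemma zero_extend_measurable:
  assumes "continuous_on (\<bbbB> \<times> \<bbbB>) F"
  shows "zero_extend F \<in> borel_measurable (borel \<Otimes>\<^sub>M borel)"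
proof -
  have "(\<lambda>p. indicator (\<bbbB> \<times> \<bbbB>) p *\<^sub>R F p) \<in> borel_measurable borel"
    by (rule borel_measurable_continuous_on_indicator[OF _ assms]) (intro borel_open open_Times open_ball)
  moreover have "(\<lambda>p. indicator (\<bbbB> \<times> \<bbbB>) p *\<^sub>R F p) = zero_extend F"
    by (auto simp: fun_eq_iff zero_extend_def indicator_def)
  ultimately show ?thesis by (simp only: borel_prod)
qed

lemma weighted_norm_tendsto:
  assumes fm: "f \<in> borel_measurable (borel \<Otimes>\<^sub>M borel)"
    and hol: "\<And>z. z \<in> D \<Longrightarrow> cholo_on (\<lambda>w. f (z, w)) \<bbbB>"
  shows "((\<lambda>\<alpha>. weighted_norm \<alpha> f) \<longlongrightarrow> kern_mass TYPE('n) * (SUP r\<in>{0..<1}. mean_growth D f r)) (at_right (-1))"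
  unfolding weighted_norm_radial[OF fm]
  by (rule kern_integral_tendsto) (rule mean_growth_mono[OF D_ball hol])

end

lemma cholo_on_diff:
  assumes f: "cholo_on f S" and g: "cholo_on g S" shows "cholo_on (\<lambda>w. f w - g w) S"
  unfolding cholo_on_def
proof
  fix z assume z: "z \<in> S"
  obtain A where A: "(f has_derivative A) (at z)" "\<And>c v. A (c *s v) = c * A v"
    using f z unfolding cholo_on_def by blast
  obtain B where B: "(g has_derivative B) (at z)" "\<And>c v. B (c *s v) = c * B v"
    using g z unfolding cholo_on_def by blast
  show "\<exists>D. ((\<lambda>w. f w - g w) has_derivative D) (at z) \<and> (\<forall>c v. D (c *s v) = c * D v)"
    by (intro exI[of _ "\<lambda>v. A v - B v"] conjI has_derivative_diff A B) (simp add: A B right_diff_distrib)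
qed

lemma nn_integral_ball_const: "(\<integral>\<^sup>+v. indicator \<bbbB> v * c \<partial>(lborel :: (complex^'n) measure)) / ball_vol TYPE('n::finite) = c"
  for c :: ennreal
proof -
  have "(\<integral>\<^sup>+v. indicator \<bbbB> v * c \<partial>(lborel :: (complex^'n) measure)) = (\<integral>\<^sup>+v. c * indicator (\<bbbB> :: (complex^'n) set) v \<partial>lborel)"
    by (simp only: mult.commute)
  also have "\<dots> = c * ball_vol TYPE('n)" by (simp add: nn_integral_cmult_indicator ball_vol_def)
  finally show ?thesis using ball_vol_nz[where 'n='n] by (simp add: mult_divide_eq_ennreal)
qed

lemma sphere_mean_eq_const:
  fixes u :: "complex^'n \<Rightarrow> ennreal"
  assumes "\<And>v. u ((r / norm v) *\<^sub>R v) = c" shows "sphere_mean u r = c"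
  unfolding sphere_mean_def assms by (rule nn_integral_ball_const)

lemma sphere_mean_le_const:
  fixes u :: "complex^'n \<Rightarrow> ennreal"
  assumes "\<And>v. u v \<le> c" shows "sphere_mean u r \<le> c"
proof -
  have "sphere_mean u r \<le> (\<integral>\<^sup>+v. indicator \<bbbB> v * c \<partial>(lborel :: (complex^'n) measure)) / ball_vol TYPE('n)"
    unfolding sphere_mean_def by (rule divide_right_mono_ennreal, rule nn_integral_mono, rule mult_left_mono) (simp_all add: assms)
  then show ?thesis unfolding nn_integral_ball_const .
qed

context ball_quotient
begin

text \<open>Both expressions for the double integral tend to \<open>\<kappa>\<^sup>2 S\<close>, up to the limit of the increments.  Since
  \<open>S\<close> is finite, this limit is \<open>0\<close>; it is \<open>\<kappa>\<close> times a supremum of nonnegative terms, so already the integral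
  with parameter \<open>\<alpha> = 0\<close> vanishes, and with it the increments at almost all points.\<close>

lemma finite_growth_imp_const_fst:
  assumes F: "continuous_on (\<bbbB> \<times> \<bbbB>) F"
    and holw: "\<And>z. z \<in> \<bbbB> \<Longrightarrow> cholo_on (\<lambda>w. F (z, w)) \<bbbB>"
    and holz: "\<And>w. w \<in> \<bbbB> \<Longrightarrow> cholo_on (\<lambda>z. F (z, w)) \<bbbB>"
    and inv: "\<And>\<gamma> z w. \<gamma> \<in> \<Gamma> \<Longrightarrow> z \<in> \<bbbB> \<Longrightarrow> w \<in> \<bbbB> \<Longrightarrow> F (\<gamma> z, \<gamma> w) = F (z, w)"
    and fin: "(SUP r\<in>{0..<1}. mean_growth D (zero_extend F) r) < \<infinity>"
    and pos: "emeasure hyp_borel D \<noteq> 0"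
  obtains z0 where "z0 \<in> \<bbbB>" "\<And>z w. z \<in> \<bbbB> \<Longrightarrow> w \<in> \<bbbB> \<Longrightarrow> F (z, w) = F (z0, w)"
proof -
  note [measurable] = borel_D
  define f where "f = zero_extend F"
  have fF: "f (z, w) = F (z, w)" if "z \<in> \<bbbB>" "w \<in> \<bbbB>" for z w using that by (simp add: f_def zero_extend_def)
  have fm[measurable]: "f \<in> borel_measurable (borel \<Otimes>\<^sub>M borel)" unfolding f_def by (rule zero_extend_measurable[OF F])
  have fw: "cholo_on (\<lambda>w. f (z, w)) \<bbbB>" if "z \<in> \<bbbB>" for z
    by (rule cholo_on_cong[OF open_ball _ holw[OF that]]) (simp only: fF[OF that])
  have fz: "cholo_on (\<lambda>z. f (z, w)) \<bbbB>" if "w \<in> \<bbbB>" for w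
    by (rule cholo_on_cong[OF open_ball _ holz[OF that]]) (simp only: fF[OF _ that])
  have finv: "f (\<gamma> z, \<gamma> w) = f (z, w)" if "\<gamma> \<in> \<Gamma>" "z \<in> \<bbbB>" "w \<in> \<bbbB>" for \<gamma> z w
    using that by (simp only: fF ball_auto_in[OF auto_\<Gamma>] inv)
  let ?\<kappa> = "kern_mass TYPE('n)"
  define S where "S = (SUP r\<in>{0..<1}. mean_growth D f r)"
  have S: "S \<noteq> top_class.top" using fin unfolding S_def f_def infinity_ennreal_def by (rule less_imp_neq)
  define X where "X \<alpha> = (\<integral>\<^sup>+t. kern CARD('n) \<alpha> (1 - (norm t)\<^sup>2) * increment_growth f (norm t) \<partial>(hyp_borel :: (complex^'n) measure))" for \<alpha>
  have incm: "increment f s \<in> borel_measurable (borel \<Otimes>\<^sub>M borel)" for s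
    unfolding increment_def[abs_def] by measurable
  have inc_hol: "cholo_on (\<lambda>w. increment f s (z, w)) \<bbbB>" if z: "z \<in> D" and s: "s \<in> \<bbbB>" for z s
  proof -
    have zb: "z \<in> \<bbbB>" using z D_ball by blast
    have "cholo_on (\<lambda>w. f (T z s, w) - f (z, w)) \<bbbB>"
      by (rule cholo_on_diff[OF fw[OF T_in_ball[OF zb s]] fw[OF zb]])
    then show ?thesis using zb by (simp add: increment_def T_eq_T_formula)
  qed
  have G_mono: "increment_growth f r \<le> increment_growth f r'" if r: "0 \<le> r" "r \<le> r'" "r' < 1" for r r'
    unfolding increment_growth_def
    by (rule hyp_borel_mono) (intro mult_left_mono mean_growth_mono[OF D_ball inc_hol r], auto)
  define SG where "SG = (SUP r\<in>{0..<1}. increment_growth f r)"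
  have "((\<lambda>\<alpha>. ?\<kappa> * weighted_norm \<alpha> f + X \<alpha>) \<longlongrightarrow> ?\<kappa> * (?\<kappa> * S) + ?\<kappa> * SG) (at_right (-1))"
  proof (intro tendsto_add tendsto_mult_ennreal tendsto_const)
    show "((\<lambda>\<alpha>. weighted_norm \<alpha> f) \<longlongrightarrow> ?\<kappa> * S) (at_right (-1))"
      unfolding S_def by (rule weighted_norm_tendsto[OF fm]) (use fw D_ball in blast)
    show "(X \<longlongrightarrow> ?\<kappa> * SG) (at_right (-1))"
      unfolding X_def[abs_def] SG_def by (rule kern_integral_tendsto) (rule G_mono)
    show "\<not> (?\<kappa> = 0 \<and> ?\<kappa> * S = \<infinity> \<or> ?\<kappa> = \<infinity> \<and> ?\<kappa> * S = 0)"
      using kern_mass_nz[where 'n='n] unfolding infinity_ennreal_def by blast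
  qed
  moreover have "eventually (\<lambda>\<alpha>. ?\<kappa> * weighted_norm \<alpha> f + X \<alpha> \<le> ?\<kappa> * ?\<kappa> * S) (at_right (-1))"
    using eventually_at_right_less[of "-1::real"]
  proof eventually_elim
    case (elim \<alpha>)
    show ?case
      unfolding X_def S_def
      by (subst double_integral_eq[OF fm _ elim, symmetric], erule fz)
        (rule double_integral_upper[OF fm _ elim], erule finv, assumption+)
  qed
  ultimately have le: "?\<kappa> * (?\<kappa> * S) + ?\<kappa> * SG \<le> ?\<kappa> * ?\<kappa> * S"
    by (rule tendsto_upperbound) (rule trivial_limit_at_right_real)
  have fin': "?\<kappa> * ?\<kappa> * S \<noteq> top_class.top"
    using S kern_mass_nz[where 'n='n] unfolding ennreal_mult_eq_top_iff by blast
  have "?\<kappa> * ?\<kappa> * S + ?\<kappa> * SG \<le> ?\<kappa> * ?\<kappa> * S + 0"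
    using le by (simp only: mult.assoc add_0_right)
  then have "?\<kappa> * SG \<le> 0"
    using fin' unfolding ennreal_add_left_cancel_le infinity_ennreal_def by blast
  then have SG: "SG = 0" using kern_mass_nz(1)[where 'n='n] by (simp only: le_zero_eq mult_eq_0_iff) blast
  \<comment> \<open>\<open>S\<close> is finite, so it cancels and the increments have growth \<open>0\<close> at every radius\<close>
  have X0: "X 0 = 0"
  proof -
    have "X 0 = (\<integral>\<^sup>+t. 0 \<partial>(hyp_borel :: (complex^'n) measure))"
      unfolding X_def
    proof (rule hyp_borel_cong)
      fix t :: "complex^'n" assume "t \<in> \<bbbB>"
      then have "increment_growth f (norm t) \<le> SG" unfolding SG_def by (intro SUP_upper) auto
      then show "kern CARD('n) 0 (1 - (norm t)\<^sup>2) * increment_growth f (norm t) = 0" using SG by simp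
    qed
    then show ?thesis by simp
  qed
  define E where "E z w = (\<integral>\<^sup>+s. kern CARD('n) 0 (1 - (norm s)\<^sup>2) * sqn (increment f s (z, w)) \<partial>hyp_borel)" for z w
  have E2[measurable]: "(\<lambda>p. E (fst p) (snd p)) \<in> borel_measurable (borel \<Otimes>\<^sub>M borel)"
    unfolding E_def increment_def by (rule hyp_borel_integral_measurable) measurable
  have Ez[measurable]: "E z \<in> borel_measurable borel" for z
    using measurable_compose[OF measurable_Pair1' E2, of z] by simp
  define Y where "Y z = (\<integral>\<^sup>+w. kern CARD('n) 0 (dl z w) * E z w \<partial>hyp_borel)" for z
  have [measurable]: "Y \<in> borel_measurable borel"
    unfolding Y_def
  proof (rule hyp_borel_integral_measurable)
    have "(\<lambda>p. kern CARD('n) 0 (dl (fst p) (snd p)) * E (fst p) (snd p)) \<in> borel_measurable (borel \<Otimes>\<^sub>M borel)" by measurable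
    then show "(\<lambda>(z, w). kern CARD('n) 0 (dl z w) * E z w) \<in> borel_measurable (borel \<Otimes>\<^sub>M borel)" by (simp add: case_prod_beta')
  qed
  have "(\<integral>\<^sup>+z. indicator D z * Y z \<partial>hyp_borel) = 0"
    using increment_integral[OF fm, of 0] X0 unfolding X_def Y_def E_def by simp
  then have ae: "AE z in hyp_borel. indicator D z * Y z = 0"
    by (rule iffD1[OF nn_integral_0_iff_AE, rotated]) (use borel_D in measurable)
  have "\<exists>z\<in>D. Y z = 0"
  proof (rule ccontr)
    assume "\<not> ?thesis"
    then have "AE z in hyp_borel. z \<notin> D" using ae by (auto elim!: eventually_mono simp: indicator_def)
    then have "emeasure hyp_borel D = 0" by (subst (asm) AE_iff_measurable[OF _ refl]) (simp_all add: borel_D)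
    then show False using pos by simp
  qed
  then obtain z0 where z0: "z0 \<in> D" "Y z0 = 0" by blast
  then have z0b: "z0 \<in> \<bbbB>" using D_ball by blast
  have aeE: "AE w in hyp_borel. E z0 w = 0"
  proof -
    have "AE w in hyp_borel. kern CARD('n) 0 (dl z0 w) * E z0 w = 0"
      using z0(2) unfolding Y_def by (rule iffD1[OF nn_integral_0_iff_AE, rotated]) measurable
    then show ?thesis using AE_hyp_borel
    proof eventually_elim
      case (elim w)
      then show ?case using kern_dl_pos[OF _ z0b, of 0 w "CARD('n)"] by auto
    qed
  qed
  have zero: "f (T z0 s, w) - f (z0, w) = 0" if Ew: "E z0 w = 0" and w: "w \<in> \<bbbB>" and s: "s \<in> \<bbbB>" for w s
  proof (rule AE_hyp_borel_continuous_zero[OF _ _ s])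
    have "AE s in hyp_borel. kern CARD('n) 0 (1 - (norm s)\<^sup>2) * sqn (increment f s (z0, w)) = 0"
      using Ew unfolding E_def increment_def by (rule iffD1[OF nn_integral_0_iff_AE, rotated]) measurable
    then show "AE s in hyp_borel. f (T z0 s, w) - f (z0, w) = 0" using AE_hyp_borel
    proof eventually_elim
      case (elim s)
      have "kern CARD('n) 0 (1 - (norm s)\<^sup>2) > 0"
        using kern_dl_pos[of 0 0 s "CARD('n)"] elim(2) by simp
      then have "increment f s (z0, w) = 0" using elim(1) by auto
      then show ?case using z0b by (simp add: increment_def T_eq_T_formula)
    qed
    have "continuous_on \<bbbB> (\<lambda>s. f (T z0 s, w))"
      using T_maps_ball[OF z0b]
      by (intro cholo_on_imp_continuous_on cholo_on_compose[OF holo_map_on_T[OF z0b] fz[OF w]]) blast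
    then show "continuous_on \<bbbB> (\<lambda>s. f (T z0 s, w) - f (z0, w))" by (intro continuous_intros)
  qed
  have final: "f (z, w) - f (z0, w) = 0" if z: "z \<in> \<bbbB>" and w: "w \<in> \<bbbB>" for z w
  proof (rule AE_hyp_borel_continuous_zero[OF _ _ w])
    show "AE w in hyp_borel. f (z, w) - f (z0, w) = 0" using aeE AE_hyp_borel
    proof eventually_elim
      case (elim w)
      have "T z0 (T z0 z) = z" using z z0b by simp
      then show ?case using zero[OF elim T_in_ball[OF z0b z]] by simp
    qed
    show "continuous_on \<bbbB> (\<lambda>w. f (z, w) - f (z0, w))"
      by (intro continuous_intros cholo_on_imp_continuous_on fw z z0b)
  qed
  show ?thesis
  proof (rule that[OF z0b])
    fix z w :: "complex^'n" assume zw: "z \<in> \<bbbB>" "w \<in> \<bbbB>"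
    show "F (z, w) = F (z0, w)" using final[OF zw] unfolding fF[OF zw] fF[OF z0b zw(2)] by simp
  qed
qed

text \<open>A function of \<open>w\<close> alone has, with the variables exchanged, the constant growth \<open>G(0)\<close>, since
  \<open>T\<^sub>z 0 = z\<close>; this is bounded by the growth of the function itself.\<close>

lemma finite_growth_imp_const:
  assumes F: "continuous_on (\<bbbB> \<times> \<bbbB>) F"
    and holw: "\<And>z. z \<in> \<bbbB> \<Longrightarrow> cholo_on (\<lambda>w. F (z, w)) \<bbbB>"
    and holz: "\<And>w. w \<in> \<bbbB> \<Longrightarrow> cholo_on (\<lambda>z. F (z, w)) \<bbbB>"
    and inv: "\<And>\<gamma> z w. \<gamma> \<in> \<Gamma> \<Longrightarrow> z \<in> \<bbbB> \<Longrightarrow> w \<in> \<bbbB> \<Longrightarrow> F (\<gamma> z, \<gamma> w) = F (z, w)"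
    and fin: "(SUP r\<in>{0..<1}. mean_growth D (zero_extend F) r) < \<infinity>"
    and pos: "emeasure hyp_borel D \<noteq> 0"
  obtains c where "\<And>z w. z \<in> \<bbbB> \<Longrightarrow> w \<in> \<bbbB> \<Longrightarrow> F (z, w) = c"
proof -
  obtain z0 where z0: "z0 \<in> \<bbbB>" "\<And>z w. z \<in> \<bbbB> \<Longrightarrow> w \<in> \<bbbB> \<Longrightarrow> F (z, w) = F (z0, w)"
    using finite_growth_imp_const_fst[OF F holw holz inv fin pos] by blast
  \<comment> \<open>\<open>F'(z, w)\<close> depends on \<open>z\<close> only, and is a function of finite growth to which the first half applies again\<close>
  define F' where "F' p = F (snd p, fst p)" for p
  have F': "F' (z, w) = F (z0, z)" if "z \<in> \<bbbB>" "w \<in> \<bbbB>" for z w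
    unfolding F'_def fst_conv snd_conv by (rule z0(2)[OF that(2,1)])
  have growth: "mean_growth D (zero_extend F') r = mean_growth D (zero_extend F) 0" if r: "r \<in> {0..<1}" for r
    unfolding mean_growth_def
  proof (rule hyp_borel_cong)
    fix z :: "complex^'n" assume z: "z \<in> \<bbbB>"
    have "sphere_mean (pullback_sq (zero_extend F') z) r = ennreal ((cmod (F (z0, z)))\<^sup>2)"
    proof (rule sphere_mean_eq_const)
      fix v :: "complex^'n"
      have b: "(r / norm v) *\<^sub>R v \<in> \<bbbB>" using r by (cases "v = 0") auto
      have "T z ((r / norm v) *\<^sub>R v) \<in> \<bbbB>" by (rule T_in_ball[OF z b])
      then show "pullback_sq (zero_extend F') z ((r / norm v) *\<^sub>R v) = ennreal ((cmod (F (z0, z)))\<^sup>2)"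
        using z b F'[OF z] by (simp add: pullback_sq_def zero_extend_def T_eq_T_formula[symmetric] del: mem_ball)
    qed
    moreover have "sphere_mean (pullback_sq (zero_extend F) z) 0 = ennreal ((cmod (F (z0, z)))\<^sup>2)"
    proof (rule sphere_mean_eq_const)
      fix v :: "complex^'n"
      have "T_formula z 0 = z" using z T_eq_T_formula[of z 0] by simp
      then show "pullback_sq (zero_extend F) z ((0 / norm v) *\<^sub>R v) = ennreal ((cmod (F (z0, z)))\<^sup>2)"
        using z z0(2)[OF z z] by (simp add: pullback_sq_def zero_extend_def)
    qed
    ultimately show "indicator D z * sphere_mean (pullback_sq (zero_extend F') z) r
      = indicator D z * sphere_mean (pullback_sq (zero_extend F) z) 0" by simp
  qed
  obtain z1 where z1: "z1 \<in> \<bbbB>" "\<And>z w. z \<in> \<bbbB> \<Longrightarrow> w \<in> \<bbbB> \<Longrightarrow> F' (z, w) = F' (z1, w)"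
  proof (rule finite_growth_imp_const_fst[of F'])
    show "continuous_on (\<bbbB> \<times> \<bbbB>) F'"
      unfolding F'_def by (rule continuous_on_compose2[OF F]) (auto intro!: continuous_intros)
    show "cholo_on (\<lambda>w. F' (z, w)) \<bbbB>" if "z \<in> \<bbbB>" for z unfolding F'_def fst_conv snd_conv by (rule holz[OF that])
    show "cholo_on (\<lambda>z. F' (z, w)) \<bbbB>" if "w \<in> \<bbbB>" for w unfolding F'_def fst_conv snd_conv by (rule holw[OF that])
    show "F' (\<gamma> z, \<gamma> w) = F' (z, w)" if "\<gamma> \<in> \<Gamma>" "z \<in> \<bbbB>" "w \<in> \<bbbB>" for \<gamma> z w
      unfolding F'_def fst_conv snd_conv by (rule inv[OF that(1,3,2)])
    have "(SUP r\<in>{0..<1}. mean_growth D (zero_extend F') r) \<le> mean_growth D (zero_extend F) 0"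
      by (rule SUP_least) (simp only: growth order_refl)
    also have "\<dots> \<le> (SUP r\<in>{0..<1}. mean_growth D (zero_extend F) r)" by (rule SUP_upper) simp
    finally show "(SUP r\<in>{0..<1}. mean_growth D (zero_extend F') r) < \<infinity>" using fin by (rule le_less_trans)
    show "emeasure hyp_borel D \<noteq> 0" by (rule pos)
  qed blast
  have "F (z, w) = F (z0, z1)" if z: "z \<in> \<bbbB>" and w: "w \<in> \<bbbB>" for z w
  proof -
    have "F (z, w) = F (z0, w)" by (rule z0(2)[OF z w])
    also have "\<dots> = F' (w, z0)" by (simp add: F'_def)
    also have "\<dots> = F' (z1, z0)" by (rule z1(2)[OF w z0(1)])
    finally show ?thesis by (simp add: F'_def)
  qed
  then show ?thesis by (rule that)
qed

lemma bounded_growth: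
  assumes M: "\<And>p. p \<in> \<bbbB> \<times> \<bbbB> \<Longrightarrow> cmod (F p) \<le> M"
    and fin: "emeasure hyp_borel D < \<infinity>"
  shows "(SUP r\<in>{0..<1}. mean_growth D (zero_extend F) r) < \<infinity>"
proof -
  note [measurable] = borel_D
  have "mean_growth D (zero_extend F) r \<le> ennreal (M\<^sup>2) * emeasure hyp_borel D" for r
  proof -
    have "mean_growth D (zero_extend F) r \<le> (\<integral>\<^sup>+z. ennreal (M\<^sup>2) * indicator D z \<partial>hyp_borel)"
      unfolding mean_growth_def
    proof (rule nn_integral_mono)
      fix z :: "complex^'n"
      have "sphere_mean (pullback_sq (zero_extend F) z) r \<le> ennreal (M\<^sup>2)"
      proof (rule sphere_mean_le_const)
        fix v :: "complex^'n"
        have "(cmod (zero_extend F (z, u)))\<^sup>2 \<le> M\<^sup>2" for u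
          using M[of "(z, u)"] by (auto simp: zero_extend_def intro: power_mono)
        then show "pullback_sq (zero_extend F) z v \<le> ennreal (M\<^sup>2)"
          by (auto simp: pullback_sq_def indicator_def intro: ennreal_leI)
      qed
      then show "indicator D z * sphere_mean (pullback_sq (zero_extend F) z) r \<le> ennreal (M\<^sup>2) * indicator D z"
        by (simp add: indicator_def)
    qed
    then show ?thesis by (simp add: nn_integral_cmult_indicator)
  qed
  then have "(SUP r\<in>{0..<1}. mean_growth D (zero_extend F) r) \<le> ennreal (M\<^sup>2) * emeasure hyp_borel D"
    by (intro SUP_least)
  also have "\<dots> < \<infinity>" using fin by (simp add: ennreal_mult_less_top)
  finally show ?thesis .
qed

lemma weighted_norm_const:
  assumes "\<alpha> > -1"
  shows "weighted_norm \<alpha> (zero_extend (\<lambda>_. c)) = kern_mass TYPE('n) * emeasure hyp_borel D * sqn c"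
proof -
  note [measurable] = borel_D
  have "weighted_norm \<alpha> (zero_extend (\<lambda>_. c)) = (\<integral>\<^sup>+z. kern_mass TYPE('n) * sqn c * indicator D z \<partial>hyp_borel)"
    unfolding weighted_norm_def
  proof (rule hyp_borel_cong)
    fix z :: "complex^'n" assume z: "z \<in> \<bbbB>"
    have "(\<integral>\<^sup>+w. kern CARD('n) \<alpha> (dl z w) * sqn (zero_extend (\<lambda>_. c) (z, w)) \<partial>hyp_borel)
      = (\<integral>\<^sup>+w. kern CARD('n) \<alpha> (dl z w) * sqn c \<partial>hyp_borel)"
      by (rule hyp_borel_cong) (use z in \<open>simp add: zero_extend_def\<close>)
    also have "\<dots> = kern_mass TYPE('n) * sqn c"
      unfolding kern_dl_mass[OF z assms, symmetric] by (rule nn_integral_multc) measurable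
    finally show "indicator D z * (\<integral>\<^sup>+w. kern CARD('n) \<alpha> (dl z w) * sqn (zero_extend (\<lambda>_. c) (z, w)) \<partial>hyp_borel)
      = kern_mass TYPE('n) * sqn c * indicator D z" by (simp only: mult.commute)
  qed
  also have "\<dots> = kern_mass TYPE('n) * sqn c * emeasure hyp_borel D" by (simp add: nn_integral_cmult_indicator)
  finally show ?thesis by (simp only: mult_ac)
qed

end

section \<open>Discrete groups of automorphisms\<close>

text \<open>The distance \<open>|T\<^sub>z w|\<^sup>2\<close> differs from \<open>|z - w|\<^sup>2\<close> by a Gram determinant and a denominator.  Both are
  harmless on smaller balls, so there the invariant and the Euclidean distance are comparable.\<close>

lemma one_minus_dl:
  fixes z w :: "complex^'n"
  assumes "norm z < 1" "norm w < 1"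
  shows "1 - dl z w = ((norm (z - w))\<^sup>2 - ((norm z)\<^sup>2 * (norm w)\<^sup>2 - (cmod (cdot w z))\<^sup>2)) / (norm (1 - cdot w z))\<^sup>2"
proof -
  have nz: "norm (1 - cdot w z) \<noteq> 0" using one_minus_cdot_nonzero[OF assms(2,1)] by simp
  have 1: "(norm (1 - cdot w z))\<^sup>2 = 1 - 2 * Re (cdot w z) + (cmod (cdot w z))\<^sup>2"
    by (simp only: cmod_power2) (simp add: power2_eq_square algebra_simps)
  have 2: "(norm (z - w))\<^sup>2 = (norm z)\<^sup>2 + (norm w)\<^sup>2 - 2 * Re (cdot w z)"
    by (simp only: power2_norm_eq_inner inner_diff_left inner_diff_right inner_commute[of z w] inner_eq_Re_cdot[of w z])
  have "(norm (1 - cdot w z))\<^sup>2 - (1 - (norm z)\<^sup>2) * (1 - (norm w)\<^sup>2)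
     = (norm (z - w))\<^sup>2 - ((norm z)\<^sup>2 * (norm w)\<^sup>2 - (cmod (cdot w z))\<^sup>2)"
    unfolding 1 2 by (simp add: algebra_simps)
  then show ?thesis using nz by (simp add: dl_def diff_divide_eq_iff)
qed

lemma norm_one_minus_cdot_bounds:
  assumes "norm z \<le> 1" "norm w < 1"
  shows "1 - norm w \<le> norm (1 - cdot w z)" "norm (1 - cdot w z) \<le> 2"
proof -
  have "norm (cdot w z) \<le> norm w"
    using norm_cdot_le[of w z] assms by (meson mult_left_le norm_ge_zero order_trans)
  then show "1 - norm w \<le> norm (1 - cdot w z)" "norm (1 - cdot w z) \<le> 2"
    using norm_triangle_ineq2[of 1 "cdot w z"] norm_triangle_ineq4[of 1 "cdot w z"] assms by auto
qed

lemma one_minus_dl_upper: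
  fixes z w :: "complex^'n"
  assumes z: "norm z \<le> R" and w: "norm w \<le> R" and R: "R < 1"
  shows "1 - dl z w \<le> (norm (z - w))\<^sup>2 / (1 - R)\<^sup>2"
proof -
  have zw: "norm z < 1" "norm w < 1" using assms by auto
  have "(cmod (cdot w z))\<^sup>2 \<le> (norm z)\<^sup>2 * (norm w)\<^sup>2"
    using power_mono[OF norm_cdot_le[of w z] norm_ge_zero, of 2] by (simp add: power_mult_distrib mult.commute)
  then have "1 - dl z w \<le> (norm (z - w))\<^sup>2 / (norm (1 - cdot w z))\<^sup>2"
    unfolding one_minus_dl[OF zw] by (intro divide_right_mono) auto
  also have "\<dots> \<le> (norm (z - w))\<^sup>2 / (1 - R)\<^sup>2"
  proof (rule divide_left_mono)
    have "1 - R \<le> norm (1 - cdot w z)" using norm_one_minus_cdot_bounds(1)[of z w] zw w by auto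
    then show "(1 - R)\<^sup>2 \<le> (norm (1 - cdot w z))\<^sup>2" using R by (intro power_mono) auto
    show "0 < (norm (1 - cdot w z))\<^sup>2 * (1 - R)\<^sup>2"
      using R one_minus_cdot_nonzero[OF zw(2,1)] by (intro mult_pos_pos zero_less_power) auto
  qed simp
  finally show ?thesis .
qed

text \<open>The Gram determinant of \<open>z, w\<close> is that of \<open>z, w - z\<close>, hence at most \<open>|z|\<^sup>2 |w - z|\<^sup>2\<close>.\<close>

lemma one_minus_dl_lower:
  fixes z w :: "complex^'n"
  assumes zw: "norm z < 1" "norm w < 1"
  shows "(1 - (norm z)\<^sup>2) * (norm (z - w))\<^sup>2 / 4 \<le> 1 - dl z w"
proof -
  have "(norm z)\<^sup>2 * (norm w)\<^sup>2 - (cmod (cdot w z))\<^sup>2 = (norm z)\<^sup>2 * (norm (w - z))\<^sup>2 - (cmod (cdot (w - z) z))\<^sup>2"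
  proof -
    have 1: "(norm (w - z))\<^sup>2 = (norm w)\<^sup>2 + (norm z)\<^sup>2 - 2 * Re (cdot w z)"
      by (simp only: power2_norm_eq_inner inner_diff_left inner_diff_right inner_commute[of z w] inner_eq_Re_cdot[of w z])
    have 2: "(cmod (cdot (w - z) z))\<^sup>2 = (cmod (cdot w z))\<^sup>2 - 2 * Re (cdot w z) * (norm z)\<^sup>2 + ((norm z)\<^sup>2)\<^sup>2"
      unfolding cdot_diff_left cdot_self cmod_power2 by (simp add: power2_diff algebra_simps)
    show ?thesis unfolding 1 2 by (simp add: power2_eq_square algebra_simps)
  qed
  also have "\<dots> \<le> (norm z)\<^sup>2 * (norm (z - w))\<^sup>2" by (simp add: norm_minus_commute)
  finally have *: "(1 - (norm z)\<^sup>2) * (norm (z - w))\<^sup>2 \<le> (norm (z - w))\<^sup>2 - ((norm z)\<^sup>2 * (norm w)\<^sup>2 - (cmod (cdot w z))\<^sup>2)"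
    by (simp add: algebra_simps)
  have pos: "0 \<le> (1 - (norm z)\<^sup>2) * (norm (z - w))\<^sup>2"
    using one_minus_norm_sq_pos[OF zw(1)] by (intro mult_nonneg_nonneg) auto
  have "(norm (1 - cdot w z))\<^sup>2 \<le> 2\<^sup>2"
    using norm_one_minus_cdot_bounds(2)[of z w] zw by (intro power_mono) auto
  then show ?thesis unfolding one_minus_dl[OF zw]
    using * pos one_minus_cdot_nonzero[OF zw(2,1)] by (intro frac_le) auto
qed

text \<open>A point at bounded invariant distance from a smaller ball stays away from the sphere.\<close>

lemma dl_lower_imp_norm:
  fixes z w :: "complex^'n"
  assumes z: "norm z \<le> r" and r: "r < 1" and w: "norm w < 1" and d: "d \<le> dl z w"
  shows "d * (1 - r)\<^sup>2 \<le> 1 - (norm w)\<^sup>2"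
proof -
  have z1: "norm z < 1" using z r by simp
  have b: "1 - r \<le> norm (1 - cdot z w)" using norm_one_minus_cdot_bounds(1)[of w z] z1 w z by auto
  have nz: "0 < (norm (1 - cdot z w))\<^sup>2" using one_minus_cdot_nonzero[OF z1 w] by simp
  have p: "0 \<le> dl z w" using dl_pos[of z w] z1 w by simp
  have "d * (1 - r)\<^sup>2 \<le> dl z w * (1 - r)\<^sup>2" using d by (intro mult_right_mono) auto
  also have "\<dots> \<le> dl z w * (norm (1 - cdot z w))\<^sup>2"
    using b r p by (intro mult_left_mono power_mono) auto
  also have "\<dots> = (1 - (norm w)\<^sup>2) * (1 - (norm z)\<^sup>2)"
    using nz by (subst dl_commute) (simp add: dl_def)
  also have "\<dots> \<le> 1 - (norm w)\<^sup>2" using one_minus_norm_sq_pos[OF w] by (intro mult_left_le) auto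
  finally show ?thesis .
qed

lemma carrier_Aut_ball: "f \<in> carrier Aut_ball \<longleftrightarrow> f \<in> extensional \<bbbB> \<and> ball_auto f"
  by (auto simp: Aut_ball_def ball_auto_def Bij_def)

lemma one_Aut_ball: "\<one>\<^bsub>Aut_ball\<^esub> = (\<lambda>z\<in>\<bbbB>. z)"
  by (simp add: Aut_ball_def BijGroup_def)

lemma mult_Aut_ball: "f \<in> carrier Aut_ball \<Longrightarrow> g \<in> carrier Aut_ball \<Longrightarrow> f \<otimes>\<^bsub>Aut_ball\<^esub> g = compose \<bbbB> f g"
  by (simp add: Aut_ball_def BijGroup_def)

lemma holo_map_on_cong:
  assumes "open S" "\<And>z. z \<in> S \<Longrightarrow> f z = g z" "holo_map_on f S"
  shows "holo_map_on g S"
  unfolding holo_map_on_def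
proof
  fix z assume z: "z \<in> S"
  then obtain A where A: "(f has_derivative A) (at z)" "\<forall>c v. A (c *s v) = c *s A v"
    using assms(3) unfolding holo_map_on_def by blast
  have "(g has_derivative A) (at z)"
    by (rule has_derivative_transform_within_open[OF A(1) assms(1) z assms(2)])
  then show "\<exists>A. (g has_derivative A) (at z) \<and> (\<forall>c v. A (c *s v) = c *s A v)" using A(2) by blast
qed

lemma ball_auto_restrict: assumes "ball_auto f" shows "restrict f \<bbbB> \<in> carrier Aut_ball"
proof -
  have f: "holo_map_on f \<bbbB>" "holo_map_on (inv_into \<bbbB> f) \<bbbB>" "f ` \<bbbB> = \<bbbB>" "inv_into \<bbbB> f ` \<bbbB> = \<bbbB>"
    using assms ball_auto_inv[OF assms] by (simp_all only: ball_auto_image ball_auto_def)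
  have "ball_auto (restrict f \<bbbB>)"
  proof (rule ball_autoI[of _ "inv_into \<bbbB> f", OF _ _ f(2)])
    show "holo_map_on (restrict f \<bbbB>) \<bbbB>" by (rule holo_map_on_cong[OF open_ball _ f(1)]) (simp only: restrict_apply')
    show "restrict f \<bbbB> ` \<bbbB> \<subseteq> \<bbbB>" "inv_into \<bbbB> f ` \<bbbB> \<subseteq> \<bbbB>" unfolding image_restrict_eq f by (rule order_refl)+
    fix z :: "complex^'a" assume z: "z \<in> \<bbbB>"
    show "inv_into \<bbbB> f (restrict f \<bbbB> z) = z" using z ball_auto_inv_left[OF assms z] by (simp only: restrict_apply')
    have "inv_into \<bbbB> f z \<in> \<bbbB>" using f(4) z by blast
    then show "restrict f \<bbbB> (inv_into \<bbbB> f z) = z" using ball_auto_inv_right[OF assms z] by (simp only: restrict_apply')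
  qed
  then show ?thesis by (simp only: carrier_Aut_ball restrict_extensional simp_thms)
qed

lemma ball_auto_compose: assumes f: "ball_auto f" and g: "ball_auto g" shows "ball_auto (\<lambda>z. f (g z))"
proof (rule ball_autoI[of _ "\<lambda>z. inv_into \<bbbB> g (inv_into \<bbbB> f z)"])
  note i = ball_auto_inv[OF f] ball_auto_inv[OF g]
  have h: "holo_map_on f \<bbbB>" "holo_map_on (inv_into \<bbbB> f) \<bbbB>" "holo_map_on g \<bbbB>" "holo_map_on (inv_into \<bbbB> g) \<bbbB>"
    using f g by (simp_all only: ball_auto_def)
  show "holo_map_on (\<lambda>z. f (g z)) \<bbbB>"
    by (rule holo_map_on_compose[OF h(3,1)]) (simp only: ball_auto_image[OF g] order_refl)
  show "holo_map_on (\<lambda>z. inv_into \<bbbB> g (inv_into \<bbbB> f z)) \<bbbB>"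
    by (rule holo_map_on_compose[OF h(2,4)]) (simp only: ball_auto_image[OF i(1)] order_refl)
  show "(\<lambda>z. f (g z)) ` \<bbbB> \<subseteq> \<bbbB>" "(\<lambda>z. inv_into \<bbbB> g (inv_into \<bbbB> f z)) ` \<bbbB> \<subseteq> \<bbbB>"
    using ball_auto_in[OF f] ball_auto_in[OF g] ball_auto_in[OF i(1)] ball_auto_in[OF i(2)] by blast+
  show "inv_into \<bbbB> g (inv_into \<bbbB> f (f (g z))) = z" if "z \<in> \<bbbB>" for z
    by (simp only: ball_auto_inv_left[OF f ball_auto_in[OF g that]] ball_auto_inv_left[OF g that])
  show "f (g (inv_into \<bbbB> g (inv_into \<bbbB> f z))) = z" if "z \<in> \<bbbB>" for z
    by (simp only: ball_auto_inv_right[OF g ball_auto_in[OF i(1) that]] ball_auto_inv_right[OF f that])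
qed

lemma group_Aut_ball: "group (Aut_ball :: (complex^'n \<Rightarrow> complex^'n) monoid)"
proof (rule groupI)
  have id: "ball_auto (\<lambda>z :: complex^'n. z)"
    by (rule ball_autoI[of _ "\<lambda>z. z"]) (auto simp: holo_map_on_def intro!: exI[of _ "\<lambda>v. v"])
  show "\<one>\<^bsub>Aut_ball\<^esub> \<in> carrier (Aut_ball :: (complex^'n \<Rightarrow> complex^'n) monoid)"
    unfolding one_Aut_ball by (rule ball_auto_restrict[OF id])
  fix x :: "complex^'n \<Rightarrow> complex^'n" assume x: "x \<in> carrier Aut_ball"
  then have xb: "ball_auto x" "x \<in> extensional \<bbbB>" by (simp_all only: carrier_Aut_ball)
  have x1: "\<one>\<^bsub>Aut_ball\<^esub> \<in> carrier (Aut_ball :: (complex^'n \<Rightarrow> complex^'n) monoid)" by fact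
  have "compose \<bbbB> (\<lambda>z\<in>\<bbbB>. z) x = x"
    by (rule Id_compose) (use xb ball_auto_in[OF xb(1)] in blast)+
  then show "\<one>\<^bsub>Aut_ball\<^esub> \<otimes>\<^bsub>Aut_ball\<^esub> x = x" using mult_Aut_ball[OF x1 x] by (simp only: one_Aut_ball)
  let ?i = "restrict (inv_into \<bbbB> x) \<bbbB>"
  have i: "?i \<in> carrier Aut_ball" by (rule ball_auto_restrict[OF ball_auto_inv[OF xb(1)]])
  have "compose \<bbbB> ?i x = (\<lambda>z\<in>\<bbbB>. z)"
    by (rule ext) (use ball_auto_in[OF xb(1)] ball_auto_inv_left[OF xb(1)] in \<open>simp del: mem_ball add: compose_def\<close>)
  then show "\<exists>y\<in>carrier Aut_ball. y \<otimes>\<^bsub>Aut_ball\<^esub> x = \<one>\<^bsub>Aut_ball\<^esub>"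
    using mult_Aut_ball[OF i x] i by (intro bexI[of _ ?i]) (simp_all only: one_Aut_ball)
  fix y :: "complex^'n \<Rightarrow> complex^'n" assume y: "y \<in> carrier Aut_ball"
  then have yb: "ball_auto y" by (simp only: carrier_Aut_ball)
  have "compose \<bbbB> x y \<in> carrier Aut_ball"
    using ball_auto_restrict[OF ball_auto_compose[OF xb(1) yb]] by (simp only: compose_def)
  then show xy: "x \<otimes>\<^bsub>Aut_ball\<^esub> y \<in> carrier Aut_ball" by (simp only: mult_Aut_ball[OF x y])
  fix w :: "complex^'n \<Rightarrow> complex^'n" assume w: "w \<in> carrier Aut_ball"
  have wb: "ball_auto w" using w by (simp only: carrier_Aut_ball)
  have "compose \<bbbB> y w \<in> carrier Aut_ball"
    using ball_auto_restrict[OF ball_auto_compose[OF yb wb]] by (simp only: compose_def)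
  then have yw: "y \<otimes>\<^bsub>Aut_ball\<^esub> w \<in> carrier Aut_ball" by (simp only: mult_Aut_ball[OF y w])
  show "x \<otimes>\<^bsub>Aut_ball\<^esub> y \<otimes>\<^bsub>Aut_ball\<^esub> w = x \<otimes>\<^bsub>Aut_ball\<^esub> (y \<otimes>\<^bsub>Aut_ball\<^esub> w)"
    unfolding mult_Aut_ball[OF xy w] mult_Aut_ball[OF x yw]
    unfolding mult_Aut_ball[OF x y] mult_Aut_ball[OF y w]
    by (rule ext) (use ball_auto_in[OF wb] in \<open>simp del: mem_ball add: compose_def\<close>)
qed

text \<open>Induction over the generation of the compact-open topology: in every neighbourhood of the identity
  lie the automorphisms that move the points of some smaller closed ball only a little.\<close>

lemma Aut_topology_nhd_identity:
  fixes W :: "(complex^'n \<Rightarrow> complex^'n) set"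
  assumes W: "openin Aut_topology W" and one: "(\<lambda>z\<in>\<bbbB>. z) \<in> W"
  obtains r \<epsilon> where "0 \<le> r" "r < 1" "0 < \<epsilon>"
    "\<And>f. f \<in> carrier Aut_ball \<Longrightarrow> (\<And>z. norm z \<le> r \<Longrightarrow> norm (f z - z) < \<epsilon>) \<Longrightarrow> f \<in> W"
proof -
  have "generate_topology_on {{f \<in> carrier Aut_ball. f ` K \<subseteq> U} | K U. compact K \<and> K \<subseteq> \<bbbB> \<and> open U} W"
    using W by (simp only: Aut_topology_def openin_topology_generated_by_iff)
  then have "(\<lambda>z\<in>\<bbbB>. z) \<in> W \<Longrightarrow> \<exists>r \<epsilon>. 0 \<le> r \<and> r < 1 \<and> 0 < \<epsilon> \<and>
    (\<forall>f\<in>carrier Aut_ball. (\<forall>z. norm z \<le> r \<longrightarrow> norm (f z - z) < \<epsilon>) \<longrightarrow> f \<in> W)"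
  proof (induction rule: generate_topology_on.induct)
    case Empty
    then show ?case by simp
  next
    case (Int a b)
    obtain r1 \<epsilon>1 where 1: "0 \<le> r1" "r1 < 1" "0 < \<epsilon>1"
      "\<forall>f\<in>carrier Aut_ball. (\<forall>z. norm z \<le> r1 \<longrightarrow> norm (f z - z) < \<epsilon>1) \<longrightarrow> f \<in> a"
      using Int.IH(1) Int.prems by blast
    obtain r2 \<epsilon>2 where 2: "0 \<le> r2" "r2 < 1" "0 < \<epsilon>2"
      "\<forall>f\<in>carrier Aut_ball. (\<forall>z. norm z \<le> r2 \<longrightarrow> norm (f z - z) < \<epsilon>2) \<longrightarrow> f \<in> b"
      using Int.IH(2) Int.prems by blast
    show ?case
      by (rule exI[of _ "max r1 r2"], rule exI[of _ "min \<epsilon>1 \<epsilon>2"]) (use 1 2 in auto)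
  next
    case (UN K)
    then obtain k where k: "k \<in> K" "(\<lambda>z\<in>\<bbbB>. z) \<in> k" by blast
    from UN.IH[OF this] obtain r \<epsilon> where "0 \<le> r" "r < 1" "0 < \<epsilon>"
      "\<forall>f\<in>carrier Aut_ball. (\<forall>z. norm z \<le> r \<longrightarrow> norm (f z - z) < \<epsilon>) \<longrightarrow> f \<in> k" by blast
    then show ?case using k(1) by blast
  next
    case (Basis s)
    then obtain K U where K: "compact K" "K \<subseteq> \<bbbB>" "open U" and s: "s = {f \<in> carrier Aut_ball. f ` K \<subseteq> U}" by blast
    have KU: "K \<subseteq> U"
    proof
      fix z assume z: "z \<in> K"
      then have "(\<lambda>z\<in>\<bbbB>. z) z \<in> U" using Basis.prems s by blast
      moreover have "z \<in> \<bbbB>" using z K(2) by blast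
      ultimately show "z \<in> U" by simp
    qed
    obtain \<epsilon> where e: "\<epsilon> > 0" "(\<Union>x\<in>K. ball x \<epsilon>) \<subseteq> U"
      using compact_subset_open_imp_ball_epsilon_subset[OF K(1,3) KU] by blast
    obtain r where r: "0 \<le> r" "r < 1" "\<And>z. z \<in> K \<Longrightarrow> norm z \<le> r"
    proof (cases "K = {}")
      case False
      obtain x where x: "x \<in> K" "\<And>y. y \<in> K \<Longrightarrow> norm y \<le> norm x"
        using continuous_attains_sup[OF K(1) False, of norm] by (auto intro: continuous_intros)
      show thesis by (rule that[of "norm x"]) (use x K(2) in auto)
    qed (use that[of 0] in auto)
    have "f \<in> s" if f: "f \<in> carrier Aut_ball" and n: "\<forall>z. norm z \<le> r \<longrightarrow> norm (f z - z) < \<epsilon>" for f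
    proof -
      have "f z \<in> U" if "z \<in> K" for z
      proof -
        have "f z \<in> ball z \<epsilon>" using n r(3)[OF that] by (simp add: dist_norm norm_minus_commute)
        then show ?thesis using e(2) that by blast
      qed
      then show ?thesis using f s by blast
    qed
    then show ?case using r(1,2) e(1) by blast
  qed
  then show ?thesis using that one by blast
qed

locale discrete_ball_group =
  fixes \<Gamma> :: "(complex^'n \<Rightarrow> complex^'n) set"
  assumes subgroup_\<Gamma>: "subgroup \<Gamma> Aut_ball"
    and discrete_\<Gamma>: "subtopology Aut_topology \<Gamma> = discrete_topology \<Gamma>"
begin

abbreviation inverse_auto :: "(complex^'n \<Rightarrow> complex^'n) \<Rightarrow> complex^'n \<Rightarrow> complex^'n"
  where "inverse_auto \<gamma> \<equiv> inv\<^bsub>Aut_ball\<^esub> \<gamma>"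

lemma \<Gamma>_carrier: "\<gamma> \<in> \<Gamma> \<Longrightarrow> \<gamma> \<in> carrier Aut_ball"
  using subgroup.subset[OF subgroup_\<Gamma>] by blast

lemma \<Gamma>_auto: "\<gamma> \<in> \<Gamma> \<Longrightarrow> ball_auto \<gamma>"
  using \<Gamma>_carrier by (simp only: carrier_Aut_ball)

lemma \<Gamma>_one: "(\<lambda>z\<in>\<bbbB>. z) \<in> \<Gamma>"
  using subgroup.one_closed[OF subgroup_\<Gamma>] by (simp only: one_Aut_ball)

lemma \<Gamma>_inv: "\<gamma> \<in> \<Gamma> \<Longrightarrow> inverse_auto \<gamma> \<in> \<Gamma>"
  by (rule subgroup.m_inv_closed[OF subgroup_\<Gamma>])

lemma \<Gamma>_compose: "\<gamma> \<in> \<Gamma> \<Longrightarrow> \<gamma>' \<in> \<Gamma> \<Longrightarrow> compose \<bbbB> \<gamma> \<gamma>' \<in> \<Gamma>"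
  using subgroup.m_closed[OF subgroup_\<Gamma>, of \<gamma> \<gamma>'] by (simp only: mult_Aut_ball \<Gamma>_carrier)

lemma \<Gamma>_eqI: "\<gamma> \<in> \<Gamma> \<Longrightarrow> \<gamma>' \<in> \<Gamma> \<Longrightarrow> (\<And>z. z \<in> \<bbbB> \<Longrightarrow> \<gamma> z = \<gamma>' z) \<Longrightarrow> \<gamma> = \<gamma>'"
  by (rule extensionalityI[of _ \<bbbB>]) (use \<Gamma>_carrier in \<open>simp_all only: carrier_Aut_ball\<close>)

lemma \<Gamma>_inv_left: assumes g: "\<gamma> \<in> \<Gamma>" and z: "z \<in> \<bbbB>" shows "inverse_auto \<gamma> (\<gamma> z) = z"
proof -
  have "compose \<bbbB> (inverse_auto \<gamma>) \<gamma> = (\<lambda>z\<in>\<bbbB>. z)"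
    using group.l_inv[OF group_Aut_ball \<Gamma>_carrier[OF g]] mult_Aut_ball[OF \<Gamma>_carrier[OF \<Gamma>_inv[OF g]] \<Gamma>_carrier[OF g]]
    by (simp only: one_Aut_ball)
  from fun_cong[OF this, of z] show ?thesis using z by (simp add: compose_def)
qed

lemma \<Gamma>_inv_right: assumes g: "\<gamma> \<in> \<Gamma>" and z: "z \<in> \<bbbB>" shows "\<gamma> (inverse_auto \<gamma> z) = z"
proof -
  have "compose \<bbbB> \<gamma> (inverse_auto \<gamma>) = (\<lambda>z\<in>\<bbbB>. z)"
    using group.r_inv[OF group_Aut_ball \<Gamma>_carrier[OF g]] mult_Aut_ball[OF \<Gamma>_carrier[OF g] \<Gamma>_carrier[OF \<Gamma>_inv[OF g]]]
    by (simp only: one_Aut_ball)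
  from fun_cong[OF this, of z] show ?thesis using z by (simp add: compose_def)
qed

lemma \<Gamma>_inv_bij: "bij_betw inverse_auto \<Gamma> \<Gamma>"
  by (rule bij_betw_byWitness[where f'=inverse_auto])
    (use \<Gamma>_inv \<Gamma>_carrier group.inv_inv[OF group_Aut_ball] in auto)

lemma \<Gamma>_dl: "\<gamma> \<in> \<Gamma> \<Longrightarrow> z \<in> \<bbbB> \<Longrightarrow> w \<in> \<bbbB> \<Longrightarrow> dl (\<gamma> z) (\<gamma> w) = dl z w"
  by (rule dl_invariant[OF \<Gamma>_auto])

lemma discreteness:
  obtains r \<epsilon> where "0 \<le> r" "r < 1" "0 < \<epsilon>"
    "\<And>\<gamma>. \<gamma> \<in> \<Gamma> \<Longrightarrow> (\<And>z. norm z \<le> r \<Longrightarrow> norm (\<gamma> z - z) < \<epsilon>) \<Longrightarrow> \<gamma> = (\<lambda>z\<in>\<bbbB>. z)"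
proof -
  have "openin (subtopology Aut_topology \<Gamma>) {\<lambda>z\<in>\<bbbB>. z}"
    unfolding discrete_\<Gamma> using \<Gamma>_one by simp
  then obtain W where W: "openin Aut_topology W" "{\<lambda>z\<in>\<bbbB>. z} = W \<inter> \<Gamma>" by (auto simp: openin_subtopology)
  then have "(\<lambda>z\<in>\<bbbB>. z) \<in> W" by blast
  from Aut_topology_nhd_identity[OF W(1) this] obtain r \<epsilon> where r: "0 \<le> r" "r < 1" "0 < \<epsilon>"
    "\<And>f. f \<in> carrier Aut_ball \<Longrightarrow> (\<And>z. norm z \<le> r \<Longrightarrow> norm (f z - z) < \<epsilon>) \<Longrightarrow> f \<in> W" by blast
  show thesis
  proof (rule that[OF r(1-3)])
    fix \<gamma> assume g: "\<gamma> \<in> \<Gamma>" and n: "\<And>z. norm z \<le> r \<Longrightarrow> norm (\<gamma> z - z) < \<epsilon>"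
    have "\<gamma> \<in> W" by (rule r(4)[OF \<Gamma>_carrier[OF g]]) (rule n)
    then show "\<gamma> = (\<lambda>z\<in>\<bbbB>. z)" using g W(2) by blast
  qed
qed

lemma image_bound:
  assumes g: "\<gamma> \<in> \<Gamma>" and R: "norm (\<gamma> 0) \<le> R" "R < 1" and r: "r < 1" and z: "norm z \<le> r"
  shows "(1 - r\<^sup>2) * (1 - R)\<^sup>2 \<le> 1 - (norm (\<gamma> z))\<^sup>2"
proof (rule dl_lower_imp_norm[OF R])
  have z1: "z \<in> \<bbbB>" using z r by simp
  then show "norm (\<gamma> z) < 1" using ball_auto_in[OF \<Gamma>_auto[OF g] z1] by simp
  have "(norm z)\<^sup>2 \<le> r\<^sup>2" using z by (intro power_mono) auto
  then show "1 - r\<^sup>2 \<le> dl (\<gamma> 0) (\<gamma> z)" using \<Gamma>_dl[OF g _ z1, of 0] by simp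
qed

text \<open>The elements that move the origin by a bounded amount map a smaller ball into a smaller ball, and are
  equicontinuous there because they preserve \<open>\<delta>\<close>.  If there were infinitely many of them, the theorem
  of Arzela and Ascoli would give two of them, as close together as desired; the quotient of these
  two would lie in the neighbourhood of the identity that contains no other element of the group.\<close>

lemma finite_bounded_orbit:
  assumes R: "R < 1" shows "finite {\<gamma> \<in> \<Gamma>. norm (\<gamma> 0) \<le> R}"
proof (rule ccontr)
  assume inf: "infinite {\<gamma> \<in> \<Gamma>. norm (\<gamma> 0) \<le> R}"
  then obtain f :: "nat \<Rightarrow> complex^'n \<Rightarrow> complex^'n" where f: "inj f" "range f \<subseteq> {\<gamma> \<in> \<Gamma>. norm (\<gamma> 0) \<le> R}"
    using infinite_countable_subset by blast
  have f\<Gamma>: "f n \<in> \<Gamma>" and f0: "norm (f n 0) \<le> R" for n using f(2) by auto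
  obtain r \<epsilon> where r: "0 \<le> r" "r < 1" "0 < \<epsilon>"
    and disc: "\<And>\<gamma>. \<gamma> \<in> \<Gamma> \<Longrightarrow> (\<And>z. norm z \<le> r \<Longrightarrow> norm (\<gamma> z - z) < \<epsilon>) \<Longrightarrow> \<gamma> = (\<lambda>z\<in>\<bbbB>. z)"
    using discreteness by blast
  \<comment> \<open>\<open>1 - |\<gamma> z|\<^sup>2 \<ge> c\<close> for all \<open>\<gamma>\<close> in question and \<open>|z| \<le> r\<close>\<close>
  define c where "c = (1 - r\<^sup>2) * (1 - R)\<^sup>2"
  have r2: "0 < 1 - r\<^sup>2" using r by (simp add: abs_square_less_1)
  have c: "0 < c" using r2 R by (simp add: c_def)
  define R' where "R' = sqrt (1 - c)"
  have bound: "c \<le> 1 - (norm (f n z))\<^sup>2" if "norm z \<le> r" for n z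
    unfolding c_def by (rule image_bound[OF f\<Gamma> f0 R r(2) that])
  have bound': "norm (f n z) \<le> R'" if "norm z \<le> r" for n z
    using bound[OF that, of n] unfolding R'_def by (intro real_le_rsqrt) simp
  have R': "R' < 1" unfolding R'_def using c by simp
  have inball: "z \<in> \<bbbB>" if "norm z \<le> r" for z :: "complex^'n" using that r by simp
  have f_less: "norm (f n z) < 1" if "norm z \<le> r" for n z using bound'[OF that, of n] R' by simp
  \<comment> \<open>the Lipschitz constant that results from the two comparisons of \<open>\<delta>\<close> with the Euclidean distance\<close>
  define L where "L = 2 / (sqrt c * (1 - r))"
  have L: "L > 0" using c r by (simp add: L_def)
  have lip: "norm (f n x - f n y) \<le> L * norm (x - y)" if x: "norm x \<le> r" and y: "norm y \<le> r" for n x y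
  proof (rule power2_le_imp_le)
    have "c * (norm (f n x - f n y))\<^sup>2 / 4 \<le> (1 - (norm (f n x))\<^sup>2) * (norm (f n x - f n y))\<^sup>2 / 4"
      by (intro divide_right_mono mult_right_mono bound[OF x]) auto
    also have "\<dots> \<le> 1 - dl (f n x) (f n y)" by (rule one_minus_dl_lower[OF f_less[OF x] f_less[OF y]])
    also have "\<dots> = 1 - dl x y" by (simp only: \<Gamma>_dl[OF f\<Gamma> inball[OF x] inball[OF y]])
    also have "\<dots> \<le> (norm (x - y))\<^sup>2 / (1 - r)\<^sup>2" by (rule one_minus_dl_upper[OF x y r(2)])
    finally have "(norm (f n x - f n y))\<^sup>2 \<le> 4 * ((norm (x - y))\<^sup>2 / (1 - r)\<^sup>2) / c"
      using c by (simp add: pos_le_divide_eq[OF c] mult.commute del: divide_divide_eq_left)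
    also have "\<dots> = (L * norm (x - y))\<^sup>2" using c by (simp add: L_def power_mult_distrib power_divide)
    finally show "(norm (f n x - f n y))\<^sup>2 \<le> (L * norm (x - y))\<^sup>2" .
    show "0 \<le> L * norm (x - y)" using L by simp
  qed
  obtain g k where k: "strict_mono (k :: nat \<Rightarrow> nat)"
    and conv: "\<And>e. 0 < e \<Longrightarrow> \<exists>N. \<forall>n x. n \<ge> N \<and> x \<in> cball 0 r \<longrightarrow> norm (f (k n) x - g x) < e"
  proof (rule Arzela_Ascoli[of "cball 0 r" f R'])
    show "compact (cball (0 :: complex^'n) r)" by (rule compact_cball)
    show "norm (f n x) \<le> R'" if "x \<in> cball 0 r" for n x using bound'[of x n] that by simp
    fix x :: "complex^'n" and e :: real assume x: "x \<in> cball 0 r" and e: "0 < e"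
    show "\<exists>d>0. \<forall>n y. y \<in> cball 0 r \<and> norm (x - y) < d \<longrightarrow> norm (f n x - f n y) < e"
    proof (rule exI[of _ "e / L"], intro conjI allI impI)
      show "0 < e / L" using e L by simp
      fix n y assume y: "y \<in> cball 0 r \<and> norm (x - y) < e / L"
      have "norm (f n x - f n y) \<le> L * norm (x - y)" using lip[of x y n] x y by simp
      also have "\<dots> < e" using y L by (simp add: pos_less_divide_eq mult.commute)
      finally show "norm (f n x - f n y) < e" .
    qed
  qed blast
  \<comment> \<open>chosen such that \<open>\<eta>\<^sup>2 / (1 - R')\<^sup>2 = (1 - r\<^sup>2) \<epsilon>\<^sup>2 / 4\<close>, which matches the lower bound for \<open>1 - \<delta>\<close> below\<close>
  define \<eta> where "\<eta> = \<epsilon> * (1 - R') * sqrt (1 - r\<^sup>2) / 2"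
  have \<eta>: "\<eta> > 0" unfolding \<eta>_def using r R' r2 by simp
  obtain N where N: "\<And>n x. n \<ge> N \<Longrightarrow> norm x \<le> r \<Longrightarrow> norm (f (k n) x - g x) < \<eta> / 2"
    using conv[of "\<eta> / 2"] \<eta> by auto
  define \<gamma> \<gamma>' where "\<gamma> = f (k N)" and "\<gamma>' = f (k (Suc N))"
  have gg: "\<gamma> \<in> \<Gamma>" "\<gamma>' \<in> \<Gamma>" unfolding \<gamma>_def \<gamma>'_def by (rule f\<Gamma>)+
  have close: "norm (\<gamma> z - \<gamma>' z) < \<eta>" if "norm z \<le> r" for z
    using norm_triangle_ineq4[of "\<gamma> z - g z" "\<gamma>' z - g z"] N[OF _ that, of N] N[OF _ that, of "Suc N"]
    by (simp add: \<gamma>_def \<gamma>'_def)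
  define h where "h = compose \<bbbB> (inverse_auto \<gamma>) \<gamma>'"
  have h: "h \<in> \<Gamma>" unfolding h_def by (rule \<Gamma>_compose[OF \<Gamma>_inv[OF gg(1)] gg(2)])
  have \<gamma>h: "\<gamma> (h z) = \<gamma>' z" if z: "z \<in> \<bbbB>" for z
    using \<Gamma>_inv_right[OF gg(1) ball_auto_in[OF \<Gamma>_auto[OF gg(2)] z]] z by (simp add: h_def compose_def)
  have "h = (\<lambda>z\<in>\<bbbB>. z)"
  proof (rule disc[OF h])
    fix z :: "complex^'n" assume z: "norm z \<le> r"
    have zb: "z \<in> \<bbbB>" by (rule inball[OF z])
    have hzb: "h z \<in> \<bbbB>" by (rule ball_auto_in[OF \<Gamma>_auto[OF h] zb])
    have "(1 - r\<^sup>2) * (norm (z - h z))\<^sup>2 / 4 \<le> (1 - (norm z)\<^sup>2) * (norm (z - h z))\<^sup>2 / 4"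
      using power_mono[OF z norm_ge_zero, of 2] by (intro divide_right_mono mult_right_mono) auto
    also have "\<dots> \<le> 1 - dl z (h z)" by (rule one_minus_dl_lower) (use zb hzb in auto)
    also have "dl z (h z) = dl (\<gamma> z) (\<gamma>' z)" by (simp only: \<Gamma>_dl[OF gg(1) zb hzb, symmetric] \<gamma>h[OF zb])
    also have "1 - dl (\<gamma> z) (\<gamma>' z) \<le> (norm (\<gamma> z - \<gamma>' z))\<^sup>2 / (1 - R')\<^sup>2"
      by (rule one_minus_dl_upper) (use bound'[OF z] R' in \<open>auto simp: \<gamma>_def \<gamma>'_def\<close>)
    also have "\<dots> < \<eta>\<^sup>2 / (1 - R')\<^sup>2"
      using R' close[OF z] by (intro divide_strict_right_mono power_strict_mono) auto
    also have "\<eta>\<^sup>2 / (1 - R')\<^sup>2 = (1 - r\<^sup>2) * \<epsilon>\<^sup>2 / 4"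
      using R' r2 by (simp add: \<eta>_def power_mult_distrib power_divide)
    finally have "(norm (z - h z))\<^sup>2 < \<epsilon>\<^sup>2" using r2 by simp
    then have "norm (z - h z) < \<epsilon>" by (rule power2_less_imp_less) (use r in simp)
    then show "norm (h z - z) < \<epsilon>" by (simp only: norm_minus_commute)
  qed
  then have "\<gamma> = \<gamma>'"
    by (intro \<Gamma>_eqI[OF gg]) (metis \<gamma>h restrict_apply')
  then have "k N = k (Suc N)" using f(1) by (simp add: \<gamma>_def \<gamma>'_def inj_eq)
  then show False using k by (simp add: strict_mono_eq)
qed

lemma countable_\<Gamma>: "countable \<Gamma>"
proof -
  have "\<Gamma> = (\<Union>n. {\<gamma> \<in> \<Gamma>. norm (\<gamma> 0) \<le> 1 - 1 / (real n + 1)})"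
  proof (intro equalityI subsetI)
    fix \<gamma> assume g: "\<gamma> \<in> \<Gamma>"
    have "\<gamma> 0 \<in> \<bbbB>" by (rule ball_auto_in[OF \<Gamma>_auto[OF g]]) simp
    then have "0 < 1 - norm (\<gamma> 0)" by simp
    then obtain n where "inverse (real (Suc n)) < 1 - norm (\<gamma> 0)" using reals_Archimedean by blast
    then have "norm (\<gamma> 0) \<le> 1 - 1 / (real n + 1)" by (simp add: inverse_eq_divide add.commute)
    then show "\<gamma> \<in> (\<Union>n. {\<gamma> \<in> \<Gamma>. norm (\<gamma> 0) \<le> 1 - 1 / (real n + 1)})" using g by blast
  qed auto
  moreover have "countable (\<Union>n. {\<gamma> \<in> \<Gamma>. norm (\<gamma> 0) \<le> 1 - 1 / (real n + 1)})"
    by (intro countable_UN countable_finite finite_bounded_orbit countableI_type) simp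
  ultimately show ?thesis by simp
qed

lemma finite_meeting_ball:
  assumes r: "0 \<le> r" "r < 1"
  shows "finite {\<gamma> \<in> \<Gamma>. \<exists>x. norm x \<le> r \<and> norm (\<gamma> x) \<le> r}"
proof (rule finite_subset[OF _ finite_bounded_orbit])
  define c where "c = (1 - r\<^sup>2) * (1 - r)\<^sup>2"
  show "{\<gamma> \<in> \<Gamma>. \<exists>x. norm x \<le> r \<and> norm (\<gamma> x) \<le> r} \<subseteq> {\<gamma> \<in> \<Gamma>. norm (\<gamma> 0) \<le> sqrt (1 - c)}"
  proof (clarsimp)
    fix \<gamma> x assume g: "\<gamma> \<in> \<Gamma>" and x: "norm x \<le> r" and y: "norm (\<gamma> x) \<le> r"
    have x1: "x \<in> \<bbbB>" using x r by simp
    have "c \<le> 1 - (norm (\<gamma> 0))\<^sup>2" unfolding c_def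
    proof (rule dl_lower_imp_norm[OF y r(2)])
      show "norm (\<gamma> 0) < 1" using ball_auto_in[OF \<Gamma>_auto[OF g], of 0] by simp
      have "(norm x)\<^sup>2 \<le> r\<^sup>2" using x by (intro power_mono) auto
      then show "1 - r\<^sup>2 \<le> dl (\<gamma> x) (\<gamma> 0)" using \<Gamma>_dl[OF g x1, of 0] by (simp add: dl_commute[of x])
    qed
    then show "norm (\<gamma> 0) \<le> sqrt (1 - c)" by (intro real_le_rsqrt) simp
  qed
  have "0 < 1 - r\<^sup>2" using r by (simp add: abs_square_less_1)
  then show "sqrt (1 - c) < 1" using r by (simp add: c_def)
qed

lemma \<Gamma>_borel: assumes "\<gamma> \<in> \<Gamma>" shows "\<gamma> \<in> borel_measurable borel"
proof -
  have "\<gamma> \<in> extensional \<bbbB>" using \<Gamma>_carrier[OF assms] by (simp only: carrier_Aut_ball)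
  then have "\<gamma> = (\<lambda>z. if z \<in> \<bbbB> then \<gamma> z else undefined)" by (auto simp: fun_eq_iff extensional_def)
  moreover have "continuous_on \<bbbB> \<gamma>"
    using \<Gamma>_auto[OF assms] by (intro holo_map_on_imp_continuous_on) (simp only: ball_auto_def)
  then have "(\<lambda>z. if z \<in> \<bbbB> then \<gamma> z else undefined) \<in> borel_measurable borel"
    by (intro borel_measurable_continuous_on_if) auto
  ultimately show ?thesis by simp
qed

text \<open>The powers of an element with a fixed point all meet a fixed ball, so there are finitely many of
  them; the element then has finite order, and torsion-freeness makes it trivial.\<close>

lemma fixed_point_free:
  assumes tf: "torsion_free \<Gamma>" and g: "\<gamma> \<in> \<Gamma>" and z: "z \<in> \<bbbB>" "\<gamma> z = z"
  shows "\<gamma> = (\<lambda>z\<in>\<bbbB>. z)"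
proof -
  interpret A: group "Aut_ball :: (complex^'n \<Rightarrow> complex^'n) monoid" by (rule group_Aut_ball)
  define p where "p k = \<gamma> [^]\<^bsub>Aut_ball\<^esub> (k :: nat)" for k
  have p: "p k \<in> \<Gamma> \<and> p k z = z" for k
  proof (induction k)
    case 0
    have "p 0 = (\<lambda>z\<in>\<bbbB>. z)" by (simp add: p_def one_Aut_ball)
    then show ?case using \<Gamma>_one z(1) by (simp only: restrict_apply' simp_thms)
  next
    case (Suc k)
    have "p (Suc k) = compose \<bbbB> (p k) \<gamma>"
      using mult_Aut_ball[OF \<Gamma>_carrier \<Gamma>_carrier[OF g], of "p k"] Suc by (simp add: p_def)
    moreover have "compose \<bbbB> (p k) \<gamma> z = z" using Suc z by (simp add: compose_def)
    ultimately show ?case using \<Gamma>_compose[of "p k", OF _ g] Suc by simp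
  qed
  have "range p \<subseteq> {\<gamma> \<in> \<Gamma>. \<exists>x. norm x \<le> norm z \<and> norm (\<gamma> x) \<le> norm z}" using p by force
  then have "finite (range p)" by (rule finite_subset) (rule finite_meeting_ball, use z in auto)
  then have "\<not> inj p" by (auto dest: range_inj_infinite)
  then obtain j k where jk: "j < k" "p j = p k"
    unfolding inj_def by (metis linorder_neqE_nat)
  have "p j \<otimes>\<^bsub>Aut_ball\<^esub> p (k - j) = p j"
    using jk \<Gamma>_carrier[OF g] A.nat_pow_mult[of \<gamma> j "k - j"] by (simp add: p_def)
  then have "p (k - j) = \<one>\<^bsub>Aut_ball\<^esub>"
    using A.l_cancel_one[OF \<Gamma>_carrier \<Gamma>_carrier, of "p j" "p (k - j)"] p by blast
  then have "\<gamma> = \<one>\<^bsub>Aut_ball\<^esub>"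
    using tf g jk(1) unfolding torsion_free_def p_def by (meson zero_less_diff)
  then show ?thesis by (simp only: one_Aut_ball)
qed

text \<open>Only finitely many elements move a point of a smaller ball into that ball, and each of those
  other than the identity moves \<open>z\<close> itself by a positive amount.\<close>

lemma wandering_neighbourhood:
  assumes tf: "torsion_free \<Gamma>" and z: "z \<in> \<bbbB>"
  obtains U where "open U" "z \<in> U" "U \<subseteq> \<bbbB>"
    "\<And>\<gamma> x. \<gamma> \<in> \<Gamma> \<Longrightarrow> x \<in> U \<Longrightarrow> \<gamma> x \<in> U \<Longrightarrow> \<gamma> = (\<lambda>z\<in>\<bbbB>. z)"
proof -
  define r where "r = (1 + norm z) / 2"
  have r: "0 \<le> r" "r < 1" "norm z < r" using z by (auto simp: r_def)
  define \<Phi> where "\<Phi> = {\<gamma> \<in> \<Gamma>. \<exists>x. norm x \<le> r \<and> norm (\<gamma> x) \<le> r} - {\<lambda>z\<in>\<bbbB>. z}"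
  have "\<forall>\<^sub>F \<delta> in at_right 0. \<forall>x. dist z x < \<delta> \<longrightarrow> \<not> dist z (\<gamma> x) < \<delta>" if "\<gamma> \<in> \<Phi>" for \<gamma>
  proof -
    have g: "\<gamma> \<in> \<Gamma>" "\<gamma> z \<noteq> z" using that fixed_point_free[OF tf _ z] by (auto simp: \<Phi>_def simp del: mem_ball)
    define e where "e = dist (\<gamma> z) z / 2"
    have e: "0 < e" using g(2) by (simp add: e_def)
    have "continuous_on \<bbbB> \<gamma>"
      using \<Gamma>_auto[OF g(1)] by (intro holo_map_on_imp_continuous_on) (simp only: ball_auto_def)
    then have "isCont \<gamma> z" using z by (simp only: continuous_on_eq_continuous_at[OF open_ball])
    then obtain d where d: "d > 0" "\<And>x. dist x z < d \<Longrightarrow> dist (\<gamma> x) (\<gamma> z) < e"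
      using e unfolding continuous_at_eps_delta by blast
    have "\<not> dist z (\<gamma> x) < \<delta>" if "\<delta> < min d e" "dist z x < \<delta>" for \<delta> x
      using d(2)[of x] that dist_triangle[of "\<gamma> z" z "\<gamma> x"] by (auto simp: e_def dist_commute)
    then show ?thesis unfolding eventually_at_right_field
      using d(1) e by (intro exI[of _ "min d e"]) auto
  qed
  moreover have "finite \<Phi>" using finite_meeting_ball[OF r(1,2)] by (simp add: \<Phi>_def)
  ultimately have "\<forall>\<^sub>F \<delta> in at_right 0. \<forall>\<gamma>\<in>\<Phi>. \<forall>x. dist z x < \<delta> \<longrightarrow> \<not> dist z (\<gamma> x) < \<delta>"
    by (intro eventually_ball_finite) auto
  moreover have "\<forall>\<^sub>F \<delta> in at_right 0. \<delta> < r - norm z"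
    unfolding eventually_at_right_field using r(3) by (intro exI[of _ "r - norm z"]) auto
  ultimately have "\<forall>\<^sub>F \<delta> in at_right (0::real). 0 < \<delta> \<and> \<delta> < r - norm z \<and>
      (\<forall>\<gamma>\<in>\<Phi>. \<forall>x. dist z x < \<delta> \<longrightarrow> \<not> dist z (\<gamma> x) < \<delta>)"
    using eventually_at_right_less[of 0] by eventually_elim blast
  then obtain \<delta> where \<delta>: "0 < \<delta>" "\<delta> < r - norm z"
    "\<And>\<gamma> x. \<gamma> \<in> \<Phi> \<Longrightarrow> dist z x < \<delta> \<Longrightarrow> \<not> dist z (\<gamma> x) < \<delta>"
    using eventually_happens'[OF trivial_limit_at_right_real] by blast
  have U: "norm x \<le> r" if "x \<in> ball z \<delta>" for x
    using that \<delta>(2) norm_triangle_ineq2[of x z] by (simp add: dist_norm norm_minus_commute)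
  show thesis
  proof (rule that[of "ball z \<delta>"])
    show "ball z \<delta> \<subseteq> \<bbbB>"
    proof
      fix x assume "x \<in> ball z \<delta>"
      then show "x \<in> \<bbbB>" using U[of x] r(2) by simp
    qed
    fix \<gamma> x assume g: "\<gamma> \<in> \<Gamma>" "x \<in> ball z \<delta>" "\<gamma> x \<in> ball z \<delta>"
    have "\<gamma> \<notin> \<Phi>" using \<delta>(3)[of \<gamma> x] g by auto
    then show "\<gamma> = (\<lambda>z\<in>\<bbbB>. z)" using g(1) U[OF g(2)] U[OF g(3)] by (auto simp: \<Phi>_def)
  qed (use \<delta> in auto)
qed

text \<open>Countably many wandering open sets \<open>U\<^sub>n\<close> cover the ball.  Of each orbit, \<open>D\<close> contains the point in the first
  \<open>U\<^sub>n\<close> that the orbit meets; it is unique because \<open>U\<^sub>n\<close> is wandering.\<close>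

lemma fundamental_domain:
  assumes tf: "torsion_free \<Gamma>"
  obtains D where "D \<in> sets borel" "D \<subseteq> \<bbbB>" "\<And>z. z \<in> \<bbbB> \<Longrightarrow> \<exists>!\<gamma>. \<gamma> \<in> \<Gamma> \<and> z \<in> \<gamma> ` D"
proof -
  define F where "F = {U. open U \<and> U \<subseteq> \<bbbB> \<and> (\<forall>\<gamma>\<in>\<Gamma>. \<forall>x\<in>U. \<gamma> x \<in> U \<longrightarrow> \<gamma> = (\<lambda>z\<in>\<bbbB>. z))}"
  have "z \<in> \<Union>F" if z: "z \<in> \<bbbB>" for z
  proof -
    obtain U where "open U" "z \<in> U" "U \<subseteq> \<bbbB>"
      "\<forall>\<gamma>\<in>\<Gamma>. \<forall>x\<in>U. \<gamma> x \<in> U \<longrightarrow> \<gamma> = (\<lambda>z\<in>\<bbbB>. z)"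
      by (rule wandering_neighbourhood[OF tf z]) blast
    then show ?thesis unfolding F_def by blast
  qed
  then have UF: "\<Union>F = \<bbbB>" unfolding F_def by blast
  obtain F' where F': "F' \<subseteq> F" "countable F'" "\<Union>F' = \<Union>F"
    using Lindelof[of F] unfolding F_def by blast
  have "(0 :: complex^'n) \<in> \<Union>F'" unfolding F'(3) UF by simp
  then have "F' \<noteq> {}" by blast
  define U where "U = from_nat_into F'"
  have rU: "range U = F'" unfolding U_def by (rule range_from_nat_into[OF \<open>F' \<noteq> {}\<close> F'(2)])
  have U: "open (U n)" "U n \<subseteq> \<bbbB>" "\<And>\<gamma> x. \<gamma> \<in> \<Gamma> \<Longrightarrow> x \<in> U n \<Longrightarrow> \<gamma> x \<in> U n \<Longrightarrow> \<gamma> = (\<lambda>z\<in>\<bbbB>. z)" for n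
    using rU F'(1) unfolding F_def by blast+
  have cover: "\<exists>n. z \<in> U n" if "z \<in> \<bbbB>" for z
  proof -
    have "z \<in> \<Union>(range U)" using that by (simp only: rU F'(3) UF)
    then show ?thesis by blast
  qed
  \<comment> \<open>translates as preimages under the inverse, which are Borel sets since the group elements are Borel functions\<close>
  define V where "V n = (\<Union>\<gamma>\<in>\<Gamma>. {z \<in> \<bbbB>. inverse_auto \<gamma> z \<in> U n})" for n
  have V: "z \<in> V n \<longleftrightarrow> (\<exists>\<gamma>\<in>\<Gamma>. inverse_auto \<gamma> z \<in> U n)" if "z \<in> \<bbbB>" for z n
    using that by (auto simp: V_def)
  \<comment> \<open>\<open>V n\<close> is the union of the translates of \<open>U n\<close>\<close>
  define D where "D = (\<Union>n. U n - (\<Union>m<n. V m))"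
  show thesis
  proof (rule that[of D])
    have Vm: "V n \<in> sets borel" for n
      unfolding V_def
    proof (intro sets.countable_UN'' countable_\<Gamma>)
      fix \<gamma> assume g: "\<gamma> \<in> \<Gamma>"
      note [measurable] = \<Gamma>_borel[OF \<Gamma>_inv[OF g]] borel_open[OF U(1)]
      show "{z \<in> \<bbbB>. inverse_auto \<gamma> z \<in> U n} \<in> sets borel" by measurable
    qed
    have DU: "\<exists>n. x \<in> U n \<and> (\<forall>m<n. x \<notin> V m)" if "x \<in> D" for x
      using that unfolding D_def by (simp add: Ball_def)
    show "D \<in> sets borel"
      unfolding D_def by (intro sets.countable_UN'' sets.Diff Vm borel_open[OF U(1)]) simp_all
    show DB: "D \<subseteq> \<bbbB>"
    proof
      fix x assume "x \<in> D"
      from DU[OF this] obtain n where "x \<in> U n" by (elim exE conjE)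
      then show "x \<in> \<bbbB>" by (rule subsetD[OF U(2)])
    qed
    fix z :: "complex^'n" assume z: "z \<in> \<bbbB>"
    define n where "n = (LEAST n. z \<in> V n)"
    have "\<exists>n. z \<in> V n"
    proof -
      obtain n where n: "z \<in> U n" using cover[OF z] by blast
      have "inverse_auto (\<lambda>z\<in>\<bbbB>. z) z = z" using \<Gamma>_inv_left[OF \<Gamma>_one z] z by simp
      then have "inverse_auto (\<lambda>z\<in>\<bbbB>. z) z \<in> U n" using n by simp
      then have "z \<in> V n" unfolding V[OF z] using \<Gamma>_one by (rule bexI)
      then show ?thesis by (rule exI)
    qed
    then have n: "z \<in> V n" unfolding n_def by (rule LeastI_ex)
    then obtain \<gamma> where g: "\<gamma> \<in> \<Gamma>" "inverse_auto \<gamma> z \<in> U n" using V[OF z] by blast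
    define u where "u = inverse_auto \<gamma> z"
    have ub: "u \<in> \<bbbB>" using g U(2) u_def by blast
    have gu: "\<gamma> u = z" unfolding u_def by (rule \<Gamma>_inv_right[OF g(1) z])
    have orbit_V: "z \<in> V m" if uV: "u \<in> V m" for m
    proof -
      obtain \<gamma>' where g': "\<gamma>' \<in> \<Gamma>" "inverse_auto \<gamma>' u \<in> U m" using uV unfolding V[OF ub] by (elim bexE)
      let ?h = "compose \<bbbB> \<gamma> \<gamma>'"
      let ?x = "inverse_auto \<gamma>' u"
      have h: "?h \<in> \<Gamma>" by (rule \<Gamma>_compose[OF g(1) g'(1)])
      have x: "?x \<in> \<bbbB>" by (rule subsetD[OF U(2) g'(2)])
      have "?h ?x = z" using x gu \<Gamma>_inv_right[OF g'(1) ub] by (simp add: compose_def)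
      then have "inverse_auto ?h z = ?x" using \<Gamma>_inv_left[OF h x] by simp
      then have "inverse_auto ?h z \<in> U m" using g'(2) by simp
      then show ?thesis unfolding V[OF z] using h by (rule bexI)
    qed
    have "u \<notin> V m" if "m < n" for m
      by (rule contrapos_nn[OF not_less_Least[OF that[unfolded n_def]] orbit_V])
    then have uD: "u \<in> D" using g(2) unfolding D_def u_def[symmetric] by auto
    show "\<exists>!\<gamma>. \<gamma> \<in> \<Gamma> \<and> z \<in> \<gamma> ` D"
    proof (rule ex1I[of _ \<gamma>])
      show "\<gamma> \<in> \<Gamma> \<and> z \<in> \<gamma> ` D" using g(1) uD gu by blast
      fix \<gamma>' assume "\<gamma>' \<in> \<Gamma> \<and> z \<in> \<gamma>' ` D"
      then obtain u' where g': "\<gamma>' \<in> \<Gamma>" and u'D: "u' \<in> D" and gu': "\<gamma>' u' = z" by blast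
      have u'b: "u' \<in> \<bbbB>" using u'D DB by blast
      let ?h = "compose \<bbbB> (inverse_auto \<gamma>') \<gamma>"
      have h: "?h \<in> \<Gamma>" by (rule \<Gamma>_compose[OF \<Gamma>_inv[OF g'] g(1)])
      have hu: "?h u = u'" using ub gu \<Gamma>_inv_left[OF g' u'b] gu' by (simp add: compose_def)
      obtain k where k: "u \<in> U k" "\<forall>m<k. u \<notin> V m" using DU[OF uD] by (elim exE conjE)
      obtain k' where k': "u' \<in> U k'" "\<forall>m<k'. u' \<notin> V m" using DU[OF u'D] by (elim exE conjE)
      have ihu': "inverse_auto ?h u' = u" using \<Gamma>_inv_left[OF h ub] hu by simp
      have "u' \<in> V k" unfolding V[OF u'b] by (rule bexI[OF _ h]) (simp only: ihu' k(1))
      then have "\<not> k < k'" using k'(2) by blast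
      have ii: "inverse_auto (inverse_auto ?h) = ?h" by (rule group.inv_inv[OF group_Aut_ball \<Gamma>_carrier[OF h]])
      have "u \<in> V k'" unfolding V[OF ub] by (rule bexI[OF _ \<Gamma>_inv[OF h]]) (simp only: ii hu k'(1))
      then have "\<not> k' < k" using k(2) by blast
      with \<open>\<not> k < k'\<close> have "k = k'" by simp
      then have "?h = (\<lambda>z\<in>\<bbbB>. z)" using U(3)[OF h k(1)] hu k'(1) by simp
      then have uu: "u = u'" and hz: "\<And>x. x \<in> \<bbbB> \<Longrightarrow> inverse_auto \<gamma>' (\<gamma> x) = x"
        using hu ub by (auto simp: fun_eq_iff compose_def restrict_def split: if_splits)
      show "\<gamma>' = \<gamma>"
      proof (rule \<Gamma>_eqI[OF g' g(1)])
        fix x :: "complex^'n" assume x: "x \<in> \<bbbB>"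
        show "\<gamma>' x = \<gamma> x" using \<Gamma>_inv_right[OF g' ball_auto_in[OF \<Gamma>_auto[OF g(1)] x]] hz[OF x] by simp
      qed
    qed
  qed
qed

lemma ball_quotient_domain:
  assumes tf: "torsion_free \<Gamma>"
  obtains D where "ball_quotient \<Gamma> inverse_auto D"
proof (rule fundamental_domain[OF tf])
  fix D assume D: "D \<in> sets borel" "D \<subseteq> \<bbbB>" "\<And>z. z \<in> \<bbbB> \<Longrightarrow> \<exists>!\<gamma>. \<gamma> \<in> \<Gamma> \<and> z \<in> \<gamma> ` D"
  have "ball_quotient \<Gamma> inverse_auto D"
    by unfold_locales (fact countable_\<Gamma> \<Gamma>_auto \<Gamma>_borel \<Gamma>_inv_bij \<Gamma>_inv_left \<Gamma>_inv_right D)+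
  then show thesis by (rule that)
qed

end

section \<open>The measure of a quotient as the measure of a fundamental domain\<close>

text \<open>Measure-preserving actions with a measurable fundamental domain, general enough for the ball and for the
  product of two balls.  The unit \<open>e\<close> and the inversion \<open>\<iota>\<close> are parameters that are
  characterised by their effect on points.\<close>

locale measured_action =
  fixes G :: "('g, 'r) monoid_scheme" and \<phi> :: "'g \<Rightarrow> 'a \<Rightarrow> 'a" and M :: "'a measure"
    and \<iota> :: "'g \<Rightarrow> 'g" and e :: 'g and E :: "'a set"
  assumes countable_G: "countable (carrier G)"
    and unit: "e \<in> carrier G" "p \<in> space M \<Longrightarrow> \<phi> e p = p"
    and action_measurable: "g \<in> carrier G \<Longrightarrow> \<phi> g \<in> measurable M M"
    and action_preserves: "g \<in> carrier G \<Longrightarrow> distr M M (\<phi> g) = M"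
    and inverse: "g \<in> carrier G \<Longrightarrow> \<iota> g \<in> carrier G"
      "g \<in> carrier G \<Longrightarrow> p \<in> space M \<Longrightarrow> \<phi> (\<iota> g) (\<phi> g p) = p"
      "g \<in> carrier G \<Longrightarrow> p \<in> space M \<Longrightarrow> \<phi> g (\<phi> (\<iota> g) p) = p"
    and orbit_action: "g \<in> carrier G \<Longrightarrow> p \<in> space M \<Longrightarrow> orbit G \<phi> (\<phi> g p) = orbit G \<phi> p"
    and domain_measurable: "E \<in> sets M"
    and domain_fundamental: "p \<in> space M \<Longrightarrow> \<exists>!g. g \<in> carrier G \<and> p \<in> \<phi> g ` E"
begin

abbreviation "orbit_sets \<equiv> {A. A \<subseteq> orbits G (space M) \<phi> \<and> {p \<in> space M. orbit G \<phi> p \<in> A} \<in> sets M}"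

lemma E_space: "E \<subseteq> space M"
  using sets.sets_into_space[OF domain_measurable] .

lemma action_space: "g \<in> carrier G \<Longrightarrow> p \<in> space M \<Longrightarrow> \<phi> g p \<in> space M"
  by (rule measurable_space[OF action_measurable])

lemma orbit_in_orbits: "p \<in> space M \<Longrightarrow> orbit G \<phi> p \<in> orbits G (space M) \<phi>"
  unfolding orbits_def by blast

lemma translate_iff: "g \<in> carrier G \<Longrightarrow> p \<in> space M \<Longrightarrow> p \<in> \<phi> g ` E \<longleftrightarrow> \<phi> (\<iota> g) p \<in> E"
proof
  assume g: "g \<in> carrier G" "p \<in> space M"
  assume "p \<in> \<phi> g ` E"
  then obtain x where x: "x \<in> E" "p = \<phi> g x" by blast
  then have "x \<in> space M" using E_space by blast
  then show "\<phi> (\<iota> g) p \<in> E" using inverse(2)[OF g(1)] x by simp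
next
  assume g: "g \<in> carrier G" "p \<in> space M" and x: "\<phi> (\<iota> g) p \<in> E"
  show "p \<in> \<phi> g ` E" by (rule image_eqI[OF _ x]) (simp only: inverse(3)[OF g])
qed

lemma translate_unique:
  "g \<in> carrier G \<Longrightarrow> h \<in> carrier G \<Longrightarrow> p \<in> space M \<Longrightarrow> p \<in> \<phi> g ` E \<Longrightarrow> p \<in> \<phi> h ` E \<Longrightarrow> g = h"
  using domain_fundamental[of p] by blast

lemma orbit_sets_sigma_algebra: "sigma_algebra (orbits G (space M) \<phi>) orbit_sets"
  unfolding sigma_algebra_iff2
proof (intro conjI ballI allI impI)
  fix S assume S: "S \<in> orbit_sets"
  have "{p \<in> space M. orbit G \<phi> p \<in> orbits G (space M) \<phi> - S} = space M - {p \<in> space M. orbit G \<phi> p \<in> S}"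
    using orbit_in_orbits by auto
  then show "orbits G (space M) \<phi> - S \<in> orbit_sets" using S by auto
next
  fix A :: "nat \<Rightarrow> 'a set set" assume A: "range A \<subseteq> orbit_sets"
  have "{p \<in> space M. orbit G \<phi> p \<in> (\<Union>i. A i)} = (\<Union>i. {p \<in> space M. orbit G \<phi> p \<in> A i})" by auto
  also have "\<dots> \<in> sets M" using A by (intro sets.countable_UN) auto
  finally show "(\<Union>i. A i) \<in> orbit_sets" using A by blast
qed auto

lemma inj_on_orbit_E: "inj_on (orbit G \<phi>) E"
proof (rule inj_onI)
  fix x y assume x: "x \<in> E" and y: "y \<in> E" and eq: "orbit G \<phi> x = orbit G \<phi> y"
  have xs: "x \<in> space M" "y \<in> space M" using x y E_space by auto
  have "\<phi> e y \<in> orbit G \<phi> y" using unit(1) unfolding orbit_def by blast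
  then have "y \<in> orbit G \<phi> x" using eq unit(2)[OF xs(2)] by simp
  then obtain g where g: "g \<in> carrier G" "y = \<phi> g x" unfolding orbit_def by blast
  have "y \<in> \<phi> g ` E" using g x by blast
  moreover have "y \<in> \<phi> e ` E" using unit(2)[OF xs(2)] y by (metis imageI)
  ultimately have "g = e" by (rule translate_unique[OF g(1) unit(1) xs(2)])
  then show "x = y" using g(2) unit(2)[OF xs(1)] by simp
qed

text \<open>Cut \<open>S\<close> along the translates of \<open>E\<close> and move the pieces into \<open>E\<close>.  They stay disjoint because the
  projection to the orbits is injective on \<open>S\<close>.\<close>

lemma emeasure_injective_le:
  assumes A: "A \<in> orbit_sets" and S: "S \<in> sets M" "inj_on (orbit G \<phi>) S" "orbit G \<phi> ` S \<subseteq> A"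
  shows "emeasure M S \<le> emeasure M (E \<inter> {p \<in> space M. orbit G \<phi> p \<in> A})"
proof -
  note [measurable] = domain_measurable S(1) action_measurable
  have Ss: "S \<subseteq> space M" using sets.sets_into_space[OF S(1)] .
  define X where "X g = {p \<in> space M. p \<in> S \<and> \<phi> (\<iota> g) p \<in> E}" for g
  define R where "R g = {p \<in> space M. p \<in> E \<and> \<phi> g p \<in> S}" for g
  have Xm: "X g \<in> sets M" and Rm: "R g \<in> sets M" if "g \<in> carrier G" for g
  proof -
    note [measurable] = action_measurable[OF that] action_measurable[OF inverse(1)[OF that]]
    show "X g \<in> sets M" "R g \<in> sets M" unfolding X_def R_def by measurable
  qed
  have X: "p \<in> X g \<longleftrightarrow> p \<in> S \<and> p \<in> \<phi> g ` E" if "g \<in> carrier G" for p g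
    using translate_iff[OF that] Ss unfolding X_def by auto
  have "S = \<Union>(X ` carrier G)"
  proof (intro equalityI subsetI)
    fix p assume p: "p \<in> S"
    then obtain g where "g \<in> carrier G" "p \<in> \<phi> g ` E" using domain_fundamental[of p] Ss by blast
    then show "p \<in> \<Union>(X ` carrier G)" using X p by blast
  qed (auto simp: X_def)
  then have "emeasure M S = emeasure M (\<Union>(X ` carrier G))" by simp
  also have "\<dots> = (\<integral>\<^sup>+g. emeasure M (X g) \<partial>count_space (carrier G))"
  proof (rule emeasure_UN_countable[OF Xm countable_G])
    show "disjoint_family_on X (carrier G)"
      unfolding disjoint_family_on_def
    proof (intro ballI impI equals0I)
      fix g h p assume gh: "g \<in> carrier G" "h \<in> carrier G" "g \<noteq> h" and p: "p \<in> X g \<inter> X h"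
      have "p \<in> space M" using p by (simp add: X_def)
      then have "g = h" using p X[OF gh(1)] X[OF gh(2)] translate_unique[OF gh(1,2)] by blast
      then show False using gh(3) by simp
    qed
  qed
  also have "\<dots> = (\<integral>\<^sup>+g. emeasure M (R g) \<partial>count_space (carrier G))"
  proof (rule nn_integral_cong)
    fix g assume "g \<in> space (count_space (carrier G))"
    then have g: "g \<in> carrier G" by simp
    have "emeasure M (X g) = emeasure (distr M M (\<phi> g)) (X g)" by (simp only: action_preserves[OF g])
    also have "\<dots> = emeasure M (\<phi> g -` X g \<inter> space M)" by (rule emeasure_distr[OF action_measurable[OF g] Xm[OF g]])
    also have "\<phi> g -` X g \<inter> space M = R g"
      using inverse(2)[OF g] action_space[OF g] by (auto simp: X_def R_def)
    finally show "emeasure M (X g) = emeasure M (R g)" .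
  qed
  also have "\<dots> = emeasure M (\<Union>(R ` carrier G))"
  proof (rule emeasure_UN_countable[OF Rm countable_G, symmetric])
    show "disjoint_family_on R (carrier G)"
      unfolding disjoint_family_on_def
    proof (intro ballI impI equals0I)
      fix g h p assume gh: "g \<in> carrier G" "h \<in> carrier G" "g \<noteq> h" and "p \<in> R g \<inter> R h"
      then have p: "p \<in> space M" "p \<in> E" "\<phi> g p \<in> S" "\<phi> h p \<in> S" by (simp_all add: R_def)
      have "\<phi> g p = \<phi> h p"
        by (rule inj_onD[OF S(2) _ p(3,4)]) (simp only: orbit_action[OF gh(1) p(1)] orbit_action[OF gh(2) p(1)])
      then have "\<phi> g p \<in> \<phi> h ` E" using p(2) by (metis imageI)
      with imageI[OF p(2), of "\<phi> g"] have "g = h" by (rule translate_unique[OF gh(1,2) action_space[OF gh(1) p(1)]])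
      then show False using gh(3) by simp
    qed
  qed
  also have "\<dots> \<le> emeasure M (E \<inter> {p \<in> space M. orbit G \<phi> p \<in> A})"
  proof (rule emeasure_mono)
    show "E \<inter> {p \<in> space M. orbit G \<phi> p \<in> A} \<in> sets M" using domain_measurable A by blast
    show "\<Union>(R ` carrier G) \<subseteq> E \<inter> {p \<in> space M. orbit G \<phi> p \<in> A}"
    proof
      fix p assume "p \<in> \<Union>(R ` carrier G)"
      then obtain g where g: "g \<in> carrier G" and p: "p \<in> space M" "p \<in> E" "\<phi> g p \<in> S" unfolding R_def by blast
      then have "orbit G \<phi> (\<phi> g p) \<in> A" using S(3) by blast
      then have "orbit G \<phi> p \<in> A" by (simp only: orbit_action[OF g p(1)])
      then show "p \<in> E \<inter> {p \<in> space M. orbit G \<phi> p \<in> A}" using p by blast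
    qed
  qed
  finally show ?thesis .
qed

lemma orbit_measurable:
  "orbit G \<phi> \<in> measurable (density M (indicator E)) (sigma (orbits G (space M) \<phi>) orbit_sets)"
proof (rule measurableI)
  interpret sigma_algebra "orbits G (space M) \<phi>" orbit_sets by (rule orbit_sets_sigma_algebra)
  show "orbit G \<phi> p \<in> space (sigma (orbits G (space M) \<phi>) orbit_sets)" if "p \<in> space (density M (indicator E))" for p using that orbit_in_orbits by simp
  fix A assume "A \<in> sets (sigma (orbits G (space M) \<phi>) orbit_sets)"
  then have "A \<in> orbit_sets" by (simp add: sigma_sets_eq)
  moreover have "orbit G \<phi> -` A \<inter> space M = {p \<in> space M. orbit G \<phi> p \<in> A}" by auto
  ultimately show "orbit G \<phi> -` A \<inter> space (density M (indicator E)) \<in> sets (density M (indicator E))" by simp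
qed

text \<open>By lemma \<open>emeasure_injective_le\<close> the supremum in the definition of the quotient measure is attained at the part
  of \<open>E\<close> above \<open>A\<close>.\<close>

lemma quotient_measure_eq_distr:
  "quotient_measure G \<phi> M = distr (density M (indicator E)) (sigma (orbits G (space M) \<phi>) orbit_sets) (orbit G \<phi>)"
  (is "_ = distr ?D ?S _")
proof -
  note [measurable] = domain_measurable
  interpret sigma_algebra "orbits G (space M) \<phi>" orbit_sets by (rule orbit_sets_sigma_algebra)
  note \<pi> = orbit_measurable
  let ?Q = "distr ?D ?S (orbit G \<phi>)"
  have sp: "space ?Q = orbits G (space M) \<phi>" "sets ?Q = orbit_sets" by (auto simp: sigma_sets_eq)
  have "quotient_measure G \<phi> M = measure_of (orbits G (space M) \<phi>) orbit_sets (emeasure ?Q)"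
    unfolding quotient_measure_def
  proof (rule measure_of_eq)
    show "orbit_sets \<subseteq> Pow (orbits G (space M) \<phi>)" by blast
    fix A assume "A \<in> sigma_sets (orbits G (space M) \<phi>) orbit_sets"
    then have A: "A \<in> orbit_sets" by (simp only: sigma_sets_eq)
    let ?P = "{p \<in> space M. orbit G \<phi> p \<in> A}"
    have Pm[measurable]: "?P \<in> sets M" using A by blast
    have "emeasure ?Q A = emeasure ?D (orbit G \<phi> -` A \<inter> space ?D)"
      by (rule emeasure_distr[OF \<pi>]) (use A sp(2) in simp)
    also have "orbit G \<phi> -` A \<inter> space ?D = ?P" by auto
    also have "emeasure ?D ?P = (\<integral>\<^sup>+p. indicator E p * indicator ?P p \<partial>M)"
      by (rule emeasure_density) measurable
    also have "\<dots> = (\<integral>\<^sup>+p. indicator (E \<inter> ?P) p \<partial>M)" by (simp only: indicator_inter_arith)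
    also have "\<dots> = emeasure M (E \<inter> ?P)" by (rule nn_integral_indicator) measurable
    finally have Q: "emeasure ?Q A = emeasure M (E \<inter> ?P)" .
    show "(SUP S \<in> {S \<in> sets M. inj_on (orbit G \<phi>) S \<and> orbit G \<phi> ` S \<subseteq> A}. emeasure M S) = emeasure ?Q A"
      unfolding Q
    proof (rule antisym)
      show "(SUP S \<in> {S \<in> sets M. inj_on (orbit G \<phi>) S \<and> orbit G \<phi> ` S \<subseteq> A}. emeasure M S) \<le> emeasure M (E \<inter> ?P)"
        by (rule SUP_least) (use emeasure_injective_le[OF A] in blast)
      show "emeasure M (E \<inter> ?P) \<le> (SUP S \<in> {S \<in> sets M. inj_on (orbit G \<phi>) S \<and> orbit G \<phi> ` S \<subseteq> A}. emeasure M S)"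
        by (rule SUP_upper) (use inj_on_subset[OF inj_on_orbit_E, of "E \<inter> ?P"] in auto)
    qed
  qed
  also have "\<dots> = ?Q" using measure_of_of_measure[of ?Q] unfolding sp .
  finally show ?thesis .
qed

lemma nn_integral_quotient_measure:
  assumes f: "(\<lambda>p. f (orbit G \<phi> p)) \<in> borel_measurable M"
  shows "(\<integral>\<^sup>+x. f x \<partial>quotient_measure G \<phi> M) = (\<integral>\<^sup>+p. indicator E p * f (orbit G \<phi> p) \<partial>M)"
proof -
  note [measurable] = domain_measurable f
  interpret sigma_algebra "orbits G (space M) \<phi>" orbit_sets by (rule orbit_sets_sigma_algebra)
  let ?D = "density M (indicator E)" and ?S = "sigma (orbits G (space M) \<phi>) orbit_sets"
  note \<pi> = orbit_measurable
  have "f \<in> borel_measurable ?S"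
  proof (rule measurableI)
    fix B :: "ennreal set" assume B: "B \<in> sets borel"
    have "{p \<in> space M. orbit G \<phi> p \<in> f -` B \<inter> orbits G (space M) \<phi>} = (\<lambda>p. f (orbit G \<phi> p)) -` B \<inter> space M"
      using orbit_in_orbits by auto
    also have "\<dots> \<in> sets M" using f B by (rule measurable_sets)
    finally show "f -` B \<inter> space ?S \<in> sets ?S" by (simp add: sigma_sets_eq space_measure_of_conv)
  qed simp
  then have "(\<integral>\<^sup>+x. f x \<partial>quotient_measure G \<phi> M) = (\<integral>\<^sup>+p. f (orbit G \<phi> p) \<partial>?D)"
    unfolding quotient_measure_eq_distr by (subst nn_integral_distr[OF \<pi>]) simp_all
  also have "\<dots> = (\<integral>\<^sup>+p. indicator E p * f (orbit G \<phi> p) \<partial>M)"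
    by (rule nn_integral_density) measurable
  finally show ?thesis .
qed

end

section \<open>The quotient of the product of two balls\<close>

lemma carrier_restricted_group: "carrier (restricted_group \<Gamma>) = \<Gamma>"
  by simp

text \<open>Stated for a general action on a set \<open>X\<close>, since it is needed on the ball and on the product of two
  balls.\<close>

lemma (in discrete_ball_group) orbit_action_eq:
  assumes act: "\<And>h k p. h \<in> \<Gamma> \<Longrightarrow> k \<in> \<Gamma> \<Longrightarrow> p \<in> X \<Longrightarrow> \<phi> (compose \<bbbB> h k) p = \<phi> h (\<phi> k p)"
    and mem: "\<And>h p. h \<in> \<Gamma> \<Longrightarrow> p \<in> X \<Longrightarrow> \<phi> h p \<in> X"
    and inverse: "\<And>h p. h \<in> \<Gamma> \<Longrightarrow> p \<in> X \<Longrightarrow> \<phi> (inverse_auto h) (\<phi> h p) = p"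
    and g: "g \<in> \<Gamma>" and p: "p \<in> X"
  shows "orbit (restricted_group \<Gamma>) \<phi> (\<phi> g p) = orbit (restricted_group \<Gamma>) \<phi> p"
proof -
  have sub: "orbit (restricted_group \<Gamma>) \<phi> (\<phi> k q) \<subseteq> orbit (restricted_group \<Gamma>) \<phi> q" if "k \<in> \<Gamma>" "q \<in> X" for k q
  proof
    fix x assume "x \<in> orbit (restricted_group \<Gamma>) \<phi> (\<phi> k q)"
    then obtain h where h: "h \<in> \<Gamma>" "x = \<phi> h (\<phi> k q)" unfolding orbit_def by auto
    then have "x = \<phi> (compose \<bbbB> h k) q" by (simp only: act[OF h(1) that])
    moreover have "compose \<bbbB> h k \<in> carrier (restricted_group \<Gamma>)" using \<Gamma>_compose[OF h(1) that(1)] by simp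
    ultimately show "x \<in> orbit (restricted_group \<Gamma>) \<phi> q" unfolding orbit_def by blast
  qed
  from sub[OF \<Gamma>_inv[OF g] mem[OF g p]] have "orbit (restricted_group \<Gamma>) \<phi> p \<subseteq> orbit (restricted_group \<Gamma>) \<phi> (\<phi> g p)"
    by (simp only: inverse[OF g p])
  with sub[OF g p] show ?thesis by (rule equalityI)
qed

locale ball_lattice = discrete_ball_group \<Gamma> + Q: ball_quotient \<Gamma> "\<lambda>\<gamma>. inv\<^bsub>Aut_ball\<^esub> \<gamma>" D
  for \<Gamma> :: "(complex^'n \<Rightarrow> complex^'n) set" and D :: "(complex^'n) set" +
  assumes finite_covolume: "emeasure (Sigma_volume \<Gamma>) (space (Sigma_volume \<Gamma>)) < \<infinity>"
begin

lemma D_hyp: "D \<in> sets hyp_volume"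
  unfolding in_sets_hyp_volume using Q.borel_D Q.D_ball by (rule conjI)

lemma one_fixes: "z \<in> \<bbbB> \<Longrightarrow> (\<lambda>z\<in>\<bbbB>. z) z = z"
  by (rule restrict_apply')

sublocale S: measured_action "restricted_group \<Gamma>" "\<lambda>\<gamma>. \<gamma>" "hyp_volume :: (complex^'n) measure" "\<lambda>\<gamma>. inv\<^bsub>Aut_ball\<^esub> \<gamma>" "\<lambda>z\<in>\<bbbB>. z" D
proof (unfold_locales, unfold space_hyp_volume carrier_restricted_group)
  fix g :: "complex^'n \<Rightarrow> complex^'n" and p :: "complex^'n"
  show "countable \<Gamma>" by (rule Q.countable_\<Gamma>)
  show "(\<lambda>z\<in>\<bbbB>. z) \<in> \<Gamma>" by (rule \<Gamma>_one)
  show "p \<in> \<bbbB> \<Longrightarrow> (\<lambda>z\<in>\<bbbB>. z) p = p" by (rule one_fixes)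
  show "g \<in> \<Gamma> \<Longrightarrow> g \<in> measurable hyp_volume hyp_volume" by (rule ball_auto_measurable[OF \<Gamma>_auto])
  show "g \<in> \<Gamma> \<Longrightarrow> distr hyp_volume hyp_volume g = hyp_volume" by (rule hyp_volume_invariant[OF \<Gamma>_auto])
  show "g \<in> \<Gamma> \<Longrightarrow> inverse_auto g \<in> \<Gamma>" by (rule \<Gamma>_inv)
  show "g \<in> \<Gamma> \<Longrightarrow> p \<in> \<bbbB> \<Longrightarrow> inverse_auto g (g p) = p" by (rule \<Gamma>_inv_left)
  show "g \<in> \<Gamma> \<Longrightarrow> p \<in> \<bbbB> \<Longrightarrow> g (inverse_auto g p) = p" by (rule \<Gamma>_inv_right)
  show "g \<in> \<Gamma> \<Longrightarrow> p \<in> \<bbbB> \<Longrightarrow> orbit (restricted_group \<Gamma>) (\<lambda>\<gamma>. \<gamma>) (g p) = orbit (restricted_group \<Gamma>) (\<lambda>\<gamma>. \<gamma>) p"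
    by (rule orbit_action_eq[where X="\<bbbB>"]) (auto simp: compose_def \<Gamma>_inv_left ball_auto_norm_less[OF \<Gamma>_auto])
  show "D \<in> sets hyp_volume" by (rule D_hyp)
  show "p \<in> \<bbbB> \<Longrightarrow> \<exists>!g. g \<in> \<Gamma> \<and> p \<in> g ` D" by (rule Q.fundamental)
qed

lemma diagonal_action_apply: "diagonal_action \<gamma> (z, w) = (\<gamma> z, \<gamma> w)"
  by (simp add: diagonal_action_def)

sublocale O: measured_action "restricted_group \<Gamma>" diagonal_action
  "(hyp_volume :: (complex^'n) measure) \<Otimes>\<^sub>M hyp_volume" "\<lambda>\<gamma>. inv\<^bsub>Aut_ball\<^esub> \<gamma>" "\<lambda>z\<in>\<bbbB>. z" "D \<times> \<bbbB>"
proof (unfold_locales, unfold space_pair_measure space_hyp_volume carrier_restricted_group)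
  fix g :: "complex^'n \<Rightarrow> complex^'n" and p :: "(complex^'n) \<times> (complex^'n)"
  show "countable \<Gamma>" by (rule Q.countable_\<Gamma>)
  show "(\<lambda>z\<in>\<bbbB>. z) \<in> \<Gamma>" by (rule \<Gamma>_one)
  show "p \<in> \<bbbB> \<times> \<bbbB> \<Longrightarrow> diagonal_action (\<lambda>z\<in>\<bbbB>. z) p = p"
    by (cases p) (simp add: diagonal_action_apply del: mem_ball)
  have m: "g \<in> measurable hyp_volume hyp_volume" if "g \<in> \<Gamma>" by (rule ball_auto_measurable[OF \<Gamma>_auto[OF that]])
  show "diagonal_action g \<in> measurable (hyp_volume \<Otimes>\<^sub>M hyp_volume) (hyp_volume \<Otimes>\<^sub>M hyp_volume)" if "g \<in> \<Gamma>"
    using m[OF that] unfolding diagonal_action_def by measurable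
  show "distr (hyp_volume \<Otimes>\<^sub>M hyp_volume) (hyp_volume \<Otimes>\<^sub>M hyp_volume) (diagonal_action g) = hyp_volume \<Otimes>\<^sub>M hyp_volume" if g: "g \<in> \<Gamma>"
  proof -
    have i: "distr hyp_volume hyp_volume g = hyp_volume" by (rule hyp_volume_invariant[OF \<Gamma>_auto[OF g]])
    have "sigma_finite_measure (distr hyp_volume hyp_volume g)" unfolding i by (rule sigma_finite_hyp_volume)
    from pair_measure_distr[OF m[OF g] m[OF g] this] show ?thesis unfolding i diagonal_action_def by simp
  qed
  show "g \<in> \<Gamma> \<Longrightarrow> inverse_auto g \<in> \<Gamma>" by (rule \<Gamma>_inv)
  show "g \<in> \<Gamma> \<Longrightarrow> p \<in> \<bbbB> \<times> \<bbbB> \<Longrightarrow> diagonal_action (inverse_auto g) (diagonal_action g p) = p"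
    by (cases p) (simp add: diagonal_action_apply \<Gamma>_inv_left del: mem_ball)
  show "g \<in> \<Gamma> \<Longrightarrow> p \<in> \<bbbB> \<times> \<bbbB> \<Longrightarrow> diagonal_action g (diagonal_action (inverse_auto g) p) = p"
    by (cases p) (simp add: diagonal_action_apply \<Gamma>_inv_right del: mem_ball)
  show "g \<in> \<Gamma> \<Longrightarrow> p \<in> \<bbbB> \<times> \<bbbB> \<Longrightarrow> orbit (restricted_group \<Gamma>) diagonal_action (diagonal_action g p) = orbit (restricted_group \<Gamma>) diagonal_action p"
    by (rule orbit_action_eq[where X="\<bbbB> \<times> \<bbbB>"])
      (auto simp: compose_def diagonal_action_apply \<Gamma>_inv_left ball_auto_norm_less[OF \<Gamma>_auto])
  show "D \<times> \<bbbB> \<in> sets ((hyp_volume :: (complex^'n) measure) \<Otimes>\<^sub>M (hyp_volume :: (complex^'n) measure))"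
    using sets.top[of "hyp_volume :: (complex^'n) measure"] by (intro pair_measureI D_hyp) (simp only: space_hyp_volume)
  show "\<exists>!g. g \<in> \<Gamma> \<and> p \<in> diagonal_action g ` (D \<times> \<bbbB>)" if pB: "p \<in> \<bbbB> \<times> \<bbbB>"
  proof -
    obtain z w where p: "p = (z, w)" "z \<in> \<bbbB>" "w \<in> \<bbbB>" using pB by blast
    have "p \<in> diagonal_action g ` (D \<times> \<bbbB>) \<longleftrightarrow> z \<in> g ` D" if g: "g \<in> \<Gamma>" for g
    proof
      assume "z \<in> g ` D"
      then obtain x where x: "x \<in> D" "z = g x" by blast
      show "p \<in> diagonal_action g ` (D \<times> \<bbbB>)"
      proof (rule image_eqI[of _ _ "(x, inverse_auto g w)"])
        show "p = diagonal_action g (x, inverse_auto g w)"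
          using \<Gamma>_inv_right[OF g p(3)] x(2) p(1) by (simp add: diagonal_action_apply)
        show "(x, inverse_auto g w) \<in> D \<times> \<bbbB>" using x(1) ball_auto_in[OF \<Gamma>_auto[OF \<Gamma>_inv[OF g]] p(3)] by blast
      qed
    qed (auto simp: p(1) diagonal_action_apply)
    then have "(g \<in> \<Gamma> \<and> p \<in> diagonal_action g ` (D \<times> \<bbbB>)) \<longleftrightarrow> (g \<in> \<Gamma> \<and> z \<in> g ` D)" for g by blast
    then show ?thesis using Q.fundamental[OF p(2)] by simp
  qed
qed

lemma volume_D: "emeasure hyp_borel D = emeasure (Sigma_volume \<Gamma>) (space (Sigma_volume \<Gamma>))"
proof -
  have "emeasure (Sigma_volume \<Gamma>) (space (Sigma_volume \<Gamma>)) = (\<integral>\<^sup>+x. 1 \<partial>Sigma_volume \<Gamma>)" by simp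
  also have "\<dots> = (\<integral>\<^sup>+z. indicator D z * 1 \<partial>hyp_volume)"
    unfolding Sigma_volume_def ball_volume_form_eq by (rule S.nn_integral_quotient_measure) simp
  also have "\<dots> = (\<integral>\<^sup>+z. indicator D z * 1 \<partial>hyp_borel)"
    by (rule nn_integral_hyp_borel_borel[symmetric]) (use Q.borel_D in measurable)
  also have "\<dots> = emeasure hyp_borel D" using Q.borel_D by simp
  finally show ?thesis by simp
qed

lemma volume_D_finite: "emeasure hyp_borel D < \<infinity>"
  unfolding volume_D by (rule finite_covolume)

text \<open>Otherwise all translates of \<open>D\<close>, and with them the ball, would have volume zero, but the kernels have
  positive mass.\<close>

lemma volume_D_pos: "emeasure hyp_borel D \<noteq> 0"
proof
  assume z: "emeasure hyp_borel D = 0"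
  have [measurable]: "D \<in> sets borel" by (rule Q.borel_D)
  let ?h = "\<lambda>t :: complex^'n. kern CARD('n) 0 (1 - (norm t)\<^sup>2)"
  have ae: "AE z in hyp_borel. z \<notin> D" by (rule AE_I[OF _ z]) auto
  have "kern_mass TYPE('n) = (\<integral>\<^sup>+t. ?h t \<partial>hyp_borel)" by (rule kern_total_mass[symmetric]) simp
  also have "\<dots> = (\<integral>\<^sup>+\<gamma>. \<integral>\<^sup>+z. indicator D z * ?h (\<gamma> z) \<partial>hyp_borel \<partial>count_space \<Gamma>)"
    by (rule Q.unfold_integral) measurable
  also have "\<dots> = (\<integral>\<^sup>+\<gamma>. 0 \<partial>count_space \<Gamma>)"
  proof (rule nn_integral_cong)
    fix \<gamma>
    have "(\<integral>\<^sup>+z. indicator D z * ?h (\<gamma> z) \<partial>hyp_borel) = (\<integral>\<^sup>+z. 0 \<partial>(hyp_borel :: (complex^'n) measure))"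
      by (rule nn_integral_cong_AE) (use ae in \<open>eventually_elim, simp\<close>)
    then show "(\<integral>\<^sup>+z. indicator D z * ?h (\<gamma> z) \<partial>hyp_borel) = 0" by simp
  qed
  finally show False using kern_mass_nz(1)[where 'n='n] by simp
qed

lemma Omega_eq: "Omega \<Gamma> = Omega_proj \<Gamma> ` (\<bbbB> \<times> \<bbbB>)"
  unfolding Omega_def Omega_proj_def orbits_def by blast

lemma Omega_proj_in: "p \<in> \<bbbB> \<times> \<bbbB> \<Longrightarrow> Omega_proj \<Gamma> p \<in> Omega \<Gamma>"
  unfolding Omega_eq by (rule imageI)

lemma Omega_proj_invariant: "\<gamma> \<in> \<Gamma> \<Longrightarrow> z \<in> \<bbbB> \<Longrightarrow> w \<in> \<bbbB> \<Longrightarrow> Omega_proj \<Gamma> (\<gamma> z, \<gamma> w) = Omega_proj \<Gamma> (z, w)"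
  using O.orbit_action[of \<gamma> "(z, w)"] by (simp add: Omega_proj_def diagonal_action_apply space_pair_measure del: mem_ball)

lemma delta_Omega_proj:
  assumes z: "z \<in> \<bbbB>" and w: "w \<in> \<bbbB>"
  shows "delta (Omega_proj \<Gamma> (z, w)) = dl z w"
proof -
  have "(\<lambda>(z, w). 1 - (norm (T z w))\<^sup>2) ` Omega_proj \<Gamma> (z, w) = {dl z w}"
  proof (rule Set.set_eqI)
    fix x
    have "x \<in> (\<lambda>(z, w). 1 - (norm (T z w))\<^sup>2) ` Omega_proj \<Gamma> (z, w) \<longleftrightarrow> (\<exists>\<gamma>\<in>\<Gamma>. x = 1 - (norm (T (\<gamma> z) (\<gamma> w)))\<^sup>2)"
      unfolding Omega_proj_def orbit_def by (force simp: diagonal_action_apply)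
    also have "\<dots> \<longleftrightarrow> (\<exists>\<gamma>\<in>\<Gamma>. x = dl z w)"
    proof (rule bex_cong[OF refl])
      fix \<gamma> assume g: "\<gamma> \<in> \<Gamma>"
      show "(x = 1 - (norm (T (\<gamma> z) (\<gamma> w)))\<^sup>2) = (x = dl z w)"
        unfolding ball_auto_norm_T[OF \<Gamma>_auto[OF g] z w] dl_T[OF z w] ..
    qed
    also have "\<dots> \<longleftrightarrow> x \<in> {dl z w}" using \<Gamma>_one by blast
    finally show "x \<in> (\<lambda>(z, w). 1 - (norm (T z w))\<^sup>2) ` Omega_proj \<Gamma> (z, w) \<longleftrightarrow> x \<in> {dl z w}" .
  qed
  then show ?thesis by (simp add: delta_def)
qed

abbreviation lift :: "(((complex^'n) \<times> (complex^'n)) set \<Rightarrow> complex) \<Rightarrow> (complex^'n) \<times> (complex^'n) \<Rightarrow> complex"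
  where "lift f p \<equiv> f (Omega_proj \<Gamma> p)"

text \<open>Integration over the quotient is integration over \<open>D \<times> \<bbbB>\<close>, where \<open>\<delta>\<close> pulls back to \<open>dl\<close>.\<close>

lemma bergman_norm_sq_eq:
  assumes f: "continuous_on (\<bbbB> \<times> \<bbbB>) (lift f)" and a: "\<alpha> > -1"
  shows "bergman_norm_sq \<Gamma> \<alpha> f = Q.weighted_norm \<alpha> (Q.zero_extend (lift f))"
proof -
  note [measurable] = Q.borel_D Q.zero_extend_measurable[OF f]
  interpret sigma_finite_measure "hyp_volume :: (complex^'n) measure" by (rule sigma_finite_hyp_volume)
  let ?F = "Q.zero_extend (lift f)"
  define u where "u p = indicator D (fst p) * (ennreal (dl (fst p) (snd p) powr (\<alpha> + real CARD('n) + 1)) * sqn (?F p))" for p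
  have um[measurable]: "u \<in> borel_measurable (borel \<Otimes>\<^sub>M borel)" unfolding u_def by measurable
  have incl: "(\<lambda>p. (fst p, snd p)) \<in> measurable (hyp_volume \<Otimes>\<^sub>M hyp_volume) ((borel :: (complex^'n) measure) \<Otimes>\<^sub>M (borel :: (complex^'n) measure))"
    by (intro measurable_Pair measurable_compose[OF measurable_fst hyp_incl_measurable] measurable_compose[OF measurable_snd hyp_incl_measurable])
  have pair: "h \<in> borel_measurable (hyp_volume \<Otimes>\<^sub>M hyp_volume)" if "h \<in> borel_measurable ((borel :: (complex^'n) measure) \<Otimes>\<^sub>M (borel :: (complex^'n) measure))"
    for h :: "(complex^'n) \<times> (complex^'n) \<Rightarrow> ennreal"
    using measurable_compose[OF incl that] by simp
  let ?g = "\<lambda>x. ennreal ((norm (f x))\<^sup>2 * delta x powr (\<alpha> + real CARD('n) + 1))"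
  have g: "?g (Omega_proj \<Gamma> p) = ennreal (dl (fst p) (snd p) powr (\<alpha> + real CARD('n) + 1)) * sqn (?F p)"
    if "p \<in> \<bbbB> \<times> \<bbbB>" for p
    using that delta_Omega_proj[of "fst p" "snd p"]
    by (cases p) (simp add: Q.zero_extend_def sqn_def ennreal_mult' mult.commute del: mem_ball)
  have "(\<lambda>p. ennreal (dl (fst p) (snd p) powr (\<alpha> + real CARD('n) + 1)) * sqn (?F p)) \<in> borel_measurable (hyp_volume \<Otimes>\<^sub>M hyp_volume)"
    by (rule pair) measurable
  then have "(\<lambda>p. ?g (Omega_proj \<Gamma> p)) \<in> borel_measurable (hyp_volume \<Otimes>\<^sub>M hyp_volume)"
    by (rule measurable_cong[THEN iffD2, rotated]) (simp only: g space_pair_measure space_hyp_volume)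
  from O.nn_integral_quotient_measure[folded Omega_proj_def, OF this]
  have "(\<integral>\<^sup>+x. ?g x \<partial>Omega_volume \<Gamma>) = (\<integral>\<^sup>+p. indicator (D \<times> \<bbbB>) p * ?g (Omega_proj \<Gamma> p) \<partial>(hyp_volume \<Otimes>\<^sub>M hyp_volume))"
    unfolding Omega_volume_def biball_volume_form_eq .
  also have "\<dots> = (\<integral>\<^sup>+p. u p \<partial>(hyp_volume \<Otimes>\<^sub>M hyp_volume))"
  proof (rule nn_integral_cong)
    fix p :: "(complex^'n) \<times> (complex^'n)" assume "p \<in> space (hyp_volume \<Otimes>\<^sub>M hyp_volume)"
    then have p: "p \<in> \<bbbB> \<times> \<bbbB>" by (simp only: space_pair_measure space_hyp_volume)
    have "indicator (D \<times> \<bbbB>) p = (indicator D (fst p) :: ennreal)" using p by (cases p) (simp add: indicator_def)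
    then show "indicator (D \<times> \<bbbB>) p * ?g (Omega_proj \<Gamma> p) = u p" unfolding g[OF p] u_def by simp
  qed
  also have "\<dots> = (\<integral>\<^sup>+z. \<integral>\<^sup>+w. u (z, w) \<partial>hyp_volume \<partial>hyp_volume)" by (rule nn_integral_fst[symmetric]) (rule pair[OF um])
  also have "\<dots> = (\<integral>\<^sup>+z. \<integral>\<^sup>+w. u (z, w) \<partial>hyp_borel \<partial>hyp_volume)"
    by (intro nn_integral_cong nn_integral_hyp_borel_borel[symmetric]) measurable
  also have "\<dots> = (\<integral>\<^sup>+z. \<integral>\<^sup>+w. u (z, w) \<partial>hyp_borel \<partial>hyp_borel)"
    by (intro nn_integral_hyp_borel_borel[symmetric] hyp_borel_integral_measurable) simp
  finally have I: "(\<integral>\<^sup>+x. ?g x \<partial>Omega_volume \<Gamma>) = (\<integral>\<^sup>+z. \<integral>\<^sup>+w. u (z, w) \<partial>hyp_borel \<partial>hyp_borel)" .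
  let ?c = "ennreal (kern_const CARD('n) \<alpha>)"
  have "bergman_norm_sq \<Gamma> \<alpha> f = ?c * (\<integral>\<^sup>+z. \<integral>\<^sup>+w. u (z, w) \<partial>hyp_borel \<partial>hyp_borel)"
    by (simp only: bergman_norm_sq_def I kern_const_def)
  also have "\<dots> = (\<integral>\<^sup>+z. ?c * (\<integral>\<^sup>+w. u (z, w) \<partial>hyp_borel) \<partial>hyp_borel)"
    by (rule nn_integral_cmult[symmetric]) (simp add: hyp_borel_integral_measurable)
  also have "\<dots> = Q.weighted_norm \<alpha> ?F"
    unfolding Q.weighted_norm_def
  proof (rule nn_integral_cong)
    fix z :: "complex^'n"
    have "(\<integral>\<^sup>+w. kern CARD('n) \<alpha> (dl z w) * sqn (?F (z, w)) \<partial>hyp_borel)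
      = (\<integral>\<^sup>+w. ?c * (ennreal (dl z w powr (\<alpha> + real CARD('n) + 1)) * sqn (?F (z, w))) \<partial>hyp_borel)"
      by (simp only: kern_def mult.assoc)
    also have "\<dots> = ?c * (\<integral>\<^sup>+w. ennreal (dl z w powr (\<alpha> + real CARD('n) + 1)) * sqn (?F (z, w)) \<partial>hyp_borel)"
      by (rule nn_integral_cmult) measurable
    moreover have "(\<integral>\<^sup>+w. u (z, w) \<partial>hyp_borel) = indicator D z * (\<integral>\<^sup>+w. ennreal (dl z w powr (\<alpha> + real CARD('n) + 1)) * sqn (?F (z, w)) \<partial>hyp_borel)"
      unfolding u_def fst_conv snd_conv by (rule nn_integral_cmult) measurable
    ultimately show "?c * (\<integral>\<^sup>+w. u (z, w) \<partial>hyp_borel) = indicator D z * (\<integral>\<^sup>+w. kern CARD('n) \<alpha> (dl z w) * sqn (?F (z, w)) \<partial>hyp_borel)"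
      by (simp only: mult_ac)
  qed
  finally show ?thesis .
qed

end

lemma holo_fun_on_imp_continuous_on: "holo_fun_on F S \<Longrightarrow> continuous_on S F"
  unfolding holo_fun_on_def by (meson continuous_at_imp_continuous_on has_derivative_continuous)

lemma holo_fun_on_slice_snd:
  assumes F: "holo_fun_on F (A \<times> B)" and z: "z \<in> A"
  shows "cholo_on (\<lambda>w. F (z, w)) B"
  unfolding cholo_on_def
proof
  fix w assume "w \<in> B"
  then obtain D where D: "(F has_derivative D) (at (z, w))" "\<And>c u v. D (c *s u, c *s v) = c * D (u, v)"
    using F z unfolding holo_fun_on_def by blast
  have "((\<lambda>w. (z, w)) has_derivative (\<lambda>v. (0, v))) (at w)"
    by (intro has_derivative_Pair has_derivative_const has_derivative_ident)
  from has_derivative_compose[OF this D(1)]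
  have "((\<lambda>w. F (z, w)) has_derivative (\<lambda>v. D (0, v))) (at w)" .
  moreover have "D (0, c *s v) = c * D (0, v)" for c v using D(2)[of c 0 v] by simp
  ultimately show "\<exists>D. ((\<lambda>w. F (z, w)) has_derivative D) (at w) \<and> (\<forall>c v. D (c *s v) = c * D v)" by blast
qed

lemma holo_fun_on_slice_fst:
  assumes F: "holo_fun_on F (A \<times> B)" and w: "w \<in> B"
  shows "cholo_on (\<lambda>z. F (z, w)) A"
  unfolding cholo_on_def
proof
  fix z assume "z \<in> A"
  then obtain D where D: "(F has_derivative D) (at (z, w))" "\<And>c u v. D (c *s u, c *s v) = c * D (u, v)"
    using F w unfolding holo_fun_on_def by blast
  have "((\<lambda>z. (z, w)) has_derivative (\<lambda>v. (v, 0))) (at z)"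
    by (intro has_derivative_Pair has_derivative_const has_derivative_ident)
  from has_derivative_compose[OF this D(1)]
  have "((\<lambda>z. F (z, w)) has_derivative (\<lambda>v. D (v, 0))) (at z)" .
  moreover have "D (c *s v, 0) = c * D (v, 0)" for c v using D(2)[of c v 0] by simp
  ultimately show "\<exists>D. ((\<lambda>z. F (z, w)) has_derivative D) (at z) \<and> (\<forall>c v. D (c *s v) = c * D v)" by blast
qed

context ball_lattice
begin

lemma finite_growth_constant:
  assumes f: "holo_on_Omega \<Gamma> f"
    and fin: "(SUP r\<in>{0..<1}. mean_growth D (Q.zero_extend (lift f)) r) < \<infinity>"
  obtains c where "\<And>x. x \<in> Omega \<Gamma> \<Longrightarrow> f x = c"
proof -
  have F: "holo_fun_on (lift f) (\<bbbB> \<times> \<bbbB>)" using f by (simp only: holo_on_Omega_def)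
  obtain c where "\<And>z w. z \<in> \<bbbB> \<Longrightarrow> w \<in> \<bbbB> \<Longrightarrow> lift f (z, w) = c"
  proof (rule Q.finite_growth_imp_const[of "lift f"])
    show "continuous_on (\<bbbB> \<times> \<bbbB>) (lift f)" by (rule holo_fun_on_imp_continuous_on[OF F])
    show "cholo_on (\<lambda>w. lift f (z, w)) \<bbbB>" if "z \<in> \<bbbB>" for z by (rule holo_fun_on_slice_snd[OF F that])
    show "cholo_on (\<lambda>z. lift f (z, w)) \<bbbB>" if "w \<in> \<bbbB>" for w by (rule holo_fun_on_slice_fst[OF F that])
    show "lift f (\<gamma> z, \<gamma> w) = lift f (z, w)" if "\<gamma> \<in> \<Gamma>" "z \<in> \<bbbB>" "w \<in> \<bbbB>" for \<gamma> z w
      by (simp only: Omega_proj_invariant[OF that])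
  qed (use fin volume_D_pos in blast)+
  then show thesis using that unfolding Omega_eq by blast
qed

lemma bounded_holomorphic_constant:
  assumes f: "holo_on_Omega \<Gamma> f" and b: "bounded (f ` Omega \<Gamma>)"
  shows "f constant_on Omega \<Gamma>"
proof -
  obtain M where M: "\<And>x. x \<in> Omega \<Gamma> \<Longrightarrow> cmod (f x) \<le> M" using b unfolding bounded_iff by blast
  have "(SUP r\<in>{0..<1}. mean_growth D (Q.zero_extend (lift f)) r) < \<infinity>"
    by (rule Q.bounded_growth[OF _ volume_D_finite]) (rule M[OF Omega_proj_in])
  then obtain c where "\<And>x. x \<in> Omega \<Gamma> \<Longrightarrow> f x = c" using finite_growth_constant[OF f] by blast
  then show ?thesis unfolding constant_on_def by blast
qed

text \<open>The limit always exists, possibly infinite, and is a positive multiple of the supremum of the growth;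
  so membership in the Hardy space is a condition on the growth alone.\<close>

lemma bergman_norm_sq_tendsto:
  assumes f: "holo_on_Omega \<Gamma> f"
  shows "((\<lambda>\<alpha>. bergman_norm_sq \<Gamma> \<alpha> f) \<longlongrightarrow>
    kern_mass TYPE('n) * (SUP r\<in>{0..<1}. mean_growth D (Q.zero_extend (lift f)) r)) (at_right (-1))"
proof -
  have F: "holo_fun_on (lift f) (\<bbbB> \<times> \<bbbB>)" using f by (simp only: holo_on_Omega_def)
  have c: "continuous_on (\<bbbB> \<times> \<bbbB>) (lift f)" by (rule holo_fun_on_imp_continuous_on[OF F])
  have lim: "((\<lambda>\<alpha>. Q.weighted_norm \<alpha> (Q.zero_extend (lift f))) \<longlongrightarrow>
    kern_mass TYPE('n) * (SUP r\<in>{0..<1}. mean_growth D (Q.zero_extend (lift f)) r)) (at_right (-1))"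
  proof (rule Q.weighted_norm_tendsto[OF Q.zero_extend_measurable[OF c]])
    fix z assume "z \<in> D"
    then have z: "z \<in> \<bbbB>" using Q.D_ball by blast
    show "cholo_on (\<lambda>w. Q.zero_extend (lift f) (z, w)) \<bbbB>"
      by (rule cholo_on_cong[OF open_ball _ holo_fun_on_slice_snd[OF F z]]) (use z in \<open>simp add: Q.zero_extend_def\<close>)
  qed
  have ev: "\<forall>\<^sub>F \<alpha> in at_right (-1). Q.weighted_norm \<alpha> (Q.zero_extend (lift f)) = bergman_norm_sq \<Gamma> \<alpha> f"
    using eventually_at_right_less[of "-1::real"] by eventually_elim (rule bergman_norm_sq_eq[OF c, symmetric])
  show ?thesis by (rule Lim_transform_eventually[OF lim ev])
qed

lemma constant_holomorphic: "holo_on_Omega \<Gamma> (\<lambda>x\<in>Omega \<Gamma>. c)"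
  unfolding holo_on_Omega_def holo_fun_on_def
proof
  fix p :: "(complex^'n) \<times> (complex^'n)" assume p: "p \<in> \<bbbB> \<times> \<bbbB>"
  have "((\<lambda>p. (\<lambda>x\<in>Omega \<Gamma>. c) (Omega_proj \<Gamma> p)) has_derivative (\<lambda>_. 0)) (at p)"
  proof (rule has_derivative_transform_within_open[OF has_derivative_const[of c] open_Times[OF open_ball open_ball] p])
    fix q :: "(complex^'n) \<times> (complex^'n)" assume "q \<in> \<bbbB> \<times> \<bbbB>"
    then show "c = (\<lambda>x\<in>Omega \<Gamma>. c) (Omega_proj \<Gamma> q)" by (simp only: restrict_apply' Omega_proj_in)
  qed
  then show "\<exists>A. ((\<lambda>p. (\<lambda>x\<in>Omega \<Gamma>. c) (Omega_proj \<Gamma> p)) has_derivative A) (at p) \<and> (\<forall>a u v. A (a *s u, a *s v) = a * A (u, v))"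
    by (intro exI[of _ "\<lambda>_. 0"]) simp
qed

lemma constant_norm_tendsto:
  "((\<lambda>\<alpha>. bergman_norm_sq \<Gamma> \<alpha> (\<lambda>x\<in>Omega \<Gamma>. c)) \<longlongrightarrow> kern_mass TYPE('n) * emeasure hyp_borel D * sqn c) (at_right (-1))"
proof -
  let ?f = "\<lambda>x\<in>Omega \<Gamma>. c"
  have cont: "continuous_on (\<bbbB> \<times> \<bbbB>) (lift ?f)"
    using constant_holomorphic[of c] unfolding holo_on_Omega_def by (rule holo_fun_on_imp_continuous_on)
  have ze: "Q.zero_extend (lift ?f) = Q.zero_extend (\<lambda>_. c)"
    by (rule ext) (auto simp: Q.zero_extend_def Omega_proj_in simp del: mem_ball mem_Sigma_iff)
  have eq: "bergman_norm_sq \<Gamma> \<alpha> ?f = kern_mass TYPE('n) * emeasure hyp_borel D * sqn c" if "\<alpha> > -1" for \<alpha>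
    by (subst bergman_norm_sq_eq[OF cont that], subst ze, rule Q.weighted_norm_const[OF that])
  have "\<forall>\<^sub>F \<alpha> in at_right (-1). bergman_norm_sq \<Gamma> \<alpha> ?f = kern_mass TYPE('n) * emeasure hyp_borel D * sqn c"
    using eventually_at_right_less[of "-1::real"] by eventually_elim (rule eq)
  then show ?thesis by (rule tendsto_eventually)
qed

lemma total_mass_finite: "kern_mass TYPE('n) * emeasure hyp_borel D < top_class.top" "kern_mass TYPE('n) * emeasure hyp_borel D \<noteq> 0"
  using kern_mass_nz[where 'n='n] volume_D_finite volume_D_pos by (simp_all add: ennreal_mult_less_top less_top)

lemma constant_in_hardy_space: "(\<lambda>x\<in>Omega \<Gamma>. c) \<in> hardy_space \<Gamma>"
  unfolding hardy_space_def
proof (intro CollectI conjI restrict_extensional constant_holomorphic exI)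
  show "kern_mass TYPE('n) * emeasure hyp_borel D * sqn c < \<infinity>"
    using total_mass_finite(1) by (simp add: ennreal_mult_less_top sqn_def)
qed (rule constant_norm_tendsto)

lemma hardy_space_constant:
  assumes f: "f \<in> hardy_space \<Gamma>"
  obtains c where "f = (\<lambda>x\<in>Omega \<Gamma>. c)"
proof -
  have h: "holo_on_Omega \<Gamma> f" and e: "f \<in> extensional (Omega \<Gamma>)" using f by (simp_all add: hardy_space_def)
  obtain L where L: "L < \<infinity>" "((\<lambda>\<alpha>. bergman_norm_sq \<Gamma> \<alpha> f) \<longlongrightarrow> L) (at_right (-1))"
    using f unfolding hardy_space_def by blast
  let ?S = "SUP r\<in>{0..<1}. mean_growth D (Q.zero_extend (lift f)) r"
  have "kern_mass TYPE('n) * ?S = L"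
    by (rule tendsto_unique[OF trivial_limit_at_right_real bergman_norm_sq_tendsto[OF h] L(2)])
  then have "kern_mass TYPE('n) * ?S \<noteq> top_class.top" using L(1) by auto
  then have "?S \<noteq> top_class.top" using kern_mass_nz(1)[where 'n='n] unfolding ennreal_mult_eq_top_iff by blast
  then have "?S < \<infinity>" unfolding infinity_ennreal_def less_top .
  then obtain c where c: "\<And>x. x \<in> Omega \<Gamma> \<Longrightarrow> f x = c" using finite_growth_constant[OF h] by blast
  have "f = (\<lambda>x\<in>Omega \<Gamma>. c)"
    by (rule extensionalityI[OF e restrict_extensional]) (simp only: c restrict_apply')
  then show thesis by (rule that)
qed

text \<open>The Hardy norm of the constant function \<open>1\<close>.\<close>

definition norm_scale :: real
  where "norm_scale = sqrt (enn2real (kern_mass TYPE('n) * emeasure hyp_borel D))"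

lemma norm_scale_pos: "norm_scale > 0"
  unfolding norm_scale_def using total_mass_finite by (simp add: enn2real_positive_iff zero_less_iff_neq_zero)

lemma hardy_norm_constant: "hardy_norm \<Gamma> (\<lambda>x\<in>Omega \<Gamma>. c) = norm_scale * cmod c"
proof -
  have "Lim (at_right (-1)) (\<lambda>\<alpha>. bergman_norm_sq \<Gamma> \<alpha> (\<lambda>x\<in>Omega \<Gamma>. c)) = kern_mass TYPE('n) * emeasure hyp_borel D * sqn c"
    by (rule tendsto_Lim[OF trivial_limit_at_right_real constant_norm_tendsto])
  then show ?thesis
    by (simp add: hardy_norm_def norm_scale_def enn2real_mult sqn_def real_sqrt_mult)
qed

lemma hardy_space_isometric_to_scalars:
  "\<exists>\<Phi>. bij_betw \<Phi> (UNIV :: complex set) (hardy_space \<Gamma>) \<and>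
    (\<forall>a b. \<forall>x\<in>Omega \<Gamma>. \<Phi> (a + b) x = \<Phi> a x + \<Phi> b x) \<and>
    (\<forall>c a. \<forall>x\<in>Omega \<Gamma>. \<Phi> (c * a) x = c * \<Phi> a x) \<and>
    (\<forall>a. hardy_norm \<Gamma> (\<Phi> a) = norm a)"
proof -
  define \<Phi> where "\<Phi> a = (\<lambda>x\<in>Omega \<Gamma>. a / complex_of_real norm_scale)" for a
  have s: "complex_of_real norm_scale \<noteq> 0" using norm_scale_pos by simp
  obtain x0 where x0: "x0 \<in> Omega \<Gamma>" using Omega_proj_in[of "(0, 0)"] by auto
  have "bij_betw \<Phi> UNIV (hardy_space \<Gamma>)"
    unfolding bij_betw_def
  proof
    show "inj \<Phi>"
    proof (rule injI)
      fix a b assume "\<Phi> a = \<Phi> b"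
      then have "\<Phi> a x0 = \<Phi> b x0" by simp
      then show "a = b" using s x0 by (simp add: \<Phi>_def)
    qed
    show "\<Phi> ` UNIV = hardy_space \<Gamma>"
    proof (intro equalityI subsetI)
      fix f assume "f \<in> \<Phi> ` UNIV"
      then show "f \<in> hardy_space \<Gamma>" unfolding \<Phi>_def using constant_in_hardy_space by blast
    next
      fix f assume "f \<in> hardy_space \<Gamma>"
      then obtain c where "f = (\<lambda>x\<in>Omega \<Gamma>. c)" by (rule hardy_space_constant)
      then have "f = \<Phi> (c * complex_of_real norm_scale)" using s by (simp add: \<Phi>_def)
      then show "f \<in> \<Phi> ` UNIV" by blast
    qed
  qed
  moreover have "hardy_norm \<Gamma> (\<Phi> a) = norm a" for a
    unfolding \<Phi>_def hardy_norm_constant using norm_scale_pos by (simp add: norm_divide)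
  ultimately show ?thesis
    by (intro exI[of _ \<Phi>]) (auto simp: \<Phi>_def add_divide_distrib)
qed

end

theorem corollary1p6:
  fixes \<Gamma> :: "(complex^'n \<Rightarrow> complex^'n) set"
  assumes "lattice_in_Aut_ball \<Gamma>" and "torsion_free \<Gamma>"
  shows "(\<exists>\<Phi>. bij_betw \<Phi> (UNIV :: complex set) (hardy_space \<Gamma>) \<and>
            (\<forall>a b. \<forall>x\<in>Omega \<Gamma>. \<Phi> (a + b) x = \<Phi> a x + \<Phi> b x) \<and>
            (\<forall>c a. \<forall>x\<in>Omega \<Gamma>. \<Phi> (c * a) x = c * \<Phi> a x) \<and>
            (\<forall>a. hardy_norm \<Gamma> (\<Phi> a) = norm a)) \<and>
         (\<forall>f. holo_on_Omega \<Gamma> f \<and> bounded (f ` Omega \<Gamma>) \<longrightarrow> f constant_on Omega \<Gamma>)"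
proof -
  interpret discrete_ball_group \<Gamma>
    using assms(1) unfolding lattice_in_Aut_ball_def by (intro discrete_ball_group.intro) blast+
  obtain D where "ball_quotient \<Gamma> (\<lambda>\<gamma>. inv\<^bsub>Aut_ball\<^esub> \<gamma>) D" by (rule ball_quotient_domain[OF assms(2)])
  then interpret Q: ball_quotient \<Gamma> "\<lambda>\<gamma>. inv\<^bsub>Aut_ball\<^esub> \<gamma>" D .
  interpret ball_lattice \<Gamma> D
    using assms(1) unfolding lattice_in_Aut_ball_def by unfold_locales blast
  show ?thesis
    using hardy_space_isometric_to_scalars bounded_holomorphic_constant by blast
qed

end
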